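(* $\mathsf{NL} \subseteq \mathsf{ReachUSP}(\log^2 n)$, where $\mathsf{ReachUSP}(s(n)) = \bigcup_{k \geq 0} \mathsf{TIUSP}(n^k, s(n))$. That is, every language decidable in nondeterministic logarithmic space is decided by an unambiguous nondeterministic Turing machine that uses $O(\log^2 n)$ space and simultaneously runs in polynomial time.
   Context: An unambiguous Turing machine is a nondeterministic Turing machine that has at most one accepting computation path on every input. $\mathsf{TIUSP}(t(n), s(n))$ denotes the class of languages decided by an unambiguous machine using $O(s(n))$ space and $O(t(n))$ time simultaneously. $\mathsf{NL}$ is the class of languages decided by nondeterministic Turing machines using $O(\log n)$ space. *)

theory Defs
  imports Complex_Main
begin

text \<open>
  Nondeterministic off-line Turing machines with a two-way read-only input tape
  (with endmarkers) and one two-way, one-way-infinite read/write work tape.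
  Input alphabet: the finite type 'a.  States and work-tape symbols are natural
  numbers below explicit bounds; work symbol 0 is the blank.

  A transition (q, a, g, q', g', di, dw) means: in state q, reading a on the input
  tape (None = endmarker) and g on the work tape, go to state q', write g' on the
  work tape, move the input head by di and the work head by dw (di, dw in {-1,0,1}).
\<close>

record 'a ntm =
  n_states :: nat
  n_syms   :: nat
  start    :: nat
  accept   :: nat
  delta    :: "(nat \<times> 'a option \<times> nat \<times> nat \<times> nat \<times> int \<times> int) set"

text \<open>Configuration: (state, input head position, work tape contents, work head position).
  Input head positions range over 0..n+1, where 0 and n+1 hold the endmarkers.\<close>
type_synonym config = "nat \<times> nat \<times> (nat \<Rightarrow> nat) \<times> nat"

definition wf_ntm :: "'a ntm \<Rightarrow> bool" where
  "wf_ntm M \<longleftrightarrow> finite (delta M) \<and> 0 < n_syms M \<and>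
     start M < n_states M \<and> accept M < n_states M \<and>
     (\<forall>(q, a, g, q', g', di, dw) \<in> delta M.
        q < n_states M \<and> q' < n_states M \<and> g < n_syms M \<and> g' < n_syms M \<and>
        di \<in> {-1, 0, 1} \<and> dw \<in> {-1, 0, 1} \<and> q \<noteq> accept M)"

definition read_input :: "'a list \<Rightarrow> nat \<Rightarrow> 'a option" where
  "read_input x i = (if 1 \<le> i \<and> i \<le> length x then Some (x ! (i - 1)) else None)"

definition init_config :: "'a ntm \<Rightarrow> config" where
  "init_config M = (start M, 0, (\<lambda>_. 0), 0)"

definition step :: "'a ntm \<Rightarrow> 'a list \<Rightarrow> config \<Rightarrow> config \<Rightarrow> bool" where
  "step M x c c' \<longleftrightarrow>
     (\<exists>q i w h q' g' di dw.
        c = (q, i, w, h) \<and>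
        (q, read_input x i, w h, q', g', di, dw) \<in> delta M \<and>
        0 \<le> int i + di \<and> int i + di \<le> int (length x) + 1 \<and>
        0 \<le> int h + dw \<and>
        c' = (q', nat (int i + di), w(h := g'), nat (int h + dw)))"

definition comp_path :: "'a ntm \<Rightarrow> 'a list \<Rightarrow> config list \<Rightarrow> bool" where
  "comp_path M x cs \<longleftrightarrow> cs \<noteq> [] \<and> hd cs = init_config M \<and>
     (\<forall>j. Suc j < length cs \<longrightarrow> step M x (cs ! j) (cs ! Suc j))"

definition accepting_path :: "'a ntm \<Rightarrow> 'a list \<Rightarrow> config list \<Rightarrow> bool" where
  "accepting_path M x cs \<longleftrightarrow> comp_path M x cs \<and> fst (last cs) = accept M"

definition accepts :: "'a ntm \<Rightarrow> 'a list \<Rightarrow> bool" where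
  "accepts M x \<longleftrightarrow> (\<exists>cs. accepting_path M x cs)"

definition unambiguous_on :: "'a ntm \<Rightarrow> 'a list \<Rightarrow> bool" where
  "unambiguous_on M x \<longleftrightarrow>
     (\<forall>cs cs'. accepting_path M x cs \<and> accepting_path M x cs' \<longrightarrow> cs = cs')"

definition space_within :: "'a ntm \<Rightarrow> 'a list \<Rightarrow> real \<Rightarrow> bool" where
  "space_within M x s \<longleftrightarrow>
     (\<forall>cs c. comp_path M x cs \<and> c \<in> set cs \<longrightarrow> real (snd (snd (snd c))) + 1 \<le> s)"

definition time_within :: "'a ntm \<Rightarrow> 'a list \<Rightarrow> real \<Rightarrow> bool" where
  "time_within M x t \<longleftrightarrow> (\<forall>cs. comp_path M x cs \<longrightarrow> real (length cs - 1) \<le> t)"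

definition decides :: "'a ntm \<Rightarrow> 'a list set \<Rightarrow> bool" where
  "decides M L \<longleftrightarrow> (\<forall>x. x \<in> L \<longleftrightarrow> accepts M x)"

definition NL :: "'a list set set" where
  "NL = {L. \<exists>(M :: 'a ntm) c. wf_ntm M \<and> decides M L \<and>
           (\<forall>x. space_within M x (c * log 2 (real (length x)) + c))}"

definition TIUSP :: "(nat \<Rightarrow> real) \<Rightarrow> (nat \<Rightarrow> real) \<Rightarrow> 'a list set set" where
  "TIUSP t s = {L. \<exists>(M :: 'a ntm) c. wf_ntm M \<and> decides M L \<and>
           (\<forall>x. unambiguous_on M x \<and>
                time_within M x (c * t (length x) + c) \<and>
                space_within M x (c * s (length x) + c))}"

definition ReachUSP :: "(nat \<Rightarrow> real) \<Rightarrow> 'a list set set" where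
  "ReachUSP s = (\<Union>k. TIUSP (\<lambda>n. real n ^ k) s)"

end

theory Submission
  imports Defs
begin

text \<open>
  Reachability among the polynomially many configurations of the given machine is decided by
  inductive counting over the length \<open>d\<close> of walks, made unambiguous by weights. A configuration
  with code \<open>v\<close> at position \<open>i\<close> of a walk weighs \<open>v * B ^ \<nu> i\<close>, where \<open>\<nu>\<close> is the 2-adic valuation
  and \<open>B\<close> exceeds any sum of codes that can occur. Cutting a walk at its unique position of maximal
  valuation shows, recursively, that every configuration reachable in \<open>d\<close> steps is the end of
  exactly one lightest walk of length \<open>d\<close>. A weight has \<open>O(log n)\<close> digits in base \<open>B\<close>, that is,
  \<open>O(log^2 n)\<close> bits.

  If the number of configurations reachable in \<open>d\<close> steps and the sum of the weights of their
  lightest walks are known, then guessing for each configuration either nothing or a walk to it,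
  and insisting on that number and that sum, succeeds for exactly one guess. Such a pass yields the
  same two numbers for \<open>d + 1\<close>. The guesses are checked by a program over finitely many counters
  that aborts when a counter or a loop exceeds a precomputed cap, so that the time and space bounds
  hold on all branches.
\<close>

section \<open>Runs of partial functions\<close>

text \<open>Sums of weights are as large as n^O(log n), whereas loops must stay polynomially long.
  Hence values and loop lengths have separate caps. Large numbers are only added, compared, or
  multiplied by polynomially bounded ones through repeated addition; division is confined to
  positions and tape numbers. Layer \<open>d\<close> consists of the ends of walks of length exactly
  \<open>d\<close>, so the last step adds a weight that depends only on the new end and its
  position. No layer is ever stored: it is regenerated by a fresh pass for each candidate member of
  the next layer. Each pass has one surviving guess, and acceptance is decided only after all
  layers, so that an accepted input has one accepting path. Unambiguity is a statement about paths.
  It becomes a statement about lists of choice bits: exactly one list leads the program to success,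
  and the machine takes a bit just where the program does. Input symbols can be read only under the
  real input head. The head therefore follows the guessed walk and is rewound after each
  one.\<close>

fun it :: "('s \<Rightarrow> 's option) \<Rightarrow> nat \<Rightarrow> 's \<Rightarrow> 's option" where
  "it f 0 s = Some s"
| "it f (Suc n) s = (case f s of None \<Rightarrow> None | Some s' \<Rightarrow> it f n s')"

lemma it_add: "it f (m + n) s = Option.bind (it f m s) (it f n)"
  by (induction m arbitrary: s) (auto split: option.splits)

lemma it_trans: "it f m s = Some s' \<Longrightarrow> it f n s' = r \<Longrightarrow> it f (m + n) s = r"
  by (simp add: it_add)

lemma it_Suc_right: "it f (Suc n) s = Option.bind (it f n s) f"
  using it_add[of f n 1 s] by (cases "it f n s") (auto split: option.splits)

definition steps_to :: "('s \<Rightarrow> 's option) \<Rightarrow> 's \<Rightarrow> 's \<Rightarrow> bool" where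
  "steps_to f s s' \<longleftrightarrow> (\<exists>n. it f n s = Some s')"

lemma steps_to_refl [simp]: "steps_to f s s"
  unfolding steps_to_def using it.simps(1) by metis

lemma steps_to_trans: "steps_to f s s' \<Longrightarrow> steps_to f s' s'' \<Longrightarrow> steps_to f s s''"
  unfolding steps_to_def using it_trans by metis

lemma steps_to_step: "f s = Some s' \<Longrightarrow> steps_to f s' s'' \<Longrightarrow> steps_to f s s''"
  unfolding steps_to_def by (metis it.simps(2) option.simps(5))

text \<open>A stuck state has no continuation, so of two runs that end stuck neither is a proper
  prefix of the other. The equality of step counts later makes two accepting paths equally
  long.\<close>

lemma it_stuck_unique:
  assumes "it f m s = Some a" "f a = None" "it f n s = Some b" "f b = None"
  shows "m = n \<and> a = b"
proof -
  have *: "n \<le> m" if "it f m s = Some a" "it f n s = Some b" "f a = None" for m n and a b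
  proof (rule ccontr)
    assume "\<not> n \<le> m"
    then obtain k where "n = m + Suc k"
      by (metis add_Suc_right less_natE not_le_imp_less)
    moreover have "it f (m + Suc k) s = None" using that by (simp add: it_add del: add_Suc_right)
    ultimately show False using that by simp
  qed
  have "m = n" using *[OF assms(1,3,2)] *[OF assms(3,1,4)] by simp
  with assms show ?thesis by simp
qed

lemma steps_to_stuck_unique:
  "steps_to f s a \<Longrightarrow> f a = None \<Longrightarrow> steps_to f s b \<Longrightarrow> f b = None \<Longrightarrow> a = b"
  unfolding steps_to_def using it_stuck_unique by metis

text \<open>Within \<open>n\<close> steps, all through states satisfying \<open>I\<close>, the run from \<open>s\<close> reaches a state
  satisfying \<open>Q\<close>; if \<open>z\<close> holds, it may instead get stuck.\<close>
inductive bd :: "('s \<Rightarrow> 's option) \<Rightarrow> ('s \<Rightarrow> bool) \<Rightarrow> bool \<Rightarrow> nat \<Rightarrow> 's \<Rightarrow> ('s \<Rightarrow> bool) \<Rightarrow> bool"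
  for f I z where
  bd_post: "Q s \<Longrightarrow> bd f I z n s Q"
| bd_stuck: "z \<Longrightarrow> I s \<Longrightarrow> f s = None \<Longrightarrow> bd f I z n s Q"
| bd_step: "I s \<Longrightarrow> f s = Some s' \<Longrightarrow> bd f I z n s' Q \<Longrightarrow> bd f I z (Suc n) s Q"

lemma bd_mono: "bd f I z n s Q \<Longrightarrow> n \<le> m \<Longrightarrow> bd f I z m s Q"
proof (induction arbitrary: m rule: bd.induct)
  case (bd_step s s' n Q)
  then obtain k where "m = Suc k" "n \<le> k" by (cases m) auto
  then show ?case using bd_step by (auto intro: bd.intros)
qed (auto intro: bd.intros)

lemma bd_weaken_stuck: "bd f I False n s Q \<Longrightarrow> bd f I z n s Q"
  by (induction rule: bd.induct) (auto intro: bd.intros)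

lemma bd_conseq: "bd f I z n s Q \<Longrightarrow> (\<And>s. Q s \<Longrightarrow> Q' s) \<Longrightarrow> bd f I z n s Q'"
  by (induction rule: bd.induct) (auto intro: bd.intros)

lemma bd_bind:
  "bd f I z n s Q \<Longrightarrow> (\<And>s. Q s \<Longrightarrow> bd f I z m s Q') \<Longrightarrow> bd f I z (n + m) s Q'"
proof (induction rule: bd.induct)
  case (bd_post Q s n)
  then show ?case by (meson bd_mono le_add2)
qed (auto intro: bd.intros)

lemma bd_steps_to: "bd f I False n s Q \<Longrightarrow> \<exists>s'. steps_to f s s' \<and> Q s'"
  by (induction rule: bd.induct) (auto intro: steps_to_step steps_to_refl)

text \<open>A target that nothing satisfies leaves getting stuck as the only way to stop, so
  \<open>n\<close> bounds every run and \<open>I\<close> holds at each of its states. Resource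
  bounds of whole programs are given in this form.\<close>

lemma bd_it:
  assumes "bd f I z n s Q" "Q = (\<lambda>_. False)" "it f j s = Some s'"
  shows "j \<le> n \<and> I s'"
  using assms
proof (induction arbitrary: j rule: bd.induct)
  case (bd_stuck s n Q)
  then show ?case by (cases j) auto
next
  case (bd_step s s1 n Q)
  then show ?case by (cases j) auto
qed auto


section \<open>Nondeterministic register programs\<close>

text \<open>\<open>Sum r b u v\<close> stores \<open>b + u + v\<close> in register \<open>r\<close>, where absent summands count as 0.
  \<open>Scan r\<close> moves the input head to the next endmarker, adding the distance to register \<open>r\<close>.\<close>
datatype 'a com = Skip | Fail
  | Sum nat bool "nat option" "nat option"
  | Seq "'a com" "'a com"
  | IfLt nat nat "'a com" "'a com"
  | IfEq nat nat "'a com" "'a com"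
  | IfSym "'a option" "'a com" "'a com"
  | InR | InL
  | Choice "'a com" "'a com"
  | For nat nat "'a com"
  | Scan nat

abbreviation Inc :: "nat \<Rightarrow> 'a com" where "Inc r \<equiv> Sum r True (Some r) None"

type_synonym 'a rcfg = "'a com list \<times> (nat \<Rightarrow> nat) \<times> nat \<times> bool list"

definition oval :: "(nat \<Rightarrow> nat) \<Rightarrow> nat option \<Rightarrow> nat" where
  "oval \<sigma> u = (case u of None \<Rightarrow> 0 | Some r \<Rightarrow> \<sigma> r)"

lemma oval_simps [simp]: "oval \<sigma> None = 0" "oval \<sigma> (Some r) = \<sigma> r"
  by (simp_all add: oval_def)

text \<open>One step of the program stack. The last component lists the nondeterministic choices
  still to be made, so that a run is a function of its choices.\<close>
fun rn :: "'a list \<Rightarrow> 'a rcfg \<Rightarrow> 'a rcfg option" where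
  "rn x ([], s) = None"
| "rn x (Skip # K, s) = Some (K, s)"
| "rn x (Fail # K, s) = None"
| "rn x (Sum r b u v # K, \<sigma>, p, g) = Some (K, \<sigma>(r := of_bool b + oval \<sigma> u + oval \<sigma> v), p, g)"
| "rn x (Seq c d # K, s) = Some (c # d # K, s)"
| "rn x (IfLt i j c d # K, \<sigma>, s) = Some ((if \<sigma> i < \<sigma> j then c # K else d # K), \<sigma>, s)"
| "rn x (IfEq i j c d # K, \<sigma>, s) = Some ((if \<sigma> i = \<sigma> j then c # K else d # K), \<sigma>, s)"
| "rn x (IfSym a c d # K, \<sigma>, p, g) = Some ((if read_input x p = a then c # K else d # K), \<sigma>, p, g)"
| "rn x (InR # K, \<sigma>, p, g) = (if p \<le> length x then Some (K, \<sigma>, Suc p, g) else None)"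
| "rn x (InL # K, \<sigma>, p, g) = (if 0 < p then Some (K, \<sigma>, p - 1, g) else None)"
| "rn x (Choice c d # K, \<sigma>, p, []) = None"
| "rn x (Choice c d # K, \<sigma>, p, b # g) = Some ((if b then c # K else d # K), \<sigma>, p, g)"
| "rn x (For i j c # K, \<sigma>, s) = Some ((if \<sigma> i < \<sigma> j then c # Inc i # For i j c # K else K), \<sigma>, s)"
| "rn x (Scan r # K, \<sigma>, p, g) =
     Some ((if read_input x p = None then K else Inc r # InR # Scan r # K), \<sigma>, p, g)"

section \<open>Finiteness of the control stacks\<close>

fun succs :: "'a com list \<Rightarrow> 'a com list set" where
  "succs [] = {}"
| "succs (Skip # K) = {K}"
| "succs (Fail # K) = {}"
| "succs (Sum r b u v # K) = {K}"
| "succs (Seq c d # K) = {c # d # K}"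
| "succs (IfLt i j c d # K) = {c # K, d # K}"
| "succs (IfEq i j c d # K) = {c # K, d # K}"
| "succs (IfSym a c d # K) = {c # K, d # K}"
| "succs (InR # K) = {K}"
| "succs (InL # K) = {K}"
| "succs (Choice c d # K) = {c # K, d # K}"
| "succs (For i j c # K) = {c # Inc i # For i j c # K, K}"
| "succs (Scan r # K) = {Inc r # InR # Scan r # K, K}"

text \<open>The stacks that can arise while \<open>c\<close> runs on top of \<open>K\<close>, with
  \<open>K\<close> itself as the exit. A loop returns to the same \<open>For i j c # K\<close> after
  each round, so the set is finite and a stack can be a machine state.\<close>

primrec conts :: "'a com \<Rightarrow> 'a com list \<Rightarrow> 'a com list set" where
  "conts Skip K = {Skip # K, K}"
| "conts Fail K = {Fail # K, K}"
| "conts (Sum r b u v) K = {Sum r b u v # K, K}"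
| "conts (Seq c d) K = {Seq c d # K} \<union> conts c (d # K) \<union> conts d K"
| "conts (IfLt i j c d) K = {IfLt i j c d # K} \<union> conts c K \<union> conts d K"
| "conts (IfEq i j c d) K = {IfEq i j c d # K} \<union> conts c K \<union> conts d K"
| "conts (IfSym a c d) K = {IfSym a c d # K} \<union> conts c K \<union> conts d K"
| "conts InR K = {InR # K, K}"
| "conts InL K = {InL # K, K}"
| "conts (Choice c d) K = {Choice c d # K} \<union> conts c K \<union> conts d K"
| "conts (For i j c) K = {For i j c # K, Inc i # For i j c # K, K} \<union> conts c (Inc i # For i j c # K)"
| "conts (Scan r) K = {Scan r # K, Inc r # InR # Scan r # K, InR # Scan r # K, K}"

lemma conts_head: "c # K \<in> conts c K"
  by (cases c) auto

lemma conts_tail: "K \<in> conts c K"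
  by (induction c arbitrary: K) auto

lemma finite_conts: "finite (conts c K)"
  by (induction c arbitrary: K) auto

text \<open>The exit \<open>K\<close> is excepted because its successors belong to the surrounding
  command. For \<open>K = []\<close> there are none, so \<open>conts c []\<close> is closed
  outright.\<close>

lemma conts_closed: "K' \<in> conts c K \<Longrightarrow> K' = K \<or> succs K' \<subseteq> conts c K"
proof (induction c arbitrary: K)
  case (Seq c d)
  show ?case using Seq.prems Seq.IH(1)[of "d # K"] Seq.IH(2)[of K]
    by (auto simp: conts_head) (use conts_head in fastforce)+
next
  case (For i j c)
  show ?case using For.prems For.IH[of "Inc i # For i j c # K"]
    by (auto simp: conts_head conts_tail)
qed (fastforce simp: conts_head conts_tail)+

primrec regs :: "'a com \<Rightarrow> nat set" where
  "regs Skip = {}"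
| "regs Fail = {}"
| "regs (Sum r b u v) = {r} \<union> set_option u \<union> set_option v"
| "regs (Seq c d) = regs c \<union> regs d"
| "regs (IfLt i j c d) = {i, j} \<union> regs c \<union> regs d"
| "regs (IfEq i j c d) = {i, j} \<union> regs c \<union> regs d"
| "regs (IfSym a c d) = regs c \<union> regs d"
| "regs InR = {}"
| "regs InL = {}"
| "regs (Choice c d) = regs c \<union> regs d"
| "regs (For i j c) = {i, j} \<union> regs c"
| "regs (Scan r) = {r}"

lemma finite_regs: "finite (regs c)"
  by (induction c) auto

lemma conts_regs: "K' \<in> conts c K \<Longrightarrow> \<Union> (regs ` set K') \<subseteq> regs c \<union> \<Union> (regs ` set K)"
proof (induction c arbitrary: K)
  case (Seq c d)
  show ?case using Seq.prems Seq.IH(1)[of "d # K"] Seq.IH(2)[of K] by auto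
next
  case (For i j c)
  show ?case using For.prems For.IH[of "Inc i # For i j c # K"] by auto
next
  case (IfLt i j c d)
  show ?case using IfLt.prems IfLt.IH[of K] by auto
next
  case (IfEq i j c d)
  show ?case using IfEq.prems IfEq.IH[of K] by auto
next
  case (IfSym a c d)
  show ?case using IfSym.prems IfSym.IH[of K] by auto
next
  case (Choice c d)
  show ?case using Choice.prems Choice.IH[of K] by auto
qed auto

section \<open>Compiling register programs to Turing machines\<close>

text \<open>Cell 0 of the work tape holds \<open>Mark\<close>; cell \<open>j + 1\<close> holds the set of registers whose
  \<open>j\<close>-th binary digit is 1. An operation is one sweep over the used cells, lowest digit first,
  with a single bit of memory (a carry, or the verdict of a comparison).\<close>
datatype op = OSum nat "nat option" "nat option" | OLt nat nat | OEq nat nat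

definition obit :: "nat set \<Rightarrow> nat option \<Rightarrow> bool" where
  "obit A u = (case u of None \<Rightarrow> False | Some r \<Rightarrow> r \<in> A)"

text \<open>Majority is the carry of a full adder. Digits arrive lowest first, so in
  \<open>OLt\<close> a differing digit overrides the verdict so far and equal digits keep
  it.\<close>

fun fa :: "op \<Rightarrow> bool \<Rightarrow> nat set \<Rightarrow> bool" where
  "fa (OSum r u v) a A = ((a \<and> obit A u) \<or> (a \<and> obit A v) \<or> (obit A u \<and> obit A v))"
| "fa (OLt i j) a A = (if (i \<in> A) = (j \<in> A) then a else j \<in> A)"
| "fa (OEq i j) a A = (a \<and> (i \<in> A) = (j \<in> A))"

text \<open>The condition for \<open>OSum\<close> is that carry and both digits have odd parity,
  which makes the digit of the sum 1.\<close>

fun fw :: "op \<Rightarrow> bool \<Rightarrow> nat set \<Rightarrow> nat set" where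
  "fw (OSum r u v) a A = (if (a = (obit A u = obit A v)) then insert r A else A - {r})"
| "fw (OLt i j) a A = A"
| "fw (OEq i j) a A = A"

fun sweep :: "op \<Rightarrow> bool \<Rightarrow> nat set list \<Rightarrow> nat set list \<times> bool" where
  "sweep o' a [] = ([], a)"
| "sweep o' a (A # As) = (let (Bs, b) = sweep o' (fa o' a A) As in (fw o' a A # Bs, b))"

primrec val :: "nat \<Rightarrow> nat set list \<Rightarrow> nat" where
  "val r [] = 0"
| "val r (A # As) = of_bool (r \<in> A) + 2 * val r As"

definition ovals :: "nat set list \<Rightarrow> nat option \<Rightarrow> nat" where
  "ovals As u = (case u of None \<Rightarrow> 0 | Some r \<Rightarrow> val r As)"

lemma ovals_Nil [simp]: "ovals [] u = 0"
  by (simp add: ovals_def split: option.splits)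

lemma ovals_Cons [simp]: "ovals (A # As) u = of_bool (obit A u) + 2 * ovals As u"
  by (simp add: ovals_def obit_def split: option.splits)

lemma val_less: "val r As < 2 ^ length As"
  by (induction As) auto

lemma val_append: "val r (As @ [A]) = val r As + 2 ^ length As * of_bool (r \<in> A)"
  by (induction As) auto

lemma length_sweep: "sweep o' a As = (Bs, b) \<Longrightarrow> length Bs = length As"
  by (induction As arbitrary: a Bs b) (auto split: prod.splits)

text \<open>The final memory bit \<open>b\<close> is the digit beyond the last cell, which
  \<open>finish\<close> turns into a new cell. The constant summand of \<open>Sum\<close> enters as
  the initial carry \<open>a\<close>.\<close>

lemma sweep_sum:
  "sweep (OSum r u v) a As = (Bs, b) \<Longrightarrow>
     val r Bs + 2 ^ length As * of_bool b = of_bool a + ovals As u + ovals As v \<and>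
     (\<forall>r'. r' \<noteq> r \<longrightarrow> val r' Bs = val r' As)"
proof (induction As arbitrary: a Bs b)
  case (Cons A As)
  obtain Bs' where B: "sweep (OSum r u v) (fa (OSum r u v) a A) As = (Bs', b)"
      "Bs = fw (OSum r u v) a A # Bs'"
    using Cons.prems by (auto split: prod.splits)
  note IH = Cons.IH[OF B(1)]
  then have IH1: "2 * val r Bs' + 2 * 2 ^ length As * of_bool b
      = 2 * of_bool (fa (OSum r u v) a A) + 2 * ovals As u + 2 * ovals As v"
    by linarith
  show ?case using IH IH1 B(2) by auto
qed auto

lemma sweep_Lt:
  "sweep (OLt i j) a As = (Bs, b) \<Longrightarrow> Bs = As \<and>
     b = (val i As < val j As \<or> (a \<and> val i As = val j As))"
proof (induction As arbitrary: a Bs b)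
  case (Cons A As)
  obtain Bs' where B: "sweep (OLt i j) (fa (OLt i j) a A) As = (Bs', b)" "Bs = A # Bs'"
    using Cons.prems by (auto split: prod.splits)
  show ?case using Cons.IH[OF B(1)] B(2) by auto
qed auto

lemma sweep_Eq:
  "sweep (OEq i j) a As = (Bs, b) \<Longrightarrow> Bs = As \<and> b = (a \<and> val i As = val j As)"
proof (induction As arbitrary: a Bs b)
  case (Cons A As)
  obtain Bs' where B: "sweep (OEq i j) (fa (OEq i j) a A) As = (Bs', b)" "Bs = A # Bs'"
    using Cons.prems by (auto split: prod.splits)
  have "2 * m = Suc (2 * n) \<longleftrightarrow> False" "Suc (2 * n) = 2 * m \<longleftrightarrow> False" for m n :: nat
    by presburger+
  then show ?case using Cons.IH[OF B(1)] B(2) by auto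
qed auto

section \<open>The compiled Turing machine\<close>

datatype 'a tst = Start | Main "'a com list"
  | Swp op bool "'a com list" "'a com list" | Ret "'a com list"

datatype tsym = Blank | Mark | Cell "nat set"

type_synonym 'a tcfg = "'a tst \<times> nat \<times> (nat \<Rightarrow> tsym) \<times> nat"

fun finish :: "op \<Rightarrow> bool \<Rightarrow> tsym" where
  "finish (OSum r u v) a = (if a then Cell {r} else Blank)"
| "finish (OLt i j) a = Blank"
| "finish (OEq i j) a = Blank"

text \<open>The two stacks kept in \<open>Swp\<close> are the continuations for the two verdicts; a
  sum has only one, so \<open>K\<close> is kept twice. Comparisons start from the verdict for equal
  numbers.\<close>

fun main_step :: "'a com list \<Rightarrow> 'a option \<Rightarrow> bool \<Rightarrow> ('a tst \<times> int \<times> int) option" where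
  "main_step [] a b = None"
| "main_step (Skip # K) a b = Some (Main K, 0, 0)"
| "main_step (Fail # K) a b = None"
| "main_step (Sum r c u v # K) a b = Some (Swp (OSum r u v) c K K, 0, 1)"
| "main_step (Seq c d # K) a b = Some (Main (c # d # K), 0, 0)"
| "main_step (IfLt i j c d # K) a b = Some (Swp (OLt i j) False (c # K) (d # K), 0, 1)"
| "main_step (IfEq i j c d # K) a b = Some (Swp (OEq i j) True (c # K) (d # K), 0, 1)"
| "main_step (IfSym e c d # K) a b = Some (Main (if a = e then c # K else d # K), 0, 0)"
| "main_step (InR # K) a b = Some (Main K, 1, 0)"
| "main_step (InL # K) a b = Some (Main K, -1, 0)"
| "main_step (Choice c d # K) a b = Some (Main (if b then c # K else d # K), 0, 0)"
| "main_step (For i j c # K) a b =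
     Some (Swp (OLt i j) False (c # Inc i # For i j c # K) K, 0, 1)"
| "main_step (Scan r # K) a b =
     Some (Main (if a = None then K else Inc r # InR # Scan r # K), 0, 0)"

fun dl :: "'a com \<Rightarrow> 'a tst \<Rightarrow> 'a option \<Rightarrow> tsym \<Rightarrow> bool \<Rightarrow> ('a tst \<times> tsym \<times> int \<times> int) option" where
  "dl c0 Start a s b = Some (Main [c0], Mark, 0, 0)"
| "dl c0 (Main K) a s b = map_option (\<lambda>(q, di, dw). (q, s, di, dw)) (main_step K a b)"
| "dl c0 (Swp o' f K K') a Mark b = None"
| "dl c0 (Swp o' f K K') a (Cell A) b = Some (Swp o' (fa o' f A) K K', Cell (fw o' f A), 0, 1)"
| "dl c0 (Swp o' f K K') a Blank b = Some (Ret (if f then K else K'), finish o' f, 0, -1)"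
| "dl c0 (Ret K) a Blank b = None"
| "dl c0 (Ret K) a (Cell A) b = Some (Ret K, Cell A, 0, -1)"
| "dl c0 (Ret K) a Mark b = Some (Main K, Mark, 0, 0)"

text \<open>Only in these states does \<open>tn\<close> take a bit off the choice list. Everywhere
  else \<open>dl\<close> ignores its bit, so the machine is deterministic there.\<close>

fun choosing :: "'a tst \<Rightarrow> bool" where
  "choosing (Main (Choice c d # K)) = True"
| "choosing q = False"

definition go :: "'a com \<Rightarrow> 'a list \<Rightarrow> bool \<Rightarrow> 'a tcfg \<Rightarrow> 'a tcfg option" where
  "go c0 x b = (\<lambda>(q, i, w, h). case dl c0 q (read_input x i) (w h) b of None \<Rightarrow> None
     | Some (q', s, di, dw) \<Rightarrow>
        if 0 \<le> int i + di \<and> int i + di \<le> int (length x) + 1 \<and> 0 \<le> int h + dw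
        then Some (q', nat (int i + di), w(h := s), nat (int h + dw)) else None)"

fun tn :: "'a com \<Rightarrow> 'a list \<Rightarrow> 'a tcfg \<times> bool list \<Rightarrow> ('a tcfg \<times> bool list) option" where
  "tn c0 x (c, g) = (if choosing (fst c)
     then (case g of [] \<Rightarrow> None | b # g' \<Rightarrow> map_option (\<lambda>d. (d, g')) (go c0 x b c))
     else map_option (\<lambda>d. (d, g)) (go c0 x False c))"

definition tp :: "nat set list \<Rightarrow> nat \<Rightarrow> tsym" where
  "tp As j = (case j of 0 \<Rightarrow> Mark | Suc k \<Rightarrow> if k < length As then Cell (As ! k) else Blank)"

lemma tp_simps [simp]:
  "tp As 0 = Mark"
  "tp As (Suc (length As)) = Blank"
  "tp (As @ A # Bs) (Suc (length As)) = Cell A"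
  by (simp_all add: tp_def)

lemma tp_upd: "(tp (As @ A # Bs))(Suc (length As) := Cell B) = tp (As @ B # Bs)"
  by (auto simp: tp_def fun_eq_iff nth_append nth_Cons' split: nat.splits)

lemma tp_app: "(tp As)(Suc (length As) := Cell B) = tp (As @ [B])"
  by (auto simp: tp_def fun_eq_iff nth_append split: nat.splits)

section \<open>Simulation of single program steps\<close>

lemma sweep_run:
  assumes "sweep o' a As = (Bs, b)" "i \<le> length x + 1" "length Ps + length As \<le> m"
  shows "bd (tn c0 x) (\<lambda>(c, g). snd (snd (snd c)) \<le> Suc m) False (length As)
     ((Swp o' a K K', i, tp (Ps @ As), Suc (length Ps)), g)
     (\<lambda>t. t = ((Swp o' b K K', i, tp (Ps @ Bs), Suc (length Ps + length As)), g))"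
  using assms
proof (induction As arbitrary: a Bs Ps)
  case Nil
  then show ?case by (auto intro: bd_post)
next
  case (Cons A As)
  obtain Bs' where B: "sweep o' (fa o' a A) As = (Bs', b)" "Bs = fw o' a A # Bs'"
    using Cons.prems by (auto split: prod.splits)
  have "bd (tn c0 x) (\<lambda>(c, g). snd (snd (snd c)) \<le> Suc m) False (length As)
     ((Swp o' (fa o' a A) K K', i, tp ((Ps @ [fw o' a A]) @ As), Suc (length (Ps @ [fw o' a A]))), g)
     (\<lambda>t. t = ((Swp o' b K K', i, tp ((Ps @ [fw o' a A]) @ Bs'), Suc (length (Ps @ [fw o' a A]) + length As)), g))"
    by (rule Cons.IH) (use B Cons.prems in auto)
  then show ?case
    using Cons.prems B
    by (auto intro!: bd_step simp: go_def tp_upd nat_add_distrib)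
qed

lemma ret_run:
  assumes "i \<le> length x + 1" "h \<le> length As" "h \<le> m"
  shows "bd (tn c0 x) (\<lambda>(c, g). snd (snd (snd c)) \<le> Suc m) False (Suc h)
     ((Ret K, i, tp As, h), g) (\<lambda>t. t = ((Main K, i, tp As, 0), g))"
  using assms
proof (induction h)
  case 0
  have "(tp As)(0 := Mark) = tp As" by (auto simp: fun_eq_iff)
  then show ?case
    by (rule_tac bd_step[where s' = "((Main K, i, tp As, 0), g)"])
      (use 0 in \<open>auto simp: go_def intro: bd_post\<close>)
next
  case (Suc h)
  have *: "tp As (Suc h) = Cell (As ! h)" using Suc.prems by (simp add: tp_def)
  then have "(tp As)(Suc h := Cell (As ! h)) = tp As" by (auto simp: fun_eq_iff)
  then show ?case using Suc * by (auto intro!: bd_step[of _ _ _ _ _ "Suc h"] simp: go_def)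
qed

fun extend :: "op \<Rightarrow> bool \<Rightarrow> nat set list \<Rightarrow> nat set list" where
  "extend (OSum r u v) True As = As @ [{r}]"
| "extend o' b As = As"

text \<open>The sweep to the right visits at most \<open>m\<close> cells; one step turns round on
  the blank after them; the way back takes at most \<open>m\<close> moves and a final step on the
  mark.\<close>

lemma op_run:
  assumes "sweep o' a As = (Bs, b)" "i \<le> length x + 1" "length As \<le> m"
  shows "bd (tn c0 x) (\<lambda>(c, g). snd (snd (snd c)) \<le> Suc m) False (2 * m + 2)
     ((Swp o' a K K', i, tp As, 1), g)
     (\<lambda>t. t = ((Main (if b then K else K'), i, tp (extend o' b Bs), 0), g))"
proof -
  let ?I = "\<lambda>(c :: 'a tcfg, g :: bool list). snd (snd (snd c)) \<le> Suc m"
  have len: "length Bs = length As" using length_sweep[OF assms(1)] .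
  have le: "length Bs \<le> length (extend o' b Bs)"
    by (cases "(o', b, Bs)" rule: extend.cases) auto
  have tape: "(tp Bs)(Suc (length Bs) := finish o' b) = tp (extend o' b Bs)"
  proof -
    have "(tp Bs)(Suc (length Bs) := Blank) = tp Bs" by (auto simp: fun_eq_iff)
    then show ?thesis by (cases o'; cases b) (auto simp: tp_app)
  qed
  have 1: "bd (tn c0 x) ?I False (length As)
     ((Swp o' a K K', i, tp As, 1), g)
     (\<lambda>t. t = ((Swp o' b K K', i, tp Bs, Suc (length As)), g))"
    using sweep_run[OF assms(1,2), of "[]"] assms(3) by simp
  have 2: "bd (tn c0 x) ?I False (Suc (Suc (length As)))
     ((Swp o' b K K', i, tp Bs, Suc (length As)), g)
     (\<lambda>t. t = ((Main (if b then K else K'), i, tp (extend o' b Bs), 0), g))"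
  proof (rule bd_step)
    show "tn c0 x ((Swp o' b K K', i, tp Bs, Suc (length As)), g)
       = Some ((Ret (if b then K else K'), i, tp (extend o' b Bs), length As), g)"
      using assms(2) tape by (auto simp: go_def simp flip: len)
    show "bd (tn c0 x) ?I False (Suc (length As))
       ((Ret (if b then K else K'), i, tp (extend o' b Bs), length As), g)
       (\<lambda>t. t = ((Main (if b then K else K'), i, tp (extend o' b Bs), 0), g))"
      using ret_run[OF assms(2), of "length As"] le len assms(3) by auto
  qed (use assms in auto)
  have "bd (tn c0 x) ?I False (length As + Suc (Suc (length As)))
     ((Swp o' a K K', i, tp As, 1), g)
     (\<lambda>t. t = ((Main (if b then K else K'), i, tp (extend o' b Bs), 0), g))"
    by (rule bd_bind[OF 1]) (use 2 in simp)
  then show ?thesis by (rule bd_mono) (use assms in simp)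
qed

text \<open>Cells are never removed, so leading zeros may remain: the digit list \<open>As\<close>
  is constrained by the register values but not determined by them.\<close>

definition rel :: "nat \<Rightarrow> 'a list \<Rightarrow> 'a rcfg \<Rightarrow> 'a tcfg \<times> bool list \<Rightarrow> bool" where
  "rel m x = (\<lambda>(K, \<sigma>, p, g) t. p \<le> length x + 1 \<and>
     (\<exists>As. length As \<le> m \<and> (\<forall>r. val r As = \<sigma> r) \<and> t = ((Main K, p, tp As, 0), g)))"

text \<open>A cell is added only for a carry out of the last one, and then the new value is at least
  \<open>2 ^ length Bs\<close>. Values below \<open>2 ^ m\<close> therefore never occupy more than
  \<open>m\<close> cells.\<close>

lemma op_sim:
  fixes K1 :: "'a com list"
  assumes As: "length As \<le> m" "\<forall>r. val r As = \<sigma> r" and i: "i \<le> length x + 1"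
    and m: "\<forall>r. \<sigma>' r < 2 ^ m"
    and o': "\<And>Bs b. sweep o' a As = (Bs, b) \<Longrightarrow>
       (\<forall>r. val r (extend o' b Bs) = \<sigma>' r) \<and> (if b then K1 else K2) = K'"
    and go1: "main_step K (read_input x i) False = Some (Swp o' a K1 K2, 0, 1)"
       "\<not> choosing (Main K)"
  shows "bd (tn c0 x) (\<lambda>(c, g). snd (snd (snd c)) \<le> Suc m) False (2 * m + 3)
     ((Main K, i, tp As, 0), g) (rel m x (K', \<sigma>', i, g))"
proof -
  let ?I = "\<lambda>(c :: 'a tcfg, g :: bool list). snd (snd (snd c)) \<le> Suc m"
  obtain Bs b where B: "sweep o' a As = (Bs, b)" by fastforce
  note o'' = o'[OF B]
  have len: "length (extend o' b Bs) \<le> m"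
  proof (cases "length (extend o' b Bs) = length Bs")
    case True
    then show ?thesis using length_sweep[OF B] As by simp
  next
    case False
    then obtain r u v where *: "o' = OSum r u v" "b"
      by (cases "(o', b, Bs)" rule: extend.cases) auto
    then have "2 ^ length Bs \<le> val r (extend o' b Bs)"
      by (simp add: val_append)
    then have "2 ^ length Bs < (2 :: nat) ^ m" using o'' m
      by (metis order.strict_trans1)
    then show ?thesis using * by simp
  qed
  have up: "(tp As)(0 := Mark) = tp As" by (auto simp: fun_eq_iff)
  have "bd (tn c0 x) ?I False (Suc (2 * m + 2)) ((Main K, i, tp As, 0), g) (rel m x (K', \<sigma>', i, g))"
  proof (rule bd_step)
    show "tn c0 x ((Main K, i, tp As, 0), g) = Some ((Swp o' a K1 K2, i, tp As, 1), g)"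
      using go1 i up by (auto simp: go_def)
    show "bd (tn c0 x) ?I False (2 * m + 2) ((Swp o' a K1 K2, i, tp As, 1), g) (rel m x (K', \<sigma>', i, g))"
      using op_run[OF B i As(1)]
      by (rule bd_conseq) (use o'' len i in \<open>auto simp: rel_def\<close>)
  qed simp
  then show ?thesis by (simp add: eval_nat_numeral)
qed

lemma rel_bound: "rel m x (K, \<sigma>, s) t \<Longrightarrow> \<forall>r. \<sigma> r < 2 ^ m"
proof -
  assume "rel m x (K, \<sigma>, s) t"
  then obtain As where *: "length As \<le> m" "\<forall>r. val r As = \<sigma> r"
    by (auto simp: rel_def)
  have "val r As < 2 ^ m" for r
    using val_less[of r As] power_increasing[OF *(1), of "2 :: nat"] by linarith
  with * show ?thesis by metis
qed

lemma rn_sim: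
  assumes "rel m x s t" "rn x s = Some s'" "\<forall>r. fst (snd s') r < 2 ^ m"
  shows "bd (tn c0 x) (\<lambda>(c, g). snd (snd (snd c)) \<le> Suc m) False (2 * m + 3) t (rel m x s')"
proof -
  obtain K \<sigma> i g where s: "s = (K, \<sigma>, i, g)" by (metis prod_cases4)
  obtain As where As: "length As \<le> m" "\<forall>r. val r As = \<sigma> r" and i: "i \<le> length x + 1"
      and t: "t = ((Main K, i, tp As, 0), g)"
    using assms(1) s by (auto simp: rel_def)
  have m: "\<forall>r. \<sigma> r < 2 ^ m" using rel_bound assms(1) s by blast
  have up: "(tp As)(0 := Mark) = tp As" by (auto simp: fun_eq_iff)
  have one: "bd (tn c0 x) (\<lambda>(c, g). snd (snd (snd c)) \<le> Suc m) False (2 * m + 3) t (rel m x s')"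
    if "tn c0 x t = Some t'" "rel m x s' t'" for t'
  proof (rule bd_mono)
    show "bd (tn c0 x) (\<lambda>(c, g). snd (snd (snd c)) \<le> Suc m) False (Suc 0) t (rel m x s')"
      by (rule bd_step[where s' = t']) (use that t in \<open>auto intro: bd_post\<close>)
  qed simp
  have ovals: "ovals As u = oval \<sigma> u" for u
    using As(2) by (simp add: ovals_def oval_def split: option.splits)
  obtain c K0 where K: "K = c # K0" using assms(2) s by (cases K) auto
  show ?thesis
  proof (cases c)
    case (Sum r b u v)
    have s': "s' = (K0, \<sigma>(r := of_bool b + oval \<sigma> u + oval \<sigma> v), i, g)"
      using assms(2) s K Sum by simp
    have *: "(\<forall>r'. val r' (extend (OSum r u v) b' Bs)
        = (\<sigma>(r := of_bool b + oval \<sigma> u + oval \<sigma> v)) r') \<and> (if b' then K0 else K0) = K0"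
      if "sweep (OSum r u v) b As = (Bs, b')" for Bs b'
      using sweep_sum[OF that] length_sweep[OF that] As(2) ovals
      by (cases b') (auto simp: val_append)
    show ?thesis unfolding s' t K Sum
      by (rule op_sim[OF As i _ *]) (use assms(3) s' in auto)
  next
    case (IfLt a b d e)
    then have s': "s' = ((if \<sigma> a < \<sigma> b then d # K0 else e # K0), \<sigma>, i, g)"
      using assms(2) s K by simp
    have *: "(\<forall>r. val r (extend (OLt a b) b' Bs) = \<sigma> r) \<and>
        (if b' then d # K0 else e # K0) = (if \<sigma> a < \<sigma> b then d # K0 else e # K0)"
      if "sweep (OLt a b) False As = (Bs, b')" for Bs b'
      using sweep_Lt[OF that] As(2) by auto
    show ?thesis unfolding s' t K IfLt
      by (rule op_sim[OF As i m *]) auto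
  next
    case (IfEq a b d e)
    then have s': "s' = ((if \<sigma> a = \<sigma> b then d # K0 else e # K0), \<sigma>, i, g)"
      using assms(2) s K by simp
    have *: "(\<forall>r. val r (extend (OEq a b) b' Bs) = \<sigma> r) \<and>
        (if b' then d # K0 else e # K0) = (if \<sigma> a = \<sigma> b then d # K0 else e # K0)"
      if "sweep (OEq a b) True As = (Bs, b')" for Bs b'
      using sweep_Eq[OF that] As(2) by auto
    show ?thesis unfolding s' t K IfEq
      by (rule op_sim[OF As i m *]) auto
  next
    case (For a b d)
    then have s': "s' = ((if \<sigma> a < \<sigma> b then d # Inc a # For a b d # K0 else K0), \<sigma>, i, g)"
      using assms(2) s K by simp
    have *: "(\<forall>r. val r (extend (OLt a b) b' Bs) = \<sigma> r) \<and>
        (if b' then d # Inc a # For a b d # K0 else K0)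
        = (if \<sigma> a < \<sigma> b then d # Inc a # For a b d # K0 else K0)"
      if "sweep (OLt a b) False As = (Bs, b')" for Bs b'
      using sweep_Lt[OF that] As(2) by auto
    show ?thesis unfolding s' t K For
      by (rule op_sim[OF As i m *]) auto
  next
    case (Choice a b)
    then obtain b' g' where g: "g = b' # g'" using assms(2) s K by (cases g) auto
    show ?thesis using assms(2) As i Choice g
      by (intro one[where t' = "((Main (if b' then a # K0 else b # K0), i, tp As, 0), g')"])
        (auto simp: go_def s t K up rel_def)
  next
    case (IfSym e d f)
    then show ?thesis using assms(2) As i
      by (intro one[where t' = "((Main (if read_input x i = e then d # K0 else f # K0), i, tp As, 0), g)"])
        (auto simp: go_def s t K up rel_def)
  next
    case (Scan r)
    then show ?thesis using assms(2) As i
      by (intro one[where t' = "((Main (if read_input x i = None then K0 else Inc r # InR # Scan r # K0), i, tp As, 0), g)"])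
        (auto simp: go_def s t K up rel_def)
  next
    case Skip
    then show ?thesis using assms(2) As i
      by (intro one[where t' = "((Main K0, i, tp As, 0), g)"]) (auto simp: go_def s t K up rel_def)
  next
    case (Seq d e)
    then show ?thesis using assms(2) As i
      by (intro one[where t' = "((Main (d # e # K0), i, tp As, 0), g)"]) (auto simp: go_def s t K up rel_def)
  next
    case InR
    then show ?thesis using assms(2) As i
      by (intro one[where t' = "((Main K0, Suc i, tp As, 0), g)"])
        (auto simp: go_def s t K up rel_def nat_add_distrib split: if_splits)
  next
    case InL
    then show ?thesis using assms(2) As i
      by (intro one[where t' = "((Main K0, i - 1, tp As, 0), g)"])
        (auto simp: go_def s t K up rel_def nat_diff_distrib' split: if_splits)
  next
    case Fail
    then show ?thesis using assms(2) s K by simp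
  qed
qed

lemma rn_stuck:
  assumes "rel m x s t" "rn x s = None"
  shows "tn c0 x t = None"
proof -
  obtain K \<sigma> i g where s: "s = (K, \<sigma>, i, g)" by (metis prod_cases4)
  obtain As where i: "i \<le> length x + 1" and t: "t = ((Main K, i, tp As, 0), g)"
    using assms(1) s by (auto simp: rel_def)
  show ?thesis
  proof (cases K)
    case (Cons c K0)
    then show ?thesis using assms(2) s t
      by (cases c; cases g) (auto simp: go_def split: if_splits)
  qed (simp add: t go_def)
qed

section \<open>Finiteness of the state set and of the alphabet\<close>

primrec op_regs :: "op \<Rightarrow> nat set" where
  "op_regs (OSum r u v) = {r} \<union> set_option u \<union> set_option v"
| "op_regs (OLt i j) = {i, j}"
| "op_regs (OEq i j) = {i, j}"

definition ops :: "nat set \<Rightarrow> op set" where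
  "ops R = {o'. op_regs o' \<subseteq> R}"

lemma finite_ops:
  assumes "finite R"
  shows "finite (ops R)"
proof -
  let ?O = "insert None (Some ` R)"
  have "ops R \<subseteq> (\<lambda>(r, u, v). OSum r u v) ` (R \<times> ?O \<times> ?O)
     \<union> (\<lambda>(i, j). OLt i j) ` (R \<times> R) \<union> (\<lambda>(i, j). OEq i j) ` (R \<times> R)"
  proof
    fix o' assume o': "o' \<in> ops R"
    show "o' \<in> (\<lambda>(r, u, v). OSum r u v) ` (R \<times> ?O \<times> ?O)
     \<union> (\<lambda>(i, j). OLt i j) ` (R \<times> R) \<union> (\<lambda>(i, j). OEq i j) ` (R \<times> R)"
    proof (cases o')
      case (OSum r u v)
      have "w \<in> ?O" if "set_option w \<subseteq> R" for w using that by (cases w) auto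
      then have "r \<in> R" "u \<in> ?O" "v \<in> ?O"
        using o' OSum by (auto simp add: ops_def simp del: insert_iff)
      then show ?thesis using OSum
        by (intro UnI1 image_eqI[where x = "(r, u, v)"]) auto
    qed (use o' in \<open>auto simp: ops_def\<close>)
  qed
  then show ?thesis by (rule finite_subset) (use assms in simp)
qed

definition tstates :: "'a com \<Rightarrow> 'a tst set" where
  "tstates c0 = {Start} \<union> Main ` conts c0 [] \<union> Ret ` conts c0 [] \<union>
     (\<lambda>(o', a, K, K'). Swp o' a K K') ` (ops (regs c0) \<times> UNIV \<times> conts c0 [] \<times> conts c0 [])"

definition tsyms :: "'a com \<Rightarrow> tsym set" where
  "tsyms c0 = {Blank, Mark} \<union> Cell ` Pow (regs c0)"

lemma finite_tstates: "finite (tstates c0)"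
  by (simp add: tstates_def finite_ops finite_conts finite_regs)

lemma finite_tsyms: "finite (tsyms c0)"
  by (simp add: tsyms_def finite_regs)

lemma tstates_iff [simp]:
  "Start \<in> tstates c0"
  "Main K \<in> tstates c0 \<longleftrightarrow> K \<in> conts c0 []"
  "Ret K \<in> tstates c0 \<longleftrightarrow> K \<in> conts c0 []"
  "Swp o' f K K' \<in> tstates c0 \<longleftrightarrow> o' \<in> ops (regs c0) \<and> K \<in> conts c0 [] \<and> K' \<in> conts c0 []"
proof -
  show "Swp o' f K K' \<in> tstates c0 \<longleftrightarrow> o' \<in> ops (regs c0) \<and> K \<in> conts c0 [] \<and> K' \<in> conts c0 []"
  proof
    assume "o' \<in> ops (regs c0) \<and> K \<in> conts c0 [] \<and> K' \<in> conts c0 []"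
    then show "Swp o' f K K' \<in> tstates c0"
      unfolding tstates_def by (intro UnI2 image_eqI[where x = "(o', f, K, K')"]) auto
  qed (auto simp: tstates_def)
qed (auto simp: tstates_def)

lemma main_step_cases:
  assumes "main_step K a b = Some (q, di, dw)" "\<Union> (regs ` set K) \<subseteq> R"
  shows "((\<exists>K' \<in> succs K. q = Main K') \<or>
      (\<exists>o' \<in> ops R. \<exists>f. \<exists>K1 \<in> succs K. \<exists>K2 \<in> succs K. q = Swp o' f K1 K2)) \<and>
     di \<in> {-1, 0, 1} \<and> dw \<in> {-1, 0, 1}"
proof (cases K)
  case (Cons c K0)
  show ?thesis
  proof (cases c)
    case (IfLt i j d e)
    then have "OLt i j \<in> ops R" using assms Cons by (auto simp: ops_def)
    then show ?thesis using assms Cons IfLt by auto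
  next
    case (IfEq i j d e)
    then have "OEq i j \<in> ops R" using assms Cons by (auto simp: ops_def)
    then show ?thesis using assms Cons IfEq by auto
  qed (use assms Cons in \<open>auto simp: ops_def split: if_splits\<close>)
qed (use assms in simp)

lemma dl_closed:
  assumes "q \<in> tstates c0" "s \<in> tsyms c0" "dl c0 q a s b = Some (q', s', di, dw)"
  shows "q' \<in> tstates c0 \<and> s' \<in> tsyms c0 \<and> di \<in> {-1, 0, 1} \<and> dw \<in> {-1, 0, 1}"
proof (cases q)
  case Start
  then show ?thesis using assms conts_head[of c0 "[]"]
    by (auto simp: tsyms_def)
next
  case (Main K)
  then have K: "K \<in> conts c0 []" using assms(1) by auto
  then have su: "succs K \<subseteq> conts c0 []" using conts_closed[OF K] by auto
  have R: "\<Union> (regs ` set K) \<subseteq> regs c0" using conts_regs[OF K] by simp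
  obtain di dw where m: "main_step K a b = Some (q', di, dw)" using assms(3) Main by auto
  note mc = main_step_cases[OF m R]
  have "q' \<in> tstates c0"
  proof (cases "\<exists>K' \<in> succs K. q' = Main K'")
    case True
    then show ?thesis using su by auto
  next
    case False
    then obtain o' f K1 K2 where "o' \<in> ops (regs c0)" "K1 \<in> succs K" "K2 \<in> succs K" "q' = Swp o' f K1 K2"
      using mc by blast
    then show ?thesis using su by auto
  qed
  then show ?thesis using mc assms m Main by auto
next
  case (Swp o' f K K')
  then have o': "o' \<in> ops (regs c0)" and K: "K \<in> conts c0 []" "K' \<in> conts c0 []"
    using assms(1) by auto
  have fin: "finish o' f \<in> tsyms c0"
    using o' by (cases o') (auto simp: ops_def tsyms_def)
  have fw: "fw o' f A \<subseteq> regs c0" if "A \<subseteq> regs c0" for A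
    using o' that by (cases o') (auto simp: ops_def tsyms_def)
  show ?thesis
  proof (cases s)
    case (Cell A)
    then have "fw o' f A \<subseteq> regs c0" using fw assms(2) by (auto simp: tsyms_def)
    then show ?thesis using assms Cell Swp o' K by (auto simp: tsyms_def)
  next
    case Blank
    then show ?thesis using assms Swp K fin by auto
  next
    case Mark
    then show ?thesis using assms Swp by auto
  qed
next
  case (Ret K)
  then show ?thesis using assms by (cases s) (auto simp: tsyms_def)
qed

lemma dl_choice_irrelevant: "\<not> choosing q \<Longrightarrow> dl c0 q a s b = dl c0 q a s False"
proof (cases q)
  case (Main K)
  then show "\<not> choosing q \<Longrightarrow> dl c0 q a s b = dl c0 q a s False"
    by (cases "(K, a, b)" rule: main_step.cases) auto
qed (cases s; auto)+

section \<open>Computation paths as lists of choices\<close>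

context
  fixes c0 :: "'a :: finite com" and eq :: "'a tst \<Rightarrow> nat" and es :: "tsym \<Rightarrow> nat"
    and nQ nG :: nat
  assumes eq: "inj_on eq (tstates c0)" "eq ` tstates c0 \<subseteq> {..<nQ}"
    and es: "inj_on es (tsyms c0)" "es ` tsyms c0 \<subseteq> {..<nG}" "es Blank = 0"
begin

definition ctm :: "'a ntm" where
  "ctm = \<lparr>n_states = nQ, n_syms = nG, start = eq Start, accept = eq (Main []),
     delta = {(eq q, a, es s, eq q', es s', di, dw) | q a s b q' s' di dw.
        q \<in> tstates c0 \<and> s \<in> tsyms c0 \<and> dl c0 q a s b = Some (q', s', di, dw)}\<rparr>"

text \<open>The numberings \<open>eq\<close> and \<open>es\<close> are injective only on the finite
  sets of states and symbols that occur, so decoding a numerical configuration requires this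
  invariant.\<close>

definition valid :: "'a tcfg \<Rightarrow> bool" where
  "valid = (\<lambda>(q, i, w, h). q \<in> tstates c0 \<and> (\<forall>j. w j \<in> tsyms c0))"

definition emb :: "'a tcfg \<Rightarrow> config" where
  "emb = (\<lambda>(q, i, w, h). (eq q, i, es \<circ> w, h))"

lemma wf_ctm: "wf_ntm ctm"
proof -
  let ?S = "tstates c0 \<times> (UNIV :: 'a option set) \<times> tsyms c0 \<times> (UNIV :: bool set)"
  have "delta ctm \<subseteq> (\<lambda>(q, a, s, b). case dl c0 q a s b of Some (q', s', di, dw) \<Rightarrow>
      (eq q, a, es s, eq q', es s', di, dw)) ` ?S"
  proof
    fix t assume "t \<in> delta ctm"
    then obtain q a s b q' s' di dw where t: "t = (eq q, a, es s, eq q', es s', di, dw)"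
        "q \<in> tstates c0" "s \<in> tsyms c0" "dl c0 q a s b = Some (q', s', di, dw)"
      by (auto simp: ctm_def)
    then show "t \<in> (\<lambda>(q, a, s, b). case dl c0 q a s b of Some (q', s', di, dw) \<Rightarrow>
      (eq q, a, es s, eq q', es s', di, dw)) ` ?S"
      by (intro image_eqI[where x = "(q, a, s, b)"]) auto
  qed
  then have fin: "finite (delta ctm)"
    by (rule finite_subset) (simp add: finite_tstates finite_tsyms)
  have st: "Start \<in> tstates c0" "Main [] \<in> tstates c0" "Blank \<in> tsyms c0"
    using conts_tail[of "[]" c0] by (auto simp: tstates_def tsyms_def)
  have "q \<noteq> Main []" if "dl c0 q a s b = Some y" for q a s b y
    using that by auto
  then have na: "eq q \<noteq> eq (Main [])" if "q \<in> tstates c0" "dl c0 q a s b = Some y" for q a s b y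
    using that eq(1) st by (metis inj_onD)
  have lt: "q \<in> tstates c0 \<Longrightarrow> eq q < nQ" "s \<in> tsyms c0 \<Longrightarrow> es s < nG" for q s
    using eq(2) es(2) by auto
  show ?thesis
    unfolding wf_ntm_def
  proof (intro conjI ballI)
    fix t assume "t \<in> delta ctm"
    then obtain q a s b q' s' di dw where t: "t = (eq q, a, es s, eq q', es s', di, dw)"
        "q \<in> tstates c0" "s \<in> tsyms c0" "dl c0 q a s b = Some (q', s', di, dw)"
      by (auto simp: ctm_def)
    show "case t of (q, a, g, q', g', di, dw) \<Rightarrow> q < n_states ctm \<and> q' < n_states ctm \<and>
       g < n_syms ctm \<and> g' < n_syms ctm \<and> di \<in> {-1, 0, 1} \<and> dw \<in> {-1, 0, 1} \<and> q \<noteq> accept ctm"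
      using dl_closed[OF t(2-4)] lt t na[OF t(2,4)] by (simp add: ctm_def)
  next
    show "0 < n_syms ctm" using lt(2)[OF st(3)] by (simp add: ctm_def)
  qed (use fin lt st in \<open>auto simp: ctm_def\<close>)
qed

lemma step_emb:
  assumes v: "valid c" and st: "step ctm x (emb c) c'"
  shows "\<exists>bs d. c' = emb d \<and> valid d \<and> (\<forall>g. tn c0 x (c, bs @ g) = Some (d, g))"
proof -
  obtain q i w h where c: "c = (q, i, w, h)" by (metis prod_cases4)
  obtain q1 a s b q' s' di dw where t: "eq q = eq q1" "read_input x i = a" "es (w h) = es s"
      "q1 \<in> tstates c0" "s \<in> tsyms c0" "dl c0 q1 a s b = Some (q', s', di, dw)"
      "0 \<le> int i + di" "int i + di \<le> int (length x) + 1" "0 \<le> int h + dw"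
      "c' = (eq q', nat (int i + di), (es \<circ> w)(h := es s'), nat (int h + dw))"
    using st c by (auto simp: step_def emb_def ctm_def)
  have q1: "q1 = q" "s = w h" using t v c eq(1) es(1)
    by (auto simp: valid_def dest: inj_onD)
  let ?d = "(q', nat (int i + di), w(h := s'), nat (int h + dw))"
  have "c' = emb ?d" using t by (auto simp: emb_def fun_eq_iff)
  moreover have "valid ?d" using dl_closed[OF t(4-6)] v c by (auto simp: valid_def)
  moreover have "go c0 x b c = Some ?d" using t q1 c by (auto simp: go_def)
  \<comment> \<open>The transition relation admits any bit \<open>b\<close>, whereas
    \<open>tn\<close> uses \<open>False\<close> outside choosing states. The two agree there, and
    the step consumes no choice.\<close>
  moreover have "go c0 x False c = go c0 x b c" if "\<not> choosing q"
    using dl_choice_irrelevant[OF that, of c0 _ _ b] c by (simp add: go_def)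
  ultimately show ?thesis
    using c by (intro exI[of _ "if choosing q then [b] else []"] exI[of _ ?d]) auto
qed

lemma tn_step:
  assumes v: "valid c" and st: "tn c0 x (c, g) = Some (d, g')"
  shows "step ctm x (emb c) (emb d) \<and> valid d"
proof -
  obtain q i w h where c: "c = (q, i, w, h)" by (metis prod_cases4)
  obtain b where "go c0 x b c = Some d"
    using st by (auto split: if_splits list.splits)
  then obtain q' s' di dw where t: "dl c0 q (read_input x i) (w h) b = Some (q', s', di, dw)"
      "0 \<le> int i + di" "int i + di \<le> int (length x) + 1" "0 \<le> int h + dw"
      "d = (q', nat (int i + di), w(h := s'), nat (int h + dw))"
    using c by (auto simp: go_def split: option.splits if_splits)
  have vq: "q \<in> tstates c0" "w h \<in> tsyms c0" using v c by (auto simp: valid_def)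
  have "(eq q, read_input x i, es (w h), eq q', es s', di, dw) \<in> delta ctm"
    using t vq unfolding ctm_def by simp blast
  moreover have "es \<circ> w(h := s') = (es \<circ> w)(h := es s')" by auto
  ultimately have "step ctm x (emb c) (emb d)"
    using t c by (auto simp: step_def emb_def)
  moreover have "valid d" using dl_closed[OF vq t(1)] v c t by (auto simp: valid_def)
  ultimately show ?thesis ..
qed

abbreviation "tinit \<equiv> (Start, 0, \<lambda>_. Blank, 0) :: 'a tcfg"

lemma valid_tinit: "valid tinit" "init_config ctm = emb tinit"
  using es(3) by (auto simp: valid_def tstates_def tsyms_def init_config_def emb_def ctm_def)

text \<open>The path is traced by some list \<open>g\<close> of choices, whatever list
  \<open>g'\<close> follows. Quantifying over \<open>g'\<close> is what allows the induction to
  append the bits of one more step.\<close>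

lemma comp_path_run:
  assumes "comp_path ctm x cs"
  shows "\<exists>g. \<forall>g'. (\<forall>j < length cs. \<exists>d g''. it (tn c0 x) j (tinit, g @ g') = Some (d, g'') \<and> cs ! j = emb d)
     \<and> (\<exists>d. it (tn c0 x) (length cs - 1) (tinit, g @ g') = Some (d, g') \<and> last cs = emb d \<and> valid d)"
  using assms
proof (induction cs rule: rev_induct)
  case Nil
  then show ?case by (simp add: comp_path_def)
next
  case (snoc c cs)
  show ?case
  proof (cases "cs = []")
    case True
    then have "c = emb tinit" using snoc.prems valid_tinit by (simp add: comp_path_def)
    then show ?thesis using True valid_tinit by (intro exI[of _ "[]"]) auto
  next
    case False
    have cp: "comp_path ctm x cs"
      using snoc.prems False unfolding comp_path_def
      by (auto simp: nth_append hd_append split: if_splits)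
    have st: "step ctm x (last cs) c"
      using snoc.prems False unfolding comp_path_def
      by (auto simp: nth_append last_conv_nth elim!: allE[of _ "length cs - 1"])
    obtain g where g: "\<And>g'. (\<forall>j < length cs. \<exists>d g''. it (tn c0 x) j (tinit, g @ g') = Some (d, g'') \<and> cs ! j = emb d)
     \<and> (\<exists>d. it (tn c0 x) (length cs - 1) (tinit, g @ g') = Some (d, g') \<and> last cs = emb d \<and> valid d)"
      using snoc.IH[OF cp] by blast
    obtain d0 where d0: "last cs = emb d0" "valid d0"
        "it (tn c0 x) (length cs - 1) (tinit, g @ []) = Some (d0, [])"
      using g[of "[]"] by blast
    \<comment> \<open>Each continuation \<open>g'\<close> yields its own preimage of
      \<open>last cs\<close>. On valid configurations \<open>emb\<close> is injective, so these
      preimages coincide and one list \<open>bs\<close> serves them all.\<close>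
    obtain bs d where bs: "c = emb d" "valid d" "\<And>d1 g. emb d1 = emb d0 \<Longrightarrow> valid d1 \<Longrightarrow> tn c0 x (d1, bs @ g) = Some (d, g)"
    proof -
      obtain bs d where bs: "c = emb d" "valid d" "\<And>g. tn c0 x (d0, bs @ g) = Some (d, g)"
        using step_emb[OF d0(2)] st d0(1) by metis
      have inj: "d1 = d0" if "emb d1 = emb d0" "valid d1" for d1
        using that d0(2) eq(1) es(1)
        by (auto simp: emb_def valid_def fun_eq_iff) (meson inj_onD)+
      show ?thesis
      proof (rule that[of d bs])
        show "tn c0 x (d1, bs @ g) = Some (d, g)" if "emb d1 = emb d0" "valid d1" for d1 g
          using inj[OF that] bs by simp
      qed (use bs in auto)
    qed
    show ?thesis
    proof (intro exI[of _ "g @ bs"] allI conjI impI)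
      fix g'
      obtain d1 where d1: "last cs = emb d1" "valid d1"
          "it (tn c0 x) (length cs - 1) (tinit, g @ bs @ g') = Some (d1, bs @ g')"
        using g[of "bs @ g'"] by blast
      have "tn c0 x (d1, bs @ g') = Some (d, g')" using bs(3) d1 d0 by simp
      then have *: "it (tn c0 x) (length cs) (tinit, g @ bs @ g') = Some (d, g')"
        using d1(3) it_Suc_right[of "tn c0 x" "length cs - 1"] False by simp
      then show "\<exists>d. it (tn c0 x) (length (cs @ [c]) - 1) (tinit, (g @ bs) @ g') = Some (d, g') \<and>
          last (cs @ [c]) = emb d \<and> valid d"
        using bs by auto
      fix j assume "j < length (cs @ [c])"
      then consider "j < length cs" | "j = length cs" by fastforce
      then show "\<exists>d g''. it (tn c0 x) j (tinit, (g @ bs) @ g') = Some (d, g'') \<and> (cs @ [c]) ! j = emb d"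
        by cases (use g[of "bs @ g'"] * bs in \<open>auto simp: nth_append\<close>)
    qed
  qed
qed

lemma run_comp_path:
  assumes "it (tn c0 x) n (tinit, g) = Some (d, g')"
  shows "valid d \<and> (\<exists>cs. comp_path ctm x cs \<and> last cs = emb d)"
  using assms
proof (induction n arbitrary: d g')
  case 0
  then show ?case using valid_tinit
    by (auto simp: comp_path_def intro!: exI[of _ "[emb tinit]"])
next
  case (Suc n)
  then obtain d1 g1 where *: "it (tn c0 x) n (tinit, g) = Some (d1, g1)" "tn c0 x (d1, g1) = Some (d, g')"
    by (auto simp: it_Suc_right bind_eq_Some_conv simp del: it.simps tn.simps)
  obtain cs where cs: "comp_path ctm x cs" "last cs = emb d1" and v: "valid d1"
    using Suc.IH[OF *(1)] by blast
  have "step ctm x (emb d1) (emb d)" "valid d" using tn_step[OF v *(2)] by auto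
  moreover have "comp_path ctm x (cs @ [emb d])"
    using cs \<open>step ctm x (emb d1) (emb d)\<close> unfolding comp_path_def
    by (auto simp: nth_append last_conv_nth less_Suc_eq)
      (metis One_nat_def Suc_lessI diff_Suc_1)
  ultimately show ?case by (intro conjI exI[of _ "cs @ [emb d]"]) auto
qed


end

text \<open>Every program run is finite, so the machine can be followed along it up to a pair of
  matching dead ends. Acceptance is read off from these; each program step costs at most
  \<open>2 * m + 3\<close> machine steps.\<close>

lemma rn_tn_run:
  assumes "bd (rn x) (\<lambda>s. \<forall>r. fst (snd s) r < 2 ^ m) True n s Q" "Q = (\<lambda>_. False)" "rel m x s t"
  shows "bd (tn c0 x) (\<lambda>(c, g). snd (snd (snd c)) \<le> Suc m) True (n * (2 * m + 3)) t (\<lambda>_. False)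
    \<and> (\<exists>s' t'. steps_to (rn x) s s' \<and> rn x s' = None \<and> steps_to (tn c0 x) t t' \<and>
         tn c0 x t' = None \<and> rel m x s' t')"
  using assms
proof (induction arbitrary: t rule: bd.induct)
  case (bd_post Q s n)
  then show ?case by simp
next
  case (bd_stuck s n Q)
  have "tn c0 x t = None" using rn_stuck bd_stuck by blast
  moreover have "snd (snd (snd (fst t))) = 0" using bd_stuck.prems by (auto simp: rel_def split: prod.splits)
  ultimately show ?case using bd_stuck
    by (intro conjI bd.bd_stuck exI[of _ s] exI[of _ t]) (auto simp: case_prod_beta)
next
  case (bd_step s s' n Q)
  let ?I = "\<lambda>(c, g :: bool list). snd (snd (snd c)) \<le> Suc m"
  have "\<forall>r. fst (snd s') r < 2 ^ m"
    using bd_step(3,5) by (cases rule: bd.cases) auto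
  then have b: "bd (tn c0 x) ?I False (2 * m + 3) t (rel m x s')"
    using rn_sim bd_step by blast
  have "bd (tn c0 x) ?I True (2 * m + 3 + n * (2 * m + 3)) t (\<lambda>_. False)"
    by (rule bd_bind[OF bd_weaken_stuck[OF b]]) (use bd_step in blast)
  moreover obtain t1 where t1: "steps_to (tn c0 x) t t1" "rel m x s' t1"
    using bd_steps_to[OF b] by blast
  moreover obtain s2 t2 where "steps_to (rn x) s' s2" "rn x s2 = None"
      "steps_to (tn c0 x) t1 t2" "tn c0 x t2 = None" "rel m x s2 t2"
    using bd_step.IH[OF bd_step.prems(1) t1(2)] by blast
  moreover have "Suc n * (2 * m + 3) = 2 * m + 3 + n * (2 * m + 3)" by simp
  ultimately show ?case using bd_step(2)
    by (metis steps_to_step steps_to_trans)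
qed

text \<open>The choices must be used up. Otherwise every extension of a successful list would
  succeed as well and no list could be unique.\<close>

definition accepted :: "'a com \<Rightarrow> 'a list \<Rightarrow> bool list \<Rightarrow> bool" where
  "accepted c0 x g \<longleftrightarrow> (\<exists>\<sigma> p. steps_to (rn x) ([c0], \<lambda>_. 0, 0, g) ([], \<sigma>, p, []))"

lemma enumerate_with_zero:
  assumes "finite A" "a \<in> A"
  obtains f :: "'b \<Rightarrow> nat" and n where "inj_on f A" "f ` A \<subseteq> {..<n}" "f a = 0"
proof -
  obtain f0 :: "'b \<Rightarrow> nat" where f0: "bij_betw f0 A {0..<card A}"
    using ex_bij_betw_finite_nat[OF assms(1)] by blast
  define f where "f = (\<lambda>b. if b = a then 0 else Suc (f0 b))"
  have "inj_on f A" using f0 by (auto simp: f_def inj_on_def bij_betw_def)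
  moreover have "f ` A \<subseteq> {..<Suc (card A)}" using f0 by (auto simp: f_def bij_betw_def)
  ultimately show ?thesis using that[of f] by (simp add: f_def)
qed

text \<open>An accepting path is determined by its choice list, so unique lists give unique paths.
  The extra step of time is the initial one that writes the mark; the space consists of the mark, at
  most \<open>m x\<close> digit cells and the blank on which a sweep turns.\<close>

theorem compile:
  fixes c0 :: "'a :: finite com" and T m :: "'a list \<Rightarrow> nat"
  assumes bound: "\<And>x g. bd (rn x) (\<lambda>s. \<forall>r. fst (snd s) r < 2 ^ m x) True (T x) ([c0], \<lambda>_. 0, 0, g) (\<lambda>_. False)"
    and uniq: "\<And>x g g'. accepted c0 x g \<Longrightarrow> accepted c0 x g' \<Longrightarrow> g = g'"
  shows "\<exists>M :: 'a ntm. wf_ntm M \<and> (\<forall>x. (accepts M x \<longleftrightarrow> (\<exists>g. accepted c0 x g)) \<and> unambiguous_on M x \<and>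
     time_within M x (real (T x * (2 * m x + 3) + 1)) \<and> space_within M x (real (m x + 2)))"
proof -
  obtain eq :: "'a tst \<Rightarrow> nat" and nQ where eq: "inj_on eq (tstates c0)" "eq ` tstates c0 \<subseteq> {..<nQ}"
    using enumerate_with_zero[OF finite_tstates, of Start c0] by (metis tstates_iff(1))
  obtain es :: "tsym \<Rightarrow> nat" and nG where es: "inj_on es (tsyms c0)" "es ` tsyms c0 \<subseteq> {..<nG}" "es Blank = 0"
    using enumerate_with_zero[OF finite_tsyms, of Blank c0] by (metis Un_iff insertI1 tsyms_def)
  let ?M = "ctm c0 eq es nQ nG"
  let ?emb = "emb eq es :: 'a tcfg \<Rightarrow> config"
  let ?i = "(Start, 0, \<lambda>_. Blank, 0) :: 'a tcfg"
  have acc: "accept ?M = eq (Main [])" by (simp add: ctm_def[OF eq es])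
  have Main: "Main [] \<in> tstates c0" by (simp add: conts_tail)
  have init: "tn c0 x (?i, g) = Some ((Main [c0], 0, tp [], 0), g)" for x g
    by (auto simp: go_def tp_def fun_eq_iff split: nat.splits)
  have rel0: "rel (m x) x ([c0], \<lambda>_. 0, 0, g) ((Main [c0], 0, tp [], 0), g)" for x g
    by (auto simp: rel_def intro!: exI[of _ "[]"])
  note run = rn_tn_run[OF bound refl rel0, where ?c0.0 = c0]
  have bd: "bd (tn c0 x) (\<lambda>(c, g). snd (snd (snd c)) \<le> Suc (m x)) True (T x * (2 * m x + 3) + 1) (?i, g) (\<lambda>_. False)" for x g
    using bd_step[OF _ init conjunct1[OF run]] by simp
  have final: "accepted c0 x g \<longleftrightarrow> (\<exists>n d. it (tn c0 x) n (?i, g) = Some (d, []) \<and> fst d = Main [])" for x g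
  proof -
    obtain s' t' where r: "steps_to (rn x) ([c0], \<lambda>_. 0, 0, g) s'" "rn x s' = None"
        "steps_to (tn c0 x) ((Main [c0], 0, tp [], 0), g) t'" "tn c0 x t' = None" "rel (m x) x s' t'"
      using run by blast
    have r3: "steps_to (tn c0 x) (?i, g) t'" using steps_to_step[OF init r(3)] .
    show ?thesis
    proof
      assume "accepted c0 x g"
      then obtain \<sigma> p where "steps_to (rn x) ([c0], \<lambda>_. 0, 0, g) ([], \<sigma>, p, [])"
        by (auto simp: accepted_def)
      then have "s' = ([], \<sigma>, p, [])" using steps_to_stuck_unique[OF r(1,2)] by simp
      then show "\<exists>n d. it (tn c0 x) n (?i, g) = Some (d, []) \<and> fst d = Main []"
        using r(5) r3 by (auto simp: rel_def steps_to_def)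
    next
      assume "\<exists>n d. it (tn c0 x) n (?i, g) = Some (d, []) \<and> fst d = Main []"
      then obtain d where d: "steps_to (tn c0 x) (?i, g) (d, [])" "fst d = Main []"
        unfolding steps_to_def by blast
      then have "tn c0 x (d, []) = None" by (auto simp: go_def split: prod.splits)
      then have "t' = (d, [])" using steps_to_stuck_unique[OF r3 r(4) d(1)] by simp
      then have "\<exists>\<sigma> p. s' = ([], \<sigma>, p, [])" using r(5) d(2) by (cases s') (auto simp: rel_def)
      then show "accepted c0 x g" using r(1) by (auto simp: accepted_def)
    qed
  qed
  have path: "\<exists>g. accepted c0 x g \<and> (\<exists>d. it (tn c0 x) (length cs - 1) (?i, g) = Some (d, []) \<and> fst d = Main []) \<and>
      (\<forall>j < length cs. \<exists>d g''. it (tn c0 x) j (?i, g) = Some (d, g'') \<and> cs ! j = ?emb d)"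
    if ap: "accepting_path ?M x cs" for x cs
  proof -
    obtain g where g: "\<forall>j < length cs. \<exists>d g''. it (tn c0 x) j (?i, g) = Some (d, g'') \<and> cs ! j = ?emb d"
        "\<exists>d. it (tn c0 x) (length cs - 1) (?i, g) = Some (d, []) \<and> last cs = ?emb d \<and> valid c0 d"
      using comp_path_run[OF eq es, of x cs] ap unfolding accepting_path_def
      by (metis append_Nil2)
    then obtain d where d: "it (tn c0 x) (length cs - 1) (?i, g) = Some (d, [])" "last cs = ?emb d" "valid c0 d"
      by blast
    have "eq (fst d) = eq (Main [])" using ap d(2) acc
      by (auto simp: accepting_path_def emb_def[OF eq es] split: prod.splits)
    moreover have "fst d \<in> tstates c0" using d(3) by (auto simp: valid_def[OF eq es])
    ultimately have "fst d = Main []" using eq(1) Main by (meson inj_onD)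
    then show ?thesis using g d final by blast
  qed
  have time: "length cs - 1 \<le> T x * (2 * m x + 3) + 1 \<and> (\<forall>c \<in> set cs. snd (snd (snd c)) \<le> Suc (m x))"
    if cp: "comp_path ?M x cs" for x cs
  proof -
    obtain g where g: "\<forall>j < length cs. \<exists>d g''. it (tn c0 x) j (?i, g) = Some (d, g'') \<and> cs ! j = ?emb d"
        "\<exists>d. it (tn c0 x) (length cs - 1) (?i, g) = Some (d, []) \<and> last cs = ?emb d \<and> valid c0 d"
      using comp_path_run[OF eq es cp] by (metis append_Nil2)
    have "snd (snd (snd (cs ! j))) \<le> Suc (m x)" if j: "j < length cs" for j
    proof -
      obtain d g'' where "it (tn c0 x) j (?i, g) = Some (d, g'')" "cs ! j = ?emb d" using g j by blast
      then show ?thesis using bd_it[OF bd refl] by (auto simp: emb_def[OF eq es] split: prod.splits)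
    qed
    moreover have "length cs - 1 \<le> T x * (2 * m x + 3) + 1" using g(2) bd_it[OF bd refl] by blast
    ultimately show ?thesis by (metis in_set_conv_nth)
  qed
  show ?thesis
  proof (intro exI[of _ ?M] conjI allI)
    show "wf_ntm ?M" by (rule wf_ctm[OF eq es])
    fix x
    show "accepts ?M x \<longleftrightarrow> (\<exists>g. accepted c0 x g)"
    proof
      assume "accepts ?M x"
      then show "\<exists>g. accepted c0 x g" using path unfolding accepts_def by blast
    next
      assume "\<exists>g. accepted c0 x g"
      then obtain g n d where "it (tn c0 x) n (?i, g) = Some (d, [])" "fst d = Main []"
        using final by blast
      then show "accepts ?M x"
        using run_comp_path[OF eq es, of x n g d "[]"] acc
        by (auto simp: accepts_def accepting_path_def emb_def[OF eq es] split: prod.splits)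
    qed
    show "unambiguous_on ?M x"
      unfolding unambiguous_on_def
    proof (intro allI impI, elim conjE)
      fix cs cs' assume ap: "accepting_path ?M x cs" "accepting_path ?M x cs'"
      have ne: "cs \<noteq> []" "cs' \<noteq> []" using ap by (auto simp: accepting_path_def comp_path_def)
      have st: "tn c0 x (d, []) = None" if "fst d = Main []" for d
        using that by (auto simp: go_def split: prod.splits)
      obtain g where g: "accepted c0 x g" "\<exists>d. it (tn c0 x) (length cs - 1) (?i, g) = Some (d, []) \<and> fst d = Main []"
         "\<forall>j < length cs. \<exists>d g''. it (tn c0 x) j (?i, g) = Some (d, g'') \<and> cs ! j = ?emb d"
        using path[OF ap(1)] by blast
      obtain g' where g': "accepted c0 x g'" "\<exists>d. it (tn c0 x) (length cs' - 1) (?i, g') = Some (d, []) \<and> fst d = Main []"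
         "\<forall>j < length cs'. \<exists>d g''. it (tn c0 x) j (?i, g') = Some (d, g'') \<and> cs' ! j = ?emb d"
        using path[OF ap(2)] by blast
      have gg: "g' = g" using uniq g(1) g'(1) by blast
      have "length cs - 1 = length cs' - 1"
        using g(2) g'(2) st unfolding gg by (meson it_stuck_unique)
      then have len: "length cs = length cs'" using ne by (metis One_nat_def Suc_pred length_greater_0_conv)
      show "cs = cs'"
      proof (rule nth_equalityI[OF len])
        fix j assume "j < length cs"
        then show "cs ! j = cs' ! j" using g(3) g'(3) len unfolding gg by fastforce
      qed
    qed
    show "time_within ?M x (real (T x * (2 * m x + 3) + 1))"
      unfolding time_within_def of_nat_le_iff using time by blast
    show "space_within ?M x (real (m x + 2))"
      unfolding space_within_def
    proof (intro allI impI, elim conjE)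
      fix cs c assume "comp_path ?M x cs" "c \<in> set cs"
      then have "snd (snd (snd c)) + 1 \<le> m x + 2" using time by fastforce
      then show "real (snd (snd (snd c))) + 1 \<le> real (m x + 2)" by linarith
    qed
  qed
qed

section \<open>Big-step semantics\<close>

declare split_paired_All [simp del] split_paired_Ex [simp del]

type_synonym rst = "(nat \<Rightarrow> nat) \<times> nat \<times> bool list"

definition inc_reg :: "nat \<Rightarrow> rst \<Rightarrow> rst option" where
  "inc_reg i = (\<lambda>(\<sigma>, s). Some (\<sigma>(i := Suc (\<sigma> i)), s))"

text \<open>\<open>Scan\<close> occurs only in the initialisation, which is analysed step by step.\<close>
primrec sem :: "'a list \<Rightarrow> 'a com \<Rightarrow> rst \<Rightarrow> rst option" where
  "sem x Skip = Some"
| "sem x Fail = (\<lambda>s. None)"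
| "sem x (Sum r b u v) = (\<lambda>(\<sigma>, s). Some (\<sigma>(r := of_bool b + oval \<sigma> u + oval \<sigma> v), s))"
| "sem x (Seq c d) = (\<lambda>s. Option.bind (sem x c s) (sem x d))"
| "sem x (IfLt i j c d) = (\<lambda>s. if fst s i < fst s j then sem x c s else sem x d s)"
| "sem x (IfEq i j c d) = (\<lambda>s. if fst s i = fst s j then sem x c s else sem x d s)"
| "sem x (IfSym a c d) = (\<lambda>s. if read_input x (fst (snd s)) = a then sem x c s else sem x d s)"
| "sem x InR = (\<lambda>(\<sigma>, p, g). if p \<le> length x then Some (\<sigma>, Suc p, g) else None)"
| "sem x InL = (\<lambda>(\<sigma>, p, g). if 0 < p then Some (\<sigma>, p - 1, g) else None)"
| "sem x (Choice c d) = (\<lambda>(\<sigma>, p, g). case g of [] \<Rightarrow> None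
     | b # g' \<Rightarrow> if b then sem x c (\<sigma>, p, g') else sem x d (\<sigma>, p, g'))"
| "sem x (For i j c) =
     (\<lambda>s. it (\<lambda>s. Option.bind (sem x c s) (inc_reg i)) (fst s j - fst s i) s)"
| "sem x (Scan r) = (\<lambda>s. None)"

primrec writes :: "'a com \<Rightarrow> nat set" where
  "writes Skip = {}"
| "writes Fail = {}"
| "writes (Sum r b u v) = {r}"
| "writes (Seq c d) = writes c \<union> writes d"
| "writes (IfLt i j c d) = writes c \<union> writes d"
| "writes (IfEq i j c d) = writes c \<union> writes d"
| "writes (IfSym a c d) = writes c \<union> writes d"
| "writes InR = {}"
| "writes InL = {}"
| "writes (Choice c d) = writes c \<union> writes d"
| "writes (For i j c) = insert i (writes c)"
| "writes (Scan r) = {r}"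

text \<open>A loop body may write neither the counter nor the limit, so the number of rounds is
  fixed on entry, as \<open>sem\<close> presupposes. \<open>Scan\<close> is excluded since
  \<open>sem\<close> does not model it.\<close>

primrec wfc :: "'a com \<Rightarrow> bool" where
  "wfc Skip = True"
| "wfc Fail = True"
| "wfc (Sum r b u v) = True"
| "wfc (Seq c d) = (wfc c \<and> wfc d)"
| "wfc (IfLt i j c d) = (wfc c \<and> wfc d)"
| "wfc (IfEq i j c d) = (wfc c \<and> wfc d)"
| "wfc (IfSym a c d) = (wfc c \<and> wfc d)"
| "wfc InR = True"
| "wfc InL = True"
| "wfc (Choice c d) = (wfc c \<and> wfc d)"
| "wfc (For i j c) = (wfc c \<and> i \<noteq> j \<and> i \<notin> writes c \<and> j \<notin> writes c)"
| "wfc (Scan r) = False"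

lemma it_invariant:
  assumes "\<And>s s'. P s \<Longrightarrow> f s = Some s' \<Longrightarrow> P s'" "P s" "it f n s = Some s'"
  shows "P s'"
  using assms(2,3)
proof (induction n arbitrary: s)
  case (Suc n)
  then show ?case using assms(1) by (auto split: option.splits)
qed auto

lemma sem_frame: "sem x c s = Some s' \<Longrightarrow> r \<notin> writes c \<Longrightarrow> fst s' r = fst s r"
proof (induction c arbitrary: s s')
  case (For i j c)
  have "fst s' r = fst s r"
  proof (rule it_invariant[where P = "\<lambda>t. fst t r = fst s r"])
    fix t t' assume "fst t r = fst s r" "Option.bind (sem x c t) (inc_reg i) = Some t'"
    then show "fst t' r = fst s r"
      using For.IH[of t] For.prems by (auto simp: bind_eq_Some_conv inc_reg_def split: prod.splits)
  qed (use For in auto)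
  then show ?case .
next
  case (Seq c d)
  then obtain s1 where "sem x c s = Some s1" "sem x d s1 = Some s'"
    by (auto simp: bind_eq_Some_conv simp del: split_paired_Ex)
  then show ?case using Seq.IH(1)[of s s1] Seq.IH(2)[of s1 s'] Seq.prems by simp
qed (fastforce split: prod.splits if_splits list.splits)+

text \<open>A run reads choices only from the front of its list and never looks at the rest, so the
  unread part can be exchanged.\<close>

lemma sem_consume:
  "sem x c (\<sigma>, p, g) = Some (\<sigma>', p', g') \<Longrightarrow>
     \<exists>h. g = h @ g' \<and> (\<forall>k. sem x c (\<sigma>, p, h @ k) = Some (\<sigma>', p', k))"
proof (induction c arbitrary: \<sigma> p g \<sigma>' p' g')
  case (Seq c d)
  then obtain \<sigma>1 p1 g1 where "sem x c (\<sigma>, p, g) = Some (\<sigma>1, p1, g1)" "sem x d (\<sigma>1, p1, g1) = Some (\<sigma>', p', g')"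
    by (auto simp: bind_eq_Some_conv)
  then obtain h1 h2 where "g = h1 @ g1" "\<forall>k. sem x c (\<sigma>, p, h1 @ k) = Some (\<sigma>1, p1, k)"
      "g1 = h2 @ g'" "\<forall>k. sem x d (\<sigma>1, p1, h2 @ k) = Some (\<sigma>', p', k)"
    using Seq.IH by meson
  then show ?case by (intro exI[of _ "h1 @ h2"]) auto
next
  case (Choice c d)
  obtain b g1 where g: "g = b # g1" using Choice.prems by (auto split: list.splits)
  then have "sem x (if b then c else d) (\<sigma>, p, g1) = Some (\<sigma>', p', g')"
    using Choice.prems by auto
  then obtain h where "g1 = h @ g'" "\<forall>k. sem x (if b then c else d) (\<sigma>, p, h @ k) = Some (\<sigma>', p', k)"
    using Choice.IH(1)[of \<sigma> p g1 \<sigma>' p' g'] Choice.IH(2)[of \<sigma> p g1 \<sigma>' p' g'] by (cases b) auto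
  then show ?case using g by (intro exI[of _ "b # h"]) (auto split: if_splits)
next
  case (For i j c)
  have *: "it (\<lambda>s. Option.bind (sem x c s) (inc_reg i)) n (\<sigma>, p, g) = Some (\<sigma>', p', g') \<Longrightarrow>
     \<exists>h. g = h @ g' \<and> (\<forall>k. it (\<lambda>s. Option.bind (sem x c s) (inc_reg i)) n (\<sigma>, p, h @ k) = Some (\<sigma>', p', k))"
    for n \<sigma> p g
  proof (induction n arbitrary: \<sigma> p g)
    case (Suc n)
    then obtain \<sigma>1 p1 g1 where 1: "sem x c (\<sigma>, p, g) = Some (\<sigma>1, p1, g1)"
      "it (\<lambda>s. Option.bind (sem x c s) (inc_reg i)) n (\<sigma>1(i := Suc (\<sigma>1 i)), p1, g1) = Some (\<sigma>', p', g')"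
      by (auto simp: bind_eq_Some_conv inc_reg_def split: option.splits)
    obtain h1 where "g = h1 @ g1" "\<forall>k. sem x c (\<sigma>, p, h1 @ k) = Some (\<sigma>1, p1, k)"
      using For.IH[OF 1(1)] by blast
    moreover obtain h2 where "g1 = h2 @ g'" "\<forall>k. it (\<lambda>s. Option.bind (sem x c s) (inc_reg i)) n
        (\<sigma>1(i := Suc (\<sigma>1 i)), p1, h2 @ k) = Some (\<sigma>', p', k)"
      using Suc.IH[OF 1(2)] by blast
    ultimately show ?case by (intro exI[of _ "h1 @ h2"]) (auto simp: inc_reg_def)
  qed auto
  from *[of "\<sigma> j - \<sigma> i"] For.prems show ?case by simp
qed (fastforce split: if_splits)+

text \<open>Failure shows as a stuck state with a nonempty stack, which is never an accepting end of
  the whole program. So \<open>sem\<close> decides success in both directions.\<close>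

lemma sem_run:
  assumes "wfc c"
  shows "(\<forall>s'. sem x c s = Some s' \<longrightarrow> steps_to (rn x) (c # K, s) (K, s')) \<and>
    (sem x c s = None \<longrightarrow> (\<exists>K' s'. K' \<noteq> [] \<and> steps_to (rn x) (c # K, s) (K', s') \<and> rn x (K', s') = None))"
  using assms
proof (induction c arbitrary: s K)
  case (Seq c d)
  have 1: "rn x (Seq c d # K, s) = Some (c # d # K, s)" by simp
  show ?case
  proof (cases "sem x c s")
    case None
    then have "\<exists>K' s'. K' \<noteq> [] \<and> steps_to (rn x) (c # d # K, s) (K', s') \<and> rn x (K', s') = None"
      using Seq by simp
    then show ?thesis using None steps_to_step[where f = "rn x", OF 1] by fastforce
  next
    case (Some s1)
    then have "steps_to (rn x) (Seq c d # K, s) (d # K, s1)"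
      using Seq steps_to_step[where f = "rn x", OF 1] by simp
    note tr = steps_to_trans[OF this]
    have "wfc d" using Seq.prems by simp
    note IH = Seq.IH(2)[OF this, of s1 K]
    have "sem x (Seq c d) s = sem x d s1" using Some by simp
    then show ?thesis using IH tr by metis
  qed
next
  case (IfLt i j c d)
  obtain \<sigma> t where s: "s = (\<sigma>, t)" by fastforce
  have 1: "rn x (IfLt i j c d # K, s) = Some ((if \<sigma> i < \<sigma> j then c else d) # K, s)" using s by simp
  note tr = steps_to_step[where f = "rn x", OF 1]
  let ?c = "if \<sigma> i < \<sigma> j then c else d"
  have IH: "(\<forall>s'. sem x ?c s = Some s' \<longrightarrow> steps_to (rn x) (?c # K, s) (K, s')) \<and>
    (sem x ?c s = None \<longrightarrow> (\<exists>K' s'. K' \<noteq> [] \<and> steps_to (rn x) (?c # K, s) (K', s') \<and> rn x (K', s') = None))"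
    using IfLt.IH[of s K] IfLt.prems by auto
  have "sem x (IfLt i j c d) s = sem x ?c s" using s by simp
  then show ?case using IH tr by metis
next
  case (IfEq i j c d)
  obtain \<sigma> t where s: "s = (\<sigma>, t)" by fastforce
  have 1: "rn x (IfEq i j c d # K, s) = Some ((if \<sigma> i = \<sigma> j then c else d) # K, s)" using s by simp
  note tr = steps_to_step[where f = "rn x", OF 1]
  let ?c = "if \<sigma> i = \<sigma> j then c else d"
  have IH: "(\<forall>s'. sem x ?c s = Some s' \<longrightarrow> steps_to (rn x) (?c # K, s) (K, s')) \<and>
    (sem x ?c s = None \<longrightarrow> (\<exists>K' s'. K' \<noteq> [] \<and> steps_to (rn x) (?c # K, s) (K', s') \<and> rn x (K', s') = None))"
    using IfEq.IH[of s K] IfEq.prems by auto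
  have "sem x (IfEq i j c d) s = sem x ?c s" using s by simp
  then show ?case using IH tr by metis
next
  case (IfSym a c d)
  obtain \<sigma> p g where s: "s = (\<sigma>, p, g)" by (metis prod_cases3)
  have 1: "rn x (IfSym a c d # K, s) = Some ((if read_input x p = a then c else d) # K, s)" using s by simp
  note tr = steps_to_step[where f = "rn x", OF 1]
  let ?c = "if read_input x p = a then c else d"
  have IH: "(\<forall>s'. sem x ?c s = Some s' \<longrightarrow> steps_to (rn x) (?c # K, s) (K, s')) \<and>
    (sem x ?c s = None \<longrightarrow> (\<exists>K' s'. K' \<noteq> [] \<and> steps_to (rn x) (?c # K, s) (K', s') \<and> rn x (K', s') = None))"
    using IfSym.IH[of s K] IfSym.prems by auto
  have "sem x (IfSym a c d) s = sem x ?c s" using s by simp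
  then show ?case using IH tr by metis
next
  case (Choice c d)
  obtain \<sigma> p g where s: "s = (\<sigma>, p, g)" by (metis prod_cases3)
  show ?case
  proof (cases g)
    case Nil
    then show ?thesis using s
      by (auto intro!: exI[of _ "Choice c d # K"] exI[of _ s])
  next
    case (Cons b g')
    have 1: "rn x (Choice c d # K, s) = Some ((if b then c else d) # K, \<sigma>, p, g')" using s Cons by simp
    note tr = steps_to_step[where f = "rn x", OF 1]
    let ?c = "if b then c else d" and ?s = "(\<sigma>, p, g')"
    have IH: "(\<forall>s'. sem x ?c ?s = Some s' \<longrightarrow> steps_to (rn x) (?c # K, ?s) (K, s')) \<and>
      (sem x ?c ?s = None \<longrightarrow> (\<exists>K' s'. K' \<noteq> [] \<and> steps_to (rn x) (?c # K, ?s) (K', s') \<and> rn x (K', s') = None))"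
      using Choice.IH[of ?s K] Choice.prems by auto
    have "sem x (Choice c d) s = sem x ?c ?s" using s Cons by simp
    then show ?thesis using IH tr by metis
  qed
next
  case (For i j c)
  let ?f = "\<lambda>s. Option.bind (sem x c s) (inc_reg i)"
  have "(\<forall>s'. it ?f n s = Some s' \<longrightarrow> steps_to (rn x) (For i j c # K, s) (K, s')) \<and>
    (it ?f n s = None \<longrightarrow> (\<exists>K' s'. K' \<noteq> [] \<and> steps_to (rn x) (For i j c # K, s) (K', s') \<and> rn x (K', s') = None))"
    if "n = fst s j - fst s i" for n s
    using that
  proof (induction n arbitrary: s)
    case 0
    obtain \<sigma> t where s: "s = (\<sigma>, t)" by fastforce
    have "rn x (For i j c # K, s) = Some (K, s)" using 0 s by simp
    then show ?case using steps_to_step[where f = "rn x"] by fastforce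
  next
    case (Suc n)
    obtain \<sigma> t where s: "s = (\<sigma>, t)" by fastforce
    have 1: "rn x (For i j c # K, s) = Some (c # Inc i # For i j c # K, s)" using Suc s by simp
    note IH = For.IH[of s "Inc i # For i j c # K"]
    show ?case
    proof (cases "sem x c s")
      case None
      then show ?thesis using IH For.prems steps_to_step[where f = "rn x", OF 1] by fastforce
    next
      case (Some s1)
      obtain \<sigma>1 t1 where s1: "s1 = (\<sigma>1, t1)" by fastforce
      let ?s2 = "(\<sigma>1(i := Suc (\<sigma>1 i)), t1)"
      have "\<sigma>1 i = \<sigma> i" "\<sigma>1 j = \<sigma> j"
        using sem_frame[OF Some] For.prems s s1 by auto
      then have n: "n = fst ?s2 j - fst ?s2 i" using Suc.prems s For.prems by simp
      obtain p1 g1 where t1: "t1 = (p1, g1)" by fastforce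
      have "steps_to (rn x) (For i j c # K, s) (Inc i # For i j c # K, s1)"
        using IH Some For.prems steps_to_step[where f = "rn x", OF 1] by simp
      moreover have "rn x (Inc i # For i j c # K, s1) = Some (For i j c # K, ?s2)"
        using s1 t1 by simp
      ultimately have "steps_to (rn x) (For i j c # K, s) (For i j c # K, ?s2)"
        by (meson steps_to_refl steps_to_step steps_to_trans)
      note tr = steps_to_trans[OF this]
      have "it ?f (Suc n) s = it ?f n ?s2" using Some s1 by (simp add: inc_reg_def)
      then show ?thesis using Suc.IH[OF n] tr by metis
    qed
  qed
  from this[OF refl, of s] show ?case by simp
next
  case Fail
  then show ?case by (auto intro!: exI[of _ "Fail # K"] exI[of _ s])
next
  case Skip
  then show ?case using steps_to_step[where f = "rn x"] by fastforce
next
  case (Sum r b u v)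
  obtain \<sigma> p g where s: "s = (\<sigma>, p, g)" by (metis prod_cases3)
  then show ?case using steps_to_step[where f = "rn x"] by fastforce
next
  case InR
  obtain \<sigma> p g where s: "s = (\<sigma>, p, g)" by (metis prod_cases3)
  show ?case
  proof (cases "p \<le> length x")
    case False
    then show ?thesis using s by (auto intro!: exI[of _ "InR # K"] exI[of _ s])
  qed (use s steps_to_step[where f = "rn x"] in fastforce)
next
  case InL
  obtain \<sigma> p g where s: "s = (\<sigma>, p, g)" by (metis prod_cases3)
  show ?case
  proof (cases "0 < p")
    case False
    then show ?thesis using s by (auto intro!: exI[of _ "InL # K"] exI[of _ s])
  qed (use s steps_to_step[where f = "rn x"] in fastforce)
qed auto

text \<open>With an empty remainder, \<open>h\<close> is precisely what the run consumes, and
  sequencing of commands becomes concatenation of choice lists.\<close>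

definition ex :: "'a list \<Rightarrow> 'a com \<Rightarrow> (nat \<Rightarrow> nat) \<Rightarrow> nat \<Rightarrow> bool list \<Rightarrow> (nat \<Rightarrow> nat) \<Rightarrow> nat \<Rightarrow> bool" where
  "ex x c \<sigma> p h \<sigma>' p' \<longleftrightarrow> sem x c (\<sigma>, p, h) = Some (\<sigma>', p', [])"

lemma ex_append: "ex x c \<sigma> p h \<sigma>' p' \<Longrightarrow> sem x c (\<sigma>, p, h @ g) = Some (\<sigma>', p', g)"
  unfolding ex_def using sem_consume by (metis append_Nil2)

lemma ex_fun: "ex x c \<sigma> p h \<sigma>1 p1 \<Longrightarrow> ex x c \<sigma> p h \<sigma>2 p2 \<Longrightarrow> \<sigma>1 = \<sigma>2 \<and> p1 = p2"
  unfolding ex_def by simp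

lemma ex_frame: "ex x c \<sigma> p h \<sigma>' p' \<Longrightarrow> r \<notin> writes c \<Longrightarrow> \<sigma>' r = \<sigma> r"
  unfolding ex_def using sem_frame[of x c "(\<sigma>, p, h)"] by fastforce

lemma ex_Seq:
  "ex x (Seq c d) \<sigma> p h \<sigma>' p' \<longleftrightarrow>
     (\<exists>h1 h2 \<sigma>1 p1. h = h1 @ h2 \<and> ex x c \<sigma> p h1 \<sigma>1 p1 \<and> ex x d \<sigma>1 p1 h2 \<sigma>' p')"
proof
  assume "ex x (Seq c d) \<sigma> p h \<sigma>' p'"
  then obtain \<sigma>1 p1 g1 where *: "sem x c (\<sigma>, p, h) = Some (\<sigma>1, p1, g1)" "sem x d (\<sigma>1, p1, g1) = Some (\<sigma>', p', [])"
    by (auto simp: ex_def bind_eq_Some_conv)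
  then obtain h1 where "h = h1 @ g1" "\<forall>k. sem x c (\<sigma>, p, h1 @ k) = Some (\<sigma>1, p1, k)"
    using sem_consume by blast
  then show "\<exists>h1 h2 \<sigma>1 p1. h = h1 @ h2 \<and> ex x c \<sigma> p h1 \<sigma>1 p1 \<and> ex x d \<sigma>1 p1 h2 \<sigma>' p'"
    using * unfolding ex_def by (metis append_Nil2)
next
  assume "\<exists>h1 h2 \<sigma>1 p1. h = h1 @ h2 \<and> ex x c \<sigma> p h1 \<sigma>1 p1 \<and> ex x d \<sigma>1 p1 h2 \<sigma>' p'"
  then show "ex x (Seq c d) \<sigma> p h \<sigma>' p'"
    using ex_append by (fastforce simp: ex_def)
qed

lemma ex_SeqI: "ex x c \<sigma> p h1 \<sigma>1 p1 \<Longrightarrow> ex x d \<sigma>1 p1 h2 \<sigma>' p' \<Longrightarrow> ex x (Seq c d) \<sigma> p (h1 @ h2) \<sigma>' p'"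
  unfolding ex_Seq by blast

lemma ex_simps [simp]:
  "ex x Skip \<sigma> p h \<sigma>' p' \<longleftrightarrow> \<sigma>' = \<sigma> \<and> p' = p \<and> h = []"
  "ex x Fail \<sigma> p h \<sigma>' p' \<longleftrightarrow> False"
  "ex x (Sum r b u v) \<sigma> p h \<sigma>' p' \<longleftrightarrow> \<sigma>' = \<sigma>(r := of_bool b + oval \<sigma> u + oval \<sigma> v) \<and> p' = p \<and> h = []"
  "ex x (IfLt i j c d) \<sigma> p h \<sigma>' p' \<longleftrightarrow> (if \<sigma> i < \<sigma> j then ex x c \<sigma> p h \<sigma>' p' else ex x d \<sigma> p h \<sigma>' p')"
  "ex x (IfEq i j c d) \<sigma> p h \<sigma>' p' \<longleftrightarrow> (if \<sigma> i = \<sigma> j then ex x c \<sigma> p h \<sigma>' p' else ex x d \<sigma> p h \<sigma>' p')"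
  "ex x (IfSym a c d) \<sigma> p h \<sigma>' p' \<longleftrightarrow> (if read_input x p = a then ex x c \<sigma> p h \<sigma>' p' else ex x d \<sigma> p h \<sigma>' p')"
  "ex x InR \<sigma> p h \<sigma>' p' \<longleftrightarrow> p \<le> length x \<and> \<sigma>' = \<sigma> \<and> p' = Suc p \<and> h = []"
  "ex x InL \<sigma> p h \<sigma>' p' \<longleftrightarrow> 0 < p \<and> \<sigma>' = \<sigma> \<and> p' = p - 1 \<and> h = []"
  "ex x (Choice c d) \<sigma> p [] \<sigma>' p' \<longleftrightarrow> False"
  "ex x (Choice c d) \<sigma> p (b # h) \<sigma>' p' \<longleftrightarrow> (if b then ex x c \<sigma> p h \<sigma>' p' else ex x d \<sigma> p h \<sigma>' p')"
  by (auto simp: ex_def)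

section \<open>Reasoning about successful runs\<close>

text \<open>A description of all successful guesses: they are the encodings \<open>e a\<close> of
  the indices in \<open>A\<close>, and the final state may depend on the index. \<open>uni\<close>
  is the case of a single guess, \<open>det\<close> that of success without choices.\<close>

definition runs :: "'a list \<Rightarrow> 'a com \<Rightarrow> 'b set \<Rightarrow> ('b \<Rightarrow> bool list) \<Rightarrow> ('b \<Rightarrow> (nat \<Rightarrow> nat) \<Rightarrow> nat \<Rightarrow> bool) \<Rightarrow>
    (nat \<Rightarrow> nat) \<Rightarrow> nat \<Rightarrow> bool" where
  "runs x c A e Q \<sigma> p \<longleftrightarrow> (\<forall>a \<in> A. \<exists>\<sigma>' p'. ex x c \<sigma> p (e a) \<sigma>' p' \<and> Q a \<sigma>' p') \<and>
     (\<forall>h \<sigma>' p'. ex x c \<sigma> p h \<sigma>' p' \<longrightarrow> h \<in> e ` A)"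

definition uni :: "'a list \<Rightarrow> 'a com \<Rightarrow> ((nat \<Rightarrow> nat) \<Rightarrow> nat \<Rightarrow> bool) \<Rightarrow> (nat \<Rightarrow> nat) \<Rightarrow> nat \<Rightarrow> bool" where
  "uni x c Q \<sigma> p \<longleftrightarrow> (\<exists>g. runs x c {()} (\<lambda>_. g) (\<lambda>_. Q) \<sigma> p)"

definition det :: "'a list \<Rightarrow> 'a com \<Rightarrow> ((nat \<Rightarrow> nat) \<Rightarrow> nat \<Rightarrow> bool) \<Rightarrow> (nat \<Rightarrow> nat) \<Rightarrow> nat \<Rightarrow> bool" where
  "det x c Q \<sigma> p \<longleftrightarrow> (\<exists>\<sigma>' p'. ex x c \<sigma> p [] \<sigma>' p' \<and> Q \<sigma>' p')"

lemma det_Seq [simp]: "det x (Seq c d) Q \<sigma> p \<longleftrightarrow> det x c (det x d Q) \<sigma> p"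
  by (auto simp: det_def ex_Seq)

lemma det_simps [simp]:
  "det x Skip Q \<sigma> p \<longleftrightarrow> Q \<sigma> p"
  "det x Fail Q \<sigma> p \<longleftrightarrow> False"
  "det x (Sum r b u v) Q \<sigma> p \<longleftrightarrow> Q (\<sigma>(r := of_bool b + oval \<sigma> u + oval \<sigma> v)) p"
  "det x (IfLt i j c d) Q \<sigma> p \<longleftrightarrow> (if \<sigma> i < \<sigma> j then det x c Q \<sigma> p else det x d Q \<sigma> p)"
  "det x (IfEq i j c d) Q \<sigma> p \<longleftrightarrow> (if \<sigma> i = \<sigma> j then det x c Q \<sigma> p else det x d Q \<sigma> p)"
  "det x (IfSym a c d) Q \<sigma> p \<longleftrightarrow> (if read_input x p = a then det x c Q \<sigma> p else det x d Q \<sigma> p)"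
  "det x InR Q \<sigma> p \<longleftrightarrow> p \<le> length x \<and> Q \<sigma> (Suc p)"
  "det x InL Q \<sigma> p \<longleftrightarrow> 0 < p \<and> Q \<sigma> (p - 1)"
  by (auto simp: det_def)

lemma det_conseq: "det x c Q \<sigma> p \<Longrightarrow> (\<And>\<sigma>' p'. Q \<sigma>' p' \<Longrightarrow> (\<forall>r. r \<notin> writes c \<longrightarrow> \<sigma>' r = \<sigma> r) \<Longrightarrow> Q' \<sigma>' p') \<Longrightarrow> det x c Q' \<sigma> p"
  unfolding det_def using ex_frame by metis

text \<open>A run that succeeds on the empty list also runs on \<open>h\<close> and leaves
  \<open>h\<close> unread, which counts as success only if \<open>h\<close> is empty.\<close>

lemma det_ex_Nil:
  assumes "det x c Q \<sigma> p" "ex x c \<sigma> p h \<sigma>' p'"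
  shows "h = [] \<and> Q \<sigma>' p'"
proof -
  obtain \<sigma>1 p1 where *: "ex x c \<sigma> p [] \<sigma>1 p1" "Q \<sigma>1 p1" using assms(1) by (auto simp: det_def)
  have "sem x c (\<sigma>, p, h) = Some (\<sigma>1, p1, h)" using ex_append[OF *(1), of h] by simp
  then show ?thesis using assms(2) * by (auto simp: ex_def)
qed

lemma det_runs: "det x c (\<lambda>\<sigma>' p'. runs x d A e Q \<sigma>' p') \<sigma> p \<Longrightarrow> runs x (Seq c d) A e Q \<sigma> p"
  unfolding runs_def ex_Seq
proof (intro conjI ballI allI impI)
  assume d: "det x c (\<lambda>\<sigma>' p'. (\<forall>a\<in>A. \<exists>\<sigma>'' p''. ex x d \<sigma>' p' (e a) \<sigma>'' p'' \<and> Q a \<sigma>'' p'') \<and>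
        (\<forall>h \<sigma>'' p''. ex x d \<sigma>' p' h \<sigma>'' p'' \<longrightarrow> h \<in> e ` A)) \<sigma> p"
  { fix a assume "a \<in> A"
    then show "\<exists>\<sigma>' p'. (\<exists>h1 h2 \<sigma>1 p1. e a = h1 @ h2 \<and> ex x c \<sigma> p h1 \<sigma>1 p1 \<and> ex x d \<sigma>1 p1 h2 \<sigma>' p') \<and> Q a \<sigma>' p'"
      using d unfolding det_def by (metis append_Nil) }
  fix h \<sigma>' p'
  assume "\<exists>h1 h2 \<sigma>1 p1. h = h1 @ h2 \<and> ex x c \<sigma> p h1 \<sigma>1 p1 \<and> ex x d \<sigma>1 p1 h2 \<sigma>' p'"
  then show "h \<in> e ` A" using det_ex_Nil[OF d] by fastforce
qed

lemma runs_conseq: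
  "runs x c A e Q \<sigma> p \<Longrightarrow> (\<And>a \<sigma>' p'. a \<in> A \<Longrightarrow> Q a \<sigma>' p' \<Longrightarrow> (\<forall>r. r \<notin> writes c \<longrightarrow> \<sigma>' r = \<sigma> r) \<Longrightarrow> Q' a \<sigma>' p') \<Longrightarrow>
   runs x c A e Q' \<sigma> p"
  unfolding runs_def using ex_frame by metis

text \<open>This is how guesses are filtered: a check \<open>d\<close> without choices passes on the
  indices in \<open>A'\<close> and fails on all others, which shrinks the set of successful
  guesses.\<close>

lemma runs_det:
  assumes "runs x c A e Q \<sigma> p" "A' \<subseteq> A"
    "\<And>a \<sigma>' p'. a \<in> A' \<Longrightarrow> Q a \<sigma>' p' \<Longrightarrow> (\<forall>r. r \<notin> writes c \<longrightarrow> \<sigma>' r = \<sigma> r) \<Longrightarrow> det x d (Q' a) \<sigma>' p'"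
    "\<And>a \<sigma>' p' h \<sigma>'' p''. a \<in> A \<Longrightarrow> a \<notin> A' \<Longrightarrow> Q a \<sigma>' p' \<Longrightarrow> (\<forall>r. r \<notin> writes c \<longrightarrow> \<sigma>' r = \<sigma> r) \<Longrightarrow>
       ex x d \<sigma>' p' h \<sigma>'' p'' \<Longrightarrow> False"
  shows "runs x (Seq c d) A' e Q' \<sigma> p"
  unfolding runs_def ex_Seq
proof (intro conjI ballI allI impI)
  fix a assume "a \<in> A'"
  then obtain \<sigma>1 p1 where 1: "ex x c \<sigma> p (e a) \<sigma>1 p1" "Q a \<sigma>1 p1"
    using assms(1,2) unfolding runs_def by blast
  then have "det x d (Q' a) \<sigma>1 p1" using assms(3)[OF \<open>a \<in> A'\<close>] ex_frame[OF 1(1)] by blast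
  then show "\<exists>\<sigma>' p'. (\<exists>h1 h2 \<sigma>1 p1. e a = h1 @ h2 \<and> ex x c \<sigma> p h1 \<sigma>1 p1 \<and> ex x d \<sigma>1 p1 h2 \<sigma>' p') \<and> Q' a \<sigma>' p'"
    using 1 unfolding det_def by (metis append_Nil2)
next
  fix h \<sigma>' p'
  assume "\<exists>h1 h2 \<sigma>1 p1. h = h1 @ h2 \<and> ex x c \<sigma> p h1 \<sigma>1 p1 \<and> ex x d \<sigma>1 p1 h2 \<sigma>' p'"
  then obtain h1 h2 \<sigma>1 p1 where 1: "h = h1 @ h2" "ex x c \<sigma> p h1 \<sigma>1 p1" "ex x d \<sigma>1 p1 h2 \<sigma>' p'" by blast
  obtain a where a: "a \<in> A" "h1 = e a" using assms(1) 1(2) unfolding runs_def by blast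
  then have Q: "Q a \<sigma>1 p1" using assms(1) 1(2) ex_fun unfolding runs_def by metis
  have a': "a \<in> A'" using assms(4)[OF a(1) _ Q _ 1(3)] ex_frame[OF 1(2)] by blast
  then have "det x d (Q' a) \<sigma>1 p1" using assms(3)[OF a' Q] ex_frame[OF 1(2)] by blast
  then have "h2 = []" using det_ex_Nil 1(3) by metis
  then show "h \<in> e ` A'" using a a' 1 by simp
qed

lemma uni_Seq: "uni x c (uni x d Q) \<sigma> p \<Longrightarrow> uni x (Seq c d) Q \<sigma> p"
proof -
  assume "uni x c (uni x d Q) \<sigma> p"
  then obtain g1 where r1: "runs x c {()} (\<lambda>_. g1) (\<lambda>_. uni x d Q) \<sigma> p"
    unfolding uni_def[of x c] by blast
  then obtain \<sigma>1 p1 where 1: "ex x c \<sigma> p g1 \<sigma>1 p1" "uni x d Q \<sigma>1 p1" "\<And>h \<sigma>' p'. ex x c \<sigma> p h \<sigma>' p' \<Longrightarrow> h = g1"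
    unfolding runs_def by blast
  then obtain g2 where r2: "runs x d {()} (\<lambda>_. g2) (\<lambda>_. Q) \<sigma>1 p1"
    unfolding uni_def by blast
  then obtain \<sigma>2 p2 where 2: "ex x d \<sigma>1 p1 g2 \<sigma>2 p2" "Q \<sigma>2 p2" "\<And>h \<sigma>' p'. ex x d \<sigma>1 p1 h \<sigma>' p' \<Longrightarrow> h = g2"
    unfolding runs_def by blast
  have "ex x (Seq c d) \<sigma> p (g1 @ g2) \<sigma>2 p2" using 1(1) 2(1) by (auto simp: ex_Seq)
  moreover have "h = g1 @ g2" if "ex x (Seq c d) \<sigma> p h \<sigma>' p'" for h \<sigma>' p'
    using that 1(3) 2(3) ex_fun[OF 1(1)] unfolding ex_Seq by metis
  ultimately show ?thesis using 2(2) by (auto simp: uni_def runs_def)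
qed

lemma uni_det:
  assumes "det x c Q \<sigma> p"
  shows "uni x c Q \<sigma> p"
  unfolding uni_def runs_def
proof (intro exI[of _ "[]"] conjI ballI allI impI)
  fix h \<sigma>' p' assume "ex x c \<sigma> p h \<sigma>' p'"
  then show "h \<in> (\<lambda>_. []) ` {()}" using det_ex_Nil[OF assms] by simp
qed (use assms in \<open>simp add: det_def\<close>)

lemma uni_conseq: "uni x c Q \<sigma> p \<Longrightarrow> (\<And>\<sigma>' p'. Q \<sigma>' p' \<Longrightarrow> (\<forall>r. r \<notin> writes c \<longrightarrow> \<sigma>' r = \<sigma> r) \<Longrightarrow> Q' \<sigma>' p') \<Longrightarrow> uni x c Q' \<sigma> p"
  unfolding uni_def by (elim exE, rule exI, erule runs_conseq) simp

lemma runs_uni: "runs x c {a} e Q \<sigma> p \<Longrightarrow> uni x c (Q a) \<sigma> p"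
  unfolding uni_def runs_def by auto

lemma ex_For_0: "\<sigma> j \<le> \<sigma> i \<Longrightarrow> ex x (For i j c) \<sigma> p h \<sigma>' p' \<longleftrightarrow> \<sigma>' = \<sigma> \<and> p' = p \<and> h = []"
  by (auto simp: ex_def)

lemma ex_For_Suc:
  assumes "\<sigma> i < \<sigma> j" "wfc (For i j c)"
  shows "ex x (For i j c) \<sigma> p h \<sigma>' p' \<longleftrightarrow> ex x (Seq (Seq c (Inc i)) (For i j c)) \<sigma> p h \<sigma>' p'"
proof -
  obtain n where n: "\<sigma> j - \<sigma> i = Suc n" using assms(1) by (metis Suc_diff_Suc)
  show ?thesis
  proof (cases "sem x c (\<sigma>, p, h)")
    case None
    then show ?thesis using n by (simp add: ex_def)
  next
    case (Some s1)
    obtain \<sigma>1 t1 where s1: "s1 = (\<sigma>1, t1)" by fastforce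
    have "\<sigma>1 i = \<sigma> i" "\<sigma>1 j = \<sigma> j"
      using sem_frame[OF Some] assms s1 by auto
    then have "n = \<sigma>1 j - Suc (\<sigma>1 i)" using n by simp
    then show ?thesis using n Some s1 assms(2) by (simp add: ex_def inc_reg_def)
  qed
qed

text \<open>One index is chosen per round, and \<open>V\<close> says which sequences of indices have
  survived so far. Since \<open>V\<close> is closed under prefixes, validity of the whole sequence
  guarantees that each single choice was available in its round.\<close>

lemma runs_For:
  assumes wf: "wfc (For i j c)" and i: "\<sigma> i = 0" and I: "I [] \<sigma> p"
    and V: "\<And>as a. V (as @ [a]) \<Longrightarrow> V as" "V []"
    and body: "\<And>as \<sigma>' p'. length as < \<sigma> j \<Longrightarrow> V as \<Longrightarrow> I as \<sigma>' p' \<Longrightarrow> \<sigma>' i = length as \<Longrightarrow> \<sigma>' j = \<sigma> j \<Longrightarrow>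
       runs x c {a. V (as @ [a])} e (\<lambda>a \<sigma>'' p''. I (as @ [a]) (\<sigma>''(i := Suc (length as))) p'') \<sigma>' p'"
  shows "runs x (For i j c) {as. length as = \<sigma> j \<and> V as} (\<lambda>as. concat (map e as)) I \<sigma> p"
proof -
  have *: "runs x (For i j c) {bs. length (as @ bs) = \<sigma> j \<and> V (as @ bs)} (\<lambda>bs. concat (map e bs))
      (\<lambda>bs. I (as @ bs)) \<sigma>' p'"
    if "\<sigma> j = length as + n" "V as" "I as \<sigma>' p'" "\<sigma>' i = length as" "\<sigma>' j = \<sigma> j" for n as \<sigma>' p'
    using that
  proof (induction n arbitrary: as \<sigma>' p')
    case 0
    then show ?case by (auto simp: runs_def ex_For_0)
  next
    case (Suc n)
    have lt: "\<sigma>' i < \<sigma>' j" using Suc.prems by simp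
    let ?J = "\<lambda>a \<sigma>'' p''. I (as @ [a]) (\<sigma>''(i := Suc (length as))) p''"
    have b: "runs x c {a. V (as @ [a])} e ?J \<sigma>' p'"
      by (rule body) (use Suc.prems in auto)
    have step: "runs x (For i j c) {bs. length (as @ [a] @ bs) = \<sigma> j \<and> V (as @ [a] @ bs)} (\<lambda>bs. concat (map e bs))
        (\<lambda>bs. I (as @ [a] @ bs)) (\<sigma>1(i := Suc (\<sigma>1 i))) p1"
      if "ex x c \<sigma>' p' (e a) \<sigma>1 p1" "V (as @ [a])" for a \<sigma>1 p1
    proof -
      have f: "\<sigma>1 i = \<sigma>' i" "\<sigma>1 j = \<sigma>' j" using ex_frame[OF that(1)] wf by auto
      have J: "?J a \<sigma>1 p1" using b that ex_fun unfolding runs_def by (metis (mono_tags, lifting) mem_Collect_eq)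
      show ?thesis
        using Suc.IH[OF _ that(2) J] Suc.prems f wf by (simp add: fun_upd_def)
    qed
    show ?case
      unfolding runs_def
    proof (intro conjI ballI allI impI)
      fix bs assume "bs \<in> {bs. length (as @ bs) = \<sigma> j \<and> V (as @ bs)}"
      then obtain a cs where bs: "bs = a # cs" and V': "V (as @ a # cs)" and l: "length (as @ a # cs) = \<sigma> j"
        using Suc.prems by (cases bs) auto
      have Va: "V (as @ [a])"
      proof -
        have "V (as @ [a] @ cs) \<Longrightarrow> V (as @ [a])" for cs
        proof (induction cs rule: rev_induct)
          case (snoc b cs)
          then show ?case using V(1)[of "as @ [a] @ cs" b] by simp
        qed simp
        then show ?thesis using V' by simp
      qed
      obtain \<sigma>1 p1 where 1: "ex x c \<sigma>' p' (e a) \<sigma>1 p1" using b Va unfolding runs_def by blast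
      obtain \<sigma>2 p2 where 2: "ex x (For i j c) (\<sigma>1(i := Suc (\<sigma>1 i))) p1 (concat (map e cs)) \<sigma>2 p2" "I (as @ [a] @ cs) \<sigma>2 p2"
        using step[OF 1 Va] V' l unfolding runs_def by auto
      have "ex x (Inc i) \<sigma>1 p1 [] (\<sigma>1(i := Suc (\<sigma>1 i))) p1" by simp
      then have "ex x (For i j c) \<sigma>' p' ((e a @ []) @ concat (map e cs)) \<sigma>2 p2"
        unfolding ex_For_Suc[OF lt wf] by (intro ex_SeqI[OF ex_SeqI[OF 1] 2(1)])
      then show "\<exists>\<sigma>'' p''. ex x (For i j c) \<sigma>' p' (concat (map e bs)) \<sigma>'' p'' \<and> I (as @ bs) \<sigma>'' p''"
        using 2(2) bs by auto
    next
      fix h \<sigma>'' p'' assume "ex x (For i j c) \<sigma>' p' h \<sigma>'' p''"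
      then obtain h1 h2 \<sigma>1 p1 where h: "h = h1 @ h2" "ex x c \<sigma>' p' h1 \<sigma>1 p1"
          "ex x (For i j c) (\<sigma>1(i := Suc (\<sigma>1 i))) p1 h2 \<sigma>'' p''"
        unfolding ex_For_Suc[OF lt wf] ex_Seq ex_simps by fastforce
      obtain a where a: "V (as @ [a])" "h1 = e a" using b h(2) unfolding runs_def by blast
      obtain cs where "length (as @ [a] @ cs) = \<sigma> j" "V (as @ [a] @ cs)" "h2 = concat (map e cs)"
        using step[of a] h a unfolding runs_def by blast
      then show "h \<in> (\<lambda>bs. concat (map e bs)) ` {bs. length (as @ bs) = \<sigma> j \<and> V (as @ bs)}"
        using h a by (intro image_eqI[of _ _ "a # cs"]) auto
    qed
  qed
  show ?thesis using *[of "[]" "\<sigma> j" \<sigma> p] i I V(2) by simp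
qed

lemma uni_For:
  assumes wf: "wfc (For i j c)" and i: "\<sigma> i = 0" and I: "I 0 \<sigma> p"
    and body: "\<And>k \<sigma>' p'. k < \<sigma> j \<Longrightarrow> I k \<sigma>' p' \<Longrightarrow> \<sigma>' i = k \<Longrightarrow> \<sigma>' j = \<sigma> j \<Longrightarrow>
       uni x c (\<lambda>\<sigma>'' p''. I (Suc k) (\<sigma>''(i := Suc k)) p'') \<sigma>' p'"
  shows "uni x (For i j c) (I (\<sigma> j)) \<sigma> p"
proof -
  have *: "uni x (For i j c) (I (\<sigma> j)) \<sigma>' p'"
    if "\<sigma> j = k + n" "I k \<sigma>' p'" "\<sigma>' i = k" "\<sigma>' j = \<sigma> j" for n k \<sigma>' p'
    using that
  proof (induction n arbitrary: k \<sigma>' p')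
    case 0
    then show ?case by (auto simp: uni_def runs_def ex_For_0)
  next
    case (Suc n)
    have lt: "\<sigma>' i < \<sigma>' j" using Suc.prems by simp
    have "uni x (Seq (Seq c (Inc i)) (For i j c)) (I (\<sigma> j)) \<sigma>' p'"
    proof (intro uni_Seq, rule uni_conseq[OF body])
      fix \<sigma>1 p1 assume *: "I (Suc k) (\<sigma>1(i := Suc k)) p1" "\<forall>r. r \<notin> writes c \<longrightarrow> \<sigma>1 r = \<sigma>' r"
      then have "\<sigma>1 i = k" "\<sigma>1 j = \<sigma> j" using wf Suc.prems by auto
      then show "uni x (Inc i) (uni x (For i j c) (I (\<sigma> j))) \<sigma>1 p1"
        using Suc.IH[of "Suc k" "\<sigma>1(i := Suc k)" p1, OF _ *(1)] Suc.prems wf by (intro uni_det) (auto simp: fun_upd_def)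
    qed (use Suc.prems in auto)
    then show ?case unfolding uni_def runs_def ex_For_Suc[OF lt wf] .
  qed
  show ?thesis by (rule *[of 0 "\<sigma> j"]) (use i I in auto)
qed

lemma det_For:
  assumes wf: "wfc (For i j c)" and i: "\<sigma> i = 0" and I: "I 0 \<sigma> p"
    and body: "\<And>k \<sigma>' p'. k < \<sigma> j \<Longrightarrow> I k \<sigma>' p' \<Longrightarrow> \<sigma>' i = k \<Longrightarrow> \<sigma>' j = \<sigma> j \<Longrightarrow>
       det x c (\<lambda>\<sigma>'' p''. I (Suc k) (\<sigma>''(i := Suc k)) p'') \<sigma>' p'"
  shows "det x (For i j c) (I (\<sigma> j)) \<sigma> p"
proof -
  have *: "det x (For i j c) (I (\<sigma> j)) \<sigma>' p'"
    if "\<sigma> j = k + n" "I k \<sigma>' p'" "\<sigma>' i = k" "\<sigma>' j = \<sigma> j" for n k \<sigma>' p'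
    using that
  proof (induction n arbitrary: k \<sigma>' p')
    case 0
    then show ?case by (auto simp: det_def ex_For_0)
  next
    case (Suc n)
    have lt: "\<sigma>' i < \<sigma>' j" using Suc.prems by simp
    have "det x (Seq (Seq c (Inc i)) (For i j c)) (I (\<sigma> j)) \<sigma>' p'"
      unfolding det_Seq
    proof (rule det_conseq[OF body])
      fix \<sigma>1 p1 assume *: "I (Suc k) (\<sigma>1(i := Suc k)) p1" "\<forall>r. r \<notin> writes c \<longrightarrow> \<sigma>1 r = \<sigma>' r"
      then have "\<sigma>1 i = k" "\<sigma>1 j = \<sigma> j" using wf Suc.prems by auto
      then show "det x (Inc i) (det x (For i j c) (I (\<sigma> j))) \<sigma>1 p1"
        using Suc.IH[of "Suc k" "\<sigma>1(i := Suc k)" p1, OF _ *(1)] Suc.prems wf by (auto simp: fun_upd_def)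
    qed (use Suc.prems in auto)
    then show ?case unfolding det_def ex_For_Suc[OF lt wf] .
  qed
  show ?thesis by (rule *[of 0 "\<sigma> j"]) (use i I in auto)
qed

lemma runs_Choice:
  assumes "runs x c A e Q \<sigma> p" "det x d Q0 \<sigma> p"
  shows "runs x (Choice c d) (insert None (Some ` A))
     (\<lambda>a. case a of None \<Rightarrow> [False] | Some a \<Rightarrow> True # e a)
     (\<lambda>a. case a of None \<Rightarrow> Q0 | Some a \<Rightarrow> Q a) \<sigma> p"
  unfolding runs_def
proof (intro conjI ballI allI impI)
  fix a assume "a \<in> insert None (Some ` A)"
  then show "\<exists>\<sigma>' p'. ex x (Choice c d) \<sigma> p (case a of None \<Rightarrow> [False] | Some a \<Rightarrow> True # e a) \<sigma>' p' \<and>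
      (case a of None \<Rightarrow> Q0 | Some a \<Rightarrow> Q a) \<sigma>' p'"
    using assms by (cases a) (auto simp: det_def runs_def)
next
  fix h \<sigma>' p' assume "ex x (Choice c d) \<sigma> p h \<sigma>' p'"
  then obtain b h' where h: "h = b # h'" "ex x (if b then c else d) \<sigma> p h' \<sigma>' p'" by (cases h) auto
  show "h \<in> (\<lambda>a. case a of None \<Rightarrow> [False] | Some a \<Rightarrow> True # e a) ` insert None (Some ` A)"
  proof (cases b)
    case True
    then have "ex x c \<sigma> p h' \<sigma>' p'" using h by simp
    then obtain a where "a \<in> A" "h' = e a" using assms(1) unfolding runs_def by blast
    then show ?thesis using True h by (intro image_eqI[of _ _ "Some a"]) auto
  next
    case False
    then have "h' = []" using h det_ex_Nil[OF assms(2)] by auto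
    then show ?thesis using False h by (intro image_eqI[of _ _ None]) auto
  qed
qed

fun select :: "'a com list \<Rightarrow> 'a com" where
  "select [] = Fail"
| "select (c # cs) = Choice c (select cs)"

text \<open>Alternative \<open>j\<close> of \<open>select\<close> is reached by declining
  \<open>j\<close> times and then consenting.\<close>

definition tag :: "nat \<Rightarrow> bool list" where
  "tag j = replicate j False @ [True]"

lemma ex_select:
  "ex x (select cs) \<sigma> p h \<sigma>' p' \<longleftrightarrow>
     (\<exists>j < length cs. \<exists>h'. h = tag j @ h' \<and> ex x (cs ! j) \<sigma> p h' \<sigma>' p')"
proof (induction cs arbitrary: h)
  case (Cons c cs)
  have "ex x (select (c # cs)) \<sigma> p h \<sigma>' p' \<longleftrightarrow>
      (\<exists>h'. h = True # h' \<and> ex x c \<sigma> p h' \<sigma>' p') \<or>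
      (\<exists>j < length cs. \<exists>h'. h = False # tag j @ h' \<and> ex x (cs ! j) \<sigma> p h' \<sigma>' p')"
    using Cons by (cases h) auto
  also have "\<dots> \<longleftrightarrow> (\<exists>j < length (c # cs). \<exists>h'. h = tag j @ h' \<and> ex x ((c # cs) ! j) \<sigma> p h' \<sigma>' p')"
    unfolding length_Cons Ex_less_Suc2 by (simp add: tag_def)
  finally show ?case .
qed simp

lemma runs_select:
  assumes "\<And>j. j \<in> J \<Longrightarrow> j < length cs \<and> det x (cs ! j) (Q j) \<sigma> p"
    "\<And>j h \<sigma>' p'. j < length cs \<Longrightarrow> j \<notin> J \<Longrightarrow> ex x (cs ! j) \<sigma> p h \<sigma>' p' \<Longrightarrow> False"
  shows "runs x (select cs) J tag Q \<sigma> p"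
  unfolding runs_def ex_select
proof (intro conjI ballI allI impI)
  fix j assume "j \<in> J"
  then show "\<exists>\<sigma>' p'. (\<exists>j' < length cs. \<exists>h'. tag j = tag j' @ h' \<and> ex x (cs ! j') \<sigma> p h' \<sigma>' p') \<and> Q j \<sigma>' p'"
    using assms(1) unfolding det_def by (metis append_Nil2)
next
  fix h \<sigma>' p'
  assume "\<exists>j < length cs. \<exists>h'. h = tag j @ h' \<and> ex x (cs ! j) \<sigma> p h' \<sigma>' p'"
  then obtain j h' where j: "j < length cs" "h = tag j @ h'" "ex x (cs ! j) \<sigma> p h' \<sigma>' p'" by blast
  then have "j \<in> J" using assms(2) by blast
  then have "h' = []" using assms(1) j(3) det_ex_Nil by metis
  then show "h \<in> tag ` J" using j \<open>j \<in> J\<close> by simp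
qed

section \<open>Guarded programs\<close>

abbreviation (input) "rCAP \<equiv> (0 :: nat)"
abbreviation (input) "rTCAP \<equiv> (1 :: nat)"

abbreviation Zero :: "nat \<Rightarrow> 'a com" where "Zero r \<equiv> Sum r False None None"
abbreviation One :: "nat \<Rightarrow> 'a com" where "One r \<equiv> Sum r True None None"
abbreviation Cp :: "nat \<Rightarrow> nat \<Rightarrow> 'a com" where "Cp r s \<equiv> Sum r False (Some s) None"

text \<open>Additions fail when the result reaches the cap in register \<open>rCAP\<close>, and loops fail when their
  length reaches the cap in register \<open>rTCAP\<close>. Space and time bounds then hold for every run, whatever
  choices it makes.\<close>
definition CSum :: "nat \<Rightarrow> bool \<Rightarrow> nat option \<Rightarrow> nat option \<Rightarrow> 'a com" where
  "CSum r b u v = Seq (Sum r b u v) (IfLt r rCAP Skip Fail)"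

abbreviation CInc :: "nat \<Rightarrow> 'a com" where "CInc r \<equiv> CSum r True (Some r) None"
abbreviation CAdd :: "nat \<Rightarrow> nat \<Rightarrow> 'a com" where "CAdd r s \<equiv> CSum r False (Some r) (Some s)"

definition FOR :: "nat \<Rightarrow> nat \<Rightarrow> 'a com \<Rightarrow> 'a com" where
  "FOR i j c = Seq (Zero i) (IfLt j rTCAP (For i j c) Fail)"

inductive capped :: "'a com \<Rightarrow> bool" where
  "capped Skip"
| "capped Fail"
| "capped InR"
| "capped InL"
| "1 < r \<Longrightarrow> capped (Zero r)"
| "1 < r \<Longrightarrow> capped (One r)"
| "1 < r \<Longrightarrow> capped (Cp r s)"
| "1 < r \<Longrightarrow> capped (CSum r b u v)"
| "capped c \<Longrightarrow> capped d \<Longrightarrow> capped (Seq c d)"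
| "capped c \<Longrightarrow> capped d \<Longrightarrow> capped (IfLt i j c d)"
| "capped c \<Longrightarrow> capped d \<Longrightarrow> capped (IfEq i j c d)"
| "capped c \<Longrightarrow> capped d \<Longrightarrow> capped (IfSym a c d)"
| "capped c \<Longrightarrow> capped d \<Longrightarrow> capped (Choice c d)"
| "1 < i \<Longrightarrow> i \<noteq> j \<Longrightarrow> i \<notin> writes c \<Longrightarrow> j \<notin> writes c \<Longrightarrow> capped c \<Longrightarrow> capped (FOR i j c)"

lemma capped_wfc: "capped c \<Longrightarrow> wfc c"
  by (induction rule: capped.induct) (auto simp: CSum_def FOR_def)

lemma capped_writes: "capped c \<Longrightarrow> rCAP \<notin> writes c \<and> rTCAP \<notin> writes c"
  by (induction rule: capped.induct) (auto simp: CSum_def FOR_def)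

primrec cost :: "nat \<Rightarrow> 'a com \<Rightarrow> nat" where
  "cost P Skip = 1"
| "cost P Fail = 1"
| "cost P (Sum r b u v) = 1"
| "cost P (Seq c d) = 1 + cost P c + cost P d"
| "cost P (IfLt i j c d) = 1 + cost P c + cost P d"
| "cost P (IfEq i j c d) = 1 + cost P c + cost P d"
| "cost P (IfSym a c d) = 1 + cost P c + cost P d"
| "cost P InR = 1"
| "cost P InL = 1"
| "cost P (Choice c d) = 1 + cost P c + cost P d"
| "cost P (For i j c) = 1 + P * (cost P c + 2)"
| "cost P (Scan r) = 1"

text \<open>The program text is fixed and every loop contributes one factor \<open>P\<close>, the
  loop cap, so the exponent does not depend on the input.\<close>

lemma cost_poly: "\<exists>C k. \<forall>P \<ge> 1. cost P c \<le> C * P ^ k"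
proof (induction c)
  have two: "\<exists>C k. \<forall>P \<ge> 1. 1 + cost P c + cost P d \<le> C * P ^ k"
    if "\<exists>C k. \<forall>P \<ge> 1. cost P c \<le> C * P ^ k" "\<exists>C k. \<forall>P \<ge> 1. cost P d \<le> C * P ^ k" for c d :: "'a com"
  proof -
    obtain C k C' k' where c: "\<forall>P \<ge> 1. cost P c \<le> C * P ^ k" "\<forall>P \<ge> 1. cost P d \<le> C' * P ^ k'"
      using \<open>\<exists>C k. \<forall>P \<ge> 1. cost P c \<le> C * P ^ k\<close> \<open>\<exists>C k. \<forall>P \<ge> 1. cost P d \<le> C * P ^ k\<close> by blast
    have "1 + cost P c + cost P d \<le> (1 + C + C') * P ^ (k + k')" if P: "P \<ge> 1" for P
    proof -
      have "P ^ k \<le> P ^ (k + k')" "P ^ k' \<le> P ^ (k + k')" "1 \<le> P ^ (k + k')"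
        using P by (auto intro!: power_increasing)
      then have "C * P ^ k \<le> C * P ^ (k + k')" "C' * P ^ k' \<le> C' * P ^ (k + k')" by auto
      then show ?thesis using c(1)[rule_format, OF P] c(2)[rule_format, OF P] \<open>1 \<le> P ^ (k + k')\<close>
        unfolding distrib_right by linarith
    qed
    then show ?thesis by blast
  qed
  { case (Seq c d) then show ?case using two by simp }
  { case (IfLt i j c d) then show ?case using two by simp }
  { case (IfEq i j c d) then show ?case using two by simp }
  { case (IfSym a c d) then show ?case using two by simp }
  { case (Choice c d) then show ?case using two by simp }
  { case (For i j c)
    then obtain C k where c: "\<forall>P \<ge> 1. cost P c \<le> C * P ^ k" by blast
    have "cost P (For i j c) \<le> (C + 3) * P ^ (Suc k)" if P: "P \<ge> 1" for P
    proof -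
      have "P * cost P c \<le> P * (C * P ^ k)" using c P by simp
      moreover have "1 \<le> P ^ Suc k" "P \<le> P ^ Suc k" using P by (auto simp: one_le_power)
      ultimately have "1 + (P * cost P c + 2 * P) \<le> C * P ^ Suc k + 3 * P ^ Suc k"
        by (simp only: power_Suc mult.left_commute[of P C])
      then show ?thesis by (simp add: algebra_simps)
    qed
    then show ?case by blast }
qed (auto intro: exI[of _ 1] exI[of _ 0])

abbreviation below :: "nat \<Rightarrow> 'a rcfg \<Rightarrow> bool" where
  "below m s \<equiv> \<forall>r. fst (snd s) r < 2 ^ m"

text \<open>Before it is checked, the sum of two values at most \<open>C\<close> and a constant 1
  can reach \<open>2 * C + 1\<close>; this is why \<open>2 ^ m\<close> has to exceed that number. A
  loop that passes its guard makes fewer than \<open>P\<close> rounds. Getting stuck is allowed, so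
  the bounds cover failing branches too.\<close>

lemma capped_bd:
  fixes c :: "'a com"
  assumes "capped c" "2 * C + 1 < 2 ^ m" "P \<le> C + 1" "1 \<le> C" "\<forall>r. \<sigma> r \<le> C" "\<sigma> rCAP = C" "\<sigma> rTCAP = P"
  shows "bd (rn x) (below m) True (cost P c) (c # K, \<sigma>, p, g)
    (\<lambda>s. \<exists>\<sigma>' p' g'. s = (K, \<sigma>', p', g') \<and> (\<forall>r. \<sigma>' r \<le> C) \<and> (\<forall>r. r \<notin> writes c \<longrightarrow> \<sigma>' r = \<sigma> r))"
  using assms(1,5-)
proof (induction c arbitrary: K \<sigma> p g rule: capped.induct)
  let ?B = "bd (rn x) (below m) True"
  let ?Q = "\<lambda>(c :: 'a com) K \<sigma> (s :: 'a rcfg). \<exists>\<sigma>' p' g'. s = (K, \<sigma>', p', g') \<and> (\<forall>r. \<sigma>' r \<le> C) \<and> (\<forall>r. r \<notin> writes c \<longrightarrow> \<sigma>' r = \<sigma> r)"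
  have below: "below m (K, \<sigma>, s)" if "\<forall>r. \<sigma> r \<le> C" for K \<sigma> s
  proof
    fix r
    have "\<sigma> r \<le> C" using that by blast
    then show "fst (snd (K, \<sigma>, s)) r < 2 ^ m" using assms(2) by simp
  qed
  have stuck: "?B n (c # K, \<sigma>, p, g) Q" if "\<forall>r. \<sigma> r \<le> C" "rn x (c # K, \<sigma>, p, g) = None" for c K \<sigma> p g Q n
    using that below by (intro bd_stuck) auto
  have step: "?B (Suc n) (c # K, \<sigma>, p, g) Q" if "\<forall>r. \<sigma> r \<le> C" "rn x (c # K, \<sigma>, p, g) = Some s'" "?B n s' Q" for c K \<sigma> p g Q s' n
    using that below by (intro bd_step) auto
  note mono = bd_mono[of "rn x" "below m" True]
  have wconseq: "?B n s (?Q dd K \<sigma>)" if "?B n s (?Q cc K \<sigma>)" "writes cc \<subseteq> writes dd" for n s K \<sigma> and cc dd :: "'a com"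
    using that(1) by (rule bd_conseq) (use that(2) in blast)
  have capfix: "\<sigma>' rCAP = C \<and> \<sigma>' rTCAP = P" if "capped c" "\<forall>r. r \<notin> writes c \<longrightarrow> \<sigma>' r = \<sigma> r" "\<sigma> rCAP = C" "\<sigma> rTCAP = P" for c :: "'a com" and \<sigma> \<sigma>'
    using that capped_writes[OF that(1)] by simp
  have two: "?B (1 + cost P c + cost P d) (e # K, \<sigma>, p, g) (?Q e K \<sigma>)"
    if "\<forall>r. \<sigma> r \<le> C" "rn x (e # K, \<sigma>, p, g) = Some ((if z then c # K else d # K), \<sigma>, p, g')" "writes e = writes c \<union> writes d"
      "?B (cost P c) (c # K, \<sigma>, p, g') (?Q c K \<sigma>)" "?B (cost P d) (d # K, \<sigma>, p, g') (?Q d K \<sigma>)"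
    for c d e z K \<sigma> p g g'
  proof -
    have "?B (cost P c + cost P d) ((if z then c # K else d # K), \<sigma>, p, g') (?Q e K \<sigma>)"
    proof -
      have "?B (cost P c) (c # K, \<sigma>, p, g') (?Q e K \<sigma>)"
        using that(4) by (rule wconseq) (use that in auto)
      moreover have "?B (cost P d) (d # K, \<sigma>, p, g') (?Q e K \<sigma>)"
        using that(5) by (rule wconseq) (use that in auto)
      ultimately show ?thesis by (auto intro: mono)
    qed
    then show ?thesis using step[OF that(1,2)] by simp
  qed
  have fin: "?B (Suc n) (e # K, \<sigma>, p, g) (?Q c' K \<sigma>)"
    if "\<forall>r. \<sigma> r \<le> C" "rn x (e # K, \<sigma>, p, g) = Some (K, \<sigma>', p', g')" "\<forall>r. \<sigma>' r \<le> C" "\<forall>r. r \<notin> writes c' \<longrightarrow> \<sigma>' r = \<sigma> r"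
    for e K \<sigma> p g \<sigma>' p' g' n and c' :: "'a com"
    by (rule step[OF that(1,2)], rule bd_post) (use that in blast)
  { case 1 show ?case unfolding cost.simps One_nat_def
      by (rule fin[OF 1(1)]) (use 1 in auto) }
  { case 2 then show ?case using stuck by simp }
  { case 3 show ?case unfolding cost.simps One_nat_def
    proof (cases "p \<le> length x")
      case True
      then show "?B (Suc 0) (InR # K, \<sigma>, p, g) (?Q (InR :: 'a com) K \<sigma>)" by (intro fin[OF 3(1)]) (use 3 in auto)
    qed (use stuck[OF 3(1)] in simp) }
  { case 4 show ?case unfolding cost.simps One_nat_def
    proof (cases "0 < p")
      case True
      then show "?B (Suc 0) (InL # K, \<sigma>, p, g) (?Q (InL :: 'a com) K \<sigma>)" by (intro fin[OF 4(1)]) (use 4 in auto)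
    qed (use stuck[OF 4(1)] in simp) }
  { case (5 r) show ?case unfolding cost.simps One_nat_def
      by (rule fin[OF 5(2) rn.simps(4)]) (use 5 in auto) }
  { case (6 r) show ?case unfolding cost.simps One_nat_def
      by (rule fin[OF 6(2) rn.simps(4)]) (use 6 assms(4) in auto) }
  { case (7 r s) show ?case unfolding cost.simps One_nat_def
      by (rule fin[OF 7(2) rn.simps(4)]) (use 7 in auto) }
  { case (8 r b u v)
    let ?v = "of_bool b + oval \<sigma> u + oval \<sigma> v" let ?\<sigma> = "\<sigma>(r := ?v)"
    have o: "oval \<sigma> u \<le> C" "oval \<sigma> v \<le> C" using 8(2) by (auto simp: oval_def split: option.splits)
    have b2: "below m (K', ?\<sigma>, s)" for K' s
    proof
      fix r'
      have "\<sigma> r' \<le> C" using 8(2) by blast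
      then show "fst (snd (K', ?\<sigma>, s)) r' < 2 ^ m" using o assms(2) by (cases b) auto
    qed
    have "?B (Suc (Suc (Suc (Suc 0)))) (CSum r b u v # K, \<sigma>, p, g) (?Q (CSum r b u v) K \<sigma>)"
      unfolding CSum_def
    proof (rule step[OF 8(2)], rule rn.simps(5), rule step[OF 8(2)], rule rn.simps(4),
        rule bd_step, rule b2, rule rn.simps(6))
      show "?B (Suc 0) ((if (\<sigma>(r := ?v)) r < (\<sigma>(r := ?v)) 0 then Skip # K else Fail # K), ?\<sigma>, p, g)
        (?Q (Seq (Sum r b u v) (IfLt r rCAP Skip Fail)) K \<sigma>)"
      proof (cases "?v < C")
        case True
        have le: "\<forall>r'. ?\<sigma> r' \<le> C" using 8(2) True by auto
        have "?B (Suc 0) (Skip # K, ?\<sigma>, p, g) (?Q (Seq (Sum r b u v) (IfLt r rCAP Skip Fail)) K \<sigma>)"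
          by (rule step[OF le], simp, rule bd_post) (use le in auto)
        then show ?thesis using True 8 by simp
      next
        case False
        have "?B (Suc 0) (Fail # K, ?\<sigma>, p, g) (?Q (Seq (Sum r b u v) (IfLt r rCAP Skip Fail)) K \<sigma>)"
          by (rule bd_stuck, simp, rule b2, simp)
        then show ?thesis using False 8 by simp
      qed
    qed
    then show ?case by (rule mono) (simp add: CSum_def) }
  { case (9 c d)
    have "?B (cost P c) (c # d # K, \<sigma>, p, g) (?Q c (d # K) \<sigma>)" using 9 by blast
    then have "?B (cost P c + cost P d) (c # d # K, \<sigma>, p, g) (?Q (Seq c d) K \<sigma>)"
    proof (rule bd_bind)
      fix s assume "?Q c (d # K) \<sigma> s"
      then obtain \<sigma>' p' g' where s: "s = (d # K, \<sigma>', p', g')" "\<forall>r. \<sigma>' r \<le> C" "\<forall>r. r \<notin> writes c \<longrightarrow> \<sigma>' r = \<sigma> r" by blast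
      have "\<sigma>' rCAP = C" "\<sigma>' rTCAP = P" using capfix[OF 9(1) s(3)] 9 by auto
      then have "?B (cost P d) s (?Q d K \<sigma>')" using 9 s by blast
      then show "?B (cost P d) s (?Q (Seq c d) K \<sigma>)"
        by (rule bd_conseq) (use s(3) in \<open>fastforce simp: \<close>)
    qed
    then show ?case using step[OF 9(5), of "Seq c d"] by simp }
  { case (10 c d i j)
    show ?case unfolding cost.simps
      by (rule two[OF 10(5) rn.simps(6)]) (use 10 in auto) }
  { case (11 c d i j)
    show ?case unfolding cost.simps
      by (rule two[OF 11(5) rn.simps(7)]) (use 11 in auto) }
  { case (12 c d a)
    show ?case unfolding cost.simps
      by (rule two[OF 12(5) rn.simps(8)]) (use 12 in auto) }
  { case (13 c d)
    show ?case unfolding cost.simps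
    proof (cases g)
      case Nil
      then show "?B (1 + cost P c + cost P d) (Choice c d # K, \<sigma>, p, g) (?Q (Choice c d) K \<sigma>)"
        using stuck[OF 13(5)] by simp
    next
      case (Cons b g')
      show "?B (1 + cost P c + cost P d) (Choice c d # K, \<sigma>, p, g) (?Q (Choice c d) K \<sigma>)"
        unfolding Cons by (rule two[OF 13(5) rn.simps(12)]) (use 13 in auto)
    qed }
  { case (14 i j c)
    have loop: "?B (1 + n * (cost P c + 2)) (For i j c # K, \<sigma>', p', g') (?Q (For i j c) K \<sigma>')"
      if "\<sigma>' j - \<sigma>' i \<le> n" "\<forall>r. \<sigma>' r \<le> C" "\<sigma>' rCAP = C" "\<sigma>' rTCAP = P" for n \<sigma>' p' g'
      using that
    proof (induction n arbitrary: \<sigma>' p' g')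
      case 0
      show ?case unfolding mult_0 add_0_right One_nat_def by (rule fin[OF 0(2)]) (use 0 in auto)
    next
      case (Suc n)
      show ?case
      proof (cases "\<sigma>' i < \<sigma>' j")
        case False
        have "?B (Suc 0) (For i j c # K, \<sigma>', p', g') (?Q (For i j c) K \<sigma>')"
          by (rule fin[OF Suc.prems(2)]) (use False Suc.prems in auto)
        then show ?thesis by (rule mono) simp
      next
        case True
        have "?B (cost P c) (c # Inc i # For i j c # K, \<sigma>', p', g') (?Q c (Inc i # For i j c # K) \<sigma>')"
          using 14 Suc.prems by blast
        then have "?B (cost P c + (2 + n * (cost P c + 2))) (c # Inc i # For i j c # K, \<sigma>', p', g') (?Q (For i j c) K \<sigma>')"
        proof (rule bd_bind)
          fix s assume "?Q c (Inc i # For i j c # K) \<sigma>' s"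
          then obtain \<sigma>1 p1 g1 where s: "s = (Inc i # For i j c # K, \<sigma>1, p1, g1)" "\<forall>r. \<sigma>1 r \<le> C" "\<forall>r. r \<notin> writes c \<longrightarrow> \<sigma>1 r = \<sigma>' r" by blast
          let ?\<sigma> = "\<sigma>1(i := Suc (\<sigma>1 i))"
          have ij: "\<sigma>1 i = \<sigma>' i" "\<sigma>1 j = \<sigma>' j" using s(3) 14 by auto
          \<comment> \<open>The unchecked increment of the counter is safe: it cannot carry the
            counter beyond the limit register, which is at most \<open>C\<close>.\<close>
          have "Suc (\<sigma>' i) \<le> C" using True Suc.prems(2) by (meson Suc_leI order_trans)
          then have le: "\<forall>r. ?\<sigma> r \<le> C" using s(2) ij by simp
          have "?\<sigma> rCAP = C" "?\<sigma> rTCAP = P" using capfix[OF 14(5) s(3)] Suc.prems 14 by auto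
          moreover have "?\<sigma> j - ?\<sigma> i \<le> n" using ij Suc.prems 14 by simp
          ultimately have "?B (1 + n * (cost P c + 2)) (For i j c # K, ?\<sigma>, p1, g1) (?Q (For i j c) K ?\<sigma>)"
            using Suc.IH le by blast
          then have "?B (1 + n * (cost P c + 2)) (For i j c # K, ?\<sigma>, p1, g1) (?Q (For i j c) K \<sigma>')"
            by (rule bd_conseq) (use s(3) in fastforce)
          then show "?B (2 + n * (cost P c + 2)) s (?Q (For i j c) K \<sigma>')"
            using step[OF s(2), of "Inc i"] s(1) by simp
        qed
        then have "?B (Suc (cost P c + (2 + n * (cost P c + 2)))) (For i j c # K, \<sigma>', p', g') (?Q (For i j c) K \<sigma>')"
          using step[OF Suc.prems(2), of "For i j c"] True by simp
        then show ?thesis by (simp add: algebra_simps)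
      qed
    qed
    let ?\<sigma> = "\<sigma>(i := 0)"
    have le: "\<forall>r. ?\<sigma> r \<le> C" and cap: "?\<sigma> rCAP = C" "?\<sigma> rTCAP = P" using 14 by auto
    let ?W = "?Q (Seq (Zero i) (IfLt j rTCAP (For i j c) Fail)) K \<sigma>"
    have 1: "?B (1 + P * (cost P c + 2)) ((if ?\<sigma> j < ?\<sigma> 1 then For i j c # K else Fail # K), ?\<sigma>, p, g) ?W"
    proof (cases "?\<sigma> j < ?\<sigma> rTCAP")
      case True
      then have "?B (1 + P * (cost P c + 2)) (For i j c # K, ?\<sigma>, p, g) (?Q (For i j c) K ?\<sigma>)"
        by (intro loop) (use le cap in auto)
      then have "?B (1 + P * (cost P c + 2)) (For i j c # K, ?\<sigma>, p, g) ?W"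
        by (rule bd_conseq) fastforce
      then show ?thesis using True by simp
    next
      case False
      have "?B (1 + P * (cost P c + 2)) (Fail # K, ?\<sigma>, p, g) ?W"
        by (rule stuck[OF le]) simp
      then show ?thesis using False by simp
    qed
    have 2: "rn x (Zero i # IfLt j rTCAP (For i j c) Fail # K, \<sigma>, p, g)
        = Some (IfLt j rTCAP (For i j c) Fail # K, ?\<sigma>, p, g)"
      by simp
    have "?B (Suc (Suc (Suc (1 + P * (cost P c + 2))))) (FOR i j c # K, \<sigma>, p, g) (?Q (FOR i j c) K \<sigma>)"
      unfolding FOR_def
      by (rule step[OF 14(7) rn.simps(5) step[OF 14(7) 2 step[OF le rn.simps(6) 1]]])
    then show ?case by (rule mono) (simp add: FOR_def) }
qed

section \<open>Arithmetic\<close>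

lemma det_Zero: "det x (Zero r) Q \<sigma> p \<longleftrightarrow> Q (\<sigma>(r := 0)) p"
  by simp

lemma det_CSum [simp]:
  "det x (CSum r b u v) Q \<sigma> p \<longleftrightarrow>
     (\<sigma>(r := of_bool b + oval \<sigma> u + oval \<sigma> v)) r < (\<sigma>(r := of_bool b + oval \<sigma> u + oval \<sigma> v)) rCAP \<and>
     Q (\<sigma>(r := of_bool b + oval \<sigma> u + oval \<sigma> v)) p"
  by (auto simp: CSum_def)

lemma writes_CSum [simp]: "writes (CSum r b u v) = {r}"
  by (simp add: CSum_def)

lemma writes_FOR [simp]: "writes (FOR i j c) = insert i (writes c)"
  by (auto simp: FOR_def)

lemma wfc_CSum [simp]: "wfc (CSum r b u v)"
  by (simp add: CSum_def)

lemma wfc_FOR [simp]: "wfc (FOR i j c) = wfc (For i j c)"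
  by (simp add: FOR_def)

lemma det_FOR:
  assumes "wfc (For i j c)" "\<sigma> j < \<sigma> rTCAP" "i \<noteq> rTCAP" "I 0 (\<sigma>(i := 0)) p"
    and "\<And>k \<sigma>' p'. k < \<sigma> j \<Longrightarrow> I k \<sigma>' p' \<Longrightarrow> \<sigma>' i = k \<Longrightarrow> \<sigma>' j = \<sigma> j \<Longrightarrow>
       det x c (\<lambda>\<sigma>'' p''. I (Suc k) (\<sigma>''(i := Suc k)) p'') \<sigma>' p'"
    and "\<And>\<sigma>' p'. I (\<sigma> j) \<sigma>' p' \<Longrightarrow> Q \<sigma>' p'"
  shows "det x (FOR i j c) Q \<sigma> p"
proof -
  have ij: "i \<noteq> j" using assms(1) by simp
  have "det x (For i j c) (I ((\<sigma>(i := 0)) j)) (\<sigma>(i := 0)) p"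
    by (rule det_For[where \<sigma> = "\<sigma>(i := 0)" and I = I]) (use assms ij in auto)
  then have "det x (For i j c) Q (\<sigma>(i := 0)) p"
    by (rule det_conseq) (use assms(6) ij in auto)
  then show ?thesis using assms(2,3) ij by (auto simp: FOR_def)
qed

lemma uni_FOR:
  assumes "wfc (For i j c)" "\<sigma> j < \<sigma> rTCAP" "i \<noteq> rTCAP" "I 0 (\<sigma>(i := 0)) p"
    and "\<And>k \<sigma>' p'. k < \<sigma> j \<Longrightarrow> I k \<sigma>' p' \<Longrightarrow> \<sigma>' i = k \<Longrightarrow> \<sigma>' j = \<sigma> j \<Longrightarrow>
       uni x c (\<lambda>\<sigma>'' p''. I (Suc k) (\<sigma>''(i := Suc k)) p'') \<sigma>' p'"
    and "\<And>\<sigma>' p'. I (\<sigma> j) \<sigma>' p' \<Longrightarrow> Q \<sigma>' p'"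
  shows "uni x (FOR i j c) Q \<sigma> p"
proof -
  have ij: "i \<noteq> j" using assms(1) by simp
  have "uni x (For i j c) (I ((\<sigma>(i := 0)) j)) (\<sigma>(i := 0)) p"
    by (rule uni_For[where \<sigma> = "\<sigma>(i := 0)" and I = I]) (use assms ij in auto)
  then have "uni x (For i j c) Q (\<sigma>(i := 0)) p"
    by (rule uni_conseq) (use assms(6) ij in auto)
  then have "uni x (IfLt j rTCAP (For i j c) Fail) Q (\<sigma>(i := 0)) p"
    using assms(2,3) ij by (simp add: uni_def runs_def)
  then have "uni x (Zero i) (uni x (IfLt j rTCAP (For i j c) Fail) Q) \<sigma> p"
    by (intro uni_det) simp
  then show ?thesis unfolding FOR_def by (rule uni_Seq)
qed

lemma runs_FOR:
  assumes "wfc (For i j c)" "\<sigma> j < \<sigma> rTCAP" "i \<noteq> rTCAP" "I [] (\<sigma>(i := 0)) p"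
    and "\<And>as a. V (as @ [a]) \<Longrightarrow> V as" "V []"
    and "\<And>as \<sigma>' p'. length as < \<sigma> j \<Longrightarrow> V as \<Longrightarrow> I as \<sigma>' p' \<Longrightarrow> \<sigma>' i = length as \<Longrightarrow> \<sigma>' j = \<sigma> j \<Longrightarrow>
       runs x c {a. V (as @ [a])} e (\<lambda>a \<sigma>'' p''. I (as @ [a]) (\<sigma>''(i := Suc (length as))) p'') \<sigma>' p'"
  shows "runs x (FOR i j c) {as. length as = \<sigma> j \<and> V as} (\<lambda>as. concat (map e as)) I \<sigma> p"
proof -
  have ij: "i \<noteq> j" using assms(1) by simp
  have "runs x (For i j c) {as. length as = (\<sigma>(i := 0)) j \<and> V as} (\<lambda>as. concat (map e as)) I (\<sigma>(i := 0)) p"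
    by (rule runs_For[where \<sigma> = "\<sigma>(i := 0)" and I = I]) (use assms ij in auto)
  then have "runs x (IfLt j rTCAP (For i j c) Fail) {as. length as = \<sigma> j \<and> V as} (\<lambda>as. concat (map e as)) I (\<sigma>(i := 0)) p"
    using assms(2,3) ij by (simp add: runs_def)
  then show ?thesis unfolding FOR_def by (intro det_runs) simp
qed

primrec setN :: "nat \<Rightarrow> nat \<Rightarrow> 'a com" where
  "setN r 0 = Zero r"
| "setN r (Suc k) = Seq (setN r k) (CInc r)"

lemma det_setN:
  "r \<noteq> rCAP \<Longrightarrow> k < \<sigma> rCAP \<Longrightarrow> Q (\<sigma>(r := k)) p \<Longrightarrow> det x (setN r k) Q \<sigma> p"
  by (induction k arbitrary: Q) simp_all

lemma writes_setN [simp]: "writes (setN r k) = {r}"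
  by (induction k) auto

lemma capped_setN: "1 < r \<Longrightarrow> capped (setN r k)"
  by (induction k) (auto intro!: capped.intros)

text \<open>Repeated addition, so the number of rounds is the value of \<open>t\<close>. Only the
  factor in \<open>s\<close> may be superpolynomial.\<close>

definition MUL :: "nat \<Rightarrow> nat \<Rightarrow> nat \<Rightarrow> nat \<Rightarrow> 'a com" where
  "MUL r s t k = Seq (Zero r) (FOR k t (CAdd r s))"

lemma writes_MUL [simp]: "writes (MUL r s t k) = {r, k}"
  by (auto simp: MUL_def)

lemma wfc_MUL [simp]: "wfc (MUL r s t k) \<longleftrightarrow> k \<noteq> t \<and> k \<noteq> r \<and> t \<noteq> r"
  by (auto simp: MUL_def)

lemma capped_MUL: "1 < r \<Longrightarrow> 1 < k \<Longrightarrow> r \<noteq> k \<Longrightarrow> r \<noteq> t \<Longrightarrow> k \<noteq> t \<Longrightarrow> capped (MUL r s t k)"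
  by (auto simp: MUL_def intro!: capped.intros)

lemma det_MUL:
  assumes "1 < r" "1 < k" "r \<noteq> k" "r \<notin> {s, t}" "k \<notin> {s, t}" "\<sigma> t < \<sigma> rTCAP" "\<sigma> s * \<sigma> t < \<sigma> rCAP"
    and Q: "Q (\<sigma>(r := \<sigma> s * \<sigma> t, k := \<sigma> t)) p"
  shows "det x (MUL r s t k) Q \<sigma> p"
  unfolding MUL_def det_Seq det_Zero
proof (rule det_FOR[where I = "\<lambda>i \<sigma>' p'. \<sigma>' = \<sigma>(r := \<sigma> s * i, k := i) \<and> p' = p"])
  fix i \<sigma>' p'
  assume *: "i < (\<sigma>(r := 0)) t" "\<sigma>' = \<sigma>(r := \<sigma> s * i, k := i) \<and> p' = p"
  then have "\<sigma> s * Suc i \<le> \<sigma> s * \<sigma> t" using assms by (intro mult_le_mono2) simp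
  then have "\<sigma> s * i + \<sigma> s < \<sigma> rCAP" using assms by simp
  then show "det x (CAdd r s) (\<lambda>\<sigma>'' p''. \<sigma>''(k := Suc i) = \<sigma>(r := \<sigma> s * Suc i, k := Suc i) \<and> p'' = p) \<sigma>' p'"
    using * assms by (auto intro!: ext)
qed (use assms in auto)

text \<open>Counts up to the value of \<open>s\<close>; the remainder wraps round at the value of
  \<open>t\<close>, and each wrap increments the quotient. Only small dividends are
  affordable.\<close>

definition DIVM :: "nat \<Rightarrow> nat \<Rightarrow> nat \<Rightarrow> nat \<Rightarrow> nat \<Rightarrow> 'a com" where
  "DIVM q m s t k = Seq (Zero q) (Seq (Zero m)
     (FOR k s (Seq (CInc m) (IfEq m t (Seq (Zero m) (CInc q)) Skip))))"

lemma writes_DIVM [simp]: "writes (DIVM q m s t k) = {q, m, k}"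
  by (auto simp: DIVM_def)

lemma wfc_DIVM [simp]: "wfc (DIVM q m s t k) \<longleftrightarrow> k \<notin> {q, m, s} \<and> s \<notin> {q, m}"
  by (auto simp: DIVM_def)

lemma capped_DIVM: "1 < q \<Longrightarrow> 1 < m \<Longrightarrow> 1 < k \<Longrightarrow> k \<notin> {q, m, s} \<Longrightarrow> s \<notin> {q, m} \<Longrightarrow> capped (DIVM q m s t k)"
  by (auto simp: DIVM_def intro!: capped.intros)

lemma det_DIVM:
  assumes "1 < q" "1 < m" "1 < k" "q \<noteq> m" "k \<notin> {q, m, s, t}" "s \<notin> {q, m}" "t \<notin> {q, m}"
    and "\<sigma> s < \<sigma> rTCAP" "\<sigma> t < \<sigma> rCAP" "\<sigma> s < \<sigma> rCAP" "0 < \<sigma> t"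
    and Q: "Q (\<sigma>(q := \<sigma> s div \<sigma> t, m := \<sigma> s mod \<sigma> t, k := \<sigma> s)) p"
  shows "det x (DIVM q m s t k) Q \<sigma> p"
  unfolding DIVM_def det_Seq det_Zero
proof (rule det_FOR[where I = "\<lambda>i \<sigma>' p'. \<sigma>' = \<sigma>(q := i div \<sigma> t, m := i mod \<sigma> t, k := i) \<and> p' = p"])
  fix i \<sigma>' p'
  assume *: "i < (\<sigma>(q := 0, m := 0)) s"
    "\<sigma>' = \<sigma>(q := i div \<sigma> t, m := i mod \<sigma> t, k := i) \<and> p' = p"
  have i: "i < \<sigma> s" using * assms by simp
  have m: "i mod \<sigma> t < \<sigma> t" using assms by simp
  have s: "Suc i div \<sigma> t = (if Suc (i mod \<sigma> t) = \<sigma> t then Suc (i div \<sigma> t) else i div \<sigma> t)"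
    "Suc i mod \<sigma> t = (if Suc (i mod \<sigma> t) = \<sigma> t then 0 else Suc (i mod \<sigma> t))"
    by (auto simp: div_Suc mod_Suc)
  have d: "Suc (i div \<sigma> t) < \<sigma> rCAP" if "Suc (i mod \<sigma> t) = \<sigma> t"
  proof -
    have "Suc i div \<sigma> t = Suc (i div \<sigma> t)" using s(1) that by simp
    then show ?thesis using div_le_dividend[of "Suc i" "\<sigma> t"] i assms(10) by linarith
  qed
  show "det x (Seq (CInc m) (IfEq m t (Seq (Zero m) (CInc q)) Skip))
      (\<lambda>\<sigma>'' p''. \<sigma>''(k := Suc i) = \<sigma>(q := Suc i div \<sigma> t, m := Suc i mod \<sigma> t, k := Suc i) \<and> p'' = p) \<sigma>' p'"
    using assms i m d * by (auto simp: s intro!: ext)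
qed (use assms in auto)

text \<open>The last round copies the counter before its final increment, which is the predecessor;
  with no round the result is 0.\<close>

definition PRED :: "nat \<Rightarrow> nat \<Rightarrow> nat \<Rightarrow> 'a com" where
  "PRED r s k = Seq (Zero r) (FOR k s (Cp r k))"

lemma writes_PRED [simp]: "writes (PRED r s k) = {r, k}"
  by (auto simp: PRED_def)

lemma capped_PRED: "1 < r \<Longrightarrow> 1 < k \<Longrightarrow> r \<notin> {s, k} \<Longrightarrow> k \<noteq> s \<Longrightarrow> capped (PRED r s k)"
  by (auto simp: PRED_def intro!: capped.intros)

lemma det_PRED:
  assumes "1 < r" "1 < k" "r \<noteq> k" "r \<noteq> s" "k \<noteq> s" "\<sigma> s < \<sigma> rTCAP"
    and Q: "Q (\<sigma>(r := \<sigma> s - 1, k := \<sigma> s)) p"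
  shows "det x (PRED r s k) Q \<sigma> p"
  unfolding PRED_def det_Seq det_Zero
proof (rule det_FOR[where I = "\<lambda>i \<sigma>' p'. \<sigma>' = \<sigma>(r := i - 1, k := i) \<and> p' = p"])
  fix i \<sigma>' p'
  assume "\<sigma>' = \<sigma>(r := i - 1, k := i) \<and> p' = p"
  then show "det x (Cp r k) (\<lambda>\<sigma>'' p''. \<sigma>''(k := Suc i) = \<sigma>(r := Suc i - 1, k := Suc i) \<and> p'' = p) \<sigma>' p'"
    using assms by (auto intro!: ext)
qed (use assms in auto)

section \<open>Isolating weights\<close>

fun nu :: "nat \<Rightarrow> nat" where
  "nu j = (if 0 < j \<and> even j then Suc (nu (j div 2)) else 0)"

declare nu.simps [simp del]

lemma nu_double: "0 < j \<Longrightarrow> nu (2 * j) = Suc (nu j)"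
  by (subst nu.simps) simp

lemma nu_power_mult: "0 < t \<Longrightarrow> nu (2 ^ k * t) = k + nu t"
  by (induction k) (auto simp: nu_double mult.assoc)

lemma nu_decomp: "0 < j \<Longrightarrow> \<exists>s. odd s \<and> j = 2 ^ nu j * s"
proof (induction j rule: nu.induct)
  case (1 j)
  show ?case
  proof (cases "even j")
    case True
    have "0 < j div 2" using True 1(2) by (metis div_greater_zero_iff dvd_imp_le zero_less_numeral)
    then obtain s where s: "odd s" "j div 2 = 2 ^ nu (j div 2) * s" using 1 True by blast
    have "nu j = Suc (nu (j div 2))" using True 1 by (subst nu.simps) simp
    moreover have "j = 2 * (j div 2)" using True by simp
    ultimately show ?thesis using s by (metis mult.assoc power_Suc)
  next
    case False
    then have "nu j = 0" by (subst nu.simps) simp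
    then show ?thesis using False by simp
  qed
qed

lemma nu_le: "0 < j \<Longrightarrow> 2 ^ nu j \<le> j"
  using nu_decomp[of j] by (metis dvd_triv_left dvd_imp_le)

definition pw :: "nat \<Rightarrow> nat \<Rightarrow> nat" where
  "pw B j = B ^ nu j"

text \<open>Between two numbers of equal 2-adic valuation lies one of larger valuation, so an interval has
  a unique element of maximal valuation.\<close>
lemma nu_max_unique:
  assumes "Suc a < b"
  obtains m where "m \<in> {a<..<b}" "\<And>i. i \<in> {a<..<b} \<Longrightarrow> i \<noteq> m \<Longrightarrow> nu i < nu m"
proof -
  have ne: "{a<..<b} \<noteq> {}" using assms by auto
  have "Max (nu ` {a<..<b}) \<in> nu ` {a<..<b}" using ne by (intro Max_in) auto
  then obtain m where m: "m \<in> {a<..<b}" "nu m = Max (nu ` {a<..<b})" by auto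
  have le: "nu i \<le> nu m" if "i \<in> {a<..<b}" for i using that m by simp
  have no: False if *: "i \<in> {a<..<b}" "i' \<in> {a<..<b}" "i < i'" "nu i = nu m" "nu i' = nu m" for i i'
  proof -
    obtain s s' where s: "odd s" "i = 2 ^ nu m * s" "odd s'" "i' = 2 ^ nu m * s'"
      using nu_decomp[of i] nu_decomp[of i'] * by auto
    have "s < s'" using s(2,4) *(3) by simp
    then have "Suc s < s'" using s(1,3) by (metis Suc_lessI even_Suc)
    let ?t = "2 ^ nu m * Suc s"
    have "?t < 2 ^ nu m * s'" using \<open>Suc s < s'\<close> by (intro mult_strict_left_mono) auto
    then have "i < ?t" "?t < i'" using s(2,4) by auto
    moreover have "nu ?t = nu m + nu (Suc s)" by (rule nu_power_mult) simp
    moreover have "0 < nu (Suc s)" using s(1) by (subst nu.simps) simp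
    ultimately show False using le[of ?t] * by auto
  qed
  have "nu i < nu m" if "i \<in> {a<..<b}" "i \<noteq> m" for i
    using le[OF that(1)] no[of i m] no[of m i] that m(1) by (metis linorder_neqE_nat order_le_less)
  then show ?thesis using that m(1) by blast
qed

text \<open>At \<open>m\<close>, the position of maximal valuation, one unit of \<open>f\<close> or
  \<open>g\<close> outweighs everything \<open>f\<close> has elsewhere: the other positions number
  fewer than \<open>D\<close>, each has a value below \<open>V\<close>, and each counts at most
  \<open>1 / B\<close> as much as \<open>m\<close>. So the value at \<open>m\<close> decides the
  comparison.\<close>

lemma isolating:
  fixes V B D :: nat
  assumes "Suc a < b" "b \<le> Suc D" "D * V \<le> B" "0 < V"
  shows "\<exists>m \<in> {a<..<b}. \<forall>f g. (\<forall>i \<in> {a<..<b}. f i < V) \<longrightarrow> f m < g m \<longrightarrow>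
     (\<Sum>i \<in> {a<..<b}. f i * pw B i) < (\<Sum>i \<in> {a<..<b}. g i * pw B i)"
proof -
  obtain m where m: "m \<in> {a<..<b}" "\<And>i. i \<in> {a<..<b} \<Longrightarrow> i \<noteq> m \<Longrightarrow> nu i < nu m"
    using nu_max_unique[OF assms(1)] by blast
  have "D > 0" using assms(1,2) by simp
  then have "D * V > 0" using assms(4) by simp
  then have B: "0 < B" using assms(3) by linarith
  show ?thesis
  proof (intro bexI[OF _ m(1)] allI impI)
    fix f g :: "nat \<Rightarrow> nat"
    assume f: "\<forall>i \<in> {a<..<b}. f i < V" and lt: "f m < g m"
    let ?S = "{a<..<b} - {m}"
    \<comment> \<open>The comparison is multiplied by \<open>B\<close>, because a smaller valuation
      gives \<open>B * pw B i\<close> at most \<open>pw B m\<close> without any division.\<close>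
    have "B * (\<Sum>i \<in> ?S. f i * pw B i) = (\<Sum>i \<in> ?S. f i * (B * pw B i))"
      by (simp add: sum_distrib_left algebra_simps)
    also have "\<dots> \<le> (\<Sum>i \<in> ?S. (V - 1) * pw B m)"
    proof (rule sum_mono)
      fix i assume i: "i \<in> ?S"
      have "B * pw B i = B ^ Suc (nu i)" by (simp add: pw_def)
      also have "\<dots> \<le> B ^ nu m" using m(2)[of i] i B by (intro power_increasing) auto
      finally have "B * pw B i \<le> pw B m" by (simp add: pw_def)
      moreover have "f i \<le> V - 1" using f i by fastforce
      ultimately show "f i * (B * pw B i) \<le> (V - 1) * pw B m" by (intro mult_le_mono)
    qed
    also have "\<dots> = card ?S * (V - 1) * pw B m" by simp
    also have "\<dots> < B * pw B m"
    proof -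
      have "card ?S < D" using assms(1,2) m(1) by auto
      then have "card ?S * V < D * V" using assms(4) by simp
      then have "card ?S * (V - 1) < D * V" by (meson diff_le_self le_less_trans mult_le_mono2)
      then show ?thesis using assms(3) B by (simp add: pw_def)
    qed
    finally have less: "(\<Sum>i \<in> ?S. f i * pw B i) < pw B m" by simp
    have "(\<Sum>i \<in> {a<..<b}. f i * pw B i) = f m * pw B m + (\<Sum>i \<in> ?S. f i * pw B i)"
      using m(1) by (simp add: sum.remove)
    also have "\<dots> < Suc (f m) * pw B m" using less by simp
    also have "\<dots> \<le> g m * pw B m" using lt by (intro mult_le_mono1) simp
    also have "\<dots> \<le> (\<Sum>i \<in> {a<..<b}. g i * pw B i)"
      using m(1) by (intro member_le_sum) auto
    finally show "(\<Sum>i \<in> {a<..<b}. f i * pw B i) < (\<Sum>i \<in> {a<..<b}. g i * pw B i)" .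
  qed
qed

section \<open>Inductive counting of lightest walks\<close>

primrec go_from :: "(nat \<Rightarrow> 'v \<Rightarrow> 'v option) \<Rightarrow> 'v \<Rightarrow> nat list \<Rightarrow> 'v option" where
  "go_from nx v [] = Some v"
| "go_from nx v (j # js) = Option.bind (nx j v) (\<lambda>w. go_from nx w js)"

lemma go_from_append: "go_from nx v (js @ ks) = Option.bind (go_from nx v js) (\<lambda>w. go_from nx w ks)"
  by (induction js arbitrary: v) (auto simp: bind_eq_Some_conv)

text \<open>Walks are lists of transition indices, whereas weights see only codes of vertices; the
  injectivity assumptions let a walk be recovered from the codes along it. They concern reachable
  vertices only, because the space bound limits only the tape numbers of reachable
  configurations.\<close>

locale layered =
  fixes nx :: "nat \<Rightarrow> 'v \<Rightarrow> 'v option" and v0 :: 'v and code :: "'v \<Rightarrow> nat" and V D B :: nat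
  assumes code_less: "go_from nx v0 js = Some v \<Longrightarrow> code v < V"
    and code_inj: "go_from nx v0 js = Some v \<Longrightarrow> go_from nx v0 ks = Some w \<Longrightarrow> code v = code w \<Longrightarrow> v = w"
    and nx_inj: "go_from nx v0 js = Some v \<Longrightarrow> nx i v = Some w \<Longrightarrow> nx j v = Some w \<Longrightarrow> i = j"
    and DV: "D * V \<le> B"
begin

abbreviation walk :: "nat list \<Rightarrow> 'v option" where "walk \<equiv> go_from nx v0"

definition loc :: "nat list \<Rightarrow> nat \<Rightarrow> nat" where
  "loc js i = code (the (walk (take i js)))"

text \<open>Position 0 carries no weight, as every walk starts at \<open>v0\<close>.\<close>

definition wt :: "nat list \<Rightarrow> nat" where
  "wt js = (\<Sum>i \<in> {0<..length js}. loc js i * pw B i)"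

definition paths :: "nat \<Rightarrow> nat \<Rightarrow> nat list set" where
  "paths d u = {js. length js = d \<and> (\<exists>v. walk js = Some v \<and> code v = u)}"

definition layer :: "nat \<Rightarrow> nat set" where
  "layer d = {u. paths d u \<noteq> {}}"

definition mu :: "nat \<Rightarrow> nat \<Rightarrow> nat" where
  "mu d u = (LEAST w. \<exists>js \<in> paths d u. wt js = w)"

lemma V_pos: "0 < V"
  using code_less[of "[]"] by fastforce

lemma loc_append: "i \<le> length js \<Longrightarrow> loc (js @ ks) i = loc js i"
  by (simp add: loc_def)

lemma wt_Nil [simp]: "wt [] = 0"
  by (simp add: wt_def)

lemma wt_snoc: "wt (js @ [j]) = wt js + loc (js @ [j]) (Suc (length js)) * pw B (Suc (length js))"
proof -
  have "{0<..Suc (length js)} = insert (Suc (length js)) {0<..length js}" by auto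
  moreover have "(\<Sum>i \<in> {0<..length js}. loc (js @ [j]) i * pw B i) = wt js"
    unfolding wt_def by (rule sum.cong) (auto simp: loc_append)
  ultimately show ?thesis by (simp add: wt_def)
qed

lemma walk_take: "walk js = Some v \<Longrightarrow> \<exists>w. walk (take i js) = Some w"
  using go_from_append[of nx v0 "take i js" "drop i js"] by (cases "walk (take i js)") auto

lemma loc_less: "walk js = Some v \<Longrightarrow> loc js i < V"
  using walk_take[of js v i] code_less by (auto simp: loc_def)

lemma loc_length: "js \<in> paths d u \<Longrightarrow> loc js d = u"
  by (auto simp: paths_def loc_def)

lemma mu_le: "js \<in> paths d u \<Longrightarrow> mu d u \<le> wt js"
  unfolding mu_def by (rule Least_le) blast

lemma mu_attained: "u \<in> layer d \<Longrightarrow> \<exists>js \<in> paths d u. wt js = mu d u"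
  unfolding mu_def layer_def by (rule LeastI_ex) blast

lemma layer_bounded: "layer d \<subseteq> {..<V}"
  using code_less by (auto simp: layer_def paths_def)

lemma finite_layer: "finite (layer d)"
  using layer_bounded finite_subset by blast

lemma layer_0: "layer 0 = {code v0}"
  by (auto simp: layer_def paths_def)

text \<open>Equal codes mean equal vertices, so two walks that meet at \<open>a\<close> and at
  \<open>b\<close> may exchange what lies between. Positions are kept, and with them the factors
  \<open>pw B i\<close>.\<close>

lemma walk_splice:
  assumes "walk js = Some v" "walk ks = Some w" "length js = length ks"
    "loc js a = loc ks a" "loc js b = loc ks b" "a \<le> b" "b \<le> length js"
  defines "ls \<equiv> take a js @ drop a (take b ks) @ drop b js"
  shows "walk ls = Some v" "length ls = length js"
    "\<And>i. i \<le> length js \<Longrightarrow> loc ls i = (if a < i \<and> i < b then loc ks i else loc js i)"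
proof -
  obtain p p' where p: "walk (take a js) = Some p" "walk (take a ks) = Some p'"
    using walk_take assms(1,2) by metis
  obtain q q' where q: "walk (take b js) = Some q" "walk (take b ks) = Some q'"
    using walk_take assms(1,2) by metis
  have pp: "p' = p" using code_inj[OF p] assms(4) p by (simp add: loc_def)
  have qq: "q' = q" using code_inj[OF q] assms(5) q by (simp add: loc_def)
  have ks_ab: "go_from nx p (drop a (take i ks)) = walk (take i ks)" if "a \<le> i" for i
  proof -
    have "take i ks = take a ks @ drop a (take i ks)"
      using that by (metis append_take_drop_id min.absorb1 take_take)
    then have "walk (take i ks) = Option.bind (walk (take a ks)) (\<lambda>w. go_from nx w (drop a (take i ks)))"
      using go_from_append by metis
    then show ?thesis using p pp by simp
  qed
  have js_b: "go_from nx q (drop b (take i js)) = walk (take i js)" if "b \<le> i" for i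
  proof -
    have "take i js = take b js @ drop b (take i js)"
      using that by (metis append_take_drop_id min.absorb1 take_take)
    then have "walk (take i js) = Option.bind (walk (take b js)) (\<lambda>w. go_from nx w (drop b (take i js)))"
      using go_from_append by metis
    then show ?thesis using q by simp
  qed
  show "length ls = length js" using assms by simp
  have len: "length (take a js) = a" "length (drop a (take b ks)) = b - a" using assms by auto
  have tk: "take i ls = (if i \<le> a then take i js else if i \<le> b then take a js @ drop a (take i ks)
      else take a js @ drop a (take b ks) @ drop b (take i js))" if "i \<le> length js" for i
    using assms that unfolding ls_def by (auto simp: min_def take_drop)
  have walk_i: "walk (take i ls) = (if i \<le> a then walk (take i js) else if i \<le> b then walk (take i ks)
      else walk (take i js))" if "i \<le> length js" for i
    using ks_ab js_b p q pp qq assms(6) that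
    by (simp add: tk go_from_append)
  show "walk ls = Some v"
    using walk_i[of "length js"] assms q qq \<open>length ls = length js\<close>
    by (auto split: if_splits)
  show "loc ls i = (if a < i \<and> i < b then loc ks i else loc js i)" if "i \<le> length js" for i
    using walk_i[OF that] assms(4,5) by (auto simp: loc_def)
qed

text \<open>Otherwise splicing the segment of \<open>ks\<close> into \<open>js\<close> would give a
  walk to \<open>u\<close> lighter than the lightest.\<close>

lemma wt_splice_le:
  assumes "js \<in> paths d u" "ks \<in> paths d u" "wt js = mu d u"
    "loc js a = loc ks a" "loc js b = loc ks b" "a \<le> b" "b \<le> d"
  shows "(\<Sum>i \<in> {a<..<b}. loc js i * pw B i) \<le> (\<Sum>i \<in> {a<..<b}. loc ks i * pw B i)"
proof -
  obtain v w where vw: "walk js = Some v" "walk ks = Some w" "length js = d" "length ks = d" "code v = u"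
    using assms(1,2) by (auto simp: paths_def)
  define ls where "ls = take a js @ drop a (take b ks) @ drop b js"
  have ls: "walk ls = Some v" "length ls = d" "\<And>i. i \<le> d \<Longrightarrow> loc ls i = (if a < i \<and> i < b then loc ks i else loc js i)"
    using walk_splice[of js v ks w a b] vw assms unfolding ls_def by auto
  have "wt js \<le> wt ls" using mu_le[of ls d u] ls vw assms(3) by (auto simp: paths_def)
  moreover have split: "(\<Sum>i \<in> {0<..d}. F i) = (\<Sum>i \<in> {a<..<b}. F i) + (\<Sum>i \<in> {0<..d} - {a<..<b}. F i)" for F :: "nat \<Rightarrow> nat"
  proof -
    have "{a<..<b} \<subseteq> {0<..d}" using assms(7) by auto
    then show ?thesis by (metis add.commute finite_greaterThanAtMost sum.subset_diff)
  qed
  moreover have "(\<Sum>i \<in> {0<..d} - {a<..<b}. loc ls i * pw B i) = (\<Sum>i \<in> {0<..d} - {a<..<b}. loc js i * pw B i)"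
    using ls(3) by (intro sum.cong) auto
  moreover have "(\<Sum>i \<in> {a<..<b}. loc ls i * pw B i) = (\<Sum>i \<in> {a<..<b}. loc ks i * pw B i)"
    using ls(3) assms(7) by (intro sum.cong) auto
  ultimately show ?thesis
    using split[of "\<lambda>i. loc ls i * pw B i"] split[of "\<lambda>i. loc js i * pw B i"] vw ls(2)
    by (simp add: wt_def)
qed

text \<open>The codes fix the vertices, and by \<open>nx_inj\<close> only one transition leads from
  one vertex to the next.\<close>

lemma loc_determines:
  assumes "js \<in> paths d u" "ks \<in> paths d u" "\<And>i. i \<le> d \<Longrightarrow> loc js i = loc ks i"
  shows "js = ks"
proof (rule nth_equalityI)
  obtain v w where vw: "walk js = Some v" "walk ks = Some w" "length js = d" "length ks = d"
    using assms(1,2) by (auto simp: paths_def)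
  show "length js = length ks" using vw by simp
  fix i assume i: "i < length js"
  have eq: "walk (take k js) = walk (take k ks)" if "k \<le> d" for k
  proof -
    obtain p p' where p: "walk (take k js) = Some p" "walk (take k ks) = Some p'"
      using walk_take vw(1,2) by metis
    then show ?thesis using code_inj[OF p] assms(3)[OF that] by (simp add: loc_def)
  qed
  obtain p where p: "walk (take i js) = Some p" using walk_take vw by metis
  obtain q where q: "walk (take (Suc i) js) = Some q" using walk_take vw by metis
  have "nx (js ! i) p = Some q" "nx (ks ! i) p = Some q"
    using p q eq[of i] eq[of "Suc i"] i vw
    by (auto simp: take_Suc_conv_app_nth go_from_append bind_eq_Some_conv)
  then show "js ! i = ks ! i" using nx_inj[OF p] by blast
qed

text \<open>Around a position of disagreement take the largest interval without agreement; the walks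
  meet at both of its ends, since they share start and end. Exchanging segments in both directions
  shows that the two segments weigh the same. By \<open>isolating\<close> they then agree at some
  position inside the interval, which is absurd.\<close>

lemma lightest_unique:
  assumes "d \<le> D" "js \<in> paths d u" "ks \<in> paths d u" "wt js = mu d u" "wt ks = mu d u"
  shows "js = ks"
proof (rule loc_determines[OF assms(2,3)], rule ccontr)
  fix i assume i: "i \<le> d" "loc js i \<noteq> loc ks i"
  define a where "a = Max {k. k < i \<and> loc js k = loc ks k}"
  define b where "b = (LEAST k. i < k \<and> loc js k = loc ks k)"
  have fin: "finite {k. k < i \<and> loc js k = loc ks k}" by simp
  have i0: "i \<noteq> 0" using i by (metis loc_def take_0)
  have "0 \<in> {k. k < i \<and> loc js k = loc ks k}" using i0 by (simp add: loc_def)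
  then have "a \<in> {k. k < i \<and> loc js k = loc ks k}" unfolding a_def using Max_in[OF fin] by blast
  then have a: "a < i" "loc js a = loc ks a" by auto
  have d: "i < d \<and> loc js d = loc ks d" using i loc_length[OF assms(2)] loc_length[OF assms(3)]
    by (metis le_neq_implies_less)
  have b: "i < b \<and> loc js b = loc ks b" "b \<le> d"
    unfolding b_def using d by (rule LeastI, rule Least_le)
  have diff: "loc js k \<noteq> loc ks k" if "k \<in> {a<..<b}" for k
  proof (cases "k < i")
    case True
    then show ?thesis using that Max_ge[OF fin, of k] unfolding a_def[symmetric] by auto
  next
    case False
    then show ?thesis using that i(2) not_less_Least[of k "\<lambda>k. i < k \<and> loc js k = loc ks k"]
      unfolding b_def[symmetric] by (cases "k = i") auto
  qed
  have eq: "(\<Sum>i \<in> {a<..<b}. loc js i * pw B i) = (\<Sum>i \<in> {a<..<b}. loc ks i * pw B i)"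
    using wt_splice_le[OF assms(2,3,4), of a b] wt_splice_le[OF assms(3,2,5), of a b] a b by simp
  have "Suc a < b" "b \<le> Suc D" using a b assms(1) by auto
  then obtain m where m: "m \<in> {a<..<b}" and iso: "\<And>f g. (\<forall>i \<in> {a<..<b}. f i < V) \<Longrightarrow> f m < g m \<Longrightarrow>
     (\<Sum>i \<in> {a<..<b}. f i * pw B i) < (\<Sum>i \<in> {a<..<b}. g i * pw B i)"
    using isolating[OF _ _ DV V_pos] by metis
  have "\<forall>i. loc js i < V" "\<forall>i. loc ks i < V"
    using loc_less assms(2,3) by (auto simp: paths_def)
  then have "\<not> loc js m < loc ks m" "\<not> loc ks m < loc js m"
    using iso[of "loc js" "loc ks"] iso[of "loc ks" "loc js"] eq by auto
  then show False using diff[OF m] by simp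
qed

text \<open>The least weights of the predecessors of \<open>u'\<close> in layer \<open>d\<close>. A
  pass can collect exactly these, as it visits the lightest walks.\<close>

definition cands :: "nat \<Rightarrow> nat \<Rightarrow> nat set" where
  "cands d u' = {mu d u | u. \<exists>js \<in> paths d u. \<exists>j v w. walk js = Some v \<and> nx j v = Some w \<and> code w = u'}"

lemma finite_cands: "finite (cands d u')"
  by (rule finite_subset[OF _ finite_imageI[OF finite_layer]]) (auto simp: cands_def layer_def)

lemma paths_Suc:
  "ks \<in> paths (Suc d) u' \<longleftrightarrow> (\<exists>js j u v w. ks = js @ [j] \<and> js \<in> paths d u \<and> walk js = Some v \<and> nx j v = Some w \<and> code w = u')"
proof
  assume ks: "ks \<in> paths (Suc d) u'"
  then obtain js j where "ks = js @ [j]" by (cases ks rule: rev_cases) (auto simp: paths_def)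
  then show "\<exists>js j u v w. ks = js @ [j] \<and> js \<in> paths d u \<and> walk js = Some v \<and> nx j v = Some w \<and> code w = u'"
    using ks by (auto simp: paths_def go_from_append bind_eq_Some_conv)
qed (auto simp: paths_def go_from_append)

lemma layer_Suc: "layer (Suc d) = {u'. cands d u' \<noteq> {}}"
proof -
  have "u' \<in> layer (Suc d) \<longleftrightarrow> cands d u' \<noteq> {}" for u'
    unfolding layer_def cands_def using paths_Suc[of _ d u'] by fastforce
  then show ?thesis by blast
qed

text \<open>The weight added by the last step depends on the new end and its position but not on the
  predecessor, so minimising over walks reduces to minimising over predecessors.\<close>

lemma mu_Suc:
  assumes "u' \<in> layer (Suc d)"
  shows "mu (Suc d) u' = Min (cands d u') + u' * pw B (Suc d)"
proof (rule antisym)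
  have ne: "cands d u' \<noteq> {}" using assms layer_Suc by simp
  have wt: "wt (js @ [j]) = wt js + u' * pw B (Suc d)" if "js @ [j] \<in> paths (Suc d) u'" for js j
    using that loc_length[OF that] by (simp add: wt_snoc paths_def)
  have "Min (cands d u') \<in> cands d u'" using ne finite_cands by simp
  then obtain u ks j v w where u: "Min (cands d u') = mu d u" "ks \<in> paths d u" "walk ks = Some v" "nx j v = Some w" "code w = u'"
    by (auto simp: cands_def)
  then obtain js where js: "js \<in> paths d u" "wt js = mu d u" using mu_attained[of u d] by (auto simp: layer_def)
  then obtain v' where v': "walk js = Some v'" "code v' = u" by (auto simp: paths_def)
  \<comment> \<open>The lightest walk to \<open>u\<close> and the given walk \<open>ks\<close> share
    the code of their end, hence the end itself, so transition \<open>j\<close> can extend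
    either.\<close>
  have "v' = v" using code_inj[OF v'(1) u(3)] v' u by (auto simp: paths_def)
  then have "js @ [j] \<in> paths (Suc d) u'" using js v' u paths_Suc by blast
  then show "mu (Suc d) u' \<le> Min (cands d u') + u' * pw B (Suc d)"
    using mu_le wt js u by metis
next
  obtain ks where ks: "ks \<in> paths (Suc d) u'" "wt ks = mu (Suc d) u'" using mu_attained[OF assms] by blast
  then obtain js j u v w where js: "ks = js @ [j]" "js \<in> paths d u" "walk js = Some v" "nx j v = Some w" "code w = u'"
    using paths_Suc by blast
  have "wt ks = wt js + u' * pw B (Suc d)"
    using ks(1) loc_length[OF ks(1)] js by (simp add: wt_snoc paths_def)
  moreover have "mu d u \<in> cands d u'" using js unfolding cands_def by blast
  then have "Min (cands d u') \<le> wt js" using Min_le[OF finite_cands] mu_le[OF js(2)] by (metis order_trans)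
  ultimately show "Min (cands d u') + u' * pw B (Suc d) \<le> mu (Suc d) u'" using ks(2) by simp
qed

text \<open>A guess assigns to every code \<open>u\<close> either nothing or a walk ending in \<open>u\<close>.\<close>
definition ok :: "nat \<Rightarrow> nat list option list \<Rightarrow> bool" where
  "ok d as \<longleftrightarrow> (\<forall>u < length as. \<forall>js. as ! u = Some js \<longrightarrow> js \<in> paths d u)"

definition found :: "nat list option list \<Rightarrow> nat set" where
  "found as = {u. u < length as \<and> as ! u \<noteq> None}"

definition total :: "nat list option list \<Rightarrow> nat" where
  "total as = (\<Sum>u \<in> found as. wt (the (as ! u)))"

text \<open>The one guess that survives a pass. For \<open>d\<close> at most \<open>D\<close> the
  walk picked by \<open>SOME\<close> is unique.\<close>

definition canon :: "nat \<Rightarrow> nat list option list" where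
  "canon d = map (\<lambda>u. if u \<in> layer d then Some (SOME js. js \<in> paths d u \<and> wt js = mu d u) else None) [0..<V]"

lemma found_snoc: "found (as @ [a]) = (if a = None then found as else insert (length as) (found as))"
  by (auto simp: found_def nth_append less_Suc_eq split: if_splits)

lemma finite_found: "finite (found as)"
  by (simp add: found_def)

lemma card_found_snoc: "card (found (as @ [a])) = card (found as) + of_bool (a \<noteq> None)"
proof -
  have "length as \<notin> found as" by (simp add: found_def)
  then show ?thesis by (simp add: found_snoc finite_found)
qed

lemma total_snoc: "total (as @ [a]) = total as + (case a of None \<Rightarrow> 0 | Some js \<Rightarrow> wt js)"
proof -
  have n: "length as \<notin> found as" by (simp add: found_def)
  have "(\<Sum>u \<in> found as. wt (the ((as @ [a]) ! u))) = total as"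
    unfolding total_def by (rule sum.cong) (auto simp: found_def nth_append)
  then show ?thesis using n
    by (cases a) (simp_all add: total_def found_snoc finite_found)
qed

lemma ok_snoc: "ok d (as @ [a]) \<longleftrightarrow> ok d as \<and> (\<forall>js. a = Some js \<longrightarrow> js \<in> paths d (length as))"
  by (auto simp: ok_def nth_append less_Suc_eq)

lemma ok_found: "ok d as \<Longrightarrow> u \<in> found as \<Longrightarrow> \<exists>js. as ! u = Some js \<and> js \<in> paths d u"
  by (auto simp: found_def ok_def)

lemma found_subset: "ok d as \<Longrightarrow> found as \<subseteq> layer d"
  using ok_found by (fastforce simp: layer_def)

lemma canon_nth:
  assumes "u < V"
  shows "canon d ! u = (if u \<in> layer d then Some (SOME js. js \<in> paths d u \<and> wt js = mu d u) else None)"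
  using assms by (simp add: canon_def)

lemma canon_some: "u \<in> layer d \<Longrightarrow> \<exists>js. canon d ! u = Some js \<and> js \<in> paths d u \<and> wt js = mu d u"
proof -
  assume u: "u \<in> layer d"
  then have "u < V" using layer_bounded by auto
  moreover have "\<exists>js. js \<in> paths d u \<and> wt js = mu d u" using mu_attained[OF u] by blast
  then have "(SOME js. js \<in> paths d u \<and> wt js = mu d u) \<in> paths d u \<and> wt (SOME js. js \<in> paths d u \<and> wt js = mu d u) = mu d u"
    by (rule someI_ex)
  ultimately show ?thesis using u canon_nth by simp
qed

lemma length_canon [simp]: "length (canon d) = V"
  by (simp add: canon_def)

lemma found_canon: "found (canon d) = layer d"
  using layer_bounded[of d] by (auto simp: found_def canon_nth split: if_splits)

lemma ok_canon: "ok d (canon d)"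
  unfolding ok_def using canon_nth canon_some by (metis length_canon option.distinct(1) option.inject)

lemma total_canon: "total (canon d) = (\<Sum>u \<in> layer d. mu d u)"
  unfolding total_def found_canon using canon_some by (intro sum.cong) (auto dest!: canon_some)

text \<open>Only members of the layer can be found, so the right count means that all are found.
  Each found walk weighs at least the minimum, so the right total means that each is lightest.
  Lightest walks are unique.\<close>

lemma canon_forced:
  assumes "d \<le> D" "ok d as" "length as = V" "card (found as) = card (layer d)" "total as = (\<Sum>u \<in> layer d. mu d u)"
  shows "as = canon d"
proof (rule nth_equalityI)
  show "length as = length (canon d)" using assms(3) by simp
  have fl: "found as = layer d"
    using found_subset[OF assms(2)] assms(4) finite_layer by (metis card_subset_eq)
  have ge: "mu d u \<le> wt (the (as ! u))" if "u \<in> layer d" for u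
  proof -
    have "the (as ! u) \<in> paths d u" using ok_found[OF assms(2), of u] that fl by auto
    then show ?thesis by (rule mu_le)
  qed
  have eq: "wt (the (as ! u)) = mu d u" if "u \<in> layer d" for u
  proof (rule ccontr)
    assume "wt (the (as ! u)) \<noteq> mu d u"
    then have "mu d u < wt (the (as ! u))" using ge[OF that] by simp
    then have "(\<Sum>u \<in> layer d. mu d u) < (\<Sum>u \<in> layer d. wt (the (as ! u)))"
      using that ge finite_layer by (intro sum_strict_mono_ex1) auto
    then show False using assms(5) fl by (simp add: total_def)
  qed
  fix u assume "u < length as"
  then have u: "u < V" using assms(3) by simp
  show "as ! u = canon d ! u"
  proof (cases "u \<in> layer d")
    case True
    then obtain js where js: "as ! u = Some js" "js \<in> paths d u" using ok_found[OF assms(2), of u] fl by auto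
    obtain ks where ks: "canon d ! u = Some ks" "ks \<in> paths d u" "wt ks = mu d u" using canon_some[OF True] by blast
    have "js = ks" using lightest_unique[OF assms(1) js(2) ks(2) _ ks(3)] eq[OF True] js by simp
    then show ?thesis using js ks by simp
  next
    case False
    then show ?thesis using fl u assms(3) canon_nth by (auto simp: found_def)
  qed
qed

text \<open>A shortest walk repeats no vertex, since the part between two visits could be cut out;
  there are at most \<open>V\<close> codes.\<close>

lemma short_walk:
  assumes "walk js = Some v"
  shows "\<exists>ks. walk ks = Some v \<and> length ks < V"
proof -
  define n where "n = (LEAST n. \<exists>ks. walk ks = Some v \<and> length ks = n)"
  have "\<exists>n ks. walk ks = Some v \<and> length ks = n" using assms by blast
  then have "\<exists>ks. walk ks = Some v \<and> length ks = n" unfolding n_def by (rule LeastI_ex)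
  then obtain ks where ks: "walk ks = Some v" "length ks = n" by blast
  have min: "n \<le> length ls" if "walk ls = Some v" for ls
    unfolding n_def by (rule Least_le) (use that in blast)
  have "loc ks i \<noteq> loc ks k" if "i < k" "k \<le> n" for i k
  proof
    assume eq: "loc ks i = loc ks k"
    obtain p q where p: "walk (take i ks) = Some p" "walk (take k ks) = Some q"
      using walk_take ks(1) by metis
    have "p = q" using code_inj[OF p] eq p by (simp add: loc_def)
    then have "walk (take i ks @ drop k ks) = Some v"
      using p ks(1) go_from_append[of nx v0 "take k ks" "drop k ks"] by (simp add: go_from_append)
    then show False using min[of "take i ks @ drop k ks"] that ks(2) by simp
  qed
  then have "inj_on (loc ks) {..n}" by (metis (no_types, lifting) atMost_iff inj_onI linorder_neqE_nat)
  moreover have "loc ks ` {..n} \<subseteq> {..<V}" using loc_less[OF ks(1)] by auto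
  ultimately have "card {..n} \<le> card {..<V}" by (metis card_image card_mono finite_lessThan)
  then show ?thesis using ks by (intro exI[of _ ks]) simp
qed

end

section \<open>Configurations as numbers\<close>

type_synonym vtx = "nat \<times> nat \<times> nat \<times> nat"

type_synonym 'a trans = "nat \<times> 'a option \<times> nat \<times> nat \<times> nat \<times> int \<times> int"

text \<open>A configuration is represented by its state, its input position, and the work tape to the left
  and to the right of the head, read as numbers in base \<open>b\<close>. The left number carries a leading 1,
  which keeps track of the head position.\<close>
fun nxt :: "nat \<Rightarrow> 'a list \<Rightarrow> 'a trans \<Rightarrow> vtx \<Rightarrow> vtx option" where
  "nxt b x (q, a, g, q', g', di, dw) (s, i, l, r) =
     (if s = q \<and> read_input x i = a \<and> r mod b = g \<and> 0 \<le> int i + di \<and> int i + di \<le> int (length x) + 1 \<and>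
         (dw = -1 \<longrightarrow> l div b \<noteq> 0)
      then Some (q', nat (int i + di),
         if dw = 0 then l else if dw = 1 then l * b + g' else l div b,
         if dw = 0 then r div b * b + g' else if dw = 1 then r div b else (r div b * b + g') * b + l mod b)
      else None)"

fun tstep :: "'a list \<Rightarrow> 'a trans \<Rightarrow> config \<Rightarrow> config \<Rightarrow> bool" where
  "tstep x (q, a, g, q', g', di, dw) (s, i, w, h) c' \<longleftrightarrow>
     s = q \<and> read_input x i = a \<and> w h = g \<and> 0 \<le> int i + di \<and> int i + di \<le> int (length x) + 1 \<and>
     0 \<le> int h + dw \<and> c' = (q', nat (int i + di), w(h := g'), nat (int h + dw))"

lemma step_tstep: "step M x c c' \<longleftrightarrow> (\<exists>t \<in> delta M. tstep x t c c')"
proof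
  assume "step M x c c'"
  then obtain q i w h q' g' di dw where *: "c = (q, i, w, h)"
      "(q, read_input x i, w h, q', g', di, dw) \<in> delta M"
      "0 \<le> int i + di" "int i + di \<le> int (length x) + 1" "0 \<le> int h + dw"
      "c' = (q', nat (int i + di), w(h := g'), nat (int h + dw))"
    by (auto simp: step_def)
  then show "\<exists>t \<in> delta M. tstep x t c c'"
    by (intro bexI[of _ "(q, read_input x i, w h, q', g', di, dw)"]) auto
next
  assume "\<exists>t \<in> delta M. tstep x t c c'"
  then obtain q a g q' g' di dw where t: "(q, a, g, q', g', di, dw) \<in> delta M" "tstep x (q, a, g, q', g', di, dw) c c'"
    by (metis prod_cases7)
  obtain s i w h where "c = (s, i, w, h)" by (metis prod_cases4)
  then show "step M x c c'" using t unfolding step_def by auto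
qed

primrec lft :: "nat \<Rightarrow> (nat \<Rightarrow> nat) \<Rightarrow> nat \<Rightarrow> nat" where
  "lft b w 0 = 1"
| "lft b w (Suc h) = lft b w h * b + w h"

primrec rgt :: "nat \<Rightarrow> (nat \<Rightarrow> nat) \<Rightarrow> nat \<Rightarrow> nat \<Rightarrow> nat" where
  "rgt b w h 0 = 0"
| "rgt b w h (Suc m) = w h + b * rgt b w (Suc h) m"

lemma lft_upd: "h \<le> k \<Longrightarrow> lft b (w(k := g)) h = lft b w h"
  by (induction h) auto

lemma rgt_upd: "k < h \<Longrightarrow> rgt b (w(k := g)) h m = rgt b w h m"
  by (induction m arbitrary: h) auto

lemma lft_pos: "0 < b \<Longrightarrow> 0 < lft b w h"
  by (induction h) auto

lemma lft_less: "1 < b \<Longrightarrow> \<forall>j. w j < b \<Longrightarrow> lft b w h < b ^ Suc h"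
proof (induction h)
  case (Suc h)
  have "w h < b" using Suc.prems by blast
  then have "lft b w (Suc h) < Suc (lft b w h) * b" by simp
  also have "\<dots> \<le> b ^ Suc h * b" using Suc by (intro mult_le_mono1) simp
  finally show ?case by (simp add: mult.commute)
qed simp

lemma rgt_less: "\<forall>j. w j < b \<Longrightarrow> rgt b w h m < b ^ m"
proof (induction m arbitrary: h)
  case (Suc m)
  have "w h < b" using Suc.prems by blast
  then have "rgt b w h (Suc m) < b * Suc (rgt b w (Suc h) m)" by simp
  also have "\<dots> \<le> b * b ^ m" using Suc.IH[OF Suc.prems, of "Suc h"] by (intro mult_le_mono2) simp
  finally show ?case by simp
qed simp

text \<open>Reading the right part up to the fixed bound \<open>S\<close>, beyond which the tape is
  blank, captures the whole tape, so the numbers determine the configuration.\<close>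

fun repr :: "nat \<Rightarrow> nat \<Rightarrow> config \<Rightarrow> vtx \<Rightarrow> bool" where
  "repr b S (s, i, w, h) v \<longleftrightarrow> h < S \<and> (\<forall>j. w j < b) \<and> (\<forall>j \<ge> S. w j = 0) \<and> v = (s, i, lft b w h, rgt b w h (S - h))"

text \<open>In the second direction the successor may leave the first \<open>S\<close> cells, where
  the numbers no longer describe the tape. The space bound of the machine will rule this out along
  computation paths.\<close>

lemma repr_step:
  assumes c: "repr b S c v" and b: "1 < b" and t: "t = (q, a, g, q', g', di, dw)"
    and g': "g' < b" and dw: "dw \<in> {-1, 0, 1}"
  shows "tstep x t c c' \<Longrightarrow> snd (snd (snd c')) < S \<Longrightarrow> \<exists>v'. nxt b x t v = Some v' \<and> repr b S c' v'"
    and "nxt b x t v = Some v' \<Longrightarrow> \<exists>c'. tstep x t c c' \<and> (snd (snd (snd c')) < S \<longrightarrow> repr b S c' v')"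
proof -
  obtain s i w h where cc: "c = (s, i, w, h)" by (metis prod_cases4)
  have h: "h < S" and w: "\<forall>j. w j < b" and z: "\<forall>j \<ge> S. w j = 0" and v: "v = (s, i, lft b w h, rgt b w h (S - h))"
    using c cc by auto
  obtain m where m: "S - h = Suc m" using h by (metis Suc_diff_Suc)
  have r: "rgt b w h (S - h) = w h + b * rgt b w (Suc h) m" using m by simp
  have wh: "w h < b" using w by blast
  have rm: "rgt b w h (S - h) mod b = w h" "rgt b w h (S - h) div b = rgt b w (Suc h) m"
    using r wh by auto
  \<comment> \<open>At cell 0 the left number is just the leading 1, so removing a digit leaves 0.
    This is how \<open>nxt\<close> notices a move off the tape.\<close>
  have hl: "lft b w h div b \<noteq> 0 \<longleftrightarrow> 0 < h"
  proof (cases h)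
    case (Suc k)
    have "w k < b" using w by blast
    then have "lft b w h div b = lft b w k" using Suc by simp
    then show ?thesis using lft_pos[of b w k] b Suc by simp
  qed (use b in simp)
  let ?c' = "(q', nat (int i + di), w(h := g'), nat (int h + dw))"
  have iff: "tstep x t c ?c' \<longleftrightarrow> (\<exists>v'. nxt b x t v = Some v')"
    using dw hl rm(1) by (auto simp: t cc v)
  have rep: "repr b S ?c' v'" if nx: "nxt b x t v = Some v'" and lt: "nat (int h + dw) < S" for v'
  proof -
    have w': "\<forall>j. (w(h := g')) j < b" "\<forall>j \<ge> S. (w(h := g')) j = 0" using w z g' h by auto
    have v': "v' = (q', nat (int i + di),
         if dw = 0 then lft b w h else if dw = 1 then lft b w h * b + g' else lft b w h div b,
         if dw = 0 then rgt b w (Suc h) m * b + g' else if dw = 1 then rgt b w (Suc h) m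
         else (rgt b w (Suc h) m * b + g') * b + lft b w h mod b)" and hpos: "dw = -1 \<Longrightarrow> 0 < h"
      using nx rm(2) hl by (auto simp: t v split: if_splits)
    consider "dw = 0" | "dw = 1" | "dw = -1" using dw by auto
    then show ?thesis
    proof cases
      case 1
      then show ?thesis using w' h v' m by (simp add: lft_upd rgt_upd)
    next
      case 2
      then have "nat (int h + dw) = Suc h" by (simp add: nat_add_distrib)
      moreover have "S - Suc h = m" using m by simp
      ultimately show ?thesis using w' lt v' 2 by (simp add: lft_upd rgt_upd)
    next
      case 3
      then obtain k where k: "h = Suc k" using hpos by (cases h) auto
      have "nat (int h + dw) = k" using 3 k by simp
      moreover have "S - k = Suc (Suc m)" using m k by simp
      moreover have "w k < b" using w by blast
      then have "lft b w h div b = lft b w k" "lft b w h mod b = w k" using k by auto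
      ultimately show ?thesis using w' lt v' 3 k by (simp add: lft_upd rgt_upd algebra_simps)
    qed
  qed
  show "\<exists>v'. nxt b x t v = Some v' \<and> repr b S c' v'" if st: "tstep x t c c'" "snd (snd (snd c')) < S"
  proof -
    have "c' = ?c'" using st t cc by simp
    moreover obtain v' where "nxt b x t v = Some v'" using iff st(1) \<open>c' = ?c'\<close> by blast
    moreover have "nat (int h + dw) < S" using st(2) \<open>c' = ?c'\<close> by simp
    ultimately show ?thesis using rep by blast
  qed
  show "\<exists>c'. tstep x t c c' \<and> (snd (snd (snd c')) < S \<longrightarrow> repr b S c' v')" if "nxt b x t v = Some v'"
    using iff rep[OF that] that by (metis snd_conv)
qed

text \<open>The successor reveals the transition. The work move shows in the size of the left
  number, since \<open>l * b + g'\<close> exceeds \<open>l\<close>, which exceeds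
  \<open>l div b\<close>; the input move shows in the position, and the written symbol is a digit of
  one of the two numbers. State and symbols read are those of \<open>v\<close>.\<close>

lemma nxt_inj:
  assumes "nxt b x t v = Some v'" "nxt b x t' v = Some v'" "1 < b" "0 < fst (snd (snd v))"
    and "t = (q, a, g, q', g', di, dw)" "g' < b" "dw \<in> {-1, 0, 1}" "di \<in> {-1, 0, 1}"
    and "t' = (p, c, e, p', e', dj, dv)" "e' < b" "dv \<in> {-1, 0, 1}" "dj \<in> {-1, 0, 1}"
  shows "t = t'"
proof -
  obtain s i l r where v: "v = (s, i, l, r)" by (metis prod_cases4)
  have l: "0 < l" using assms(4) v by simp
  have lb: "l < l * b + k" for k
    using l assms(3) by (metis add.commute le_add1 less_le_trans mult.right_neutral nat_mult_less_cancel1 trans_le_add2)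
  have ld: "l div b < l" using l assms(3) by simp
  have md: "(k * b + g') mod b = g'" "(k * b + e') mod b = e'" for k using assms(6,10) by auto
  have md2: "((k * b + g') * b + l mod b) div b = k * b + g'" "((k * b + e') * b + l mod b) div b = k * b + e'" for k
    using assms(3) by auto
  have eqs: "p = q" "c = a" "e = g" "p' = q'" "nat (int i + di) = nat (int i + dj)"
    using assms(1,2,5,9) v by (auto split: if_splits)
  have pos: "0 \<le> int i + di" "0 \<le> int i + dj" using assms(1,2,5,9) v by (auto split: if_splits)
  have "di = dj" using eqs(5) pos by simp
  moreover have "dw = dv"
  proof -
    have "fst (snd (snd v')) = (if dw = 0 then l else if dw = 1 then l * b + g' else l div b)"
      using assms(1,5) v by (cases "nxt b x t v") (auto split: if_split_asm)
    moreover have "fst (snd (snd v')) = (if dv = 0 then l else if dv = 1 then l * b + e' else l div b)"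
      using assms(2,9) v by (cases "nxt b x t' v") (auto split: if_split_asm)
    ultimately have "(if dw = 0 then l else if dw = 1 then l * b + g' else l div b) =
        (if dv = 0 then l else if dv = 1 then l * b + e' else l div b)" by simp
    then show ?thesis using lb[of g'] lb[of e'] ld assms(7,11)
      by (auto split: if_split_asm)
  qed
  moreover have "g' = e'"
  proof -
    consider "dw = 0" | "dw = 1" | "dw = -1" using assms(7) by auto
    then show ?thesis
    proof cases
      case 1
      then have "r div b * b + g' = r div b * b + e'"
        using assms(1,2,5,9) v \<open>dw = dv\<close> by (auto split: if_splits)
      then show ?thesis by simp
    next
      case 2
      then have "l * b + g' = l * b + e'"
        using assms(1,2,5,9) v \<open>dw = dv\<close> by (auto split: if_splits)
      then show ?thesis by simp
    next
      case 3
      then have "(r div b * b + g') * b + l mod b = (r div b * b + e') * b + l mod b"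
        using assms(1,2,5,9) v \<open>dw = dv\<close> by (auto split: if_splits)
      then show ?thesis using md2 by (metis add_left_cancel)
    qed
  qed
  ultimately show ?thesis using eqs assms(5,9) by simp
qed

text \<open>\<open>S\<close> bounds the space of the given machine on \<open>x\<close>, and
  \<open>N\<close> exceeds every component of a reachable configuration. Fixing an order
  \<open>ts\<close> of the transitions makes a computation a list of indices.\<close>

locale nl_machine =
  fixes M :: "'a ntm" and x :: "'a list" and S N :: nat and ts :: "'a trans list"
  assumes wf: "wf_ntm M"
    and space: "\<And>cs c. comp_path M x cs \<Longrightarrow> c \<in> set cs \<Longrightarrow> snd (snd (snd c)) < S"
    and ts: "set ts = delta M" "distinct ts"
    and N: "Suc (n_syms M) ^ S \<le> N" "n_states M \<le> N" "length x + 2 \<le> N"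
begin

definition b :: nat where "b = Suc (n_syms M)"

definition nx :: "nat \<Rightarrow> vtx \<Rightarrow> vtx option" where
  "nx j v = (if j < length ts then nxt b x (ts ! j) v else None)"

definition v0 :: vtx where "v0 = (start M, 0, 1, 0)"

fun code :: "vtx \<Rightarrow> nat" where
  "code (s, i, l, r) = ((s * N + i) * N + l) * N + r"

text \<open>The base of the weights. It must be at least the product of walk length and number of
  codes, both of which are \<open>N ^ 4\<close>; the fourth power leaves room for further polynomial
  factors.\<close>

definition BV :: nat where "BV = (N ^ 4) ^ 4"

lemma b: "1 < b"
  using wf by (simp add: b_def wf_ntm_def)

lemma trans_bounds:
  assumes "(q, a, g, q', g', di, dw) \<in> delta M"
  shows "q < n_states M" "q' < n_states M" "g < b" "g' < b" "di \<in> {-1, 0, 1}" "dw \<in> {-1, 0, 1}"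
proof -
  have "\<forall>(q, a, g, q', g', di, dw) \<in> delta M. q < n_states M \<and> q' < n_states M \<and> g < n_syms M \<and>
      g' < n_syms M \<and> di \<in> {-1, 0, 1} \<and> dw \<in> {-1, 0, 1} \<and> q \<noteq> accept M"
    using wf unfolding wf_ntm_def by (elim conjE) assumption
  from bspec[OF this assms] show "q < n_states M" "q' < n_states M" "g < b" "g' < b" "di \<in> {-1, 0, 1}" "dw \<in> {-1, 0, 1}"
    by (simp_all add: b_def)
qed

lemma comp_path_snoc:
  "comp_path M x (cs @ [c]) \<longleftrightarrow> (if cs = [] then c = init_config M else comp_path M x cs \<and> step M x (last cs) c)"
proof (cases "cs = []")
  case False
  have "(\<forall>j. Suc j < length (cs @ [c]) \<longrightarrow> step M x ((cs @ [c]) ! j) ((cs @ [c]) ! Suc j)) \<longleftrightarrow>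
      (\<forall>j. Suc j < length cs \<longrightarrow> step M x (cs ! j) (cs ! Suc j)) \<and> step M x (last cs) c" (is "?L \<longleftrightarrow> ?R")
  proof
    assume L: ?L
    have "step M x (cs ! j) (cs ! Suc j)" if "Suc j < length cs" for j
      using L[rule_format, of j] that by (simp add: nth_append)
    moreover have "step M x (last cs) c"
      using L[rule_format, of "length cs - 1"] False by (simp add: nth_append last_conv_nth)
    ultimately show ?R by blast
  next
    assume R: ?R
    show ?L
    proof (intro allI impI)
      fix j assume "Suc j < length (cs @ [c])"
      then consider "Suc j < length cs" | "Suc j = length cs" by fastforce
      then show "step M x ((cs @ [c]) ! j) ((cs @ [c]) ! Suc j)"
      proof cases
        case 2
        then have "last cs = cs ! j" using False by (metis diff_Suc_1 last_conv_nth)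
        then show ?thesis using R 2 by (simp add: nth_append)
      qed (use R in \<open>simp add: nth_append\<close>)
    qed
  qed
  then show ?thesis using False by (auto simp: comp_path_def)
qed (auto simp: comp_path_def)

lemma repr_init: "comp_path M x [init_config M] \<and> repr b S (init_config M) v0"
proof -
  have cp: "comp_path M x [init_config M]" by (simp add: comp_path_def)
  then have "0 < S" using space[OF cp, of "init_config M"] by (simp add: init_config_def)
  moreover have "rgt b (\<lambda>_. 0) h m = 0" for h m by (induction m arbitrary: h) auto
  ultimately show ?thesis using cp b by (simp add: init_config_def v0_def)
qed

lemma walk_comp_path:
  assumes "go_from nx v0 js = Some v"
  shows "\<exists>cs. comp_path M x cs \<and> repr b S (last cs) v \<and> fst (snd v) \<le> length x + 1 \<and> fst v < n_states M"
  using assms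
proof (induction js arbitrary: v rule: rev_induct)
  case Nil
  have "fst (snd v0) \<le> length x + 1" "fst v0 < n_states M" using wf by (simp_all add: v0_def wf_ntm_def)
  moreover have "v = v0" using Nil by simp
  ultimately show ?case using repr_init by (intro exI[of _ "[init_config M]"]) simp
next
  case (snoc j js)
  then obtain u where u: "go_from nx v0 js = Some u" "nx j u = Some v"
    by (auto simp: go_from_append bind_eq_Some_conv)
  obtain cs where cs: "comp_path M x cs" "repr b S (last cs) u" using snoc.IH[OF u(1)] by blast
  have j: "j < length ts" "nxt b x (ts ! j) u = Some v" using u(2) by (auto simp: nx_def split: if_splits)
  obtain q a g q' g' di dw where t: "ts ! j = (q, a, g, q', g', di, dw)" by (metis prod_cases7)
  have td: "(q, a, g, q', g', di, dw) \<in> delta M" using ts j(1) t by (metis nth_mem)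
  obtain c' where c': "tstep x (ts ! j) (last cs) c'" "snd (snd (snd c')) < S \<longrightarrow> repr b S c' v"
    using repr_step(2)[OF cs(2) b t _ _ j(2)] trans_bounds[OF td] by blast
  have st: "step M x (last cs) c'" using c'(1) td t step_tstep by metis
  have cp: "comp_path M x (cs @ [c'])" using cs(1) st by (simp add: comp_path_snoc) (auto simp: comp_path_def)
  \<comment> \<open>The space bound applies to the extended path and keeps the head below
    \<open>S\<close>, which discharges the proviso of \<open>repr_step\<close>.\<close>
  have "repr b S c' v" using c'(2) space[OF cp, of c'] by simp
  moreover obtain s i l r where "u = (s, i, l, r)" by (metis prod_cases4)
  then have "fst (snd v) \<le> length x + 1" "fst v = q'"
    using j(2) t by (auto split: if_splits)
  ultimately show ?case using cp trans_bounds[OF td] by (intro exI[of _ "cs @ [c']"]) auto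
qed

lemma comp_path_walk:
  assumes "comp_path M x cs"
  shows "\<exists>js v. go_from nx v0 js = Some v \<and> repr b S (last cs) v"
  using assms
proof (induction cs rule: rev_induct)
  case Nil
  then show ?case by (simp add: comp_path_def)
next
  case (snoc c cs)
  show ?case
  proof (cases "cs = []")
    case True
    then have "c = init_config M" using snoc.prems comp_path_snoc[of "[]" c] by simp
    then show ?thesis using True repr_init
      by (intro exI[of _ "[]"] exI[of _ v0]) simp
  next
    case False
    then have cp: "comp_path M x cs" "step M x (last cs) c" using snoc.prems by (auto simp: comp_path_snoc)
    obtain js u where u: "go_from nx v0 js = Some u" "repr b S (last cs) u" using snoc.IH[OF cp(1)] by blast
    obtain t where t: "t \<in> delta M" "tstep x t (last cs) c" using cp(2) step_tstep by metis
    obtain q a g q' g' di dw where tt: "t = (q, a, g, q', g', di, dw)" by (metis prod_cases7)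
    have "snd (snd (snd c)) < S" using space[OF snoc.prems, of c] by simp
    then obtain v where v: "nxt b x t u = Some v" "repr b S c v"
      using repr_step(1)[OF u(2) b tt _ _ t(2)] trans_bounds t(1) tt by metis
    obtain j where "j < length ts" "ts ! j = t" using ts t(1) by (metis in_set_conv_nth)
    then have "go_from nx v0 (js @ [j]) = Some v" using u v by (simp add: go_from_append nx_def)
    then show ?thesis using v by (intro exI[of _ "js @ [j]"] exI[of _ v]) auto
  qed
qed

lemma walk_bounds:
  assumes "go_from nx v0 js = Some (s, i, l, r)"
  shows "s < N" "i < N" "l < N" "r < N" "0 < l" "i \<le> length x + 1" "s < n_states M"
proof -
  obtain cs where cs: "repr b S (last cs) (s, i, l, r)" "i \<le> length x + 1" "s < n_states M"
    using walk_comp_path[OF assms] by auto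
  obtain s' i' w h where c: "last cs = (s', i', w, h)" by (metis prod_cases4)
  have h: "h < S" "\<forall>j. w j < b" "l = lft b w h" "r = rgt b w h (S - h)" using cs(1) c by auto
  have "l < b ^ Suc h" using lft_less[OF b h(2)] h by simp
  also have "\<dots> \<le> b ^ S" using h(1) b by (intro power_increasing) auto
  finally show "l < N" using N(1) b_def by simp
  have "r < b ^ (S - h)" using rgt_less[OF h(2)] h by simp
  also have "\<dots> \<le> b ^ S" using b by (intro power_increasing) auto
  finally show "r < N" using N(1) b_def by simp
  show "0 < l" using h lft_pos b by simp
  show "s < N" "i < N" "i \<le> length x + 1" "s < n_states M" using cs N by auto
qed

lemma code_bound: "s < N \<Longrightarrow> i < N \<Longrightarrow> l < N \<Longrightarrow> r < N \<Longrightarrow> code (s, i, l, r) < N ^ 4"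
proof -
  have *: "k * N + j < m * N" if "k < m" "j < N" for k j m
  proof -
    have "k * N + j < Suc k * N" using that by simp
    also have "\<dots> \<le> m * N" using that by (intro mult_le_mono1) simp
    finally show ?thesis .
  qed
  assume "s < N" "i < N" "l < N" "r < N"
  then have "((s * N + i) * N + l) * N + r < ((N * N) * N) * N" using * by blast
  then show ?thesis by (simp add: eval_nat_numeral)
qed

lemma code_eqD:
  assumes "code (s, i, l, r) = code (s', i', l', r')" "i < N" "l < N" "r < N" "i' < N" "l' < N" "r' < N"
  shows "(s, i, l, r) = (s', i', l', r')"
proof -
  have *: "k = k' \<and> j = j'" if "k * N + j = k' * N + j'" "j < N" "j' < N" for k k' j j'
  proof -
    have "(k * N + j) div N = k" "(k' * N + j') div N = k'" using that(2,3) by auto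
    then have "k = k'" using that(1) by simp
    then show ?thesis using that(1) by simp
  qed
  have "((s * N + i) * N + l) * N + r = ((s' * N + i') * N + l') * N + r'" using assms(1) by simp
  note 1 = *[OF this assms(4,7)]
  note 2 = *[OF conjunct1[OF 1] assms(3,6)]
  note 3 = *[OF conjunct1[OF 2] assms(2,5)]
  from 1 2 3 show ?thesis by simp
qed

text \<open>A code has four digits below \<open>N\<close>, so there are \<open>N ^ 4\<close> codes;
  by \<open>short_walk\<close> walks below that length suffice, whence the same bound for
  \<open>D\<close>.\<close>

sublocale layered nx v0 code "N ^ 4" "N ^ 4" BV
proof
  fix js v assume w: "go_from nx v0 js = Some v"
  obtain s i l r where v: "v = (s, i, l, r)" by (metis prod_cases4)
  note wb = walk_bounds[OF w[unfolded v]]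
  show "code v < N ^ 4" using code_bound wb v by simp
  { fix ks u assume u: "go_from nx v0 ks = Some u" "code v = code u"
    obtain s' i' l' r' where u': "u = (s', i', l', r')" by (metis prod_cases4)
    show "v = u" using code_eqD[of s i l r s' i' l' r'] walk_bounds[OF u(1)[unfolded u']] wb u(2) v u' by simp }
  { fix j k u assume jk: "nx j v = Some u" "nx k v = Some u"
    have lt: "j < length ts" "k < length ts" and n: "nxt b x (ts ! j) v = Some u" "nxt b x (ts ! k) v = Some u"
      using jk by (auto simp: nx_def split: if_splits)
    obtain q a g q' g' di dw where t: "ts ! j = (q, a, g, q', g', di, dw)" by (metis prod_cases7)
    obtain p c e p' e' dj dv where t': "ts ! k = (p, c, e, p', e', dj, dv)" by (metis prod_cases7)
    have d: "(q, a, g, q', g', di, dw) \<in> delta M" "(p, c, e, p', e', dj, dv) \<in> delta M"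
      using lt t t' ts(1) by (metis nth_mem)+
    have "ts ! j = ts ! k"
      by (rule nxt_inj[OF n b _ t _ _ _ t'])
        (use trans_bounds[OF d(1)] trans_bounds[OF d(2)] wb v in auto)
    then show "j = k" using ts(2) lt by (simp add: nth_eq_iff_index_eq) }
next
  have "0 < N" using N(3) by simp
  then have "(N ^ 4) ^ 2 \<le> (N ^ 4) ^ 4" by (intro power_increasing) auto
  then show "N ^ 4 * N ^ 4 \<le> BV" by (simp add: BV_def power2_eq_square)
qed

text \<open>Arbitrarily long accepting computations of the given machine are shortened here, so the
  counting may stop after \<open>N ^ 4\<close> layers.\<close>

lemma accepts_iff_walk:
  "accepts M x \<longleftrightarrow> (\<exists>d < N ^ 4. \<exists>js v. length js = d \<and> walk js = Some v \<and> fst v = accept M)"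
proof
  assume "accepts M x"
  then obtain cs where cs: "comp_path M x cs" "fst (last cs) = accept M"
    by (auto simp: accepts_def accepting_path_def)
  obtain js v where js: "walk js = Some v" "repr b S (last cs) v" using comp_path_walk[OF cs(1)] by blast
  have "fst v = accept M" using js(2) cs(2) by (cases "last cs") auto
  then show "\<exists>d < N ^ 4. \<exists>js v. length js = d \<and> walk js = Some v \<and> fst v = accept M"
    using short_walk[OF js(1)] by blast
next
  assume "\<exists>d < N ^ 4. \<exists>js v. length js = d \<and> walk js = Some v \<and> fst v = accept M"
  then obtain js v where js: "walk js = Some v" "fst v = accept M" by blast
  obtain cs where "comp_path M x cs" "repr b S (last cs) v" using walk_comp_path[OF js(1)] by blast
  then have "accepting_path M x cs" using js(2)
    by (cases "last cs") (auto simp: accepting_path_def)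
  then show "accepts M x" by (auto simp: accepts_def)
qed

end

section \<open>The counting program\<close>

text \<open>Registers below 10 hold constants set once; the others are numbered roughly by nesting
  level, so that what a subprogram writes lies in few intervals. \<open>rQ\<close>,
  \<open>rI\<close>, \<open>rL\<close>, \<open>rR\<close> hold a vertex before a step and the primed
  ones its successor. \<open>rC\<close> and \<open>rSG\<close> are the known count and total weight
  of layer \<open>rD\<close>, their primed versions those of the next layer. \<open>rU\<close> is
  the code a guessed walk must reach, \<open>rV\<close> the candidate for the next layer, and
  \<open>rHAS\<close>, \<open>rBEST\<close> keep the lightest way to reach it.\<close>

abbreviation (input) "rZR \<equiv> (2 :: nat)"
abbreviation (input) "rTWO \<equiv> (3 :: nat)"
abbreviation (input) "rBB \<equiv> (4 :: nat)"
abbreviation (input) "rNN \<equiv> (5 :: nat)"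
abbreviation (input) "rVV \<equiv> (6 :: nat)"
abbreviation (input) "rBW \<equiv> (8 :: nat)"
abbreviation (input) "rN1 \<equiv> (9 :: nat)"
abbreviation (input) "rT \<equiv> (10 :: nat)"
abbreviation (input) "rT1 \<equiv> (11 :: nat)"
abbreviation (input) "rT2 \<equiv> (12 :: nat)"
abbreviation (input) "rK1 \<equiv> (13 :: nat)"
abbreviation (input) "rK2 \<equiv> (14 :: nat)"
abbreviation (input) "rK3 \<equiv> (15 :: nat)"
abbreviation (input) "rQD \<equiv> (16 :: nat)"
abbreviation (input) "rMD \<equiv> (17 :: nat)"
abbreviation (input) "rRQ \<equiv> (18 :: nat)"
abbreviation (input) "rRM \<equiv> (19 :: nat)"
abbreviation (input) "rLQ \<equiv> (20 :: nat)"
abbreviation (input) "rLM \<equiv> (21 :: nat)"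
abbreviation (input) "rJJ \<equiv> (22 :: nat)"
abbreviation (input) "rPW \<equiv> (23 :: nat)"
abbreviation (input) "rOK \<equiv> (24 :: nat)"
abbreviation (input) "rQ' \<equiv> (25 :: nat)"
abbreviation (input) "rI' \<equiv> (26 :: nat)"
abbreviation (input) "rL' \<equiv> (27 :: nat)"
abbreviation (input) "rR' \<equiv> (28 :: nat)"
abbreviation (input) "rX \<equiv> (29 :: nat)"
abbreviation (input) "rQ \<equiv> (30 :: nat)"
abbreviation (input) "rI \<equiv> (31 :: nat)"
abbreviation (input) "rL \<equiv> (32 :: nat)"
abbreviation (input) "rR \<equiv> (33 :: nat)"
abbreviation (input) "rWT \<equiv> (34 :: nat)"
abbreviation (input) "rST \<equiv> (35 :: nat)"
abbreviation (input) "rII \<equiv> (36 :: nat)"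
abbreviation (input) "rBEST \<equiv> (40 :: nat)"
abbreviation (input) "rHAS \<equiv> (41 :: nat)"
abbreviation (input) "rCNT \<equiv> (42 :: nat)"
abbreviation (input) "rSUM \<equiv> (43 :: nat)"
abbreviation (input) "rACC \<equiv> (44 :: nat)"
abbreviation (input) "rU \<equiv> (45 :: nat)"
abbreviation (input) "rC' \<equiv> (46 :: nat)"
abbreviation (input) "rSG' \<equiv> (47 :: nat)"
abbreviation (input) "rV \<equiv> (48 :: nat)"
abbreviation (input) "rC \<equiv> (49 :: nat)"
abbreviation (input) "rSG \<equiv> (50 :: nat)"
abbreviation (input) "rD \<equiv> (51 :: nat)"

text \<open>Halves \<open>rJJ\<close> as long as it is even and multiplies by the base each time.
  Loops have a length fixed in advance, so there are \<open>rII\<close> rounds, most of them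
  idle.\<close>

definition PWR :: "'a com" where
  "PWR = Seq (Cp rJJ rII) (Seq (One rPW) (FOR rK3 rII (Seq (DIVM rQD rMD rJJ rTWO rK2)
     (IfEq rMD rZR (Seq (Cp rJJ rQD) (Seq (MUL rT1 rPW rBW rK1) (Cp rPW rT1))) Skip))))"

text \<open>Horner's scheme for \<open>code\<close>. It alternates between two registers because
  \<open>MUL\<close> cannot overwrite its factor.\<close>

definition ENC :: "'a com" where
  "ENC = Seq (MUL rT1 rQ' rNN rK1) (Seq (CAdd rT1 rI') (Seq (MUL rT2 rT1 rNN rK1) (Seq (CAdd rT2 rL')
     (Seq (MUL rT1 rT2 rNN rK1) (Seq (CAdd rT1 rR') (Cp rX rT1))))))"

definition MVI :: "int \<Rightarrow> 'a com" where
  "MVI di = (if di = 0 then Seq (Cp rI' rI) (One rOK)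
     else if di = 1 then IfLt rI rN1 (Seq (Cp rI' rI) (Seq (CInc rI') (One rOK))) Skip
     else IfLt rZR rI (Seq (PRED rI' rI rK2) (One rOK)) Skip)"

definition MVW :: "nat \<Rightarrow> nat \<Rightarrow> int \<Rightarrow> 'a com" where
  "MVW q' g' dw = Seq (setN rQ' q') (Seq (setN rT g') (Seq (MUL rR' rRQ rBB rK1) (Seq (CAdd rR' rT)
     (if dw = 0 then Cp rL' rL
      else if dw = 1 then Seq (MUL rL' rL rBB rK1) (Seq (CAdd rL' rT) (Cp rR' rRQ))
      else Seq (DIVM rLQ rLM rL rBB rK2) (Seq (IfEq rLQ rZR (Zero rOK) Skip) (Seq (Cp rL' rLQ)
        (Seq (MUL rT1 rR' rBB rK1) (Seq (CAdd rT1 rLM) (Cp rR' rT1)))))))))"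

text \<open>The step is carried out in registers only and its success is noted in
  \<open>rOK\<close>; the input head stays. Thus the same code serves \<open>STEP\<close>, which
  then moves the head, and \<open>TRY\<close>, which only examines an edge.\<close>

fun TR :: "'a trans \<Rightarrow> 'a com" where
  "TR (q, a, g, q', g', di, dw) = Seq (Zero rOK) (Seq (setN rT q) (IfEq rQ rT (IfSym a
     (Seq (DIVM rRQ rRM rR rBB rK2) (Seq (setN rT g) (IfEq rRM rT (Seq (MVI di) (MVW q' g' dw)) Skip))) Skip) Skip))"

definition CPY :: "'a com" where
  "CPY = Seq (Cp rQ rQ') (Seq (Cp rI rI') (Seq (Cp rL rL') (Cp rR rR')))"

fun STEP :: "'a trans \<Rightarrow> 'a com" where
  "STEP (q, a, g, q', g', di, dw) = Seq (TR (q, a, g, q', g', di, dw))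
     (IfEq rOK rZR Fail (if di = 1 then InR else if di = -1 then InL else Skip))"

definition TAIL :: "'a com" where
  "TAIL = Seq ENC (Seq (Cp rII rST) (Seq (CInc rII) (Seq PWR (Seq (MUL rT1 rPW rX rK1) (CAdd rWT rT1)))))"

definition PBODY :: "'a trans list \<Rightarrow> 'a com" where
  "PBODY ts = Seq CPY (Seq (select (map STEP ts)) TAIL)"

text \<open>The initial 1 in \<open>rL'\<close> is the leading digit that marks the left end of the
  tape. The first \<open>ENC\<close> provides the end code of the walk of length 0.\<close>

definition PATH :: "nat \<Rightarrow> 'a trans list \<Rightarrow> 'a com" where
  "PATH q0 ts = Seq (Seq (setN rQ' q0) (Seq (Zero rI') (Seq (One rL') (Seq (Zero rR') (Seq (Zero rWT) ENC)))))
     (FOR rST rD (PBODY ts))"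

definition TRY :: "'a trans \<Rightarrow> 'a com" where
  "TRY t = Seq (TR t) (IfEq rOK rZR Skip (Seq ENC (IfEq rX rV
     (IfEq rHAS rZR (Seq (Cp rBEST rWT) (One rHAS)) (IfLt rWT rBEST (Cp rBEST rWT) Skip)) Skip)))"

primrec TRIES :: "'a trans list \<Rightarrow> 'a com" where
  "TRIES [] = Skip"
| "TRIES (t # ts) = Seq (TRY t) (TRIES ts)"

text \<open>A walk that does not end in the announced code kills the branch. The flag
  \<open>rACC\<close> may be set before the guess is confirmed; this is harmless, as an unconfirmed
  branch does not survive the pass.\<close>

definition CHK :: "nat \<Rightarrow> 'a trans list \<Rightarrow> 'a com" where
  "CHK qa ts = Seq CPY (Seq (IfEq rX rU Skip Fail) (Seq (TRIES ts) (Seq (FOR rK1 rI InL)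
     (Seq (CInc rCNT) (Seq (CAdd rSUM rWT) (Seq (setN rT qa) (IfEq rQ rT (One rACC) Skip)))))))"

definition PASS :: "nat \<Rightarrow> nat \<Rightarrow> 'a trans list \<Rightarrow> 'a com" where
  "PASS q0 qa ts = Seq (Seq (Zero rCNT) (Seq (Zero rSUM) (Seq (Zero rHAS) (Zero rBEST))))
     (Seq (FOR rU rVV (Choice (Seq (PATH q0 ts) (CHK qa ts)) Skip))
       (IfEq rCNT rC (IfEq rSUM rSG Skip Fail) Fail))"

text \<open>Storing layer \<open>rD\<close> would take too much space, so it is guessed anew for
  every candidate \<open>rV\<close>. The same guess is forced each time, which keeps the number of
  successful branches at one.\<close>

definition LAYER :: "nat \<Rightarrow> nat \<Rightarrow> 'a trans list \<Rightarrow> 'a com" where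
  "LAYER q0 qa ts = Seq (Seq (Zero rC') (Zero rSG'))
     (Seq (FOR rV rVV (Seq (PASS q0 qa ts) (IfEq rHAS rZR Skip (Seq (CInc rC') (Seq (CAdd rSG' rBEST)
        (Seq (Cp rII rD) (Seq (CInc rII) (Seq PWR (Seq (MUL rT1 rPW rV rK1) (CAdd rSG' rT1)))))))))
       ) (Seq (Cp rC rC') (Cp rSG rSG')))"

text \<open>Layer 0 has one member, of weight 0. The flag is tested after the last layer, so success
  cannot occur at several moments.\<close>

definition MAIN :: "nat \<Rightarrow> nat \<Rightarrow> 'a trans list \<Rightarrow> 'a com" where
  "MAIN q0 qa ts = Seq (Seq (One rC) (Seq (Zero rSG) (Zero rACC)))
     (Seq (FOR rD rVV (LAYER q0 qa ts)) (IfEq rACC rZR Fail Skip))"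

declare TR.simps [simp del] STEP.simps [simp del]

section \<open>Registers written and respect for the caps\<close>

lemma writes_PWR: "writes PWR \<subseteq> {11, 13, 14, 15, 16, 17, 22, 23}"
  by (auto simp: PWR_def)

lemma writes_ENC: "writes ENC \<subseteq> {11, 12, 13, 29}"
  by (auto simp: ENC_def)

lemma writes_MVI: "writes (MVI di) \<subseteq> {14, 24, 26}"
  by (auto simp: MVI_def)

lemma writes_MVW: "writes (MVW q' g' dw) \<subseteq> {10, 11, 13, 14, 20, 21, 24, 25, 27, 28}"
  by (auto simp: MVW_def)

lemma writes_TR: "writes (TR t) \<subseteq> {10..<29}"
proof (cases t rule: TR.cases)
  case (1 q a g q' g' di dw)
  then show ?thesis by (auto simp: TR.simps dest!: subsetD[OF writes_MVI] subsetD[OF writes_MVW])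
qed

lemma writes_STEP: "writes (STEP t) \<subseteq> {10..<29}"
proof (cases t rule: STEP.cases)
  case (1 q a g q' g' di dw)
  then show ?thesis by (auto simp: STEP.simps split: if_splits dest!: subsetD[OF writes_TR])
qed

lemma writes_select: "(\<And>c. c \<in> set cs \<Longrightarrow> writes c \<subseteq> A) \<Longrightarrow> writes (select cs) \<subseteq> A"
  by (induction cs) auto

lemma writes_TAIL: "writes TAIL \<subseteq> {10..<37}"
  by (auto simp: TAIL_def dest!: subsetD[OF writes_ENC] subsetD[OF writes_PWR])

lemma writes_PBODY: "writes (PBODY ts) \<subseteq> {10..<35} \<union> {36}"
proof -
  have "writes (select (map STEP ts)) \<subseteq> {10..<29}"
    by (rule writes_select) (auto dest: subsetD[OF writes_STEP])
  then show ?thesis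
    by (auto simp: PBODY_def TAIL_def CPY_def dest!: subsetD[OF writes_ENC] subsetD[OF writes_PWR])
qed

lemma writes_PATH: "writes (PATH q0 ts) \<subseteq> {10..<37}"
  by (auto simp: PATH_def dest!: subsetD[OF writes_ENC] subsetD[OF writes_PBODY])

lemma writes_TRY: "writes (TRY t) \<subseteq> {10..<30} \<union> {40, 41}"
  by (auto simp: TRY_def dest!: subsetD[OF writes_ENC] subsetD[OF writes_TR])

lemma writes_TRIES: "writes (TRIES ts) \<subseteq> {10..<30} \<union> {40, 41}"
proof (induction ts)
  case (Cons t ts)
  then show ?case by (auto dest!: subsetD[OF writes_TRY])
qed simp

lemma writes_CHK: "writes (CHK qa ts) \<subseteq> {10..<37} \<union> {40..<45}"
  by (auto simp: CHK_def CPY_def dest!: subsetD[OF writes_TRIES])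

lemma writes_PASS: "writes (PASS q0 qa ts) \<subseteq> {10..<37} \<union> {40..<46}"
  by (auto simp: PASS_def dest!: subsetD[OF writes_PATH] subsetD[OF writes_CHK])

lemma writes_LAYER: "writes (LAYER q0 qa ts) \<subseteq> {10..<37} \<union> {40..<51}"
  by (auto simp: LAYER_def dest!: subsetD[OF writes_PASS] subsetD[OF writes_PWR])

lemma capped_PWR: "capped PWR"
  by (auto simp: PWR_def intro!: capped.intros capped_DIVM capped_MUL)

lemma capped_ENC: "capped ENC"
  by (auto simp: ENC_def intro!: capped.intros capped_MUL)

lemma capped_MVI: "capped (MVI di)"
  by (auto simp: MVI_def intro!: capped.intros capped_PRED)

lemma capped_MVW: "capped (MVW q' g' dw)"
  by (auto simp: MVW_def intro!: capped.intros capped_MUL capped_DIVM capped_setN)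

lemma capped_TR: "capped (TR t)"
  by (cases t rule: TR.cases) (auto simp: TR.simps intro!: capped.intros capped_DIVM capped_setN capped_MVI capped_MVW)

lemma capped_STEP: "capped (STEP t)"
  by (cases t rule: STEP.cases) (auto simp: STEP.simps intro!: capped.intros capped_TR)

lemma capped_select: "(\<And>c. c \<in> set cs \<Longrightarrow> capped c) \<Longrightarrow> capped (select cs)"
  by (induction cs) (auto intro!: capped.intros)

lemma capped_PBODY: "capped (PBODY ts)"
  by (auto simp: PBODY_def CPY_def TAIL_def intro!: capped.intros capped_ENC capped_PWR capped_MUL capped_select capped_STEP)

lemma capped_PATH: "capped (PATH q0 ts)"
  unfolding PATH_def
  by (intro capped.intros capped_setN capped_ENC capped_PBODY) (auto dest!: subsetD[OF writes_PBODY])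

lemma capped_TRY: "capped (TRY t)"
  by (auto simp: TRY_def intro!: capped.intros capped_TR capped_ENC)

lemma capped_TRIES: "capped (TRIES ts)"
  by (induction ts) (auto intro!: capped.intros capped_TRY)

lemma capped_CHK: "capped (CHK qa ts)"
  by (auto simp: CHK_def CPY_def intro!: capped.intros capped_TRIES capped_setN)

lemma capped_PASS: "capped (PASS q0 qa ts)"
  unfolding PASS_def
  by (intro capped.intros capped_PATH capped_CHK) (auto dest!: subsetD[OF writes_PATH] subsetD[OF writes_CHK])

lemma capped_LAYER: "capped (LAYER q0 qa ts)"
  unfolding LAYER_def
  by (intro capped.intros capped_PASS capped_PWR capped_MUL) (auto dest!: subsetD[OF writes_PASS] subsetD[OF writes_PWR])

lemma capped_MAIN: "capped (MAIN q0 qa ts)"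
  unfolding MAIN_def
  by (intro capped.intros capped_LAYER) (auto dest!: subsetD[OF writes_LAYER])

section \<open>Correctness of the counting program\<close>

context layered
begin

text \<open>Positions up to \<open>2 ^ e\<close> have valuation at most \<open>e\<close>, so the
  exponent of \<open>B\<close> is only logarithmic in the length of the walk.\<close>

lemma wt_bound:
  assumes "walk js = Some v" "length js \<le> m" "m \<le> 2 ^ e" "0 < B"
  shows "wt js \<le> m * (V * B ^ e)"
proof -
  have "wt js \<le> (\<Sum>i \<in> {0<..length js}. V * B ^ e)"
    unfolding wt_def
  proof (rule sum_mono)
    fix i assume i: "i \<in> {0<..length js}"
    have "2 ^ nu i \<le> i" using nu_le i by simp
    then have "2 ^ nu i \<le> (2 :: nat) ^ e" using i assms(2,3) by (metis greaterThanAtMost_iff order_trans)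
    then have "nu i \<le> e" by simp
    then have "pw B i \<le> B ^ e" unfolding pw_def using assms(4) by (intro power_increasing) auto
    then show "loc js i * pw B i \<le> V * B ^ e" using loc_less[OF assms(1), of i] by (intro mult_le_mono) auto
  qed
  also have "\<dots> = length js * (V * B ^ e)" by simp
  also have "\<dots> \<le> m * (V * B ^ e)" using assms(2) by (rule mult_le_mono1)
  finally show ?thesis .
qed

lemma total_bound:
  assumes "ok d as" "d \<le> m" "m \<le> 2 ^ e" "0 < B"
  shows "total as \<le> length as * (m * (V * B ^ e))"
proof -
  have "total as \<le> (\<Sum>u \<in> found as. m * (V * B ^ e))"
    unfolding total_def
  proof (rule sum_mono)
    fix u assume "u \<in> found as"
    then obtain js where js: "as ! u = Some js" "js \<in> paths d u" using ok_found assms(1) by blast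
    then obtain v where "walk js = Some v" "length js = d" by (auto simp: paths_def)
    then show "wt (the (as ! u)) \<le> m * (V * B ^ e)" using wt_bound js assms by simp
  qed
  also have "\<dots> = card (found as) * (m * (V * B ^ e))" by simp
  also have "card (found as) \<le> card {..<length as}" by (intro card_mono) (auto simp: found_def)
  finally show ?thesis by simp
qed

lemma mu_bound:
  assumes "u \<in> layer d" "d \<le> m" "m \<le> 2 ^ e" "0 < B"
  shows "mu d u \<le> m * (V * B ^ e)"
proof -
  obtain js where js: "js \<in> paths d u" using assms(1) by (auto simp: layer_def)
  then obtain v where "walk js = Some v" "length js = d" by (auto simp: paths_def)
  then show ?thesis using mu_le[OF js] wt_bound[of js v m e] assms by simp
qed

end

lemma pw_even: "0 < j \<Longrightarrow> even j \<Longrightarrow> pw B j = B * pw B (j div 2)"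
  unfolding pw_def by (subst nu.simps) simp

lemma pw_odd: "odd j \<Longrightarrow> pw B j = 1"
  unfolding pw_def by (subst nu.simps) simp

locale nl_run = nl_machine M x S N ts for M :: "'a ntm" and x S N ts +
  fixes e :: nat
  assumes e: "N ^ 4 \<le> 2 ^ e"
begin

text \<open>A sum over at most \<open>N ^ 4\<close> walks with \<open>N ^ 4\<close> positions and
  codes below \<open>N ^ 4\<close> is at most \<open>N ^ 12 * BV ^ e\<close>, hence at most
  \<open>BV ^ (e + 2)\<close>. One more factor makes the comparison strict.\<close>

definition CV :: nat where "CV = BV ^ (e + 3)"

text \<open>The loop cap is \<open>BV + 1\<close> because multiplying by the base takes
  \<open>BV\<close> rounds.\<close>

definition kst :: "(nat \<Rightarrow> nat) \<Rightarrow> bool" where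
  "kst \<sigma> \<longleftrightarrow> \<sigma> rCAP = CV \<and> \<sigma> rTCAP = BV + 1 \<and> \<sigma> rZR = 0 \<and> \<sigma> rTWO = 2 \<and> \<sigma> rBB = b \<and> \<sigma> rNN = N \<and>
     \<sigma> rVV = N ^ 4 \<and> \<sigma> rBW = BV \<and> \<sigma> rN1 = length x + 1"

lemma kst_cong: "kst \<sigma> \<Longrightarrow> (\<forall>r < 10. \<sigma>' r = \<sigma> r) \<Longrightarrow> kst \<sigma>'"
  by (simp add: kst_def)

lemma kstD:
  assumes "kst \<sigma>"
  shows "\<sigma> 0 = CV" "\<sigma> (Suc 0) = BV + 1" "\<sigma> 2 = 0" "\<sigma> 3 = 2" "\<sigma> 4 = b" "\<sigma> 5 = N" "\<sigma> 6 = N ^ 4" "\<sigma> 8 = BV" "\<sigma> 9 = length x + 1"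
  using assms by (simp_all add: kst_def)

lemma N2: "2 \<le> N"
  using N(3) by simp

lemma bN: "b \<le> N"
proof -
  have "0 < S" using repr_init by (simp add: init_config_def)
  then have "b ^ 1 \<le> b ^ S" using b by (intro power_increasing) auto
  then show ?thesis using N(1) by (simp add: b_def)
qed

lemma V2: "2 \<le> N ^ 4"
proof -
  have "N ^ 1 \<le> N ^ 4" using N2 by (intro power_increasing) auto
  then show ?thesis using N2 by simp
qed

lemma BV_bounds: "N ^ 4 \<le> BV" "BV < CV" "0 < BV"
proof -
  have "(N ^ 4) ^ 1 \<le> BV" unfolding BV_def using V2 by (intro power_increasing) auto
  then show "N ^ 4 \<le> BV" by simp
  then have "2 \<le> BV" using V2 by linarith
  then have "BV ^ 1 < CV" unfolding CV_def by (intro power_strict_increasing) auto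
  then show "BV < CV" by simp
  show "0 < BV" using \<open>2 \<le> BV\<close> by simp
qed

lemma small: "m \<le> N ^ 4 \<Longrightarrow> m < CV" "m \<le> N ^ 4 \<Longrightarrow> m < BV + 1" "m \<le> N ^ 4 \<Longrightarrow> m \<le> BV"
  using BV_bounds by auto

lemma N_powers: "N \<le> N ^ 4" "Suc N \<le> N ^ 4" "2 * N \<le> N ^ 4" "N * N + N \<le> N ^ 4" "(N + N) * N + N \<le> N ^ 4"
proof -
  have "N * N * 4 \<le> N * N * (N * N)" using N2 mult_le_mono[of 2 N 2 N] by (intro mult_le_mono2) simp
  then have 1: "N * N * 4 \<le> N ^ 4" by (simp add: eval_nat_numeral mult.assoc)
  have 2: "2 * N \<le> N * N" using N2 by simp
  show "(N + N) * N + N \<le> N ^ 4" "N * N + N \<le> N ^ 4" "2 * N \<le> N ^ 4" "N \<le> N ^ 4" "Suc N \<le> N ^ 4"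
    unfolding distrib_right using 1 2 N2 by linarith+
qed

lemma det_PWR:
  assumes k: "kst \<sigma>" and i: "0 < \<sigma> rII" "\<sigma> rII \<le> N ^ 4"
  shows "det x PWR (\<lambda>\<sigma>' p'. p' = p \<and> \<sigma>' rPW = pw BV (\<sigma> rII)) \<sigma> p"
proof -
  let ?i = "\<sigma> rII"
  \<comment> \<open>The product with the remaining power stays constant. If \<open>rJJ\<close> is
    still even after \<open>k\<close> rounds, it has been halved each time; after \<open>?i\<close>
    rounds this would force \<open>2 ^ ?i\<close> below \<open>?i\<close>, so it is odd and its own
    power is 1.\<close>
  let ?I = "\<lambda>k \<sigma>' p'. p' = p \<and> kst \<sigma>' \<and> 0 < \<sigma>' rJJ \<and> \<sigma>' rJJ \<le> ?i \<and> \<sigma>' rPW * pw BV (\<sigma>' rJJ) = pw BV ?i \<and>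
      (odd (\<sigma>' rJJ) \<or> \<sigma>' rJJ * 2 ^ k \<le> ?i)"
  have pwi: "pw BV ?i < CV"
  proof -
    have "2 ^ nu ?i \<le> (2 :: nat) ^ e" using nu_le[OF i(1)] i(2) e by linarith
    then have "nu ?i \<le> e" by simp
    then have "pw BV ?i \<le> BV ^ e" unfolding pw_def using BV_bounds by (intro power_increasing) auto
    also have "\<dots> < CV" unfolding CV_def using BV_bounds V2 by (intro power_strict_increasing) auto
    finally show ?thesis .
  qed
  show ?thesis
    unfolding PWR_def det_Seq det_simps
  proof (rule det_FOR[where I = ?I], goal_cases)
    case (5 k \<sigma>' p')
    note k' = kstD[OF 5(2)[THEN conjunct2, THEN conjunct1]]
    have I: "p' = p" "kst \<sigma>'" "0 < \<sigma>' 22" "\<sigma>' 22 \<le> ?i" "\<sigma>' 23 * pw BV (\<sigma>' 22) = pw BV ?i" "odd (\<sigma>' 22) \<or> \<sigma>' 22 * 2 ^ k \<le> ?i"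
      using 5(2) by auto
    have lt: "\<sigma>' 22 \<le> N ^ 4" using I(4) i(2) by simp
    show ?case
      unfolding det_Seq
    proof (rule det_DIVM)
      show "\<sigma>' 22 < \<sigma>' 1" "\<sigma>' 3 < \<sigma>' 0" "\<sigma>' 22 < \<sigma>' 0" "0 < \<sigma>' 3"
        using k' small[OF lt] small(1)[OF V2] by auto
      let ?\<sigma> = "\<sigma>'(16 := \<sigma>' 22 div \<sigma>' 3, 17 := \<sigma>' 22 mod \<sigma>' 3, 14 := \<sigma>' 22)"
      show "det x (IfEq 17 2 (Seq (Cp 22 16) (Seq (MUL 11 23 8 13) (Cp 23 11))) Skip)
         (\<lambda>\<sigma>'' p''. p'' = p \<and> kst (\<sigma>''(15 := Suc k)) \<and> 0 < (\<sigma>''(15 := Suc k)) 22 \<and> (\<sigma>''(15 := Suc k)) 22 \<le> ?i \<and>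
           (\<sigma>''(15 := Suc k)) 23 * pw BV ((\<sigma>''(15 := Suc k)) 22) = pw BV ?i \<and>
           (odd ((\<sigma>''(15 := Suc k)) 22) \<or> (\<sigma>''(15 := Suc k)) 22 * 2 ^ Suc k \<le> ?i)) ?\<sigma> p'"
      proof (cases "even (\<sigma>' 22)")
        case False
        then have "\<sigma>' 22 mod 2 \<noteq> 0" by presburger
        then show ?thesis using I False k' by (auto simp: kst_def)
      next
        case True
        have pe: "pw BV ?i = \<sigma>' 23 * BV * pw BV (\<sigma>' 22 div 2)"
          using I(5) pw_even[OF I(3) True] by simp
        \<comment> \<open>The remaining power is positive, so the partial product does not exceed
          the final one and stays below the cap.\<close>
        have "0 < pw BV (\<sigma>' 22 div 2)" using BV_bounds by (simp add: pw_def)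
        then have "\<sigma>' 23 * BV * 1 \<le> pw BV ?i" unfolding pe by (intro mult_le_mono2) simp
        then have c: "\<sigma>' 23 * BV < CV" using pwi by simp
        have j: "0 < \<sigma>' 22 div 2" using True I(3) by (metis div_greater_zero_iff dvd_imp_le zero_less_numeral)
        have "\<sigma>' 22 * 2 ^ k \<le> ?i" using I(6) True by simp
        moreover have "\<sigma>' 22 = 2 * (\<sigma>' 22 div 2)" using True by simp
        ultimately have h: "(\<sigma>' 22 div 2) * 2 ^ Suc k \<le> ?i" by (metis mult.assoc mult.commute power_Suc)
        have "\<sigma>' 22 mod \<sigma>' 3 = \<sigma>' 2" using True k' by simp
        then show ?thesis using True
          by simp (rule det_MUL; use I k' c j h pe in \<open>auto simp: kst_def div_le_dividend intro: order_trans[OF div_le_dividend]\<close>)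
      qed
    qed auto
  next
    case (6 \<sigma>' p')
    then have I: "p' = p" "0 < \<sigma>' 22" "\<sigma>' 23 * pw BV (\<sigma>' 22) = pw BV ?i" "odd (\<sigma>' 22) \<or> \<sigma>' 22 * 2 ^ ?i \<le> ?i"
      by auto
    have "?i < 2 ^ ?i" by (rule less_exp)
    also have "\<dots> \<le> \<sigma>' 22 * 2 ^ ?i" using I(2) by simp
    finally have "odd (\<sigma>' 22)" using I(4) by simp
    then show ?case using I pw_odd[of "\<sigma>' 22" BV] by simp
  qed (use i k kstD[OF k] small in \<open>auto simp: kst_def\<close>)
qed

text \<open>As \<open>N\<close> is at least 1, the intermediate values of Horner's scheme grow
  towards the code, so its bound covers them.\<close>

lemma det_ENC:
  assumes k: "kst \<sigma>" and c: "code (\<sigma> rQ', \<sigma> rI', \<sigma> rL', \<sigma> rR') < N ^ 4"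
  shows "det x ENC (\<lambda>\<sigma>' p'. p' = p \<and> \<sigma>' rX = code (\<sigma> rQ', \<sigma> rI', \<sigma> rL', \<sigma> rR')) \<sigma> p"
proof -
  note k' = kstD[OF k]
  have le: "m \<le> m * N" for m using N2 by simp
  let ?a = "\<sigma> 25 * N" let ?b = "(?a + \<sigma> 26) * N" let ?c = "(?b + \<sigma> 27) * N"
  have "?c + \<sigma> 28 < N ^ 4" using c by simp
  moreover have "?a + \<sigma> 26 \<le> ?b" "?b + \<sigma> 27 \<le> ?c" using le by auto
  ultimately have "?a + \<sigma> 26 < CV" "?b + \<sigma> 27 < CV" "?c + \<sigma> 28 < CV" using BV_bounds by linarith+
  moreover have "N < BV + 1" using small(2)[OF N_powers(1)] .
  ultimately show ?thesis
    unfolding ENC_def det_Seq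
    using k' by (intro det_MUL; simp; intro det_MUL; simp; intro det_MUL; simp)
qed

lemma det_MVI:
  assumes k: "kst \<sigma>" and "\<sigma> rI \<le> length x + 1" "\<sigma> rOK = 0" "di \<in> {-1, 0, 1}"
  shows "det x (MVI di) (\<lambda>\<sigma>' p'. p' = p \<and>
     (if 0 \<le> int (\<sigma> rI) + di \<and> int (\<sigma> rI) + di \<le> int (length x) + 1
      then \<sigma>' rOK = 1 \<and> \<sigma>' rI' = nat (int (\<sigma> rI) + di) else \<sigma>' rOK = 0)) \<sigma> p"
proof -
  note k' = kstD[OF k]
  have I: "\<sigma> 31 < N" using assms(2) N(3) by simp
  then have s: "\<sigma> 31 < BV + 1" "Suc (\<sigma> 31) < CV"
    using small(2)[of "\<sigma> 31"] small(1)[of "Suc (\<sigma> 31)"] N_powers by linarith+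
  consider "di = 0" | "di = 1" | "di = -1" using assms(4) by auto
  then show ?thesis
  proof cases
    case 1
    then show ?thesis using assms by (simp add: MVI_def)
  next
    case 2
    then show ?thesis using assms k' s by (auto simp: MVI_def nat_add_distrib)
  next
    case 3
    show ?thesis
    proof (cases "\<sigma> 31 = 0")
      case True
      then show ?thesis using 3 assms k' by (simp add: MVI_def)
    next
      case False
      then show ?thesis using 3 assms(2) k' s(1)
        by (auto simp: MVI_def nat_diff_distrib' intro!: det_PRED)
    qed
  qed
qed

text \<open>The new numbers are computed even when the move is impossible and \<open>rOK\<close>
  ends up 0. The cap checks must therefore pass for arbitrary arguments below \<open>N\<close>, not
  just for successors that are vertices.\<close>

lemma det_MVW:
  assumes k: "kst \<sigma>" and lr: "\<sigma> rL < N" "\<sigma> rR < N" and rq: "\<sigma> rRQ = \<sigma> rR div b"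
    and "q' < N" "g' < b" "dw \<in> {-1, 0, 1}"
  shows "det x (MVW q' g' dw) (\<lambda>\<sigma>' p'. p' = p \<and> \<sigma>' rQ' = q' \<and>
     \<sigma>' rL' = (if dw = 0 then \<sigma> rL else if dw = 1 then \<sigma> rL * b + g' else \<sigma> rL div b) \<and>
     \<sigma>' rR' = (if dw = 0 then \<sigma> rR div b * b + g' else if dw = 1 then \<sigma> rR div b else (\<sigma> rR div b * b + g') * b + \<sigma> rL mod b) \<and>
     \<sigma>' rOK = (if dw = -1 \<and> \<sigma> rL div b = 0 then 0 else \<sigma> rOK)) \<sigma> p"
proof -
  note k' = kstD[OF k]
  have rd: "\<sigma> 33 div b * b \<le> \<sigma> 33" by simp
  then have r1: "\<sigma> 33 div b * b + g' < N + N" using lr assms(6) bN by linarith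
  have ll: "\<sigma> 32 * b + g' \<le> N * N + N" using mult_le_mono[of "\<sigma> 32" N b N] lr bN assms(6) by linarith
  have lm: "\<sigma> 32 mod b < b" using b by simp
  have r2: "(\<sigma> 33 div b * b + g') * b + \<sigma> 32 mod b \<le> (N + N) * N + N"
    using mult_le_mono[of "\<sigma> 33 div b * b + g'" "N + N" b N] r1 bN lm by linarith
  have caps: "q' < CV" "g' < CV" "b < Suc BV" "b < CV" "\<sigma> 33 div b * b + g' < CV" "\<sigma> 33 div b * b < CV"
      "\<sigma> 32 * b + g' < CV" "\<sigma> 32 * b < CV" "\<sigma> 32 < Suc BV" "\<sigma> 32 < CV"
      "(\<sigma> 33 div b * b + g') * b + \<sigma> 32 mod b < CV" "(\<sigma> 33 div b * b + g') * b < CV"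
    using r1 ll r2 lr bN assms(5,6) N_powers BV_bounds by linarith+
  have b0: "0 < b" using b by simp
  consider "dw = 0" | "dw = 1" | "dw = -1" using assms(7) by auto
  then show ?thesis
  proof cases
    case 1
    show ?thesis unfolding MVW_def
      by (simp add: 1 k' caps rq | rule det_setN det_MUL)+
  next
    case 2
    show ?thesis unfolding MVW_def
      by (simp add: 2 k' caps rq | rule det_setN det_MUL)+
  next
    case 3
    show ?thesis unfolding MVW_def
      by (simp add: 3 k' caps rq b0 | rule conjI impI det_setN det_MUL det_DIVM)+
  qed
qed

end

lemma det_use:
  assumes "det x c Q0 \<sigma> p" "writes c \<subseteq> W"
    "\<And>\<sigma>' p'. Q0 \<sigma>' p' \<Longrightarrow> (\<And>r. r \<notin> W \<Longrightarrow> \<sigma>' r = \<sigma> r) \<Longrightarrow> Q \<sigma>' p'"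
  shows "det x c Q \<sigma> p"
  using assms(1) by (rule det_conseq) (use assms(2,3) in blast)

lemma det_Seq_fun: "det x (Seq c d) Q = det x c (det x d Q)"
  by (intro ext) simp

context nl_run
begin

abbreviation cur :: "(nat \<Rightarrow> nat) \<Rightarrow> vtx" where
  "cur \<sigma> \<equiv> (\<sigma> rQ, \<sigma> rI, \<sigma> rL, \<sigma> rR)"

abbreviation new :: "(nat \<Rightarrow> nat) \<Rightarrow> vtx" where
  "new \<sigma> \<equiv> (\<sigma> rQ', \<sigma> rI', \<sigma> rL', \<sigma> rR')"

text \<open>If the transition does not apply, the primed registers may contain anything, so only the
  flag is specified.\<close>

lemma det_TR:
  assumes k: "kst \<sigma>" and t: "t \<in> set ts" and p: "\<sigma> rI = p" "p \<le> length x + 1" and lr: "\<sigma> rL < N" "\<sigma> rR < N"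
  shows "det x (TR t) (\<lambda>\<sigma>' p'. p' = p \<and> (case nxt b x t (cur \<sigma>) of None \<Rightarrow> \<sigma>' rOK = 0
     | Some v \<Rightarrow> \<sigma>' rOK = 1 \<and> new \<sigma>' = v)) \<sigma> p"
proof -
  obtain q a g q' g' di dw where tt: "t = (q, a, g, q', g', di, dw)" by (metis prod_cases7)
  have "(q, a, g, q', g', di, dw) \<in> delta M" using t ts(1) tt by simp
  note tb = trans_bounds[OF this]
  note k' = kstD[OF k]
  have caps: "q < CV" "g < CV" "\<sigma> 33 < Suc BV" "\<sigma> 33 < CV" "b < CV" "q' < N"
    using tb N(2) bN lr N_powers BV_bounds by linarith+
  have b0: "0 < b" using b by simp
  let ?Q = "\<lambda>\<sigma>' p'. p' = p \<and> (case nxt b x t (cur \<sigma>) of None \<Rightarrow> \<sigma>' rOK = 0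
     | Some v \<Rightarrow> \<sigma>' rOK = 1 \<and> new \<sigma>' = v)"
  let ?c = "\<sigma> rQ = q \<and> read_input x p = a \<and> \<sigma> rR mod b = g"
  let ?s = "\<sigma>(24 := 0, 10 := q, 18 := \<sigma> 33 div b, 19 := \<sigma> 33 mod b, 14 := \<sigma> 33, 10 := g)"
  have inner: "det x (Seq (MVI di) (MVW q' g' dw)) ?Q ?s p" if c: ?c
    unfolding det_Seq
  proof (rule det_use[OF det_MVI writes_MVI])
    show "kst ?s" using k by (rule kst_cong) simp
    fix \<sigma>1 p1
    assume 1: "p1 = p \<and> (if 0 \<le> int (?s rI) + di \<and> int (?s rI) + di \<le> int (length x) + 1
        then \<sigma>1 rOK = 1 \<and> \<sigma>1 rI' = nat (int (?s rI) + di) else \<sigma>1 rOK = 0)"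
      and f1: "\<And>r. r \<notin> {14, 24, 26} \<Longrightarrow> \<sigma>1 r = ?s r"
    show "det x (MVW q' g' dw) ?Q \<sigma>1 p1"
    proof (rule det_use[OF det_MVW writes_MVW])
      show "kst \<sigma>1" using k by (rule kst_cong) (simp add: f1)
      fix \<sigma>2 p2
      assume 2: "p2 = p1 \<and> \<sigma>2 rQ' = q' \<and>
         \<sigma>2 rL' = (if dw = 0 then \<sigma>1 rL else if dw = 1 then \<sigma>1 rL * b + g' else \<sigma>1 rL div b) \<and>
         \<sigma>2 rR' = (if dw = 0 then \<sigma>1 rR div b * b + g' else if dw = 1 then \<sigma>1 rR div b else (\<sigma>1 rR div b * b + g') * b + \<sigma>1 rL mod b) \<and>
         \<sigma>2 rOK = (if dw = -1 \<and> \<sigma>1 rL div b = 0 then 0 else \<sigma>1 rOK)"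
        and f2: "\<And>r. r \<notin> {10, 11, 13, 14, 20, 21, 24, 25, 27, 28} \<Longrightarrow> \<sigma>2 r = \<sigma>1 r"
      have f: "\<sigma>1 32 = \<sigma> 32" "\<sigma>1 33 = \<sigma> 33" "\<sigma>2 26 = \<sigma>1 26" using f1[of 32] f1[of 33] f2[of 26] by auto
      let ?ok = "0 \<le> int p + di \<and> int p + di \<le> int (length x) + 1"
      have I: "if ?ok then \<sigma>1 24 = 1 \<and> \<sigma>1 26 = nat (int p + di) else \<sigma>1 24 = 0" "p1 = p"
        using 1 p by auto
      show "?Q \<sigma>2 p2"
      proof (cases "?ok \<and> (dw = -1 \<longrightarrow> \<sigma> 32 div b \<noteq> 0)")
        case True
        then show ?thesis using 2 I f c p by (simp add: tt)
      next
        case False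
        then have "nxt b x t (cur \<sigma>) = None" using p by (auto simp: tt)
        moreover have "\<sigma>2 24 = 0" using False 2 I f by (auto split: if_splits)
        ultimately show ?thesis using 2 I by simp
      qed
    qed (use f1[of 32] f1[of 33] f1[of 18] lr caps tb in auto)
  qed (use p tb in auto)
  have none: "nxt b x t (cur \<sigma>) = None" if "\<not> ?c" using that p by (auto simp: tt)
  show ?thesis
  proof (cases "\<sigma> 30 = q \<and> read_input x p = a")
    case False
    then have "nxt b x t (cur \<sigma>) = None" using none by blast
    then show ?thesis unfolding tt TR.simps using False tt
      by (auto simp: k' caps intro!: det_setN)
  next
    case True
    let ?W = "IfEq rRM rT (Seq (MVI di) (MVW q' g' dw)) Skip"
    have 1: "det x ?W ?Q ?s p"
    proof (cases "\<sigma> 33 mod b = g")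
      case T2: True
      then show ?thesis using inner True by (simp del: det_Seq)
    next
      case False
      then have "nxt b x t (cur \<sigma>) = None" using none by blast
      then show ?thesis using False by simp
    qed
    have 2: "det x (setN rT g) (det x ?W ?Q)
        (\<sigma>(24 := 0, 10 := q, 18 := \<sigma> 33 div b, 19 := \<sigma> 33 mod b, 14 := \<sigma> 33)) p"
      by (rule det_setN) (use 1 k' caps in \<open>simp_all del: det_simps\<close>)
    have 3: "det x (DIVM rRQ rRM rR rBB rK2) (det x (setN rT g) (det x ?W ?Q)) (\<sigma>(24 := 0, 10 := q)) p"
      by (rule det_DIVM) (use 2 k' caps b0 in \<open>simp_all del: det_simps\<close>)
    have 4: "det x (IfEq rQ rT (IfSym a (Seq (DIVM rRQ rRM rR rBB rK2) (Seq (setN rT g) ?W)) Skip) Skip) ?Q (\<sigma>(24 := 0, 10 := q)) p"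
      using True 3 by (simp add: det_Seq_fun)
    have "det x (setN rT q) (det x (IfEq rQ rT (IfSym a (Seq (DIVM rRQ rRM rR rBB rK2) (Seq (setN rT g) ?W)) Skip) Skip) ?Q) (\<sigma>(24 := 0)) p"
      by (rule det_setN) (use 4 k' caps in \<open>simp_all del: det_simps\<close>)
    then show ?thesis unfolding tt TR.simps det_Seq_fun det_Zero .
  qed
qed

lemma STEP_Some:
  assumes k: "kst \<sigma>" and t: "t \<in> set ts" and p: "\<sigma> rI = p" "p \<le> length x + 1" and lr: "\<sigma> rL < N" "\<sigma> rR < N"
    and nx: "nxt b x t (cur \<sigma>) = Some v"
  shows "det x (STEP t) (\<lambda>\<sigma>' p'. p' = fst (snd v) \<and> new \<sigma>' = v) \<sigma> p"
proof -
  obtain q a g q' g' di dw where tt: "t = (q, a, g, q', g', di, dw)" by (metis prod_cases7)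
  have "(q, a, g, q', g', di, dw) \<in> delta M" using t ts(1) tt by simp
  note tb = trans_bounds[OF this]
  have di: "0 \<le> int p + di" "int p + di \<le> int (length x) + 1" "fst (snd v) = nat (int p + di)"
    using nx p tt by (auto split: if_splits)
  show ?thesis unfolding tt STEP.simps det_Seq unfolding tt[symmetric]
  proof (rule det_use[OF det_TR[OF k t p lr] writes_TR])
    fix \<sigma>1 p1 assume 1: "p1 = p \<and> (case nxt b x t (cur \<sigma>) of None \<Rightarrow> \<sigma>1 rOK = 0 | Some v \<Rightarrow> \<sigma>1 rOK = 1 \<and> new \<sigma>1 = v)"
      and f: "\<And>r. r \<notin> {10..<29} \<Longrightarrow> \<sigma>1 r = \<sigma> r"
    have "\<sigma>1 2 = 0" using f[of 2] kstD[OF k] by simp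
    then show "det x (IfEq rOK rZR Fail (if di = 1 then InR else if di = - 1 then InL else Skip))
        (\<lambda>\<sigma>' p'. p' = fst (snd v) \<and> new \<sigma>' = v) \<sigma>1 p1"
      using 1 nx di tb(5) by (auto simp: nat_add_distrib nat_diff_distrib')
  qed
qed

text \<open>\<open>det\<close> can express success only; that a wrong transition dies is a statement
  about all its runs.\<close>

lemma STEP_None:
  assumes k: "kst \<sigma>" and t: "t \<in> set ts" and p: "\<sigma> rI = p" "p \<le> length x + 1" and lr: "\<sigma> rL < N" "\<sigma> rR < N"
    and nx: "nxt b x t (cur \<sigma>) = None" and ex: "ex x (STEP t) \<sigma> p h \<sigma>' p'"
  shows False
proof -
  obtain q a g q' g' di dw where tt: "t = (q, a, g, q', g', di, dw)" by (metis prod_cases7)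
  obtain h1 h2 \<sigma>1 p1 where e: "ex x (TR t) \<sigma> p h1 \<sigma>1 p1"
      "ex x (IfEq rOK rZR Fail (if di = 1 then InR else if di = - 1 then InL else Skip)) \<sigma>1 p1 h2 \<sigma>' p'"
    using ex unfolding tt STEP.simps ex_Seq by blast
  have "\<sigma>1 24 = 0" using det_ex_Nil[OF det_TR[OF k t p lr] e(1)] nx by simp
  moreover have "2 \<notin> writes (TR t)" using writes_TR[of t] by force
  then have "\<sigma>1 2 = 0" using ex_frame[OF e(1), of 2] kstD[OF k] by simp
  ultimately show False using e(2) by simp
qed

text \<open>\<open>rST\<close> counts completed steps from 0 and is incremented only after the body,
  so the vertex just reached is at position \<open>Suc\<close> of it.\<close>

lemma det_TAIL:
  assumes k: "kst \<sigma>" and c: "code (new \<sigma>) < N ^ 4" and st: "\<sigma> rST < N ^ 4"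
    and w: "\<sigma> rWT + code (new \<sigma>) * pw BV (Suc (\<sigma> rST)) < CV"
  shows "det x TAIL (\<lambda>\<sigma>' p'. p' = p \<and> new \<sigma>' = new \<sigma> \<and> \<sigma>' rX = code (new \<sigma>) \<and>
     \<sigma>' rWT = \<sigma> rWT + code (new \<sigma>) * pw BV (Suc (\<sigma> rST))) \<sigma> p"
  unfolding TAIL_def det_Seq_fun
proof (rule det_use[OF det_ENC[OF k c] writes_ENC])
  let ?G = "\<lambda>\<sigma>' p'. p' = p \<and> new \<sigma>' = new \<sigma> \<and> \<sigma>' rX = code (new \<sigma>) \<and>
     \<sigma>' rWT = \<sigma> rWT + code (new \<sigma>) * pw BV (Suc (\<sigma> rST))"
  fix \<sigma>1 p1
  assume 1: "p1 = p \<and> \<sigma>1 rX = code (new \<sigma>)" and f1: "\<And>r. r \<notin> {11, 12, 13, 29} \<Longrightarrow> \<sigma>1 r = \<sigma> r"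
  have cap: "Suc (\<sigma> 35) < CV" using small(1)[of "Suc (\<sigma> 35)"] st by simp
  let ?s = "\<sigma>1(36 := Suc (\<sigma> 35))"
  have ks: "kst ?s" using k by (rule kst_cong) (simp add: f1)
  have "det x PWR (det x (MUL rT1 rPW rX rK1) (det x (CAdd rWT rT1) ?G)) ?s p1"
  proof (rule det_use[OF det_PWR[OF ks] writes_PWR])
    fix \<sigma>2 p2
    assume 2: "p2 = p1 \<and> \<sigma>2 rPW = pw BV (?s rII)"
      and f2: "\<And>r. r \<notin> {11, 13, 14, 15, 16, 17, 22, 23} \<Longrightarrow> \<sigma>2 r = ?s r"
    have k2: "kst \<sigma>2" using ks by (rule kst_cong) (simp add: f2)
    have X: "\<sigma>2 29 = code (new \<sigma>)" "\<sigma>2 23 = pw BV (Suc (\<sigma> 35))" using f2[of 29] 1 2 by auto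
    have W: "\<sigma>2 34 = \<sigma> 34" "new \<sigma>2 = new \<sigma>" using f2 f1 by auto
    show "det x (MUL rT1 rPW rX rK1) (det x (CAdd rWT rT1) ?G) \<sigma>2 p2"
    proof (rule det_MUL)
      show "\<sigma>2 29 < \<sigma>2 1" using kstD[OF k2] X c small(3)[of "code (new \<sigma>)"] by simp
      show "\<sigma>2 23 * \<sigma>2 29 < \<sigma>2 0" using kstD[OF k2] X w by (simp add: mult.commute)
      show "det x (CAdd rWT rT1) ?G (\<sigma>2(11 := \<sigma>2 23 * \<sigma>2 29, 13 := \<sigma>2 29)) p2"
        using kstD[OF k2] X W w 1 2 by (simp add: mult.commute)
    qed auto
  qed (use st in auto)
  then show "det x (Cp rII rST) (det x (CInc rII) (det x PWR (det x (MUL rT1 rPW rX rK1) (det x (CAdd rWT rT1) ?G)))) \<sigma>1 p1"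
    using f1 cap kstD[OF k] by simp
qed

lemma wt_cap:
  assumes "walk js = Some v" "length js \<le> N ^ 4"
  shows "wt js \<le> N ^ 4 * (N ^ 4 * BV ^ e)"
  using wt_bound[OF assms e] BV_bounds by simp

lemma V3_cap: "N ^ 4 * (N ^ 4 * (N ^ 4 * BV ^ e)) < CV" "N ^ 4 * (N ^ 4 * BV ^ e) < CV"
proof -
  have "N ^ 4 * (N ^ 4 * N ^ 4) \<le> BV * BV"
    using BV_bounds DV by (intro mult_le_mono) auto
  then have "N ^ 4 * (N ^ 4 * N ^ 4) * BV ^ e \<le> BV * BV * BV ^ e" by (intro mult_le_mono1)
  also have "\<dots> = BV ^ (e + 2)" by (simp add: power_add power2_eq_square)
  also have "\<dots> < CV" unfolding CV_def using BV_bounds V2 by (intro power_strict_increasing) auto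
  finally show 1: "N ^ 4 * (N ^ 4 * (N ^ 4 * BV ^ e)) < CV" by (simp add: mult.assoc)
  have "1 \<le> N ^ 4" using V2 by simp
  from mult_le_mono1[OF this, of "N ^ 4 * (N ^ 4 * BV ^ e)"]
  show "N ^ 4 * (N ^ 4 * BV ^ e) < CV" using 1 unfolding mult_1 by (rule le_less_trans)
qed

lemma nx_ts: "nx j v = Some w \<longleftrightarrow> j < length ts \<and> nxt b x (ts ! j) v = Some w"
  by (simp add: nx_def)

text \<open>The successful guesses are the encodings of all walks of length \<open>rD\<close>, not
  only of the lightest ones. The invariant ties the real input head to the input component of the
  current vertex, so that each step reads the right symbol.\<close>

lemma runs_PATH:
  assumes k: "kst \<sigma>" and d: "\<sigma> rD < N ^ 4"
  shows "runs x (PATH (start M) ts) {js. length js = \<sigma> rD \<and> (\<exists>v. walk js = Some v)} (\<lambda>js. concat (map tag js))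
     (\<lambda>js \<sigma>' p'. \<exists>v. walk js = Some v \<and> new \<sigma>' = v \<and> p' = fst (snd v) \<and> \<sigma>' rX = code v \<and> \<sigma>' rWT = wt js) \<sigma> 0"
  unfolding PATH_def
proof (rule det_runs)
  let ?J = "\<lambda>js \<sigma>' p'. \<exists>v. walk js = Some v \<and> new \<sigma>' = v \<and> p' = fst (snd v) \<and> \<sigma>' rX = code v \<and> \<sigma>' rWT = wt js"
  let ?R = "\<lambda>\<sigma>' p'. runs x (FOR rST rD (PBODY ts)) {js. length js = \<sigma> rD \<and> (\<exists>v. walk js = Some v)}
     (\<lambda>js. concat (map tag js)) ?J \<sigma>' p'"
  let ?s = "\<sigma>(25 := start M, 26 := 0, 27 := 1, 28 := 0, 34 := 0)"
  have ks: "kst ?s" using k by (rule kst_cong) simp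
  have v0c: "code v0 < N ^ 4" using code_less[of "[]"] by simp
  then have c: "code (new ?s) < N ^ 4" by (simp add: v0_def)
  have "det x ENC ?R ?s 0"
  proof (rule det_use[OF det_ENC[OF ks c] writes_ENC])
    fix \<sigma>1 :: "nat \<Rightarrow> nat" and p1 :: nat
    assume 1: "p1 = 0 \<and> \<sigma>1 rX = code (new ?s)" and f1: "\<And>r. r \<notin> {11, 12, 13, 29} \<Longrightarrow> \<sigma>1 r = ?s r"
    let ?I = "\<lambda>js \<sigma>' p'. ?J js \<sigma>' p' \<and> kst \<sigma>'"
    have D: "\<sigma>1 51 = \<sigma> 51" using f1[of 51] by simp
    have k1: "kst \<sigma>1" using ks by (rule kst_cong) (simp add: f1)
    have wf: "wfc (For rST rD (PBODY ts))"
      using capped_wfc[OF capped_PBODY] by (auto dest!: subsetD[OF writes_PBODY])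
    have "runs x (FOR rST rD (PBODY ts)) {js. length js = \<sigma>1 rD \<and> (\<exists>v. walk js = Some v)}
     (\<lambda>js. concat (map tag js)) ?I \<sigma>1 p1"
    proof (rule runs_FOR[OF wf])
      show "\<sigma>1 51 < \<sigma>1 1" using d D kstD[OF k1] small(3)[of "\<sigma> 51"] by simp
      show "?I [] (\<sigma>1(35 := 0)) p1"
      proof -
        have "new \<sigma>1 = v0" "\<sigma>1 34 = 0" "fst (snd v0) = 0" using f1 by (simp_all add: v0_def)
        moreover have "\<sigma>1 29 = code v0" using 1 by (simp add: v0_def)
        moreover have "kst (\<sigma>1(35 := 0))" using k1 by (rule kst_cong) simp
        ultimately show ?thesis using 1 by simp
      qed
      show "\<exists>v. walk as = Some v" if "\<exists>v. walk (as @ [a]) = Some v" for as a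
        using that by (auto simp: go_from_append bind_eq_Some_conv)
    next
      fix js \<sigma>' p'
      assume len: "length js < \<sigma>1 51" and I: "?I js \<sigma>' p'" and i: "\<sigma>' 35 = length js"
      obtain v where v: "walk js = Some v" "new \<sigma>' = v" "p' = fst (snd v)" "\<sigma>' 34 = wt js" using I by blast
      have k2: "kst \<sigma>'" using I by blast
      let ?A = "{j. \<exists>v. walk (js @ [j]) = Some v}"
      have A: "j \<in> ?A \<longleftrightarrow> (\<exists>w. nx j v = Some w)" for j using v by (simp add: go_from_append)
      define \<tau> where "\<tau> = \<sigma>'(30 := \<sigma>' 25, 31 := \<sigma>' 26, 32 := \<sigma>' 27, 33 := \<sigma>' 28)"
      have k3: "kst \<tau>" using k2 by (rule kst_cong) (simp add: \<tau>_def)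
      have cv: "cur \<tau> = v" using v by (simp add: \<tau>_def)
      have vb: "\<tau> 31 = p'" "p' \<le> length x + 1" "\<tau> 32 < N" "\<tau> 33 < N"
        using walk_bounds[of js "\<sigma>' 25" "\<sigma>' 26" "\<sigma>' 27" "\<sigma>' 28"] v by (auto simp: \<tau>_def)
      let ?Q = "\<lambda>j \<sigma>'' p''. \<exists>w. nx j v = Some w \<and> p'' = fst (snd w) \<and> new \<sigma>'' = w"
      have sel: "runs x (select (map STEP ts)) ?A tag ?Q \<tau> p'"
      proof (rule runs_select)
        fix j assume "j \<in> ?A"
        then obtain w where w: "nx j v = Some w" using A by blast
        then have j: "j < length ts" "nxt b x (ts ! j) v = Some w" by (auto simp: nx_ts)
        have "det x (STEP (ts ! j)) (\<lambda>\<sigma>'' p''. p'' = fst (snd w) \<and> new \<sigma>'' = w) \<tau> p'"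
          using STEP_Some[OF k3 nth_mem[OF j(1)] vb] j(2) cv by simp
        then have "det x (STEP (ts ! j)) (?Q j) \<tau> p'" by (rule det_conseq) (use w in blast)
        then show "j < length (map STEP ts) \<and> det x (map STEP ts ! j) (?Q j) \<tau> p'" using j by simp
      next
        fix j h \<sigma>'' p'' assume j: "j < length (map STEP ts)" "j \<notin> ?A" "ex x (map STEP ts ! j) \<tau> p' h \<sigma>'' p''"
        then have j1: "j < length ts" by simp
        have "nxt b x (ts ! j) v = None" using j A[of j] by (auto simp: nx_ts)
        then show False using STEP_None[OF k3 nth_mem[OF j1] vb] j cv by simp
      qed
      have "runs x (Seq (select (map STEP ts)) TAIL) ?A tag (\<lambda>a \<sigma>'' p''. ?I (js @ [a]) (\<sigma>''(35 := Suc (length js))) p'') \<tau> p'"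
      proof (rule runs_det[OF sel])
        fix j \<sigma>2 p2
        assume j: "j \<in> ?A" "?Q j \<sigma>2 p2" "\<forall>r. r \<notin> writes (select (map STEP ts)) \<longrightarrow> \<sigma>2 r = \<tau> r"
        have "writes (select (map STEP ts)) \<subseteq> {10..<29}"
          by (rule writes_select) (auto dest: subsetD[OF writes_STEP])
        then have f2: "\<sigma>2 r = \<tau> r" if "r \<notin> {10..<29}" for r using j(3) that by blast
        obtain w where w: "nx j v = Some w" "p2 = fst (snd w)" "new \<sigma>2 = w" using j(2) by blast
        have wk: "walk (js @ [j]) = Some w" using v w by (simp add: go_from_append)
        have k4: "kst \<sigma>2" using k3 by (rule kst_cong) (simp add: f2)
        have cw: "code (new \<sigma>2) < N ^ 4" using code_less[OF wk] w by simp
        have st: "\<sigma>2 35 = length js" "\<sigma>2 34 = wt js" using f2[of 35] f2[of 34] i v by (auto simp: \<tau>_def)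
        have "loc (js @ [j]) (Suc (length js)) = code w" using wk by (simp add: loc_def)
        then have wts: "wt (js @ [j]) = wt js + code w * pw BV (Suc (length js))" by (simp add: wt_snoc)
        have lj: "Suc (length js) \<le> N ^ 4" "length js < N ^ 4" using len D d by auto
        have "wt (js @ [j]) < CV" using wt_cap[OF wk] lj V3_cap(2) by simp
        then have cap: "\<sigma>2 rWT + code (new \<sigma>2) * pw BV (Suc (\<sigma>2 rST)) < CV" using wts st w by simp
        show "det x TAIL (\<lambda>\<sigma>'' p''. ?I (js @ [j]) (\<sigma>''(35 := Suc (length js))) p'') \<sigma>2 p2"
        proof (rule det_use[OF det_TAIL[OF k4 cw _ cap] writes_TAIL])
          fix \<sigma>3 p3 assume 3: "p3 = p2 \<and> new \<sigma>3 = new \<sigma>2 \<and> \<sigma>3 rX = code (new \<sigma>2) \<and>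
             \<sigma>3 rWT = \<sigma>2 rWT + code (new \<sigma>2) * pw BV (Suc (\<sigma>2 rST))" "\<And>r. r \<notin> {10..<37} \<Longrightarrow> \<sigma>3 r = \<sigma>2 r"
          have "kst (\<sigma>3(35 := Suc (length js)))" using k4 by (rule kst_cong) (simp add: 3(2))
          then show "?I (js @ [j]) (\<sigma>3(35 := Suc (length js))) p3"
            using 3(1) w wk wts st by auto
        qed (use st lj in simp)
      qed auto
      then show "runs x (PBODY ts) ?A tag (\<lambda>a \<sigma>'' p''. ?I (js @ [a]) (\<sigma>''(35 := Suc (length js))) p'') \<sigma>' p'"
        unfolding PBODY_def by (intro det_runs) (simp add: CPY_def \<tau>_def)
    qed auto
    then show "?R \<sigma>1 p1" unfolding D by (rule runs_conseq) blast
  qed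
  moreover have "start M < CV"
    using wf N(2) N_powers BV_bounds unfolding wf_ntm_def by linarith
  ultimately show "det x (Seq (setN rQ' (start M)) (Seq (Zero rI') (Seq (One rL') (Seq (Zero rR') (Seq (Zero rWT) ENC))))) ?R \<sigma> 0"
    unfolding det_Seq_fun using kstD[OF k] by (intro det_setN) auto
qed

definition edge :: "vtx \<Rightarrow> nat \<Rightarrow> bool" where
  "edge v u \<longleftrightarrow> (\<exists>j w. nx j v = Some w \<and> code w = u)"

lemma edge_ts: "edge v u \<longleftrightarrow> (\<exists>t \<in> set ts. \<exists>w. nxt b x t v = Some w \<and> code w = u)"
  unfolding edge_def nx_ts by (metis in_set_conv_nth)

section \<open>One pass over a layer\<close>

definition best_is :: "nat set \<Rightarrow> (nat \<Rightarrow> nat) \<Rightarrow> bool" where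
  "best_is A \<sigma> \<longleftrightarrow> finite A \<and> \<sigma> rHAS = of_bool (A \<noteq> {}) \<and> (A \<noteq> {} \<longrightarrow> \<sigma> rBEST = Min A)"

text \<open>\<open>A\<close> is the set of weights recorded so far for the candidate
  \<open>rV\<close>. Several transitions from one vertex may lead there; inserting the same weight
  again does no harm.\<close>

lemma det_TRY:
  assumes k: "kst \<sigma>" and t: "t \<in> set ts" and w: "walk js = Some (cur \<sigma>)" and A: "best_is A \<sigma>" and p: "\<sigma> rI = p"
  shows "det x (TRY t) (\<lambda>\<sigma>' p'. p' = p \<and>
     best_is (if \<exists>w. nxt b x t (cur \<sigma>) = Some w \<and> code w = \<sigma> rV then insert (\<sigma> rWT) A else A) \<sigma>') \<sigma> p"
proof -
  note wb = walk_bounds[OF w]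
  show ?thesis unfolding TRY_def det_Seq_fun
  proof (rule det_use[OF det_TR[OF k t p _ wb(3,4)] writes_TR])
    show "p \<le> length x + 1" using wb p by simp
    fix \<sigma>1 p1
    assume 1: "p1 = p \<and> (case nxt b x t (cur \<sigma>) of None \<Rightarrow> \<sigma>1 rOK = 0 | Some v \<Rightarrow> \<sigma>1 rOK = 1 \<and> new \<sigma>1 = v)"
      and f1: "\<And>r. r \<notin> {10..<29} \<Longrightarrow> \<sigma>1 r = \<sigma> r"
    let ?B = "if \<exists>w. nxt b x t (cur \<sigma>) = Some w \<and> code w = \<sigma> rV then insert (\<sigma> rWT) A else A"
    let ?P = "IfEq rX rV (IfEq rHAS rZR (Seq (Cp rBEST rWT) (One rHAS)) (IfLt rWT rBEST (Cp rBEST rWT) Skip)) Skip"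
    have k1: "kst \<sigma>1" using k by (rule kst_cong) (simp add: f1)
    have z: "\<sigma>1 2 = 0" using kstD[OF k1] by simp
    show "det x (IfEq rOK rZR Skip (Seq ENC ?P)) (\<lambda>\<sigma>' p'. p' = p \<and> best_is ?B \<sigma>') \<sigma>1 p1"
    proof (cases "nxt b x t (cur \<sigma>)")
      case None
      then show ?thesis using 1 z A f1 by (simp add: best_is_def)
    next
      case (Some v)
      obtain j where "j < length ts" "ts ! j = t" using t by (metis in_set_conv_nth)
      then have "walk (js @ [j]) = Some v" using w Some by (simp add: go_from_append nx_def)
      then have cv: "code (new \<sigma>1) < N ^ 4" using code_less 1 Some by simp
      have nv: "new \<sigma>1 = v" "\<sigma>1 24 = 1" "p1 = p" using 1 Some by auto
      have "det x ENC (det x ?P (\<lambda>\<sigma>' p'. p' = p \<and> best_is ?B \<sigma>')) \<sigma>1 p1"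
      proof (rule det_use[OF det_ENC[OF k1 cv] writes_ENC])
        fix \<sigma>2 p2
        assume 2: "p2 = p1 \<and> \<sigma>2 rX = code (new \<sigma>1)" and f2: "\<And>r. r \<notin> {11, 12, 13, 29} \<Longrightarrow> \<sigma>2 r = \<sigma>1 r"
        have f: "\<sigma>2 48 = \<sigma> 48" "\<sigma>2 41 = \<sigma> 41" "\<sigma>2 40 = \<sigma> 40" "\<sigma>2 34 = \<sigma> 34" "\<sigma>2 2 = 0"
          using f2 f1 z by auto
        have X: "\<sigma>2 29 = code v" "p2 = p" using 2 nv by auto
        show "det x ?P (\<lambda>\<sigma>' p'. p' = p \<and> best_is ?B \<sigma>') \<sigma>2 p2"
        proof (cases "code v = \<sigma> 48")
          case False
          then show ?thesis using f X A Some by (simp add: best_is_def)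
        next
          case True
          show ?thesis
          proof (cases "A = {}")
            case True
            then show ?thesis using f X A Some \<open>code v = \<sigma> 48\<close> by (simp add: best_is_def)
          next
            case False
            then have "Min (insert (\<sigma> 34) A) = min (\<sigma> 34) (Min A)" using A by (simp add: best_is_def)
            then show ?thesis using f X A Some False \<open>code v = \<sigma> 48\<close>
              by (auto simp: best_is_def min_def simp del: Min_gr_iff Min_ge_iff Min_less_iff Min_le_iff Min_insert)
          qed
        qed
      qed
      then show ?thesis using nv z by (simp add: det_Seq_fun)
    qed
  qed
qed

lemma det_TRIES:
  assumes "kst \<sigma>" "set us \<subseteq> set ts" "walk js = Some (cur \<sigma>)" "best_is A \<sigma>" "\<sigma> rI = p"
  shows "det x (TRIES us) (\<lambda>\<sigma>' p'. p' = p \<and>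
     best_is (if \<exists>t \<in> set us. \<exists>w. nxt b x t (cur \<sigma>) = Some w \<and> code w = \<sigma> rV then insert (\<sigma> rWT) A else A) \<sigma>') \<sigma> p"
  using assms
proof (induction us arbitrary: \<sigma> A)
  case (Cons t us)
  let ?B = "if \<exists>w. nxt b x t (cur \<sigma>) = Some w \<and> code w = \<sigma> rV then insert (\<sigma> rWT) A else A"
  let ?C = "if \<exists>t \<in> set (t # us). \<exists>w. nxt b x t (cur \<sigma>) = Some w \<and> code w = \<sigma> rV then insert (\<sigma> rWT) A else A"
  have t: "t \<in> set ts" "set us \<subseteq> set ts" using Cons.prems(2) by auto
  show ?case unfolding TRIES.simps det_Seq_fun
  proof (rule det_use[OF det_TRY[OF Cons.prems(1) t(1) Cons.prems(3,4,5)] writes_TRY])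
    fix \<sigma>1 p1
    assume 1: "p1 = p \<and> best_is ?B \<sigma>1" and f: "\<And>r. r \<notin> {10..<30} \<union> {40, 41} \<Longrightarrow> \<sigma>1 r = \<sigma> r"
    have c: "cur \<sigma>1 = cur \<sigma>" "\<sigma>1 48 = \<sigma> 48" "\<sigma>1 34 = \<sigma> 34" "\<sigma>1 31 = p" using f Cons.prems(5) by auto
    have k1: "kst \<sigma>1" using Cons.prems(1) by (rule kst_cong) (simp add: f)
    have "det x (TRIES us) (\<lambda>\<sigma>' p'. p' = p \<and>
     best_is (if \<exists>t \<in> set us. \<exists>w. nxt b x t (cur \<sigma>1) = Some w \<and> code w = \<sigma>1 rV then insert (\<sigma>1 rWT) ?B else ?B) \<sigma>') \<sigma>1 p"
      by (rule Cons.IH[OF k1 t(2)]) (use Cons.prems(3) 1 c in auto)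
    moreover have "(if \<exists>t \<in> set us. \<exists>w. nxt b x t (cur \<sigma>1) = Some w \<and> code w = \<sigma>1 rV then insert (\<sigma>1 rWT) ?B else ?B) = ?C"
      unfolding c(1-3) by (auto simp del: nxt.simps code.simps)
    ultimately show "det x (TRIES us) (\<lambda>\<sigma>' p'. p' = p \<and> best_is ?C \<sigma>') \<sigma>1 p1" using 1 by simp
  qed
qed simp

end

context nl_run
begin

lemma det_CHK:
  assumes k: "kst \<sigma>" and w: "walk js = Some v" "new \<sigma> = v" "p = fst (snd v)" "\<sigma> rX = code v" "\<sigma> rWT = wt js"
    and u: "\<sigma> rU = code v" and A: "best_is A \<sigma>"
    and caps: "Suc (\<sigma> rCNT) < CV" "\<sigma> rSUM + wt js < CV"
  shows "det x (CHK (accept M) ts) (\<lambda>\<sigma>' p'. p' = 0 \<and> \<sigma>' rCNT = Suc (\<sigma> rCNT) \<and> \<sigma>' rSUM = \<sigma> rSUM + wt js \<and>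
     \<sigma>' rACC = (if fst v = accept M then 1 else \<sigma> rACC) \<and>
     best_is (if edge v (\<sigma> rV) then insert (wt js) A else A) \<sigma>') \<sigma> p"
proof -
  let ?G = "\<lambda>\<sigma>' p'. p' = 0 \<and> \<sigma>' rCNT = Suc (\<sigma> rCNT) \<and> \<sigma>' rSUM = \<sigma> rSUM + wt js \<and>
     \<sigma>' rACC = (if fst v = accept M then 1 else \<sigma> rACC) \<and>
     best_is (if edge v (\<sigma> rV) then insert (wt js) A else A) \<sigma>'"
  define \<tau> where "\<tau> = \<sigma>(30 := \<sigma> 25, 31 := \<sigma> 26, 32 := \<sigma> 27, 33 := \<sigma> 28)"
  have kt: "kst \<tau>" using k by (rule kst_cong) (simp add: \<tau>_def)
  have cv: "cur \<tau> = v" using w by (simp add: \<tau>_def)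
  have wt: "walk js = Some (cur \<tau>)" using w(1) cv by simp
  have At: "best_is A \<tau>" using A by (simp add: best_is_def \<tau>_def)
  have pI: "\<tau> 31 = p" using w by (auto simp: \<tau>_def)
  have tv: "\<tau> 48 = \<sigma> 48" "\<tau> 34 = wt js" "\<tau> 29 = \<tau> 45" using w u by (auto simp: \<tau>_def)
  let ?E = "if \<exists>t \<in> set ts. \<exists>w. nxt b x t (cur \<tau>) = Some w \<and> code w = \<tau> rV then insert (\<tau> rWT) A else A"
  have E: "?E = (if edge v (\<sigma> rV) then insert (wt js) A else A)"
    unfolding cv edge_ts tv(1,2) ..
  let ?R = "det x (FOR rK1 rI InL) (det x (CInc rCNT) (det x (CAdd rSUM rWT) (det x (setN rT (accept M))
      (det x (IfEq rQ rT (One rACC) Skip) ?G))))"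
  have "det x (TRIES ts) ?R \<tau> p"
  proof (rule det_use[OF det_TRIES[OF kt subset_refl wt At pI] writes_TRIES])
    fix \<sigma>1 :: "nat \<Rightarrow> nat" and p1 :: nat
    assume 1: "p1 = p \<and> best_is ?E \<sigma>1" and f1: "\<And>r. r \<notin> {10..<30} \<union> {40, 41} \<Longrightarrow> \<sigma>1 r = \<tau> r"
    have k1: "kst \<sigma>1" using kt by (rule kst_cong) (simp add: f1)
    have f: "\<sigma>1 30 = fst v" "\<sigma>1 31 = p" "\<sigma>1 34 = wt js" "\<sigma>1 42 = \<sigma> 42" "\<sigma>1 43 = \<sigma> 43" "\<sigma>1 44 = \<sigma> 44"
      using f1 pI tv cv by (auto simp: \<tau>_def)
    have "p < N" using walk_bounds(2)[of js "fst v" p "fst (snd (snd v))" "snd (snd (snd v))"] w by (cases v) auto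
    then have p: "p \<le> N ^ 4" using N_powers(1) by linarith
    have a: "accept M < CV"
      using wf N(2) N_powers BV_bounds unfolding wf_ntm_def by linarith
    have best: "best_is (if edge v (\<sigma> rV) then insert (wt js) A else A) \<sigma>1" using 1 E by simp
    have fin: "det x (CInc rCNT) (det x (CAdd rSUM rWT) (det x (setN rT (accept M))
      (det x (IfEq rQ rT (One rACC) Skip) ?G))) (\<sigma>1(13 := p)) 0"
    proof -
      define \<rho> where "\<rho> = \<sigma>1(13 := p, 42 := Suc (\<sigma> 42), 43 := \<sigma> 43 + wt js)"
      have "det x (IfEq rQ rT (One rACC) Skip) ?G (\<rho>(10 := accept M)) 0"
        using f best by (auto simp: \<rho>_def best_is_def)
      then have "det x (setN rT (accept M)) (det x (IfEq rQ rT (One rACC) Skip) ?G) \<rho> 0"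
        using a kstD[OF k1] by (intro det_setN) (auto simp: \<rho>_def)
      then show ?thesis using f caps kstD[OF k1] by (simp add: \<rho>_def)
    qed
    show "?R \<sigma>1 p1"
    \<comment> \<open>The head stands at \<open>p\<close>, which is the value of \<open>rI\<close>,
      so \<open>p\<close> moves to the left bring it back to the left endmarker for the next
      guess.\<close>
    proof (rule det_FOR[where I = "\<lambda>i \<sigma>' p'. p' = p - i \<and> \<sigma>' = \<sigma>1(13 := i)"])
      show "\<sigma>1 31 < \<sigma>1 1" using f kstD[OF k1] small(3)[OF p] by simp
    qed (use f 1 fin in auto)
  qed
  then have "det x (IfEq rX rU Skip Fail) (det x (TRIES ts) ?R) \<tau> p" using tv(3) by simp
  then show ?thesis unfolding CHK_def det_Seq_fun by (simp add: CPY_def \<tau>_def)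
qed

lemma CHK_wrong:
  assumes "ex x (CHK qa ts) \<sigma> p h \<sigma>' p'" "\<sigma> rX \<noteq> \<sigma> rU"
  shows False
  using assms unfolding CHK_def CPY_def ex_Seq by auto

text \<open>What a pass collects for the candidate \<open>u'\<close> if it follows the guess
  \<open>as\<close>, before knowing whether the guess is right.\<close>

definition bests :: "nat \<Rightarrow> nat list option list \<Rightarrow> nat set" where
  "bests u' as = (\<lambda>u. wt (the (as ! u))) ` {u \<in> found as. edge (the (walk (the (as ! u)))) u'}"

definition accf :: "nat list option list \<Rightarrow> bool" where
  "accf as \<longleftrightarrow> (\<exists>u \<in> found as. fst (the (walk (the (as ! u)))) = accept M)"

lemma found_nth: "u \<in> found as \<Longrightarrow> (as @ [a]) ! u = as ! u"
  by (simp add: found_def nth_append)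

lemma bests_snoc_None: "bests u' (as @ [None]) = bests u' as"
  unfolding bests_def by (rule image_cong) (auto simp: found_snoc found_nth)

lemma bests_snoc_Some:
  assumes "walk js = Some v"
  shows "bests u' (as @ [Some js]) = (if edge v u' then insert (wt js) (bests u' as) else bests u' as)"
proof -
  let ?F = "\<lambda>as. {u \<in> found as. edge (the (walk (the (as ! u)))) u'}"
  have 1: "?F (as @ [Some js]) = (if edge v u' then insert (length as) (?F as) else ?F as)"
    using assms by (auto simp: found_snoc found_nth)
  have 2: "(\<lambda>u. wt (the ((as @ [Some js]) ! u))) ` ?F as = bests u' as"
    unfolding bests_def by (rule image_cong) (auto simp: found_nth)
  show ?thesis
    unfolding bests_def[of u' "as @ [Some js]"] 1 using 2 by (cases "edge v u'") simp_all
qed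

lemma accf_snoc_None: "accf (as @ [None]) = accf as"
  unfolding accf_def by (simp add: found_snoc found_nth)

lemma accf_snoc_Some:
  assumes "walk js = Some v"
  shows "accf (as @ [Some js]) \<longleftrightarrow> accf as \<or> fst v = accept M"
  unfolding accf_def using assms by (auto simp: found_snoc found_nth)

lemma bests_Nil: "bests u' [] = {}" "accf [] = False" "found [] = {}" "total [] = 0"
  by (simp_all add: bests_def accf_def found_def total_def)

text \<open>\<open>cands\<close> allows any walk as witness for a predecessor, \<open>bests\<close>
  only the guessed one. Both end in the same vertex, and an edge depends on the vertex
  alone.\<close>

lemma bests_canon: "bests u' (canon d) = cands d u'"
proof -
  have 1: "wt (the (canon d ! u)) = mu d u" "\<exists>js v. canon d ! u = Some js \<and> js \<in> paths d u \<and> walk js = Some v" if "u \<in> layer d" for u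
    using canon_some[OF that] by (auto simp: paths_def)
  have 2: "edge (the (walk (the (canon d ! u)))) u' \<longleftrightarrow> (\<exists>js \<in> paths d u. \<exists>j v w. walk js = Some v \<and> nx j v = Some w \<and> code w = u')"
    if u: "u \<in> layer d" for u
  proof -
    obtain js v where js: "canon d ! u = Some js" "js \<in> paths d u" "walk js = Some v" using 1(2)[OF u] by blast
    have "v' = v" if "ks \<in> paths d u" "walk ks = Some v'" for ks v'
      using code_inj[OF that(2) js(3)] that js by (auto simp: paths_def)
    then show ?thesis using js unfolding edge_def by (metis option.sel)
  qed
  have 3: "u \<in> layer d" if "js \<in> paths d u" for js u using that by (auto simp: layer_def)
  have "bests u' (canon d) = mu d ` {u \<in> layer d. \<exists>js \<in> paths d u. \<exists>j v w. walk js = Some v \<and> nx j v = Some w \<and> code w = u'}"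
    unfolding bests_def found_canon by (rule image_cong) (use 1(1) 2 in blast)+
  also have "\<dots> = cands d u'" unfolding cands_def using 3 by blast
  finally show ?thesis .
qed

lemma accf_canon: "accf (canon d) \<longleftrightarrow> (\<exists>js v. length js = d \<and> walk js = Some v \<and> fst v = accept M)"
proof
  assume "accf (canon d)"
  then obtain u where u: "u \<in> layer d" "fst (the (walk (the (canon d ! u)))) = accept M"
    by (auto simp: accf_def found_canon)
  then show "\<exists>js v. length js = d \<and> walk js = Some v \<and> fst v = accept M"
    using canon_some[OF u(1)] by (auto simp: paths_def)
next
  assume "\<exists>js v. length js = d \<and> walk js = Some v \<and> fst v = accept M"
  then obtain js v where js: "length js = d" "walk js = Some v" "fst v = accept M" by blast
  then have u: "code v \<in> layer d" by (auto simp: layer_def paths_def)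
  obtain ks w where ks: "canon d ! code v = Some ks" "walk ks = Some w" "code w = code v"
    using canon_some[OF u] by (auto simp: paths_def)
  have "w = v" using code_inj[OF ks(2) js(2) ks(3)] .
  then show "accf (canon d)" unfolding accf_def found_canon using u ks js by (intro bexI[of _ "code v"]) simp_all
qed

text \<open>The loop succeeds for every assignment of genuine walks to codes; comparing count and
  sum with the known values leaves \<open>canon d\<close> as the only one, by
  \<open>canon_forced\<close>.\<close>

lemma uni_PASS:
  assumes k: "kst \<sigma>" and d: "\<sigma> rD < N ^ 4"
    and C: "\<sigma> rC = card (layer (\<sigma> rD))" and SG: "\<sigma> rSG = (\<Sum>u \<in> layer (\<sigma> rD). mu (\<sigma> rD) u)"
  shows "uni x (PASS (start M) (accept M) ts) (\<lambda>\<sigma>' p'. p' = 0 \<and> best_is (cands (\<sigma> rD) (\<sigma> rV)) \<sigma>' \<and>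
     \<sigma>' rACC = (if \<exists>js v. length js = \<sigma> rD \<and> walk js = Some v \<and> fst v = accept M then 1 else \<sigma> rACC)) \<sigma> 0"
proof -
  define d where "d = \<sigma> rD"
  define \<tau> where "\<tau> = \<sigma>(42 := 0, 43 := 0, 41 := 0, 40 := 0)"
  have kt: "kst \<tau>" using k by (rule kst_cong) (simp add: \<tau>_def)
  let ?c = "Choice (Seq (PATH (start M) ts) (CHK (accept M) ts)) Skip"
  \<comment> \<open>Registers from 46 on belong to the enclosing loops. Carrying their values along
    keeps target, count and sum available for the final comparison.\<close>
  let ?I = "\<lambda>as \<sigma>' p'. p' = 0 \<and> kst \<sigma>' \<and> (\<forall>r \<ge> 46. \<sigma>' r = \<sigma> r) \<and> \<sigma>' rCNT = card (found as) \<and>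
     \<sigma>' rSUM = total as \<and> \<sigma>' rACC = (if accf as then 1 else \<sigma> rACC) \<and> best_is (bests (\<sigma> rV) as) \<sigma>'"
  let ?e = "\<lambda>a. case a of None \<Rightarrow> [False] | Some js \<Rightarrow> True # concat (map tag js)"
  have wf: "wfc (For rU rVV ?c)"
    using capped_wfc[OF capped_PATH] capped_wfc[OF capped_CHK]
    by (auto dest!: subsetD[OF writes_PATH] subsetD[OF writes_CHK])
  have loop: "runs x (FOR rU rVV ?c) {as. length as = \<tau> rVV \<and> ok d as} (\<lambda>as. concat (map ?e as)) ?I \<tau> 0"
  proof (rule runs_FOR[OF wf])
    show "\<tau> 6 < \<tau> 1" using kstD[OF kt] BV_bounds by simp
    show "?I [] (\<tau>(45 := 0)) 0"
      using kt by (auto simp: \<tau>_def kst_def bests_Nil best_is_def)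
    show "ok d as" if "ok d (as @ [a])" for as a using that by (simp add: ok_snoc)
    show "ok d []" by (simp add: ok_def)
  next
    fix as and \<sigma>' :: "nat \<Rightarrow> nat" and p' :: nat
    assume len: "length as < \<tau> 6" and ok: "ok d as" and I: "?I as \<sigma>' p'" and u: "\<sigma>' 45 = length as"
    have k1: "kst \<sigma>'" and D: "\<sigma>' 51 = d" "\<sigma>' 48 = \<sigma> 48" using I by (auto simp: d_def)
    have lV: "length as < N ^ 4" using len kstD[OF kt] by simp
    have cnt: "card (found as) \<le> length as"
      using card_mono[of "{..<length as}" "found as"] by (auto simp: found_def)
    have pt: "runs x (PATH (start M) ts) {js. length js = d \<and> (\<exists>v. walk js = Some v)} (\<lambda>js. concat (map tag js))
     (\<lambda>js \<sigma>' p'. \<exists>v. walk js = Some v \<and> new \<sigma>' = v \<and> p' = fst (snd v) \<and> \<sigma>' rX = code v \<and> \<sigma>' rWT = wt js) \<sigma>' 0"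
      using runs_PATH[OF k1] D assms(2) by (simp add: d_def)
    let ?J = "\<lambda>a \<sigma>'' p''. ?I (as @ [a]) (\<sigma>''(45 := Suc (length as))) p''"
    have pos: "runs x (Seq (PATH (start M) ts) (CHK (accept M) ts)) (paths d (length as)) (\<lambda>js. concat (map tag js)) (\<lambda>js. ?J (Some js)) \<sigma>' 0"
    proof (rule runs_det[OF pt])
      show "paths d (length as) \<subseteq> {js. length js = d \<and> (\<exists>v. walk js = Some v)}" by (auto simp: paths_def)
    next
      fix js \<sigma>1 p1
      assume js: "js \<in> paths d (length as)"
        and "\<exists>v. walk js = Some v \<and> new \<sigma>1 = v \<and> p1 = fst (snd v) \<and> \<sigma>1 rX = code v \<and> \<sigma>1 rWT = wt js"
        and fr: "\<forall>r. r \<notin> writes (PATH (start M) ts) \<longrightarrow> \<sigma>1 r = \<sigma>' r"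
      then obtain v where v: "walk js = Some v" "new \<sigma>1 = v" "p1 = fst (snd v)" "\<sigma>1 rX = code v" "\<sigma>1 rWT = wt js" by blast
      have f1: "\<sigma>1 r = \<sigma>' r" if "r \<notin> {10..<37}" for r using fr that subsetD[OF writes_PATH] by blast
      have cv: "code v = length as" using js v by (auto simp: paths_def)
      have k2: "kst \<sigma>1" using k1 by (rule kst_cong) (simp add: f1)
      have U: "\<sigma>1 rU = code v" using f1[of 45] u cv by simp
      have best: "best_is (bests (\<sigma> rV) as) \<sigma>1" using I f1 by (simp add: best_is_def)
      have vals: "\<sigma>1 42 = card (found as)" "\<sigma>1 43 = total as" "\<sigma>1 44 = (if accf as then 1 else \<sigma> 44)" "\<sigma>1 48 = \<sigma> 48"
        using I f1 by auto
      have dl: "d \<le> N ^ 4" using assms(2) by (simp add: d_def)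
      have oks: "ok d (as @ [Some js])" using ok js by (simp add: ok_snoc)
      have "total (as @ [Some js]) \<le> length (as @ [Some js]) * (N ^ 4 * (N ^ 4 * BV ^ e))"
        using total_bound[OF oks dl e] BV_bounds by simp
      also have "\<dots> \<le> N ^ 4 * (N ^ 4 * (N ^ 4 * BV ^ e))" using lV by (intro mult_le_mono1) simp
      also have "\<dots> < CV" by (rule V3_cap)
      finally have cap: "\<sigma>1 rSUM + wt js < CV" using vals by (simp add: total_snoc)
      have cap2: "Suc (\<sigma>1 rCNT) < CV" using vals cnt lV small(1)[of "Suc (card (found as))"] by simp
      show "det x (CHK (accept M) ts) (?J (Some js)) \<sigma>1 p1"
      proof (rule det_use[OF det_CHK[OF k2 v U best cap2 cap] writes_CHK])
        fix \<sigma>2 :: "nat \<Rightarrow> nat" and p2 :: nat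
        assume 2: "p2 = 0 \<and> \<sigma>2 rCNT = Suc (\<sigma>1 rCNT) \<and> \<sigma>2 rSUM = \<sigma>1 rSUM + wt js \<and>
           \<sigma>2 rACC = (if fst v = accept M then 1 else \<sigma>1 rACC) \<and>
           best_is (if edge v (\<sigma>1 rV) then insert (wt js) (bests (\<sigma> rV) as) else bests (\<sigma> rV) as) \<sigma>2"
          and f2: "\<And>r. r \<notin> {10..<37} \<union> {40..<45} \<Longrightarrow> \<sigma>2 r = \<sigma>1 r"
        have "kst (\<sigma>2(45 := Suc (length as)))" using k2 by (rule kst_cong) (simp add: f2)
        moreover have "\<forall>r \<ge> 46. \<sigma>2 r = \<sigma> r" using f2 f1 I by simp
        moreover have "best_is (bests (\<sigma> rV) (as @ [Some js])) \<sigma>2"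
          using 2 vals by (simp add: bests_snoc_Some[OF v(1)])
        ultimately show "?J (Some js) \<sigma>2 p2"
          using 2 vals by (simp add: card_found_snoc total_snoc accf_snoc_Some[OF v(1)] best_is_def)
      qed
    next
      fix js \<sigma>1 p1 h \<sigma>2 p2
      assume js: "js \<in> {js. length js = d \<and> (\<exists>v. walk js = Some v)}" "js \<notin> paths d (length as)"
        and "\<exists>v. walk js = Some v \<and> new \<sigma>1 = v \<and> p1 = fst (snd v) \<and> \<sigma>1 rX = code v \<and> \<sigma>1 rWT = wt js"
        and fr: "\<forall>r. r \<notin> writes (PATH (start M) ts) \<longrightarrow> \<sigma>1 r = \<sigma>' r"
        and ex: "ex x (CHK (accept M) ts) \<sigma>1 p1 h \<sigma>2 p2"
      then obtain v where v: "walk js = Some v" "\<sigma>1 rX = code v" by blast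
      have "45 \<notin> writes (PATH (start M) ts)" by (auto dest!: subsetD[OF writes_PATH])
      then have "\<sigma>1 45 = length as" using fr u by simp
      moreover have "code v \<noteq> length as" using js v by (auto simp: paths_def)
      ultimately show False using CHK_wrong[OF ex] v by simp
    qed
    have p0: "p' = 0" using I by blast
    have neg: "det x Skip (?J None) \<sigma>' 0"
    proof -
      have "kst (\<sigma>'(45 := Suc (length as)))" using k1 by (rule kst_cong) simp
      then show ?thesis using I by (simp add: card_found_snoc total_snoc accf_snoc_None bests_snoc_None best_is_def)
    qed
    have set: "insert None (Some ` paths d (length as)) = {a. ok d (as @ [a])}"
    proof -
      have "a \<in> insert None (Some ` paths d (length as)) \<longleftrightarrow> ok d (as @ [a])" for a
        using ok by (cases a) (auto simp: ok_snoc)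
      then show ?thesis by blast
    qed
    have "runs x ?c {a. ok d (as @ [a])} ?e (\<lambda>a. case a of None \<Rightarrow> ?J None | Some js \<Rightarrow> ?J (Some js)) \<sigma>' 0"
      using runs_Choice[OF pos neg] unfolding set .
    then show "runs x ?c {a. ok d (as @ [a])} ?e ?J \<sigma>' p'"
      unfolding p0 by (rule runs_conseq) (auto split: option.splits)
  qed auto
  let ?F = "IfEq rCNT rC (IfEq rSUM rSG Skip Fail) Fail"
  have dN: "d \<le> N ^ 4" using assms(2) by (simp add: d_def)
  have "runs x (Seq (FOR rU rVV ?c) ?F) {canon d} (\<lambda>as. concat (map ?e as)) ?I \<tau> 0"
  proof (rule runs_det[OF loop])
    show "{canon d} \<subseteq> {as. length as = \<tau> 6 \<and> ok d as}" using kstD[OF kt] ok_canon by simp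
  next
    fix as and \<sigma>1 :: "nat \<Rightarrow> nat" and p1 :: nat
    assume "as \<in> {canon d}" and I: "?I as \<sigma>1 p1"
    then show "det x ?F (?I as) \<sigma>1 p1"
      using C SG by (simp add: found_canon total_canon d_def)
  next
    fix as and \<sigma>1 :: "nat \<Rightarrow> nat" and p1 h \<sigma>2 p2
    assume as: "as \<in> {as. length as = \<tau> 6 \<and> ok d as}" "as \<notin> {canon d}" and I: "?I as \<sigma>1 p1"
      and ex: "ex x ?F \<sigma>1 p1 h \<sigma>2 p2"
    have "card (found as) = card (layer d)" "total as = (\<Sum>u \<in> layer d. mu d u)"
      using ex I C SG by (auto simp: d_def split: if_splits)
    then show False using canon_forced[OF dN] as kstD[OF kt] by simp
  qed
  then have "runs x (PASS (start M) (accept M) ts) {canon d} (\<lambda>as. concat (map ?e as)) ?I \<sigma> 0"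
    unfolding PASS_def by (intro det_runs) (simp add: \<tau>_def)
  then have "uni x (PASS (start M) (accept M) ts) (?I (canon d)) \<sigma> 0" by (rule runs_uni)
  then show ?thesis
    by (rule uni_conseq) (simp add: bests_canon accf_canon d_def)
qed

abbreviation acc_at :: "nat \<Rightarrow> bool" where
  "acc_at d \<equiv> \<exists>js v. length js = d \<and> walk js = Some v \<and> fst v = accept M"

section \<open>From layer to layer\<close>

lemma det_TALLY:
  assumes k: "kst \<sigma>" and d: "\<sigma> rD < N ^ 4" and v: "\<sigma> rV < N ^ 4" and c: "\<sigma> rC' < N ^ 4"
    and w: "\<sigma> rSG' + \<sigma> rBEST + \<sigma> rV * pw BV (Suc (\<sigma> rD)) < CV"
  shows "det x (Seq (CInc rC') (Seq (CAdd rSG' rBEST) (Seq (Cp rII rD) (Seq (CInc rII) (Seq PWR (Seq (MUL rT1 rPW rV rK1) (CAdd rSG' rT1)))))))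
     (\<lambda>\<sigma>' p'. p' = p \<and> \<sigma>' rC' = Suc (\<sigma> rC') \<and> \<sigma>' rSG' = \<sigma> rSG' + \<sigma> rBEST + \<sigma> rV * pw BV (Suc (\<sigma> rD))) \<sigma> p"
proof -
  let ?G = "\<lambda>\<sigma>' p'. p' = p \<and> \<sigma>' rC' = Suc (\<sigma> rC') \<and> \<sigma>' rSG' = \<sigma> rSG' + \<sigma> rBEST + \<sigma> rV * pw BV (Suc (\<sigma> rD))"
  define \<tau> where "\<tau> = \<sigma>(46 := Suc (\<sigma> 46), 47 := \<sigma> 47 + \<sigma> 40, 36 := Suc (\<sigma> 51))"
  have kt: "kst \<tau>" using k by (rule kst_cong) (simp add: \<tau>_def)
  have II: "0 < \<tau> 36" "\<tau> 36 \<le> N ^ 4" using d by (auto simp: \<tau>_def)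
  have "det x PWR (det x (MUL rT1 rPW rV rK1) (det x (CAdd rSG' rT1) ?G)) \<tau> p"
  proof (rule det_use[OF det_PWR[OF kt II] writes_PWR])
    fix \<sigma>2 :: "nat \<Rightarrow> nat" and p2 :: nat
    assume 2: "p2 = p \<and> \<sigma>2 rPW = pw BV (\<tau> rII)" and f2: "\<And>r. r \<notin> {11, 13, 14, 15, 16, 17, 22, 23} \<Longrightarrow> \<sigma>2 r = \<tau> r"
    have k2: "kst \<sigma>2" using kt by (rule kst_cong) (simp add: f2)
    have f: "\<sigma>2 48 = \<sigma> 48" "\<sigma>2 23 = pw BV (Suc (\<sigma> 51))" "\<sigma>2 47 = \<sigma> 47 + \<sigma> 40" "\<sigma>2 46 = Suc (\<sigma> 46)"
      using f2 2 by (auto simp: \<tau>_def)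
    show "det x (MUL rT1 rPW rV rK1) (det x (CAdd rSG' rT1) ?G) \<sigma>2 p2"
    proof (rule det_MUL)
      show "\<sigma>2 48 < \<sigma>2 1" using kstD[OF k2] f v small(3)[of "\<sigma> 48"] by simp
      show "\<sigma>2 23 * \<sigma>2 48 < \<sigma>2 0" using kstD[OF k2] f w by (simp add: mult.commute)
      show "det x (CAdd rSG' rT1) ?G (\<sigma>2(11 := \<sigma>2 23 * \<sigma>2 48, 13 := \<sigma>2 48)) p2"
        using kstD[OF k2] f w 2 by (simp add: mult.commute)
    qed auto
  qed
  moreover have "Suc (\<sigma> 46) < CV" "Suc (\<sigma> 51) < CV" "\<sigma> 47 + \<sigma> 40 < CV"
    using small(1)[of "Suc (\<sigma> 46)"] small(1)[of "Suc (\<sigma> 51)"] c d w by auto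
  ultimately show ?thesis unfolding det_Seq_fun using kstD[OF k] by (simp add: \<tau>_def)
qed

lemma sum_mu_cap:
  assumes "d \<le> N ^ 4" "L \<subseteq> layer d"
  shows "(\<Sum>u \<in> L. mu d u) < CV" "card L \<le> N ^ 4"
proof -
  have "card L \<le> card {..<N ^ 4}" using assms(2) layer_bounded by (intro card_mono) auto
  then show c: "card L \<le> N ^ 4" by simp
  have "(\<Sum>u \<in> L. mu d u) \<le> (\<Sum>u \<in> L. N ^ 4 * (N ^ 4 * BV ^ e))"
    using mu_bound[OF _ assms(1) e] assms(2) BV_bounds by (intro sum_mono) auto
  also have "\<dots> = card L * (N ^ 4 * (N ^ 4 * BV ^ e))" by simp
  also have "\<dots> \<le> N ^ 4 * (N ^ 4 * (N ^ 4 * BV ^ e))" using c by (rule mult_le_mono1)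
  also have "\<dots> < CV" by (rule V3_cap)
  finally show "(\<Sum>u \<in> L. mu d u) < CV" .
qed

text \<open>For each candidate the pass leaves the minimum of \<open>cands\<close>, or its absence.
  By \<open>layer_Suc\<close> the absence means that the candidate is not in the next layer;
  otherwise \<open>mu_Suc\<close> gives its least weight.\<close>

lemma uni_LAYER:
  assumes k: "kst \<sigma>" and dN: "\<sigma> rD < N ^ 4"
    and C: "\<sigma> rC = card (layer (\<sigma> rD))" and SG: "\<sigma> rSG = (\<Sum>u \<in> layer (\<sigma> rD). mu (\<sigma> rD) u)"
  shows "uni x (LAYER (start M) (accept M) ts) (\<lambda>\<sigma>' p'. p' = 0 \<and> \<sigma>' rC = card (layer (Suc (\<sigma> rD))) \<and>
     \<sigma>' rSG = (\<Sum>u \<in> layer (Suc (\<sigma> rD)). mu (Suc (\<sigma> rD)) u) \<and>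
     \<sigma>' rACC = (if acc_at (\<sigma> rD) then 1 else \<sigma> rACC)) \<sigma> 0"
proof -
  define d where "d = \<sigma> rD"
  define \<tau> where "\<tau> = \<sigma>(46 := 0, 47 := 0)"
  have kt: "kst \<tau>" using k by (rule kst_cong) (simp add: \<tau>_def)
  let ?L = "\<lambda>k. layer (Suc d) \<inter> {..<k}"
  let ?T = "IfEq rHAS rZR Skip (Seq (CInc rC') (Seq (CAdd rSG' rBEST) (Seq (Cp rII rD) (Seq (CInc rII) (Seq PWR (Seq (MUL rT1 rPW rV rK1) (CAdd rSG' rT1)))))))"
  let ?c = "Seq (PASS (start M) (accept M) ts) ?T"
  \<comment> \<open>Every pass visits the whole layer \<open>d\<close>, so acceptance there is noted
    as soon as one pass is complete; hence the condition \<open>0 < k\<close>.\<close>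
  let ?I = "\<lambda>k \<sigma>' p'. p' = 0 \<and> kst \<sigma>' \<and> (\<forall>r \<ge> 49. \<sigma>' r = \<sigma> r) \<and> \<sigma>' rC' = card (?L k) \<and>
     \<sigma>' rSG' = (\<Sum>u \<in> ?L k. mu (Suc d) u) \<and> \<sigma>' rACC = (if 0 < k \<and> acc_at d then 1 else \<sigma> rACC)"
  have wT: "writes ?T \<subseteq> {10..<37} \<union> {46, 47}" by (auto dest!: subsetD[OF writes_PWR])
  have wf: "wfc (For rV rVV ?c)"
    using capped_wfc[OF capped_PASS] capped_wfc[OF capped_PWR]
    by (auto dest!: subsetD[OF writes_PASS] subsetD[OF writes_PWR])
  have loop: "uni x (FOR rV rVV ?c) (?I (N ^ 4)) \<tau> 0"
  proof (rule uni_FOR[OF wf, where I = ?I])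
    show "\<tau> 6 < \<tau> 1" using kstD[OF kt] BV_bounds by simp
    show "?I 0 (\<tau>(48 := 0)) 0" using kt by (auto simp: \<tau>_def kst_def)
  next
    fix i and \<sigma>' :: "nat \<Rightarrow> nat" and p' :: nat
    assume i: "i < \<tau> 6" and I: "?I i \<sigma>' p'" and v: "\<sigma>' 48 = i"
    have k1: "kst \<sigma>'" and D: "\<sigma>' 51 = d" "\<sigma>' 49 = \<sigma> 49" "\<sigma>' 50 = \<sigma> 50" and p0: "p' = 0" using I by (auto simp: d_def)
    have iN: "i < N ^ 4" using i kstD[OF kt] by simp
    have dN': "d < N ^ 4" using dN by (simp add: d_def)
    have pass: "uni x (PASS (start M) (accept M) ts) (\<lambda>\<sigma>'' p''. p'' = 0 \<and> best_is (cands d i) \<sigma>'' \<and>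
       \<sigma>'' rACC = (if acc_at d then 1 else \<sigma>' rACC)) \<sigma>' 0"
      using uni_PASS[OF k1] D v dN C SG by (simp add: d_def)
    show "uni x ?c (\<lambda>\<sigma>'' p''. ?I (Suc i) (\<sigma>''(48 := Suc i)) p'') \<sigma>' p'"
      unfolding p0
    proof (rule uni_Seq, rule uni_conseq[OF pass])
      fix \<sigma>1 :: "nat \<Rightarrow> nat" and p1 :: nat
      assume 1: "p1 = 0 \<and> best_is (cands d i) \<sigma>1 \<and> \<sigma>1 rACC = (if acc_at d then 1 else \<sigma>' rACC)"
        and fr: "\<forall>r. r \<notin> writes (PASS (start M) (accept M) ts) \<longrightarrow> \<sigma>1 r = \<sigma>' r"
      have f1: "\<sigma>1 r = \<sigma>' r" if "r \<notin> {10..<37} \<union> {40..<46}" for r using fr that subsetD[OF writes_PASS] by blast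
      have k2: "kst \<sigma>1" using k1 by (rule kst_cong) (simp add: f1)
      have vals: "\<sigma>1 46 = card (?L i)" "\<sigma>1 47 = (\<Sum>u \<in> ?L i. mu (Suc d) u)" "\<sigma>1 48 = i" "\<sigma>1 51 = d"
          "\<forall>r \<ge> 49. \<sigma>1 r = \<sigma> r" "\<sigma>1 44 = (if acc_at d then 1 else \<sigma> 44)"
        using I f1 v D 1 by auto
      have ks: "kst (\<sigma>1(48 := Suc i))" using k2 by (rule kst_cong) simp
      show "uni x ?T (\<lambda>\<sigma>'' p''. ?I (Suc i) (\<sigma>''(48 := Suc i)) p'') \<sigma>1 p1"
      proof (rule uni_det, cases "cands d i = {}")
        case True
        then have "i \<notin> layer (Suc d)" using layer_Suc by simp
        then have "?L (Suc i) = ?L i" by (auto simp: less_Suc_eq)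
        then show "det x ?T (\<lambda>\<sigma>'' p''. ?I (Suc i) (\<sigma>''(48 := Suc i)) p'') \<sigma>1 p1"
          using True 1 vals ks kstD[OF k2] by (simp add: best_is_def)
      next
        case False
        then have il: "i \<in> layer (Suc d)" using layer_Suc by simp
        then have Li: "?L (Suc i) = insert i (?L i)" by (auto simp: less_Suc_eq)
        have b: "\<sigma>1 40 = Min (cands d i)" "\<sigma>1 41 = 1" using 1 False by (auto simp: best_is_def)
        have fin: "finite (?L i)" by simp
        have sum: "(\<Sum>u \<in> ?L (Suc i). mu (Suc d) u) = \<sigma>1 47 + \<sigma>1 40 + i * pw BV (Suc d)"
          unfolding Li using mu_Suc[OF il] b vals by simp
        have card: "card (?L (Suc i)) = Suc (\<sigma>1 46)" unfolding Li using vals by simp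
        have cap: "\<sigma>1 rSG' + \<sigma>1 rBEST + \<sigma>1 rV * pw BV (Suc (\<sigma>1 rD)) < CV"
          using sum_mu_cap(1)[of "Suc d" "?L (Suc i)"] dN' sum vals by simp
        have cap2: "\<sigma>1 rC' < N ^ 4" using sum_mu_cap(2)[of "Suc d" "?L (Suc i)"] dN' card by simp
        have "det x (Seq (CInc rC') (Seq (CAdd rSG' rBEST) (Seq (Cp rII rD) (Seq (CInc rII) (Seq PWR (Seq (MUL rT1 rPW rV rK1) (CAdd rSG' rT1)))))))
          (\<lambda>\<sigma>'' p''. ?I (Suc i) (\<sigma>''(48 := Suc i)) p'') \<sigma>1 p1"
        proof (rule det_use[OF det_TALLY[OF k2 _ _ cap2 cap], where W = "{10..<37} \<union> {46, 47}"])
          fix \<sigma>2 :: "nat \<Rightarrow> nat" and p2 :: nat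
          assume 2: "p2 = p1 \<and> \<sigma>2 rC' = Suc (\<sigma>1 rC') \<and> \<sigma>2 rSG' = \<sigma>1 rSG' + \<sigma>1 rBEST + \<sigma>1 rV * pw BV (Suc (\<sigma>1 rD))"
            and f2: "\<And>r. r \<notin> {10..<37} \<union> {46, 47} \<Longrightarrow> \<sigma>2 r = \<sigma>1 r"
          have "kst (\<sigma>2(48 := Suc i))" using k2 by (rule kst_cong) (simp add: f2)
          moreover have "\<forall>r \<ge> 49. \<sigma>2 r = \<sigma> r" using f2 vals by simp
          moreover have "\<sigma>2 44 = \<sigma>1 44" using f2 by simp
          ultimately show "?I (Suc i) (\<sigma>2(48 := Suc i)) p2"
            using 2 1 sum card vals by simp
        qed (use vals dN' iN wT in auto)
        then show "det x ?T (\<lambda>\<sigma>'' p''. ?I (Suc i) (\<sigma>''(48 := Suc i)) p'') \<sigma>1 p1"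
          using b kstD[OF k2] by (simp del: det_Seq)
      qed
    qed
  next
    fix \<sigma>' :: "nat \<Rightarrow> nat" and p' :: nat
    assume "?I (\<tau> 6) \<sigma>' p'"
    then show "?I (N ^ 4) \<sigma>' p'" using kstD[OF kt] by simp
  qed auto
  have all: "?L (N ^ 4) = layer (Suc d)" using layer_bounded by auto
  have "uni x (Seq (FOR rV rVV ?c) (Seq (Cp rC rC') (Cp rSG rSG'))) (\<lambda>\<sigma>' p'. p' = 0 \<and> \<sigma>' rC = card (layer (Suc d)) \<and>
     \<sigma>' rSG = (\<Sum>u \<in> layer (Suc d). mu (Suc d) u) \<and> \<sigma>' rACC = (if acc_at d then 1 else \<sigma> rACC)) \<tau> 0"
    \<comment> \<open>\<open>V2\<close> guarantees that at least one pass takes place, without which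
      acceptance in layer \<open>d\<close> would go unnoticed.\<close>
    by (rule uni_Seq, rule uni_conseq[OF loop], rule uni_det) (use all V2 in auto)
  then show ?thesis unfolding LAYER_def d_def[symmetric]
    by (intro uni_Seq[of _ "Seq (Zero rC') (Zero rSG')"] uni_det) (simp add: \<tau>_def)
qed

lemma uni_exD: "uni x c Q \<sigma> p \<Longrightarrow> ex x c \<sigma> p h \<sigma>' p' \<Longrightarrow> Q \<sigma>' p'"
  unfolding uni_def runs_def using ex_fun by blast

lemma uni_unique: "uni x c Q \<sigma> p \<Longrightarrow> ex x c \<sigma> p g \<sigma>1 p1 \<Longrightarrow> ex x c \<sigma> p h \<sigma>2 p2 \<Longrightarrow> g = h"
  unfolding uni_def runs_def by blast

lemma uni_exists: "uni x c Q \<sigma> p \<Longrightarrow> \<exists>g \<sigma>' p'. ex x c \<sigma> p g \<sigma>' p'"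
  unfolding uni_def runs_def by blast

text \<open>The guess is unique whether or not the input is accepted; only the final test of
  \<open>rACC\<close> depends on that. Count and sum, correct for layer \<open>k\<close>, are the
  hypotheses under which layer \<open>k\<close> determines the next.\<close>

lemma MAIN_loop:
  assumes k: "kst \<sigma>"
  shows "uni x (Seq (Seq (One rC) (Seq (Zero rSG) (Zero rACC))) (FOR rD rVV (LAYER (start M) (accept M) ts)))
     (\<lambda>\<sigma>' p'. \<sigma>' rZR = 0 \<and> \<sigma>' rACC = of_bool (accepts M x)) \<sigma> 0"
proof -
  define \<tau> where "\<tau> = \<sigma>(49 := 1, 50 := 0, 44 := 0)"
  have kt: "kst \<tau>" using k by (rule kst_cong) (simp add: \<tau>_def)
  let ?I = "\<lambda>k \<sigma>' p'. p' = 0 \<and> kst \<sigma>' \<and> \<sigma>' rC = card (layer k) \<and> \<sigma>' rSG = (\<Sum>u \<in> layer k. mu k u) \<and>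
     \<sigma>' rACC = of_bool (\<exists>d < k. acc_at d)"
  have wf: "wfc (For rD rVV (LAYER (start M) (accept M) ts))"
    using capped_wfc[OF capped_LAYER] by (auto dest!: subsetD[OF writes_LAYER])
  have mu0: "mu 0 (code v0) = 0"
    using mu_le[of "[]" 0 "code v0"] by (simp add: paths_def)
  have "uni x (FOR rD rVV (LAYER (start M) (accept M) ts)) (\<lambda>\<sigma>' p'. \<sigma>' rZR = 0 \<and> \<sigma>' rACC = of_bool (accepts M x)) \<tau> 0"
  proof (rule uni_FOR[OF wf, where I = ?I])
    show "\<tau> 6 < \<tau> 1" using kstD[OF kt] BV_bounds by simp
    show "?I 0 (\<tau>(51 := 0)) 0" using kt mu0 by (auto simp: \<tau>_def kst_def layer_0)
  next
    fix i and \<sigma>' :: "nat \<Rightarrow> nat" and p' :: nat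
    assume i: "i < \<tau> 6" and I: "?I i \<sigma>' p'" and d: "\<sigma>' 51 = i"
    have k1: "kst \<sigma>'" and p0: "p' = 0" using I by auto
    have iN: "\<sigma>' 51 < N ^ 4" using i kstD[OF kt] d by simp
    show "uni x (LAYER (start M) (accept M) ts) (\<lambda>\<sigma>'' p''. ?I (Suc i) (\<sigma>''(51 := Suc i)) p'') \<sigma>' p'"
      unfolding p0
    proof (rule uni_conseq[OF uni_LAYER[OF k1 iN]])
      fix \<sigma>1 :: "nat \<Rightarrow> nat" and p1 :: nat
      assume 1: "p1 = 0 \<and> \<sigma>1 rC = card (layer (Suc (\<sigma>' rD))) \<and>
         \<sigma>1 rSG = (\<Sum>u \<in> layer (Suc (\<sigma>' rD)). mu (Suc (\<sigma>' rD)) u) \<and>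
         \<sigma>1 rACC = (if acc_at (\<sigma>' rD) then 1 else \<sigma>' rACC)"
        and fr: "\<forall>r. r \<notin> writes (LAYER (start M) (accept M) ts) \<longrightarrow> \<sigma>1 r = \<sigma>' r"
      have f1: "\<sigma>1 r = \<sigma>' r" if "r < 10" for r
      proof -
        have "r \<notin> {10..<37} \<union> {40..<51}" using that by auto
        then show ?thesis using fr subsetD[OF writes_LAYER] by blast
      qed
      have "kst (\<sigma>1(51 := Suc i))" using k1 by (rule kst_cong) (simp add: f1)
      moreover have "(\<exists>d < Suc i. acc_at d) \<longleftrightarrow> (\<exists>d < i. acc_at d) \<or> acc_at i" by (metis less_Suc_eq)
      ultimately show "?I (Suc i) (\<sigma>1(51 := Suc i)) p1" using 1 I d by simp
    qed (use I d in auto)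
  next
    fix \<sigma>' :: "nat \<Rightarrow> nat" and p' :: nat
    assume "?I (\<tau> 6) \<sigma>' p'"
    then show "\<sigma>' 2 = 0 \<and> \<sigma>' 44 = of_bool (accepts M x)"
      using kstD[OF kt] kstD(3) unfolding accepts_iff_walk by auto
  qed auto
  then show ?thesis
    by (intro uni_Seq[of _ "Seq (One rC) (Seq (Zero rSG) (Zero rACC))"] uni_det) (simp add: \<tau>_def)
qed

theorem MAIN_correct:
  assumes "kst \<sigma>"
  shows "ex x (MAIN (start M) (accept M) ts) \<sigma> 0 g \<sigma>1 p1 \<Longrightarrow> ex x (MAIN (start M) (accept M) ts) \<sigma> 0 h \<sigma>2 p2 \<Longrightarrow> g = h"
    and "(\<exists>g \<sigma>' p'. ex x (MAIN (start M) (accept M) ts) \<sigma> 0 g \<sigma>' p') \<longleftrightarrow> accepts M x"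
proof -
  let ?A = "Seq (Seq (One rC) (Seq (Zero rSG) (Zero rACC))) (FOR rD rVV (LAYER (start M) (accept M) ts))"
  \<comment> \<open>\<open>MAIN\<close> nests its sequence to the right; the loop has to be split
    off as a prefix before the test.\<close>
  have assoc: "ex x (MAIN (start M) (accept M) ts) \<sigma> 0 g \<sigma>' p' \<longleftrightarrow> ex x (Seq ?A (IfEq rACC rZR Fail Skip)) \<sigma> 0 g \<sigma>' p'" for g \<sigma>' p'
    unfolding MAIN_def ex_def by (simp add: Option.bind_assoc)
  note loop = MAIN_loop[OF assms]
  \<comment> \<open>After the unique loop the flag equals acceptance, so any success implies
    acceptance, and acceptance makes the final test pass without choices. Both claims of the theorem
    follow from this one fact.\<close>
  have acc: "accepts M x \<and> uni x (Seq ?A (IfEq rACC rZR Fail Skip)) (\<lambda>_ _. True) \<sigma> 0"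
    if r: "ex x (Seq ?A (IfEq rACC rZR Fail Skip)) \<sigma> 0 g \<sigma>' p' \<or> accepts M x" for g \<sigma>' p'
  proof -
    have a: "accepts M x"
    proof (rule disjE[OF r])
      assume "ex x (Seq ?A (IfEq rACC rZR Fail Skip)) \<sigma> 0 g \<sigma>' p'"
      then obtain h1 h2 \<sigma>1 p1 where e: "ex x ?A \<sigma> 0 h1 \<sigma>1 p1" "ex x (IfEq rACC rZR Fail Skip) \<sigma>1 p1 h2 \<sigma>' p'"
        unfolding ex_Seq[of x ?A] by blast
      then show ?thesis using uni_exD[OF loop e(1)] by (cases "accepts M x") auto
    qed
    then show ?thesis
      by (intro conjI uni_Seq[of x ?A] uni_conseq[OF loop] uni_det) auto
  qed
  show "g = h" if "ex x (MAIN (start M) (accept M) ts) \<sigma> 0 g \<sigma>1 p1" "ex x (MAIN (start M) (accept M) ts) \<sigma> 0 h \<sigma>2 p2"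
    using that uni_unique[OF conjunct2[OF acc]] unfolding assoc by blast
  show "(\<exists>g \<sigma>' p'. ex x (MAIN (start M) (accept M) ts) \<sigma> 0 g \<sigma>' p') \<longleftrightarrow> accepts M x"
    using acc uni_exists[OF conjunct2[OF acc]] unfolding assoc by blast
qed

end

section \<open>Initialisation\<close>

text \<open>While the caps are being computed, nothing can be checked against them. Initialisation
  therefore uses unchecked arithmetic, and its time and values are bounded by direct
  computation.\<close>

primrec setU :: "nat \<Rightarrow> nat \<Rightarrow> 'a com" where
  "setU r 0 = Zero r"
| "setU r (Suc k) = Seq (setU r k) (Inc r)"

definition MULU :: "nat \<Rightarrow> nat \<Rightarrow> 'a com" where
  "MULU r s = Seq (Zero 11) (Seq (Zero 13) (Seq (For 13 s (Sum 11 False (Some 11) (Some r))) (Cp r 11)))"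

primrec POWU :: "nat \<Rightarrow> nat \<Rightarrow> nat \<Rightarrow> 'a com" where
  "POWU r s 0 = Skip"
| "POWU r s (Suc k) = Seq (POWU r s k) (MULU r s)"

text \<open>Register 12 runs through the powers of 2 until it reaches \<open>rVV\<close>, and the
  cap gains a factor \<open>rBW\<close> for each doubling. This produces a power whose exponent is
  logarithmic without computing a logarithm; the remaining rounds are idle.\<close>

definition CAPLOOP :: "'a com" where
  "CAPLOOP = For 14 rVV (IfLt 12 rVV (Seq (Sum 12 False (Some 12) (Some 12)) (MULU rCAP rBW)) Skip)"

text \<open>The first move leaves the left endmarker, on which \<open>Scan\<close> would stop at
  once. After the scan the head is \<open>rN1\<close> cells away from the start and is brought back.
  \<open>rZR\<close> is never written and keeps its initial 0.\<close>

definition INIT :: "nat \<Rightarrow> nat \<Rightarrow> 'a com" where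
  "INIT k b = Seq InR (Seq (Scan 10) (Seq (Sum rN1 True (Some 10) None) (Seq (For 13 rN1 InL)
     (Seq (Sum 10 True (Some rN1) None) (Seq (One rNN) (Seq (POWU rNN 10 k) (Seq (One rVV) (Seq (POWU rVV rNN 4)
     (Seq (One rBW) (Seq (POWU rBW rVV 4) (Seq (Sum rTCAP True (Some rBW) None) (Seq (setU rTWO 2) (Seq (setU rBB b)
     (Seq (One rCAP) (Seq (POWU rCAP rBW 3) (Seq (One 12) CAPLOOP))))))))))))))))"

text \<open>\<open>X\<close> will be the final value of \<open>rCAP\<close>, which is the largest
  number that occurs during initialisation.\<close>

locale init_run =
  fixes x :: "'a list" and X m :: nat
  assumes X: "X < 2 ^ m"
begin

definition bnd :: "(nat \<Rightarrow> nat) \<Rightarrow> bool" where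
  "bnd \<sigma> \<longleftrightarrow> (\<forall>r. \<sigma> r \<le> X)"

text \<open>The reached state must not depend on the choices \<open>g\<close>.\<close>
definition tw :: "nat \<Rightarrow> 'a com \<Rightarrow> ((nat \<Rightarrow> nat) \<Rightarrow> nat \<Rightarrow> bool) \<Rightarrow> (nat \<Rightarrow> nat) \<Rightarrow> nat \<Rightarrow> bool" where
  "tw n c Q \<sigma> p \<longleftrightarrow> (\<exists>\<sigma>' p'. Q \<sigma>' p' \<and>
     (\<forall>K g. bd (rn x) (below m) False n (c # K, \<sigma>, p, g) (\<lambda>s. s = (K, \<sigma>', p', g))))"

lemma bndD: "bnd \<sigma> \<Longrightarrow> \<sigma> r \<le> X"
  by (simp add: bnd_def)

lemma bnd_upd: "bnd \<sigma> \<Longrightarrow> v \<le> X \<Longrightarrow> bnd (\<sigma>(r := v))"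
  by (simp add: bnd_def)

lemma bnd_below:
  assumes "bnd \<sigma>"
  shows "below m (K, \<sigma>, s)"
proof
  fix r
  show "fst (snd (K, \<sigma>, s)) r < 2 ^ m" using bndD[OF assms, of r] X by simp
qed

lemma tw_mono: "tw n c Q \<sigma> p \<Longrightarrow> n \<le> n' \<Longrightarrow> tw n' c Q \<sigma> p"
  unfolding tw_def using bd_mono by meson

lemma tw_atom:
  assumes "bnd \<sigma>" "\<And>K g. rn x (c # K, \<sigma>, p, g) = Some (K, \<sigma>', p', g)" "Q \<sigma>' p'"
  shows "tw 1 c Q \<sigma> p"
  unfolding tw_def One_nat_def
proof (intro exI conjI allI)
  fix K g
  show "bd (rn x) (below m) False (Suc 0) (c # K, \<sigma>, p, g) (\<lambda>s. s = (K, \<sigma>', p', g))"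
    by (rule bd_step, rule bnd_below[OF assms(1)], rule assms(2), rule bd_post) simp
qed (rule assms(3))

lemma tw_Sum: "bnd \<sigma> \<Longrightarrow> Q (\<sigma>(r := of_bool b + oval \<sigma> u + oval \<sigma> v)) p \<Longrightarrow> tw 1 (Sum r b u v) Q \<sigma> p"
  by (rule tw_atom) auto

lemma tw_Skip: "bnd \<sigma> \<Longrightarrow> Q \<sigma> p \<Longrightarrow> tw 1 Skip Q \<sigma> p"
  by (rule tw_atom) auto

lemma tw_InR: "bnd \<sigma> \<Longrightarrow> p \<le> length x \<Longrightarrow> Q \<sigma> (Suc p) \<Longrightarrow> tw 1 InR Q \<sigma> p"
  by (rule tw_atom) auto

lemma tw_InL: "bnd \<sigma> \<Longrightarrow> 0 < p \<Longrightarrow> Q \<sigma> (p - 1) \<Longrightarrow> tw 1 InL Q \<sigma> p"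
  by (rule tw_atom) auto

lemma tw_Seq:
  assumes "bnd \<sigma>" "tw n1 c (tw n2 d Q) \<sigma> p"
  shows "tw (1 + n1 + n2) (Seq c d) Q \<sigma> p"
proof -
  obtain \<sigma>1 p1 where 1: "tw n2 d Q \<sigma>1 p1" "\<And>K g. bd (rn x) (below m) False n1 (c # K, \<sigma>, p, g) (\<lambda>s. s = (K, \<sigma>1, p1, g))"
    using assms(2) unfolding tw_def[of n1] by blast
  obtain \<sigma>2 p2 where 2: "Q \<sigma>2 p2" "\<And>K g. bd (rn x) (below m) False n2 (d # K, \<sigma>1, p1, g) (\<lambda>s. s = (K, \<sigma>2, p2, g))"
    using 1(1) unfolding tw_def by blast
  have "bd (rn x) (below m) False (Suc (n1 + n2)) (Seq c d # K, \<sigma>, p, g) (\<lambda>s. s = (K, \<sigma>2, p2, g))" for K g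
  proof (rule bd_step, rule bnd_below[OF assms(1)], rule rn.simps(5))
    show "bd (rn x) (below m) False (n1 + n2) (c # d # K, \<sigma>, p, g) (\<lambda>s. s = (K, \<sigma>2, p2, g))"
      by (rule bd_bind[OF 1(2)]) (use 2(2) in simp)
  qed
  then have "tw (Suc (n1 + n2)) (Seq c d) Q \<sigma> p" unfolding tw_def using 2(1) by blast
  then show ?thesis by simp
qed

lemma tw_step:
  assumes "bnd \<sigma>" "\<And>K g. rn x (c # K, \<sigma>, p, g) = Some (d # K, \<sigma>, p, g)" "tw n d Q \<sigma> p"
  shows "tw (Suc n) c Q \<sigma> p"
proof -
  obtain \<sigma>1 p1 where 1: "Q \<sigma>1 p1" "\<And>K g. bd (rn x) (below m) False n (d # K, \<sigma>, p, g) (\<lambda>s. s = (K, \<sigma>1, p1, g))"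
    using assms(3) unfolding tw_def by blast
  have "bd (rn x) (below m) False (Suc n) (c # K, \<sigma>, p, g) (\<lambda>s. s = (K, \<sigma>1, p1, g))" for K g
    by (rule bd_step, rule bnd_below[OF assms(1)], rule assms(2), rule 1(2))
  then show ?thesis unfolding tw_def using 1(1) by blast
qed

lemma tw_IfLt: "bnd \<sigma> \<Longrightarrow> tw n (if \<sigma> i < \<sigma> j then c else d) Q \<sigma> p \<Longrightarrow> tw (Suc n) (IfLt i j c d) Q \<sigma> p"
  by (rule tw_step) auto

lemma tw_For:
  assumes I: "I 0 \<sigma> p"
    and body: "\<And>k \<sigma> p. k < n \<Longrightarrow> I k \<sigma> p \<Longrightarrow> bnd \<sigma> \<and> \<sigma> i < \<sigma> j \<and>
       tw nb c (\<lambda>\<sigma>' p'. bnd \<sigma>' \<and> I (Suc k) (\<sigma>'(i := Suc (\<sigma>' i))) p') \<sigma> p"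
    and fin: "\<And>\<sigma> p. I n \<sigma> p \<Longrightarrow> bnd \<sigma> \<and> \<not> \<sigma> i < \<sigma> j \<and> Q \<sigma> p"
  shows "tw (1 + n * (nb + 2)) (For i j c) Q \<sigma> p"
proof -
  have "tw (1 + l * (nb + 2)) (For i j c) Q \<sigma> p" if "n = k + l" "I k \<sigma> p" for l k \<sigma> p
    using that
  proof (induction l arbitrary: k \<sigma> p)
    case 0
    then show ?case using fin[of \<sigma> p] by (simp, intro tw_atom[of \<sigma> "For i j c", unfolded One_nat_def]) auto
  next
    case (Suc l)
    note b = body[of k \<sigma> p]
    have bn: "bnd \<sigma>" "\<sigma> i < \<sigma> j" using b Suc.prems by auto
    obtain \<sigma>1 p1 where 1: "bnd \<sigma>1" "I (Suc k) (\<sigma>1(i := Suc (\<sigma>1 i))) p1"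
        "\<And>K g. bd (rn x) (below m) False nb (c # K, \<sigma>, p, g) (\<lambda>s. s = (K, \<sigma>1, p1, g))"
      using b Suc.prems unfolding tw_def by auto
    let ?\<sigma> = "\<sigma>1(i := Suc (\<sigma>1 i))"
    have "tw (1 + l * (nb + 2)) (For i j c) Q ?\<sigma> p1" by (rule Suc.IH[OF _ 1(2)]) (use Suc.prems in simp)
    then obtain \<sigma>2 p2 where 2: "Q \<sigma>2 p2"
        "\<And>K g. bd (rn x) (below m) False (1 + l * (nb + 2)) (For i j c # K, ?\<sigma>, p1, g) (\<lambda>s. s = (K, \<sigma>2, p2, g))"
      unfolding tw_def by blast
    have "bd (rn x) (below m) False (Suc (nb + Suc (1 + l * (nb + 2)))) (For i j c # K, \<sigma>, p, g) (\<lambda>s. s = (K, \<sigma>2, p2, g))" for K g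
    proof (rule bd_step, rule bnd_below[OF bn(1)])
      show "rn x (For i j c # K, \<sigma>, p, g) = Some (c # Inc i # For i j c # K, \<sigma>, p, g)" using bn(2) by simp
      show "bd (rn x) (below m) False (nb + Suc (1 + l * (nb + 2))) (c # Inc i # For i j c # K, \<sigma>, p, g) (\<lambda>s. s = (K, \<sigma>2, p2, g))"
      proof (rule bd_bind[OF 1(3)])
        fix s assume s: "s = (Inc i # For i j c # K, \<sigma>1, p1, g)"
        have r: "rn x (Inc i # For i j c # K, \<sigma>1, p1, g) = Some (For i j c # K, ?\<sigma>, p1, g)" by simp
        show "bd (rn x) (below m) False (Suc (1 + l * (nb + 2))) s (\<lambda>s. s = (K, \<sigma>2, p2, g))"
          unfolding s by (rule bd_step, rule bnd_below[OF 1(1)], rule r, rule 2(2))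
      qed
    qed
    then have "tw (Suc (nb + Suc (1 + l * (nb + 2)))) (For i j c) Q \<sigma> p" unfolding tw_def using 2(1) by blast
    then show ?case by (rule tw_mono) simp
  qed
  from this[of 0 n] show ?thesis using I by simp
qed

text \<open>Each input cell costs three program steps, for the test, the increment and the move; one
  more finds the endmarker.\<close>

lemma tw_Scan:
  assumes "bnd \<sigma>" "1 \<le> p" "p \<le> length x + 1" "\<sigma> r + (length x + 1 - p) \<le> X"
    and "\<And>\<sigma>'. bnd \<sigma>' \<Longrightarrow> \<sigma>' = \<sigma>(r := \<sigma> r + (length x + 1 - p)) \<Longrightarrow> Q \<sigma>' (length x + 1)"
  shows "tw (1 + 3 * (length x + 1 - p)) (Scan r) Q \<sigma> p"
  using assms
proof (induction "length x + 1 - p" arbitrary: p \<sigma>)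
  case 0
  then have p: "p = length x + 1" by simp
  have r: "read_input x p = None" using p by (simp add: read_input_def)
  show ?case using 0 p r by (simp, intro tw_atom[of \<sigma> "Scan r", unfolded One_nat_def]) auto
next
  case (Suc l)
  have r: "read_input x p \<noteq> None" using Suc by (simp add: read_input_def)
  let ?\<sigma> = "\<sigma>(r := Suc (\<sigma> r))"
  have b: "bnd ?\<sigma>" using Suc by (intro bnd_upd) auto
  have l: "l = length x + 1 - Suc p" using Suc(2) by simp
  have "tw (1 + 3 * (length x + 1 - Suc p)) (Scan r) Q ?\<sigma> (Suc p)"
  proof (rule Suc.hyps(1)[OF l b])
    show "?\<sigma> r + (length x + 1 - Suc p) \<le> X" using Suc by simp
    fix \<sigma>' assume 1: "bnd \<sigma>'" "\<sigma>' = ?\<sigma>(r := ?\<sigma> r + (length x + 1 - Suc p))"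
    have "?\<sigma> r + (length x + 1 - Suc p) = \<sigma> r + (length x + 1 - p)" using Suc(2) by simp
    then have "\<sigma>' = \<sigma>(r := \<sigma> r + (length x + 1 - p))" unfolding 1(2) fun_upd_upd by (simp only:)
    then show "Q \<sigma>' (length x + 1)" using Suc.prems(5) 1(1) by blast
  qed (use Suc in auto)
  then obtain \<sigma>2 p2 where 2: "Q \<sigma>2 p2"
      "\<And>K g. bd (rn x) (below m) False (1 + 3 * l) (Scan r # K, ?\<sigma>, Suc p, g) (\<lambda>s. s = (K, \<sigma>2, p2, g))"
    unfolding tw_def l[symmetric] by blast
  have "bd (rn x) (below m) False (Suc (Suc (Suc (1 + 3 * l)))) (Scan r # K, \<sigma>, p, g) (\<lambda>s. s = (K, \<sigma>2, p2, g))" for K g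
  proof -
    have 1: "rn x (Scan r # K, \<sigma>, p, g) = Some (Inc r # InR # Scan r # K, \<sigma>, p, g)" using r by simp
    have 3: "rn x (Inc r # InR # Scan r # K, \<sigma>, p, g) = Some (InR # Scan r # K, ?\<sigma>, p, g)" by simp
    have 4: "rn x (InR # Scan r # K, ?\<sigma>, p, g) = Some (Scan r # K, ?\<sigma>, Suc p, g)" using Suc(2) by simp
    show ?thesis
      by (rule bd_step, rule bnd_below[OF Suc.prems(1)], rule 1, rule bd_step, rule bnd_below[OF Suc.prems(1)], rule 3,
          rule bd_step, rule bnd_below[OF b], rule 4, rule 2(2))
  qed
  then have "tw (Suc (Suc (Suc (1 + 3 * l)))) (Scan r) Q \<sigma> p" unfolding tw_def using 2(1) by blast
  then show ?case by (rule tw_mono) (use Suc(2) in simp)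
qed

lemma tw_setU:
  "bnd \<sigma> \<Longrightarrow> k \<le> X \<Longrightarrow> Q (\<sigma>(r := k)) p \<Longrightarrow> tw (1 + 2 * k) (setU r k) Q \<sigma> p"
proof (induction k arbitrary: Q)
  case 0
  have "tw 1 (Zero r) Q \<sigma> p" by (rule tw_Sum) (use 0 in \<open>simp_all add: fun_upd_def\<close>)
  then show ?case by simp
next
  case (Suc k)
  have "bnd (\<sigma>(r := k))" using Suc.prems by (intro bnd_upd) auto
  then have inc: "tw 1 (Inc r) Q (\<sigma>(r := k)) p"
    by (rule tw_Sum) (use Suc.prems in \<open>simp add: fun_upd_def cong: if_cong\<close>)
  have "tw (1 + 2 * k) (setU r k) (tw 1 (Inc r) Q) \<sigma> p"
    by (rule Suc.IH) (use Suc.prems inc in \<open>simp_all add: fun_upd_def\<close>)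
  from tw_Seq[OF Suc.prems(1) this] show ?case unfolding setU.simps by (rule tw_mono) simp
qed

lemma tw_MULU:
  assumes b: "bnd \<sigma>" and r: "r \<notin> {11, 13}" "s \<notin> {11, 13}" and le: "\<sigma> r * \<sigma> s \<le> X"
    and Q: "Q (\<sigma>(11 := \<sigma> r * \<sigma> s, 13 := \<sigma> s, r := \<sigma> r * \<sigma> s)) p"
  shows "tw (8 + 3 * \<sigma> s) (MULU r s) Q \<sigma> p"
proof -
  let ?\<tau> = "\<lambda>i. \<sigma>(11 := \<sigma> r * i, 13 := i)"
  have bt: "bnd (?\<tau> i)" if "i \<le> \<sigma> s" for i
  proof -
    have "\<sigma> r * i \<le> X" using le mult_le_mono2[OF that, of "\<sigma> r"] by linarith
    moreover have "i \<le> X" using that bndD[OF b, of s] by linarith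
    ultimately show ?thesis using b by (intro bnd_upd)
  qed
  have loop: "tw (1 + \<sigma> s * (1 + 2)) (For 13 s (Sum 11 False (Some 11) (Some r))) (tw 1 (Cp r 11) Q) (?\<tau> 0) p"
  proof (rule tw_For[where I = "\<lambda>i \<sigma>' p'. \<sigma>' = ?\<tau> i \<and> p' = p"])
    fix k \<sigma>' p' assume k: "k < \<sigma> s" "\<sigma>' = ?\<tau> k \<and> p' = p"
    have u: "\<sigma>'(11 := of_bool False + oval \<sigma>' (Some 11) + oval \<sigma>' (Some r)) = \<sigma>(11 := \<sigma> r * Suc k, 13 := k)"
      using k r by (auto intro!: ext)
    have "bnd (\<sigma>(11 := \<sigma> r * Suc k, 13 := k))"
    proof (intro bnd_upd b)
      have "\<sigma> r * Suc k \<le> \<sigma> r * \<sigma> s" using k by (intro mult_le_mono2) simp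
      then show "\<sigma> r * Suc k \<le> X" using le by simp
      show "k \<le> X" using k bndD[OF b, of s] by linarith
    qed
    moreover have "(\<sigma>(11 := \<sigma> r * Suc k, 13 := k))(13 := Suc k) = ?\<tau> (Suc k)" by simp
    ultimately have q: "bnd (\<sigma>(11 := \<sigma> r * Suc k, 13 := k)) \<and>
        (\<sigma>(11 := \<sigma> r * Suc k, 13 := k))(13 := Suc ((\<sigma>(11 := \<sigma> r * Suc k, 13 := k)) 13)) = ?\<tau> (Suc k) \<and> p' = p"
      using k by simp
    have "bnd \<sigma>'" using k bt[of k] by simp
    then have "tw 1 (Sum 11 False (Some 11) (Some r)) (\<lambda>\<sigma>'' p''. bnd \<sigma>'' \<and> \<sigma>''(13 := Suc (\<sigma>'' 13)) = ?\<tau> (Suc k) \<and> p'' = p) \<sigma>' p'"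
      by (rule tw_Sum) (unfold u, rule q)
    then show "bnd \<sigma>' \<and> \<sigma>' 13 < \<sigma>' s \<and> tw 1 (Sum 11 False (Some 11) (Some r))
        (\<lambda>\<sigma>'' p''. bnd \<sigma>'' \<and> \<sigma>''(13 := Suc (\<sigma>'' 13)) = ?\<tau> (Suc k) \<and> p'' = p) \<sigma>' p'"
      using k bt[of k] r by simp
  next
    fix \<sigma>' p' assume k: "\<sigma>' = ?\<tau> (\<sigma> s) \<and> p' = p"
    have b': "bnd \<sigma>'" using k bt[of "\<sigma> s"] by simp
    then have "tw 1 (Cp r 11) Q \<sigma>' p'" by (rule tw_Sum) (use k Q in simp)
    then show "bnd \<sigma>' \<and> \<not> \<sigma>' 13 < \<sigma>' s \<and> tw 1 (Cp r 11) Q \<sigma>' p'"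
      using k b' r by simp
  qed simp
  have b1: "bnd (\<sigma>(11 := 0))" using b by (intro bnd_upd) auto
  have b2: "bnd (\<sigma>(11 := 0, 13 := 0))" using b by (intro bnd_upd) auto
  have s0: "?\<tau> 0 = \<sigma>(11 := 0, 13 := 0)" by simp
  have "tw (1 + (1 + \<sigma> s * (1 + 2)) + 1) (Seq (For 13 s (Sum 11 False (Some 11) (Some r))) (Cp r 11)) Q (\<sigma>(11 := 0, 13 := 0)) p"
    using tw_Seq[OF b2 loop[unfolded s0]] .
  then have "tw 1 (Zero 13) (tw (1 + (1 + \<sigma> s * (1 + 2)) + 1) (Seq (For 13 s (Sum 11 False (Some 11) (Some r))) (Cp r 11)) Q) (\<sigma>(11 := 0)) p"
    by (intro tw_Sum[OF b1]) simp
  from tw_Seq[OF b1 this] have "tw 1 (Zero 11) (tw (1 + 1 + (1 + (1 + \<sigma> s * (1 + 2)) + 1))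
      (Seq (Zero 13) (Seq (For 13 s (Sum 11 False (Some 11) (Some r))) (Cp r 11))) Q) \<sigma> p"
    by (intro tw_Sum[OF b]) simp
  from tw_Seq[OF b this] show ?thesis unfolding MULU_def by (rule tw_mono) simp
qed

lemma tw_POWU:
  assumes b: "bnd \<sigma>" and r: "r \<notin> {11, 13, s}" "s \<notin> {11, 13}" and s: "1 \<le> \<sigma> s" and le: "\<sigma> r * \<sigma> s ^ k \<le> X"
    and Q: "\<And>\<sigma>'. bnd \<sigma>' \<Longrightarrow> \<sigma>' r = \<sigma> r * \<sigma> s ^ k \<Longrightarrow> (\<And>i. i \<notin> {11, 13, r} \<Longrightarrow> \<sigma>' i = \<sigma> i) \<Longrightarrow> Q \<sigma>' p"
  shows "tw (1 + k * (9 + 3 * \<sigma> s)) (POWU r s k) Q \<sigma> p"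
  using le Q
proof (induction k arbitrary: Q)
  case 0
  have "Q \<sigma> p" by (rule 0(2)) (use b in auto)
  then show ?case using tw_Skip[OF b] by simp
next
  case (Suc k)
  have le: "\<sigma> r * \<sigma> s ^ k \<le> X"
  proof -
    have "\<sigma> r * \<sigma> s ^ k * 1 \<le> \<sigma> r * \<sigma> s ^ k * \<sigma> s" by (rule mult_le_mono2[OF s])
    also have "\<dots> = \<sigma> r * \<sigma> s ^ Suc k" by simp
    also have "\<dots> \<le> X" by (rule Suc.prems(1))
    finally show ?thesis by simp
  qed
  have "tw (1 + k * (9 + 3 * \<sigma> s)) (POWU r s k) (tw (8 + 3 * \<sigma> s) (MULU r s) Q) \<sigma> p"
  proof (rule Suc.IH[OF le])
    fix \<sigma>' assume 1: "bnd \<sigma>'" "\<sigma>' r = \<sigma> r * \<sigma> s ^ k" and f: "\<And>i. i \<notin> {11, 13, r} \<Longrightarrow> \<sigma>' i = \<sigma> i"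
    have ss: "\<sigma>' s = \<sigma> s" using f r by auto
    have pr: "\<sigma>' r * \<sigma>' s = \<sigma> r * \<sigma> s ^ Suc k" using 1 ss by simp
    have "tw (8 + 3 * \<sigma>' s) (MULU r s) Q \<sigma>' p"
    proof (rule tw_MULU[OF 1(1)])
      show "Q (\<sigma>'(11 := \<sigma>' r * \<sigma>' s, 13 := \<sigma>' s, r := \<sigma>' r * \<sigma>' s)) p"
        unfolding pr
      proof (rule Suc.prems(2))
        show "bnd (\<sigma>'(11 := \<sigma> r * \<sigma> s ^ Suc k, 13 := \<sigma>' s, r := \<sigma> r * \<sigma> s ^ Suc k))"
          by (intro bnd_upd 1(1) Suc.prems(1) bndD)
      qed (use f in auto)
    qed (use r pr Suc.prems(1) in auto)
    then show "tw (8 + 3 * \<sigma> s) (MULU r s) Q \<sigma>' p" using ss by simp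
  qed
  from tw_Seq[OF b this] show ?case unfolding POWU.simps by (rule tw_mono) simp
qed

text \<open>Registers 11 and 13 are scratch registers of the multiplication.\<close>
definition held :: "(nat \<Rightarrow> nat) \<Rightarrow> (nat \<Rightarrow> nat) \<Rightarrow> nat \<Rightarrow> bool" where
  "held \<tau> \<sigma> p \<longleftrightarrow> bnd \<sigma> \<and> p = 0 \<and> (\<forall>r. r \<notin> {11, 13} \<longrightarrow> \<sigma> r = \<tau> r)"

text \<open>A Hoare triple between register contents: from the values \<open>\<tau>\<close> to the
  values \<open>\<tau>'\<close>, up to scratch registers, with the head at the left end and within
  time \<open>n\<close>. The steps of \<open>INIT\<close> compose by \<open>hp_Seq\<close>.\<close>

definition hp :: "nat \<Rightarrow> 'a com \<Rightarrow> (nat \<Rightarrow> nat) \<Rightarrow> (nat \<Rightarrow> nat) \<Rightarrow> bool" where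
  "hp n c \<tau> \<tau>' \<longleftrightarrow> (\<forall>\<sigma> p. held \<tau> \<sigma> p \<longrightarrow> tw n c (held \<tau>') \<sigma> p)"

lemma tw_conseq: "tw n c Q \<sigma> p \<Longrightarrow> (\<And>\<sigma> p. Q \<sigma> p \<Longrightarrow> R \<sigma> p) \<Longrightarrow> tw n c R \<sigma> p"
  unfolding tw_def by blast

lemma hp_mono: "hp n c \<tau> \<tau>' \<Longrightarrow> n \<le> n' \<Longrightarrow> hp n' c \<tau> \<tau>'"
  unfolding hp_def using tw_mono by blast

lemma hp_Seq:
  assumes "hp n1 c \<tau> \<tau>1" "hp n2 d \<tau>1 \<tau>2"
  shows "hp (1 + n1 + n2) (Seq c d) \<tau> \<tau>2"
  unfolding hp_def
proof (intro allI impI)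
  fix \<sigma> p assume h: "held \<tau> \<sigma> p"
  have "tw n1 c (tw n2 d (held \<tau>2)) \<sigma> p"
    by (rule tw_conseq[of n1 c "held \<tau>1"]) (use assms h in \<open>auto simp: hp_def\<close>)
  then show "tw (1 + n1 + n2) (Seq c d) (held \<tau>2) \<sigma> p" using h by (intro tw_Seq) (auto simp: held_def)
qed

lemma oval_held: "held \<tau> \<sigma> p \<Longrightarrow> u \<noteq> Some 11 \<Longrightarrow> u \<noteq> Some 13 \<Longrightarrow> oval \<sigma> u = oval \<tau> u"
  by (cases u) (auto simp: held_def)

lemma hp_Sum:
  assumes "u \<notin> {Some 11, Some 13}" "v \<notin> {Some 11, Some 13}" "w = of_bool c + oval \<tau> u + oval \<tau> v" "w \<le> X"
  shows "hp 1 (Sum r c u v) \<tau> (\<tau>(r := w))"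
  unfolding hp_def
proof (intro allI impI)
  fix \<sigma> p assume h: "held \<tau> \<sigma> p"
  have w: "of_bool c + oval \<sigma> u + oval \<sigma> v = w" using oval_held[OF h] assms by simp
  have "held (\<tau>(r := w)) (\<sigma>(r := w)) p" using h assms(4) bnd_upd[of \<sigma> w r] by (simp add: held_def)
  then show "tw 1 (Sum r c u v) (held (\<tau>(r := w))) \<sigma> p"
    using h by (intro tw_Sum) (simp_all add: w held_def)
qed

lemma hp_setU: "k \<le> X \<Longrightarrow> hp (1 + 2 * k) (setU r k) \<tau> (\<tau>(r := k))"
  unfolding hp_def
proof (intro allI impI)
  fix \<sigma> p assume k: "k \<le> X" and h: "held \<tau> \<sigma> p"
  have "held (\<tau>(r := k)) (\<sigma>(r := k)) p" using h k bnd_upd[of \<sigma> k r] by (simp add: held_def)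
  then show "tw (1 + 2 * k) (setU r k) (held (\<tau>(r := k))) \<sigma> p"
    using h k by (intro tw_setU) (simp_all add: held_def)
qed

lemma hp_POWU:
  assumes r: "r \<notin> {11, 13, s}" "s \<notin> {11, 13}" and s: "1 \<le> \<tau> s" and w: "w = \<tau> r * \<tau> s ^ k" "w \<le> X" and t: "t = 1 + k * (9 + 3 * \<tau> s)"
  shows "hp t (POWU r s k) \<tau> (\<tau>(r := w))"
  unfolding hp_def
proof (intro allI impI)
  fix \<sigma> p assume h: "held \<tau> \<sigma> p"
  have e: "\<sigma> r = \<tau> r" "\<sigma> s = \<tau> s" using h r by (auto simp: held_def)
  have "tw (1 + k * (9 + 3 * \<sigma> s)) (POWU r s k) (held (\<tau>(r := w))) \<sigma> p"
  proof (rule tw_POWU)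
    fix \<sigma>' assume "bnd \<sigma>'" "\<sigma>' r = \<sigma> r * \<sigma> s ^ k" "\<And>i. i \<notin> {11, 13, r} \<Longrightarrow> \<sigma>' i = \<sigma> i"
    then show "held (\<tau>(r := w)) \<sigma>' p" using h e w by (auto simp: held_def)
  qed (use h e r s w in \<open>auto simp: held_def\<close>)
  then show "tw t (POWU r s k) (held (\<tau>(r := w))) \<sigma> p" using e t by simp
qed

text \<open>The assumptions make \<open>E\<close> the least exponent with \<open>2 ^ E\<close> at
  least \<open>V\<close>, hence the number of doublings performed.\<close>

lemma hp_CAPLOOP:
  assumes \<tau>: "\<tau> 14 = 0" "\<tau> 12 = 1" "\<tau> rCAP = B ^ 3" "\<tau> rVV = V" "\<tau> rBW = B"
    and X: "X = B ^ (E + 3)" and B: "2 * V \<le> B" "0 < V" and E: "V \<le> 2 ^ E" "\<And>j. j < E \<Longrightarrow> 2 ^ j < V"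
  shows "hp (1 + V * ((11 + 3 * B) + 2)) CAPLOOP \<tau> (\<tau>(14 := V, 12 := 2 ^ E, rCAP := X))"
proof -
  \<comment> \<open>The registers after \<open>k\<close> rounds; from round \<open>E\<close> on only
    the counter changes.\<close>
  define T where "T k = \<tau>(14 := k, 12 := 2 ^ min k E, rCAP := B ^ (min k E + 3))" for k
  have BX: "B \<le> X"
  proof -
    have "B ^ 1 \<le> B ^ (E + 3)" using B by (intro power_increasing) auto
    then show ?thesis using X by simp
  qed
  \<comment> \<open>The loop has \<open>V\<close> rounds, enough for all \<open>E\<close> doublings,
    since \<open>2 ^ V\<close> exceeds \<open>V\<close>.\<close>
  have EV: "E \<le> V"
  proof (rule ccontr)
    assume "\<not> E \<le> V"
    then have "2 ^ V < V" using E(2)[of V] by simp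
    then show False using less_exp[of V] by simp
  qed
  have TV: "T V = \<tau>(14 := V, 12 := 2 ^ E, rCAP := X)" using EV X by (simp add: T_def min_def)
  have T0: "T 0 = \<tau>" using \<tau> by (auto simp: T_def)
  let ?body = "IfLt 12 rVV (Seq (Sum 12 False (Some 12) (Some 12)) (MULU rCAP rBW)) Skip :: 'a com"
  have step: "tw (11 + 3 * B) ?body (\<lambda>\<sigma>' p'. bnd \<sigma>' \<and> held (T (Suc k)) (\<sigma>'(14 := Suc (\<sigma>' 14))) p') \<sigma> p"
    (is "tw _ _ ?Q \<sigma> p") if k: "k < V" "held (T k) \<sigma> p" for k \<sigma> p
  proof -
    have b: "bnd \<sigma>" using k by (simp add: held_def)
    have v: "\<sigma> 14 = k" "\<sigma> 12 = 2 ^ min k E" "\<sigma> rCAP = B ^ (min k E + 3)" "\<sigma> rVV = V" "\<sigma> rBW = B"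
      using k \<tau> by (auto simp: held_def T_def)
    have kX: "Suc k \<le> X" using k B BX by simp
    have fr: "\<sigma> r = \<tau> r" if "r \<notin> {11, 13, 14, 12, rCAP}" for r using k that by (simp add: held_def T_def)
    have p0: "p = 0" using k by (simp add: held_def)
    show ?thesis
    proof (cases "k < E")
      case True
      have lt: "\<sigma> 12 < \<sigma> rVV" using E(2)[OF True] True v by simp
      define \<sigma>1 where "\<sigma>1 = \<sigma>(12 := 2 ^ Suc k)"
      have b1: "bnd \<sigma>1" unfolding \<sigma>1_def
      proof (intro bnd_upd b)
        have "2 ^ Suc k \<le> 2 * V" using E(2)[OF True] by simp
        then show "2 ^ Suc k \<le> X" using B BX by linarith
      qed
      have v1: "\<sigma>1 rCAP = B ^ (k + 3)" "\<sigma>1 rBW = B" using v True by (simp_all add: \<sigma>1_def)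
      have pr: "\<sigma>1 rCAP * \<sigma>1 rBW = B ^ (Suc k + 3)" by (simp only: v1 add_Suc power_Suc2)
      have prX: "B ^ (Suc k + 3) \<le> X" unfolding X using True B by (intro power_increasing) auto
      have "tw (8 + 3 * \<sigma>1 rBW) (MULU rCAP rBW) ?Q \<sigma>1 p"
      proof (rule tw_MULU[OF b1])
        let ?s = "\<sigma>1(11 := \<sigma>1 rCAP * \<sigma>1 rBW, 13 := \<sigma>1 rBW, rCAP := \<sigma>1 rCAP * \<sigma>1 rBW)"
        have "bnd ?s" unfolding pr by (intro bnd_upd b1 prX bndD)
        moreover have "?s 14 = k" using v by (simp add: \<sigma>1_def)
        moreover have "bnd (?s(14 := Suc k))" using \<open>bnd ?s\<close> kX by (rule bnd_upd)
        moreover have "(?s(14 := Suc k)) r = T (Suc k) r" if r: "r \<notin> {11, 13}" for r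
          using r fr[of r] True unfolding pr by (auto simp: T_def \<sigma>1_def)
        ultimately show "?Q ?s p" using p0 by (simp only: held_def) simp
      qed (use pr prX in \<open>simp_all del: power_Suc\<close>)
      then have "tw 1 (Sum 12 False (Some 12) (Some 12)) (tw (8 + 3 * B) (MULU rCAP rBW) ?Q) \<sigma> p"
        using v True by (intro tw_Sum[OF b]) (simp add: \<sigma>1_def mult_2)
      from tw_Seq[OF b this] have "tw (10 + 3 * B) (Seq (Sum 12 False (Some 12) (Some 12)) (MULU rCAP rBW)) ?Q \<sigma> p"
        by (rule tw_mono) simp
      then show ?thesis using tw_IfLt[OF b, of "10 + 3 * B" 12 rVV] lt by simp
    next
      case False
      have lt: "\<not> \<sigma> 12 < \<sigma> rVV" using E(1) False v by (simp add: min_def)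
      have "bnd (\<sigma>(14 := Suc k))" using b kX by (rule bnd_upd)
      moreover have "(\<sigma>(14 := Suc k)) r = T (Suc k) r" if r: "r \<notin> {11, 13}" for r
        using r fr[of r] v False by (auto simp: T_def min_def)
      ultimately have q: "?Q \<sigma> p" using b p0 v by (simp add: held_def)
      have "tw 1 Skip ?Q \<sigma> p" by (rule tw_Skip[OF b]) (rule q)
      then have "tw (10 + 3 * B) Skip ?Q \<sigma> p" by (rule tw_mono) simp
      then show ?thesis using tw_IfLt[OF b, of "10 + 3 * B" 12 rVV] lt by simp
    qed
  qed
  show ?thesis unfolding hp_def CAPLOOP_def TV[symmetric]
  proof (intro allI impI)
    fix \<sigma> p assume h: "held \<tau> \<sigma> p"
    show "tw (1 + V * ((11 + 3 * B) + 2)) (For 14 rVV ?body) (held (T V)) \<sigma> p"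
    proof (rule tw_For[where I = "\<lambda>k. held (T k)"])
      show "held (T 0) \<sigma> p" using h T0 by simp
      fix k \<sigma> p assume k: "k < V" "held (T k) \<sigma> p"
      have "\<sigma> 14 = k" "\<sigma> rVV = V" "bnd \<sigma>" using k \<tau> by (auto simp: held_def T_def)
      then show "bnd \<sigma> \<and> \<sigma> 14 < \<sigma> rVV \<and> tw (11 + 3 * B) ?body (\<lambda>\<sigma>' p'. bnd \<sigma>' \<and> held (T (Suc k)) (\<sigma>'(14 := Suc (\<sigma>' 14))) p') \<sigma> p"
        using k step[OF k] by simp
    next
      fix \<sigma> p assume k: "held (T V) \<sigma> p"
      have "\<sigma> 14 = V" "\<sigma> rVV = V" "bnd \<sigma>" using k \<tau> by (auto simp: held_def T_def)
      then show "bnd \<sigma> \<and> \<not> \<sigma> 14 < \<sigma> rVV \<and> held (T V) \<sigma> p" using k by simp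
    qed
  qed
qed

lemma input_length_tw:
  assumes n: "length x + 2 \<le> X"
    and Q: "\<And>\<sigma> p. held ((\<lambda>_. 0)(10 := length x, rN1 := length x + 1)) \<sigma> p \<Longrightarrow> tw t c Q \<sigma> p"
  shows "tw (12 + 6 * length x + t) (Seq InR (Seq (Scan 10) (Seq (Sum rN1 True (Some 10) None) (Seq (For 13 rN1 InL) c)))) Q (\<lambda>_. 0) 0"
proof -
  let ?n = "length x"
  define \<sigma>0 :: "nat \<Rightarrow> nat" where "\<sigma>0 = (\<lambda>_. 0)"
  define \<sigma>1 where "\<sigma>1 = \<sigma>0(10 := ?n)"
  define \<sigma>2 where "\<sigma>2 = \<sigma>1(rN1 := ?n + 1)"
  have b0: "bnd \<sigma>0" by (simp add: bnd_def \<sigma>0_def)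
  have b1: "bnd \<sigma>1" unfolding \<sigma>1_def using n by (intro bnd_upd b0) simp
  have b2: "bnd \<sigma>2" unfolding \<sigma>2_def using n by (intro bnd_upd b1) simp
  have b2': "bnd (\<sigma>2(13 := k))" if "k \<le> ?n + 1" for k using that n by (intro bnd_upd b2) simp
  have loop: "tw (1 + (?n + 1) * (1 + 2)) (For 13 rN1 InL) (tw t c Q) \<sigma>2 (?n + 1)"
  proof (rule tw_For[where I = "\<lambda>k \<sigma> p. \<sigma> = \<sigma>2(13 := k) \<and> p = ?n + 1 - k"])
    show "\<sigma>2 = \<sigma>2(13 := 0) \<and> ?n + 1 = ?n + 1 - 0" by (auto simp: \<sigma>2_def \<sigma>1_def \<sigma>0_def)
  next
    fix k \<sigma> p assume k: "k < ?n + 1" "\<sigma> = \<sigma>2(13 := k) \<and> p = ?n + 1 - k"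
    have b: "bnd \<sigma>" using b2'[of k] k by simp
    have q: "bnd \<sigma> \<and> \<sigma>(13 := Suc (\<sigma> 13)) = \<sigma>2(13 := Suc k) \<and> p - 1 = ?n + 1 - Suc k" using b k by simp
    have "tw 1 InL (\<lambda>\<sigma>' p'. bnd \<sigma>' \<and> \<sigma>'(13 := Suc (\<sigma>' 13)) = \<sigma>2(13 := Suc k) \<and> p' = ?n + 1 - Suc k) \<sigma> p"
      by (rule tw_InL[OF b]) (use k in simp, rule q)
    then show "bnd \<sigma> \<and> \<sigma> 13 < \<sigma> rN1 \<and> tw 1 InL (\<lambda>\<sigma>' p'. bnd \<sigma>' \<and> \<sigma>'(13 := Suc (\<sigma>' 13)) = \<sigma>2(13 := Suc k) \<and> p' = ?n + 1 - Suc k) \<sigma> p"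
      using b k by (simp add: \<sigma>2_def)
  next
    fix \<sigma> p assume k: "\<sigma> = \<sigma>2(13 := ?n + 1) \<and> p = ?n + 1 - (?n + 1)"
    have b: "bnd \<sigma>" using b2'[of "?n + 1"] k by simp
    have "tw t c Q \<sigma> p" by (rule Q) (use k b in \<open>simp add: held_def \<sigma>2_def \<sigma>1_def \<sigma>0_def\<close>)
    then show "bnd \<sigma> \<and> \<not> \<sigma> 13 < \<sigma> rN1 \<and> tw t c Q \<sigma> p" using b k by (simp add: \<sigma>2_def)
  qed
  let ?c1 = "Seq (For 13 rN1 InL) c"
  let ?t1 = "1 + (1 + (?n + 1) * (1 + 2)) + t"
  have 1: "tw ?t1 ?c1 Q \<sigma>2 (?n + 1)" by (rule tw_Seq[OF b2 loop])
  have e2: "\<sigma>1(rN1 := of_bool True + oval \<sigma>1 (Some 10) + oval \<sigma>1 None) = \<sigma>2" by (simp add: \<sigma>2_def \<sigma>1_def)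
  have "tw 1 (Sum rN1 True (Some 10) None) (tw ?t1 ?c1 Q) \<sigma>1 (?n + 1)"
    by (rule tw_Sum[OF b1]) (unfold e2, rule 1)
  from tw_Seq[OF b1 this] have 2: "tw (1 + 1 + ?t1) (Seq (Sum rN1 True (Some 10) None) ?c1) Q \<sigma>1 (?n + 1)" .
  have "tw (1 + 3 * (?n + 1 - 1)) (Scan 10) (tw (1 + 1 + ?t1) (Seq (Sum rN1 True (Some 10) None) ?c1) Q) \<sigma>0 1"
  proof (rule tw_Scan[OF b0])
    fix \<sigma>' assume "\<sigma>' = \<sigma>0(10 := \<sigma>0 10 + (?n + 1 - 1))"
    then have "\<sigma>' = \<sigma>1" by (simp add: \<sigma>1_def \<sigma>0_def)
    then show "tw (1 + 1 + ?t1) (Seq (Sum rN1 True (Some 10) None) ?c1) Q \<sigma>' (?n + 1)" using 2 by simp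
  qed (use n in \<open>simp_all add: \<sigma>0_def\<close>)
  from tw_Seq[OF b0 this]
  have 3: "tw (1 + (1 + 3 * (?n + 1 - 1)) + (1 + 1 + ?t1)) (Seq (Scan 10) (Seq (Sum rN1 True (Some 10) None) ?c1)) Q \<sigma>0 (Suc 0)"
    by simp
  have "tw 1 InR (tw (1 + (1 + 3 * (?n + 1 - 1)) + (1 + 1 + ?t1)) (Seq (Scan 10) (Seq (Sum rN1 True (Some 10) None) ?c1)) Q) \<sigma>0 0"
    by (rule tw_InR[OF b0]) (simp, rule 3)
  from tw_Seq[OF b0 this] show ?thesis unfolding \<sigma>0_def by (rule tw_mono) simp
qed

lemma INIT_tw:
  assumes N: "N = (length x + 2) ^ k" "length x + 2 \<le> N" and V: "V = N ^ 4" and B: "B = V ^ 4"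
    and b: "b \<le> N" and X': "X = B ^ (E + 3)" and E: "V \<le> 2 ^ E" "\<And>j. j < E \<Longrightarrow> 2 ^ j < V"
  shows "tw ((400 + 20 * k) * (B * B)) (INIT k b) (\<lambda>\<sigma> p. bnd \<sigma> \<and> p = 0 \<and> \<sigma> rCAP = X \<and> \<sigma> rTCAP = B + 1 \<and> \<sigma> rZR = 0 \<and>
    \<sigma> rTWO = 2 \<and> \<sigma> rBB = b \<and> \<sigma> rNN = N \<and> \<sigma> rVV = V \<and> \<sigma> rBW = B \<and> \<sigma> rN1 = length x + 1) (\<lambda>_. 0) 0"
proof -
  let ?n = "length x"
  have pw: "a \<le> a ^ 4" "2 \<le> a \<Longrightarrow> 2 * a \<le> a ^ 4" if "1 \<le> a" for a :: nat
  proof -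
    show "a \<le> a ^ 4" using self_le_power[of a 4] that by simp
    assume a: "2 \<le> a"
    have "2 * a \<le> a * a" using a by simp
    also have "\<dots> \<le> a ^ 4" using power_increasing[of 2 4 a] that by (simp add: power2_eq_square)
    finally show "2 * a \<le> a ^ 4" .
  qed
  have N2: "2 \<le> N" using N by simp
  have NV: "2 * N \<le> V" unfolding V by (rule pw) (use N2 in auto)
  have VB: "2 * V \<le> B" unfolding B by (rule pw) (use N2 NV in auto)
  have B1: "1 \<le> B" using N2 NV VB by linarith
  have B3X: "B ^ 3 \<le> X" unfolding X' using B1 by (intro power_increasing) auto
  have "B * 4 \<le> B ^ 3"
  proof -
    have "2 * 2 \<le> B * B" using N2 NV VB by (intro mult_le_mono) auto
    then have "B * 4 \<le> B * (B * B)" by (intro mult_le_mono2) simp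
    then show ?thesis by (simp add: power3_eq_cube)
  qed
  then have BX: "B * 4 \<le> X" using B3X by linarith
  let ?c = "Seq (Sum 10 True (Some rN1) None) (Seq (One rNN) (Seq (POWU rNN 10 k) (Seq (One rVV) (Seq (POWU rVV rNN 4)
     (Seq (One rBW) (Seq (POWU rBW rVV 4) (Seq (Sum rTCAP True (Some rBW) None) (Seq (setU rTWO 2) (Seq (setU rBB b)
     (Seq (One rCAP) (Seq (POWU rCAP rBW 3) (Seq (One 12) CAPLOOP)))))))))))) :: 'a com"
  define T0 :: "nat \<Rightarrow> nat" where "T0 = (\<lambda>_. 0)(10 := ?n, rN1 := ?n + 1)"
  define T1 where "T1 = T0(10 := ?n + 2)"
  define T2 where "T2 = T1(rNN := 1)"
  define T3 where "T3 = T2(rNN := N)"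
  define T4 where "T4 = T3(rVV := 1)"
  define T5 where "T5 = T4(rVV := V)"
  define T6 where "T6 = T5(rBW := 1)"
  define T7 where "T7 = T6(rBW := B)"
  define T8 where "T8 = T7(rTCAP := B + 1)"
  define T9 where "T9 = T8(rTWO := 2)"
  define T10 where "T10 = T9(rBB := b)"
  define T11 where "T11 = T10(rCAP := 1)"
  define T12 where "T12 = T11(rCAP := B ^ 3)"
  define T13 where "T13 = T12(12 := 1)"
  note defs = T13_def T12_def T11_def T10_def T9_def T8_def T7_def T6_def T5_def T4_def T3_def T2_def T1_def T0_def
  have bX: "b \<le> X" "1 \<le> X" "2 \<le> X" "N \<le> X" "V \<le> X" "B + 1 \<le> X" "?n + 2 \<le> X"
    using b N N2 NV VB BX by linarith+
  have h13: "hp (1 + V * ((11 + 3 * B) + 2)) CAPLOOP T13 (T13(14 := V, 12 := 2 ^ E, rCAP := X))"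
    by (rule hp_CAPLOOP) (use X' VB N2 NV E in \<open>simp_all add: defs\<close>)
  have h12: "hp 1 (One 12) T12 T13" unfolding T13_def by (rule hp_Sum) (use bX in auto)
  have h11: "hp (1 + 3 * (9 + 3 * B)) (POWU rCAP rBW 3) T11 T12" unfolding T12_def by (rule hp_POWU) (use B3X B1 in \<open>simp_all add: defs\<close>)
  have h10: "hp 1 (One rCAP) T10 T11" unfolding T11_def by (rule hp_Sum) (use bX in auto)
  have h9: "hp (1 + 2 * b) (setU rBB b) T9 T10" unfolding T10_def by (rule hp_setU) (use bX in auto)
  have h8: "hp (1 + 2 * 2) (setU rTWO 2) T8 T9" unfolding T9_def by (rule hp_setU) (use bX in auto)
  have h7: "hp 1 (Sum rTCAP True (Some rBW) None) T7 T8" unfolding T8_def by (rule hp_Sum) (use bX in \<open>auto simp: defs\<close>)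
  have h6: "hp (1 + 4 * (9 + 3 * V)) (POWU rBW rVV 4) T6 T7" unfolding T7_def by (rule hp_POWU) (use bX B N2 NV in \<open>simp_all add: defs\<close>)
  have h5: "hp 1 (One rBW) T5 T6" unfolding T6_def by (rule hp_Sum) (use bX in auto)
  have h4: "hp (1 + 4 * (9 + 3 * N)) (POWU rVV rNN 4) T4 T5" unfolding T5_def by (rule hp_POWU) (use bX V N2 in \<open>simp_all add: defs\<close>)
  have h3: "hp 1 (One rVV) T3 T4" unfolding T4_def by (rule hp_Sum) (use bX in auto)
  have h2: "hp (1 + k * (9 + 3 * (?n + 2))) (POWU rNN 10 k) T2 T3" unfolding T3_def by (rule hp_POWU) (use bX N in \<open>simp_all add: defs\<close>)
  have h1: "hp 1 (One rNN) T1 T2" unfolding T2_def by (rule hp_Sum) (use bX in auto)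
  have h0: "hp 1 (Sum 10 True (Some rN1) None) T0 T1" unfolding T1_def by (rule hp_Sum) (use bX in \<open>auto simp: defs\<close>)
  note h = hp_Seq[OF h0 hp_Seq[OF h1 hp_Seq[OF h2 hp_Seq[OF h3 hp_Seq[OF h4 hp_Seq[OF h5 hp_Seq[OF h6 hp_Seq[OF h7
    hp_Seq[OF h8 hp_Seq[OF h9 hp_Seq[OF h10 hp_Seq[OF h11 hp_Seq[OF h12 h13]]]]]]]]]]]]]
  define D where "D = B * B"
  \<comment> \<open>The budget of the whole initialisation less what the trip over the input costs,
    \<open>12 + 6 * ?n\<close>, with 12 estimated by \<open>12 * D\<close>. The numerical factors
    are generous.\<close>
  define t where "t = (388 + 20 * k) * D - 6 * ?n"
  have BB: "B \<le> D" using B1 by (simp add: D_def)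
  have nB: "?n + 2 \<le> B" using N NV VB by linarith
  have k1: "k * (9 + 3 * (?n + 2)) \<le> 20 * (k * D)"
  proof -
    have "9 + 3 * (?n + 2) \<le> 20 * D" using nB BB B1 by simp
    then have "k * (9 + 3 * (?n + 2)) \<le> k * (20 * D)" by (rule mult_le_mono2)
    then show ?thesis by simp
  qed
  have V1: "V * ((11 + 3 * B) + 2) \<le> 13 * B + 3 * D"
  proof -
    have "V * ((11 + 3 * B) + 2) \<le> B * ((11 + 3 * B) + 2)" using VB by (intro mult_le_mono1) simp
    then show ?thesis by (simp add: D_def algebra_simps)
  qed
  have kD: "(c + 20 * k) * D = c * D + 20 * (k * D)" for c by (simp add: algebra_simps)
  have t: "6 * ?n + t = 388 * D + 20 * (k * D)"
    unfolding t_def kD using nB BB by simp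
  have "hp t ?c T0 (T13(14 := V, 12 := 2 ^ E, rCAP := X))"
  proof (rule hp_mono[OF h])
    have bounds: "N \<le> D" "V \<le> D" "b \<le> D" "B \<le> D" "?n \<le> D" "1 \<le> D" using nB BB b NV VB B1 by simp_all
    \<comment> \<open>The products are replaced by variables, so that the estimate is linear in
      everything that remains.\<close>
    have *: "1 + 1 + (1 + 1 + (1 + (1 + a) + (1 + 1 + (1 + (1 + 4 * (9 + 3 * N)) + (1 + 1 + (1 + (1 + 4 * (9 + 3 * V)) +
      (1 + 1 + (1 + (1 + 2 * 2) + (1 + (1 + 2 * b) + (1 + 1 + (1 + (1 + 3 * (9 + 3 * B)) + (1 + 1 + (1 + v))))))))))))) \<le> t"
      if "a \<le> 20 * kd" "v \<le> 13 * B + 3 * D" "6 * ?n + t = 388 * D + 20 * kd" for a v kd :: nat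
      using that bounds by simp
    show "1 + 1 + (1 + 1 + (1 + (1 + k * (9 + 3 * (?n + 2))) + (1 + 1 + (1 + (1 + 4 * (9 + 3 * N)) + (1 + 1 + (1 + (1 + 4 * (9 + 3 * V)) +
      (1 + 1 + (1 + (1 + 2 * 2) + (1 + (1 + 2 * b) + (1 + 1 + (1 + (1 + 3 * (9 + 3 * B)) + (1 + 1 + (1 + V * (11 + 3 * B + 2)))))))))))))) \<le> t"
      by (rule *[OF k1 V1 t])
  qed
  then have c: "tw t ?c (held (T13(14 := V, 12 := 2 ^ E, rCAP := X))) \<sigma> p" if "held T0 \<sigma> p" for \<sigma> p
    using that by (simp add: hp_def)
  have "tw (12 + 6 * ?n + t) (INIT k b) (held (T13(14 := V, 12 := 2 ^ E, rCAP := X))) (\<lambda>_. 0) 0"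
    unfolding INIT_def by (rule input_length_tw) (use bX c in \<open>simp_all add: T0_def\<close>)
  then have "tw ((400 + 20 * k) * (B * B)) (INIT k b) (held (T13(14 := V, 12 := 2 ^ E, rCAP := X))) (\<lambda>_. 0) 0"
  proof (rule tw_mono)
    show "12 + 6 * ?n + t \<le> (400 + 20 * k) * (B * B)" unfolding D_def[symmetric] kD using t B1 BB by simp
  qed
  then show ?thesis
  proof (rule tw_conseq)
    fix \<sigma> p assume "held (T13(14 := V, 12 := 2 ^ E, rCAP := X)) \<sigma> p"
    then show "bnd \<sigma> \<and> p = 0 \<and> \<sigma> rCAP = X \<and> \<sigma> rTCAP = B + 1 \<and> \<sigma> rZR = 0 \<and>
    \<sigma> rTWO = 2 \<and> \<sigma> rBB = b \<and> \<sigma> rNN = N \<and> \<sigma> rVV = V \<and> \<sigma> rBW = B \<and> \<sigma> rN1 = ?n + 1"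
      by (simp add: held_def defs)
  qed
qed

end

section \<open>Resource bounds\<close>

text \<open>Initialisation makes no choices and always ends in the same state
  \<open>\<sigma>1\<close>, so the accepted lists are exactly those on which \<open>MAIN\<close>
  succeeds from there. In the time bound, 2 counts the unfolding of the outer \<open>Seq\<close> and
  one unit for the end.\<close>

lemma program_run:
  fixes M :: "'a ntm"
  assumes nl: "nl_machine M x S N ts" and Nk: "N = (length x + 2) ^ k"
    and E: "N ^ 4 \<le> 2 ^ E" "\<And>j. j < E \<Longrightarrow> 2 ^ j < N ^ 4"
    and B: "B = (N ^ 4) ^ 4" and m: "2 * B ^ (E + 3) + 1 < 2 ^ m"
    and c0: "c0 = Seq (INIT k (Suc (n_syms M))) (MAIN (start M) (accept M) ts)"
  shows "bd (rn x) (below m) True (2 + (400 + 20 * k) * (B * B) + cost (B + 1) (MAIN (start M) (accept M) ts)) ([c0], \<lambda>_. 0, 0, g) (\<lambda>_. False)"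
    and "accepted c0 x g \<Longrightarrow> accepted c0 x g' \<Longrightarrow> g = g'"
    and "(\<exists>g. accepted c0 x g) \<longleftrightarrow> accepts M x"
proof -
  interpret nl_run M x S N ts E by (intro nl_run.intro nl_run_axioms.intro nl E(1))
  have BV: "BV = B" by (simp add: B BV_def)
  have CV: "CV = B ^ (E + 3)" by (simp add: CV_def BV)
  interpret I: init_run x CV m by unfold_locales (use m CV in simp)
  let ?I = "INIT k (Suc (n_syms M)) :: 'a com" and ?M = "MAIN (start M) (accept M) ts"
  let ?ti = "(400 + 20 * k) * (B * B)"
  have "I.tw ?ti (INIT k b) (\<lambda>\<sigma> p. I.bnd \<sigma> \<and> p = 0 \<and> \<sigma> rCAP = CV \<and> \<sigma> rTCAP = B + 1 \<and> \<sigma> rZR = 0 \<and>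
    \<sigma> rTWO = 2 \<and> \<sigma> rBB = b \<and> \<sigma> rNN = N \<and> \<sigma> rVV = N ^ 4 \<and> \<sigma> rBW = B \<and> \<sigma> rN1 = length x + 1) (\<lambda>_. 0) 0"
    by (rule I.INIT_tw[OF Nk N(3) refl B bN CV E])
  then obtain \<sigma>1 where 1: "I.bnd \<sigma>1" "kst \<sigma>1"
    and "\<forall>K g. bd (rn x) (below m) False ?ti (?I # K, \<lambda>_. 0, 0, g) (\<lambda>s. s = (K, \<sigma>1, 0, g))"
    unfolding I.tw_def b_def kst_def BV by blast
  then have init: "\<And>K g. bd (rn x) (below m) False ?ti (?I # K, \<lambda>_. 0, 0, g) (\<lambda>s. s = (K, \<sigma>1, 0, g))" by blast
  have s1: "rn x ([c0], \<lambda>_. 0, 0, g) = Some ([?I, ?M], \<lambda>_. 0, 0, g)" for g by (simp add: c0)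
  have wf: "wfc ?M" by (rule capped_wfc[OF capped_MAIN])
  have to1: "steps_to (rn x) ([c0], \<lambda>_. 0, 0, g) ([?M], \<sigma>1, 0, g)" for g
    using bd_steps_to[OF init[of "[?M]" g]] steps_to_step[of "rn x", OF s1] by blast
  have acc: "accepted c0 x g \<longleftrightarrow> (\<exists>\<sigma>' p'. ex x ?M \<sigma>1 0 g \<sigma>' p')" for g
  proof
    assume "accepted c0 x g"
    then obtain \<sigma>' p' where a: "steps_to (rn x) ([c0], \<lambda>_. 0, 0, g) ([], \<sigma>', p', [])" by (auto simp: accepted_def)
    show "\<exists>\<sigma>' p'. ex x ?M \<sigma>1 0 g \<sigma>' p'"
    proof (cases "sem x ?M (\<sigma>1, 0, g)")
      case None
      then obtain K' s' where k: "K' \<noteq> []" "steps_to (rn x) ([?M], \<sigma>1, 0, g) (K', s')" "rn x (K', s') = None"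
        using sem_run[OF wf, of x "(\<sigma>1, 0, g)" "[]"] by blast
      have "(K', s') = ([], \<sigma>', p', [])"
        by (rule steps_to_stuck_unique[OF steps_to_trans[OF to1 k(2)] k(3) a]) simp
      then show ?thesis using k(1) by simp
    next
      case (Some s')
      then have k: "steps_to (rn x) ([?M], \<sigma>1, 0, g) ([], s')"
        using sem_run[OF wf, of x "(\<sigma>1, 0, g)" "[]"] by blast
      have "([], s') = ([] :: 'a com list, \<sigma>', p', [] :: bool list)"
        by (rule steps_to_stuck_unique[OF steps_to_trans[OF to1 k] _ a]) simp_all
      then show ?thesis using Some by (auto simp: ex_def)
    qed
  next
    assume "\<exists>\<sigma>' p'. ex x ?M \<sigma>1 0 g \<sigma>' p'"
    then obtain \<sigma>' p' where "sem x ?M (\<sigma>1, 0, g) = Some (\<sigma>', p', [])" by (auto simp: ex_def)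
    then have "steps_to (rn x) ([?M], \<sigma>1, 0, g) ([], \<sigma>', p', [])"
      using sem_run[OF wf, of x "(\<sigma>1, 0, g)" "[]"] by blast
    then show "accepted c0 x g" unfolding accepted_def using steps_to_trans[OF to1] by blast
  qed
  show "accepted c0 x g \<Longrightarrow> accepted c0 x g' \<Longrightarrow> g = g'"
    using MAIN_correct(1)[OF 1(2)] unfolding acc by blast
  show "(\<exists>g. accepted c0 x g) \<longleftrightarrow> accepts M x"
    using MAIN_correct(2)[OF 1(2)] unfolding acc .
  have main: "bd (rn x) (below m) True (cost (B + 1) ?M) ([?M], \<sigma>1, 0, g)
    (\<lambda>s. \<exists>\<sigma>' p' g'. s = ([], \<sigma>', p', g') \<and> (\<forall>r. \<sigma>' r \<le> CV) \<and> (\<forall>r. r \<notin> writes ?M \<longrightarrow> \<sigma>' r = \<sigma>1 r))"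
  proof (rule capped_bd[OF capped_MAIN])
    show "\<forall>r. \<sigma>1 r \<le> CV" using 1(1) by (simp add: I.bnd_def)
  qed (use m CV BV_bounds 1(2) in \<open>auto simp: BV kst_def\<close>)
  have "bd (rn x) (below m) True (cost (B + 1) ?M + 1) ([?M], \<sigma>1, 0, g) (\<lambda>_. False)"
  proof (rule bd_bind[OF main])
    fix s :: "'a rcfg"
    assume "\<exists>\<sigma>' p' g'. s = ([], \<sigma>', p', g') \<and> (\<forall>r. \<sigma>' r \<le> CV) \<and> (\<forall>r. r \<notin> writes ?M \<longrightarrow> \<sigma>' r = \<sigma>1 r)"
    then obtain \<sigma>' p' g' where s: "s = ([], \<sigma>', p', g')" "I.bnd \<sigma>'" unfolding I.bnd_def by blast
    show "bd (rn x) (below m) True 1 s (\<lambda>_. False)"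
      unfolding s by (rule bd_stuck, rule TrueI, rule I.bnd_below[OF s(2)]) simp
  qed
  then have b1: "bd (rn x) (below m) True (?ti + (cost (B + 1) ?M + 1)) ([?I, ?M], \<lambda>_. 0, 0, g) (\<lambda>_. False)"
    by (intro bd_bind[OF bd_weaken_stuck[OF init]]) simp
  have "bd (rn x) (below m) True (Suc (?ti + (cost (B + 1) ?M + 1))) ([c0], \<lambda>_. 0, 0, g) (\<lambda>_. False)"
    by (rule bd_step, simp, rule s1, rule b1)
  then show "bd (rn x) (below m) True (2 + ?ti + cost (B + 1) ?M) ([c0], \<lambda>_. 0, 0, g) (\<lambda>_. False)"
    by (rule bd_mono) simp
qed

text \<open>The base \<open>n + 2\<close> is at least 2, so powers are monotone in the exponent also
  for \<open>n = 0\<close>, and constants are absorbed.\<close>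

definition polb :: "(nat \<Rightarrow> nat) \<Rightarrow> bool" where
  "polb f \<longleftrightarrow> (\<exists>C k. \<forall>n. f n \<le> C * (n + 2) ^ k)"

lemma polb_le: "polb g \<Longrightarrow> (\<And>n. f n \<le> g n) \<Longrightarrow> polb f"
  unfolding polb_def using order_trans by meson

lemma polb_const: "polb (\<lambda>_. c)"
  unfolding polb_def by (intro exI[of _ c] exI[of _ 0]) simp

lemma polb_base: "polb (\<lambda>n. n + 2)"
  unfolding polb_def by (intro exI[of _ 1]) simp

lemma polb_add:
  assumes "polb f" "polb g"
  shows "polb (\<lambda>n. f n + g n)"
proof -
  obtain C k C' k' where f: "\<And>n. f n \<le> C * (n + 2) ^ k" and g: "\<And>n. g n \<le> C' * (n + 2) ^ k'"
    using assms unfolding polb_def by blast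
  have "f n + g n \<le> (C + C') * (n + 2) ^ (k + k')" for n
  proof -
    have "C * (n + 2) ^ k \<le> C * (n + 2) ^ (k + k')" "C' * (n + 2) ^ k' \<le> C' * (n + 2) ^ (k + k')"
      by (intro mult_le_mono2 power_increasing; simp)+
    then show ?thesis using f[of n] g[of n] unfolding add_mult_distrib by linarith
  qed
  then show ?thesis unfolding polb_def by blast
qed

lemma polb_mult:
  assumes "polb f" "polb g"
  shows "polb (\<lambda>n. f n * g n)"
proof -
  obtain C k C' k' where f: "\<And>n. f n \<le> C * (n + 2) ^ k" and g: "\<And>n. g n \<le> C' * (n + 2) ^ k'"
    using assms unfolding polb_def by blast
  have "f n * g n \<le> (C * C') * (n + 2) ^ (k + k')" for n
    using mult_le_mono[OF f[of n] g[of n]] by (simp add: power_add ac_simps)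
  then show ?thesis unfolding polb_def by blast
qed

lemma polb_power: "polb f \<Longrightarrow> polb (\<lambda>n. f n ^ k)"
  by (induction k) (auto intro: polb_const polb_mult)

lemma polb_real:
  assumes "polb f"
  obtains C k where "0 \<le> C" "\<And>n. real (f n) \<le> C * real n ^ k + C"
proof -
  obtain C k where f: "\<And>n. f n \<le> C * (n + 2) ^ k" using assms unfolding polb_def by blast
  have "real (f n) \<le> real (C * 3 ^ k) * real n ^ k + real (C * 3 ^ k)" for n
  proof -
    \<comment> \<open>For positive \<open>n\<close> the base is at most \<open>3 * n\<close>; for
      \<open>n = 0\<close> the additive constant takes over.\<close>
    have "(n + 2) ^ k \<le> 3 ^ k * n ^ k + 3 ^ k"
    proof (cases "n = 0")
      case True
      then have "(n + 2) ^ k \<le> 3 ^ k" by (intro power_mono) auto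
      then show ?thesis by (rule trans_le_add2)
    next
      case False
      then have "(n + 2) ^ k \<le> (3 * n) ^ k" by (intro power_mono) auto
      then show ?thesis by (simp add: power_mult_distrib)
    qed
    then have "f n \<le> C * (3 ^ k * n ^ k + 3 ^ k)" using f[of n] mult_le_mono2 order_trans by blast
    also have "\<dots> = C * 3 ^ k * n ^ k + C * 3 ^ k" by (simp add: algebra_simps)
    finally show ?thesis by (metis of_nat_add of_nat_le_iff of_nat_mult of_nat_power)
  qed
  then show ?thesis using that[of "real (C * 3 ^ k)" k] by simp
qed

text \<open>The binary logarithm rounded up, with value 0 for arguments 0 and 1.\<close>

definition bitlen :: "nat \<Rightarrow> nat" where
  "bitlen n = (LEAST j. n \<le> 2 ^ j)"

lemma bitlen: "n \<le> 2 ^ bitlen n"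
  unfolding bitlen_def by (rule LeastI[of _ n]) (rule less_imp_le[OF less_exp])

lemma bitlen_le: "n \<le> 2 ^ j \<Longrightarrow> bitlen n \<le> j"
  unfolding bitlen_def by (rule Least_le)

lemma less_bitlen: "j < bitlen n \<Longrightarrow> 2 ^ j < n"
  using bitlen_le[of n j] by (meson not_le)

lemma bitlen_bounds:
  shows "bitlen (n + 2) \<le> n + 2" "2 ^ bitlen (n + 2) \<le> 2 * (n + 2)"
    "log 2 (real n) \<le> bitlen (n + 2)" "bitlen (n + 2) \<le> log 2 (real n) + 3"
proof -
  show "bitlen (n + 2) \<le> n + 2" by (rule bitlen_le) (rule less_imp_le[OF less_exp])
  have "bitlen (n + 2) \<noteq> 0"
  proof
    assume "bitlen (n + 2) = 0"
    then show False using bitlen[of "n + 2"] by simp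
  qed
  then obtain j where j: "bitlen (n + 2) = Suc j" by (cases "bitlen (n + 2)") auto
  have lt: "2 ^ j < n + 2" by (rule less_bitlen) (simp only: j lessI)
  then show "2 ^ bitlen (n + 2) \<le> 2 * (n + 2)" unfolding j by simp
  show "log 2 (real n) \<le> bitlen (n + 2)"
  \<comment> \<open>For \<open>n = 0\<close> the logarithm takes its default value 0.\<close>
  proof (cases "n = 0")
    case False
    have "n \<le> 2 ^ bitlen (n + 2)" using bitlen[of "n + 2"] by simp
    then have "real n \<le> 2 ^ bitlen (n + 2)" by (metis of_nat_le_iff of_nat_numeral of_nat_power)
    then have "log 2 (real n) \<le> log 2 (2 ^ bitlen (n + 2))" using False by (subst log_le_cancel_iff) auto
    then show ?thesis by (simp add: log_nat_power)
  qed (simp add: log_def)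
  show "bitlen (n + 2) \<le> log 2 (real n) + 3"
  proof (cases "n = 0")
    case True
    have "bitlen 2 \<le> 1" by (rule bitlen_le) simp
    then show ?thesis using True by (simp add: log_def numeral_2_eq_2)
  next
    case False
    then have "2 ^ j < 4 * n" using lt by simp
    then have "(2 :: real) ^ j < 4 * real n" by (metis of_nat_less_iff of_nat_mult of_nat_numeral of_nat_power)
    then have "log 2 (2 ^ j) < log 2 (4 * real n)" using False by (subst log_less_cancel_iff) auto
    also have "log 2 (4 * real n) = log 2 4 + log 2 (real n)" using False by (subst log_mult) auto
    also have "log 2 (4 :: real) = 2" using log_nat_power[of "2 :: real" 2 2] by simp
    finally have "real j < 2 + log 2 (real n)" by (simp add: log_nat_power)
    then show ?thesis unfolding j by simp
  qed
qed

theorem theorem1: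
  shows "(NL :: ('a :: finite) list set set) \<subseteq> ReachUSP (\<lambda>n. (log 2 (real n))\<^sup>2)"
proof
  fix L :: "'a list set"
  assume "L \<in> NL"
  then obtain M :: "'a ntm" and c :: real where wf: "wf_ntm M" and dec: "decides M L"
    and sp: "\<And>x. space_within M x (c * log 2 (real (length x)) + c)"
    unfolding NL_def by blast
  obtain ts where ts: "set ts = delta M" "distinct ts"
    using finite_distinct_list[of "delta M"] wf by (auto simp: wf_ntm_def)
  \<comment> \<open>The space constant is an arbitrary real and may be negative; a natural bound
    makes it usable as a factor of an exponent.\<close>
  obtain k1 :: nat where k1: "c \<le> real k1" using real_arch_simple by blast
  define b where "b = Suc (n_syms M)"
  \<comment> \<open>With \<open>S x\<close> cells and at most \<open>b\<close> symbols the tape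
    numbers stay below \<open>b ^ S x\<close>. As \<open>b\<close> is at most \<open>2 ^ b\<close>
    and \<open>2 ^ (bitlen (n + 2) + 1)\<close> at most \<open>(n + 2) ^ 3\<close>, this is at most
    \<open>(n + 2) ^ (3 * (k1 * b))\<close>. The other summands of \<open>K\<close> cover the number
    of states and the input positions.\<close>
  define K where "K = 3 * (k1 * b) + n_states M + 1"
  define S where "S x = k1 * (bitlen (length x + 2) + 1)" for x :: "'a list"
  define N where "N n = (n + 2) ^ K" for n :: nat
  define B where "B n = (N n ^ 4) ^ 4" for n
  define E where "E n = bitlen (N n ^ 4)" for n
  \<comment> \<open>\<open>B n\<close> has at most \<open>16 * K * l\<close> bits and is raised to a
    power of at most \<open>4 * K * l + 3\<close>. The final 2 pays for doubling the cap and adding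
    1.\<close>
  define m where "m n = (let l = bitlen (n + 2) in 16 * K * l * (4 * K * l + 3) + 2)" for n
  have nl: "nl_machine M x (S x) (N (length x)) ts" for x
  proof unfold_locales
    let ?n = "length x"
    let ?l = "bitlen (?n + 2)"
    show "wf_ntm M" "set ts = delta M" "distinct ts" by (fact wf ts)+
    have l0: "0 \<le> log 2 (real ?n)"
    proof (cases "?n = 0")
      case False
      then have "1 \<le> real ?n" by linarith
      then show ?thesis unfolding log_def by (intro divide_nonneg_nonneg ln_ge_zero) auto
    qed (simp add: log_def)
    fix cs d assume "comp_path M x cs" "d \<in> set cs"
    then have "real (snd (snd (snd d))) + 1 \<le> c * log 2 (real ?n) + c"
      using sp unfolding space_within_def by blast
    also have "\<dots> = c * (log 2 (real ?n) + 1)" by (simp add: algebra_simps)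
    also have "\<dots> \<le> real k1 * (log 2 (real ?n) + 1)" using k1 l0 by (intro mult_right_mono) auto
    also have "\<dots> \<le> real k1 * (real ?l + 1)" using bitlen_bounds(3)[of ?n] by (intro mult_left_mono) auto
    also have "\<dots> = real (S x)" by (simp add: S_def algebra_simps)
    finally show "snd (snd (snd d)) < S x" by linarith
  next
    let ?n = "length x"
    let ?l = "bitlen (?n + 2)"
    have mono: "(?n + 2) ^ a \<le> N ?n" if "a \<le> K" for a unfolding N_def using that by (intro power_increasing) auto
    have "b ^ S x \<le> (2 ^ b) ^ S x" by (intro power_mono less_imp_le[OF less_exp]) simp
    also have "\<dots> = (2 ^ (?l + 1)) ^ (k1 * b)" by (simp only: S_def power_mult[symmetric] mult_ac)
    also have "\<dots> \<le> ((?n + 2) ^ 3) ^ (k1 * b)"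
    proof (rule power_mono)
      have "2 ^ (?l + 1) \<le> 4 * (?n + 2)" using bitlen_bounds(2)[of ?n] by simp
      also have "\<dots> \<le> (?n + 2) * (?n + 2) * (?n + 2)" by (intro mult_le_mono1) simp
      finally show "2 ^ (?l + 1) \<le> (?n + 2) ^ 3" by (simp add: power3_eq_cube)
    qed simp
    also have "\<dots> \<le> N ?n" unfolding power_mult[symmetric] by (rule mono) (simp add: K_def)
    finally show "Suc (n_syms M) ^ S x \<le> N ?n" by (simp add: b_def)
    have "n_states M \<le> 2 ^ n_states M" by (rule less_imp_le[OF less_exp])
    also have "\<dots> \<le> (?n + 2) ^ n_states M" by (intro power_mono) auto
    also have "\<dots> \<le> N ?n" by (rule mono) (simp add: K_def)
    finally show "n_states M \<le> N ?n" .
    show "?n + 2 \<le> N ?n" using mono[of 1] by (simp add: K_def)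
  qed
  have mB: "2 * B n ^ (E n + 3) + 1 < 2 ^ m n" for n
  proof -
    define l where "l = bitlen (n + 2)"
    have "N n \<le> (2 ^ l) ^ K" unfolding N_def l_def by (intro power_mono bitlen) simp
    then have N: "N n \<le> 2 ^ (l * K)" by (simp add: power_mult)
    have "N n ^ 4 \<le> (2 ^ (l * K)) ^ 4" by (intro power_mono N) simp
    then have V: "N n ^ 4 \<le> 2 ^ (4 * K * l)" by (simp add: power_mult[symmetric] ac_simps)
    have "B n \<le> (2 ^ (4 * K * l)) ^ 4" unfolding B_def by (intro power_mono V) simp
    then have B: "B n \<le> 2 ^ (16 * K * l)" by (simp add: power_mult[symmetric] ac_simps)
    have E: "E n \<le> 4 * K * l" unfolding E_def by (rule bitlen_le[OF V])
    have "B n ^ (E n + 3) \<le> (2 ^ (16 * K * l)) ^ (E n + 3)" by (intro power_mono B) simp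
    also have "\<dots> = 2 ^ (16 * K * l * (E n + 3))" by (simp add: power_mult)
    also have "\<dots> \<le> 2 ^ (16 * K * l * (4 * K * l + 3))" using E by (intro power_increasing mult_le_mono2) auto
    finally have a: "B n ^ (E n + 3) \<le> 2 ^ (16 * K * l * (4 * K * l + 3))" .
    have "m n = 16 * K * l * (4 * K * l + 3) + 2" by (simp add: m_def l_def Let_def)
    then have "2 ^ m n = 4 * (2 :: nat) ^ (16 * K * l * (4 * K * l + 3))" by (simp only: power_add) simp
    moreover have "1 \<le> (2 :: nat) ^ (16 * K * l * (4 * K * l + 3))" by simp
    ultimately show ?thesis using a by linarith
  qed
  define c0 where "c0 = Seq (INIT K b) (MAIN (start M) (accept M) ts)"
  define T where "T n = 2 + (400 + 20 * K) * (B n * B n) + cost (B n + 1) (MAIN (start M) (accept M) ts)" for n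
  have run1: "bd (rn x) (below (m (length x))) True (T (length x)) ([c0], \<lambda>_. 0, 0, g) (\<lambda>_. False)" for x g
    unfolding T_def
    by (rule program_run(1)[OF nl N_def _ _ B_def mB c0_def[unfolded b_def]]) (use bitlen less_bitlen in \<open>auto simp: E_def\<close>)
  have run2: "accepted c0 x g \<Longrightarrow> accepted c0 x g' \<Longrightarrow> g = g'" for x g g'
    by (rule program_run(2)[OF nl N_def _ _ B_def mB c0_def[unfolded b_def]]) (use bitlen less_bitlen in \<open>auto simp: E_def\<close>)
  have run3: "(\<exists>g. accepted c0 x g) \<longleftrightarrow> accepts M x" for x
    by (rule program_run(3)[OF nl N_def _ _ B_def mB c0_def[unfolded b_def]]) (use bitlen less_bitlen in \<open>auto simp: E_def\<close>)
  obtain M' :: "'a ntm" where wf': "wf_ntm M'"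
    and M': "\<And>x. (accepts M' x \<longleftrightarrow> (\<exists>g. accepted c0 x g)) \<and> unambiguous_on M' x \<and>
     time_within M' x (real (T (length x) * (2 * m (length x) + 3) + 1)) \<and> space_within M' x (real (m (length x) + 2))"
  proof -
    have "\<exists>M' :: 'a ntm. wf_ntm M' \<and> (\<forall>x. (accepts M' x \<longleftrightarrow> (\<exists>g. accepted c0 x g)) \<and> unambiguous_on M' x \<and>
     time_within M' x (real (T (length x) * (2 * m (length x) + 3) + 1)) \<and> space_within M' x (real (m (length x) + 2)))"
      by (rule compile) (rule run1, rule run2)
    then show ?thesis using that by blast
  qed
  have dec': "decides M' L" using dec M' run3 by (simp add: decides_def)
  have pB: "polb B" unfolding B_def N_def by (intro polb_power polb_base)
  have pm: "polb m"
  proof (rule polb_le)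
    show "polb (\<lambda>n. 16 * K * (n + 2) * (4 * K * (n + 2) + 3) + 2)"
      by (intro polb_add polb_mult polb_const polb_base)
    show "m n \<le> 16 * K * (n + 2) * (4 * K * (n + 2) + 3) + 2" for n
      unfolding m_def Let_def using bitlen_bounds(1)[of n] by (intro add_le_mono mult_le_mono) auto
  qed
  have pcost: "polb (\<lambda>n. cost (B n + 1) (MAIN (start M) (accept M) ts))"
  proof -
    obtain C k where C: "\<And>P. 1 \<le> P \<Longrightarrow> cost P (MAIN (start M) (accept M) ts) \<le> C * P ^ k" using cost_poly by blast
    show ?thesis
    proof (rule polb_le)
      show "polb (\<lambda>n. C * (B n + 1) ^ k)" by (intro polb_mult polb_power polb_add polb_const pB)
    qed (rule C, simp)
  qed
  have "polb (\<lambda>n. T n * (2 * m n + 3) + 1)"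
    unfolding T_def by (intro polb_add polb_mult polb_const pB pm pcost)
  then obtain C k where C: "0 \<le> C" "\<And>n. real (T n * (2 * m n + 3) + 1) \<le> C * real n ^ k + C"
    by (rule polb_real) blast
  define A where "A = 16 * real K * (4 * real K + 3)"
  have A0: "0 \<le> A" by (simp add: A_def)
  have m: "real (m n + 2) \<le> (18 * A + 4) * (log 2 (real n))\<^sup>2 + (18 * A + 4)" for n
  proof -
    define l where "l = real (bitlen (n + 2))"
    define g where "g = log 2 (real n)"
    have l: "0 \<le> l" "l \<le> g + 3" using bitlen_bounds(4)[of n] by (auto simp: l_def g_def)
    have ll: "l \<le> l\<^sup>2"
    proof -
      have "bitlen (n + 2) \<le> bitlen (n + 2) ^ 2" by (simp add: power2_eq_square)
      then show ?thesis unfolding l_def by (metis of_nat_le_iff of_nat_power)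
    qed
    have "l\<^sup>2 \<le> (g + 3)\<^sup>2" using l by (intro power_mono) auto
    \<comment> \<open>The difference of the two sides is the square of \<open>g - 3\<close>.\<close>
    also have "\<dots> \<le> 2 * g\<^sup>2 + 18"
      using zero_le_power2[of "g - 3"] by (simp add: power2_sum power2_diff)
    finally have lg: "l\<^sup>2 \<le> 2 * g\<^sup>2 + 18" .
    have "real (m n + 2) = 16 * real K * l * (4 * real K * l + 3) + 4" by (simp add: m_def Let_def l_def)
    also have "\<dots> = 16 * real K * (4 * real K * l\<^sup>2 + 3 * l) + 4" by (simp add: power2_eq_square algebra_simps)
    also have "\<dots> \<le> 16 * real K * (4 * real K * l\<^sup>2 + 3 * l\<^sup>2) + 4"
      using ll by (intro add_right_mono mult_left_mono add_left_mono) auto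
    also have "\<dots> = A * l\<^sup>2 + 4" by (simp add: A_def algebra_simps)
    also have "\<dots> \<le> A * (2 * g\<^sup>2 + 18) + 4" using lg A0 by (intro add_right_mono mult_left_mono)
    also have "\<dots> = 2 * (A * g\<^sup>2) + 18 * A + 4" by (simp add: algebra_simps)
    \<comment> \<open>The coefficient of the square is raised to that of the constant term, since a
      single constant must serve as both.\<close>
    also have "\<dots> \<le> 18 * (A * g\<^sup>2) + 4 * g\<^sup>2 + 18 * A + 4"
    proof -
      have "0 \<le> A * g\<^sup>2" "0 \<le> g\<^sup>2" using A0 by auto
      then show ?thesis by linarith
    qed
    finally show ?thesis by (simp add: g_def algebra_simps)
  qed
  \<comment> \<open>\<open>TIUSP\<close> asks for one constant for time and space, so the two are
    added.\<close>
  define D where "D = C + (18 * A + 4)"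
  have "time_within M' x (D * real (length x) ^ k + D)" for x
  proof -
    have "C * real (length x) ^ k + C \<le> D * real (length x) ^ k + D"
      using A0 by (intro add_mono mult_right_mono) (auto simp: D_def)
    then show ?thesis using M'[of x] C(2)[of "length x"] unfolding time_within_def by (meson order_trans)
  qed
  moreover have "space_within M' x (D * (log 2 (real (length x)))\<^sup>2 + D)" for x
  proof -
    have "(18 * A + 4) * (log 2 (real (length x)))\<^sup>2 + (18 * A + 4) \<le> D * (log 2 (real (length x)))\<^sup>2 + D"
      using C(1) by (intro add_mono mult_right_mono) (auto simp: D_def)
    then show ?thesis using M'[of x] m[of "length x"] unfolding space_within_def by (meson order_trans)
  qed
  ultimately have "L \<in> TIUSP (\<lambda>n. real n ^ k) (\<lambda>n. (log 2 (real n))\<^sup>2)"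
    unfolding TIUSP_def using wf' dec' M' by blast
  then show "L \<in> ReachUSP (\<lambda>n. (log 2 (real n))\<^sup>2)" unfolding ReachUSP_def by blast
qed

end
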